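(* Let $d\in\mathbb{R}\setminus\{0\}$ and $f_0,\zeta,\mu\in\mathbb{R}$ be fixed, and let $V$ be a real-valued, $2\pi$-periodic, continuously differentiable function. Let $u_0\in H^2_{\mathrm{per}}([-\pi,\pi],\mathbb{C})$ be a non-constant, non-degenerate solution of $$-d u''+\mathrm{i}\epsilon V(x)u'+(\zeta-\mathrm{i}\mu)u-|u|^2u+\mathrm{i}f_0=0\qquad (S_\epsilon)$$ for $\epsilon=0$, and assume that $0\in\sigma(\widetilde L_{u_0,0})$ is an algebraically simple eigenvalue and that there exists $\xi>0$ with $$\sigma(\widetilde L_{u_0,0})\subset\{z\in\mathbb{C}:\operatorname{Re}z\le-\xi\}\cup\{0\}.$$ Let $\ker L_{u_0}^*=\operatorname{span}\{\phi_0^*\}$ with the normalization $\langle\bm u_0',J\bm\phi_0^*\rangle_{L^2}=1$, and let $\sigma_0$ be a simple zero of $V_{\mathrm{eff}}(\sigma)=\operatorname{Re}\int_{-\pi}^{\pi}\mathrm{i}V(x+\sigma)u_0'\bar\phi_0^*\,dx$. Then $$V_{\mathrm{eff}}'(\sigma_0)=\operatorname{Re}\int_{-\pi}^{\pi}\mathrm{i}V'(x+\sigma_0)u_0'\bar\phi_0^*\,dx=\langle V'(\cdot+\sigma_0)\bm u_0',J\bm\phi_0^*\rangle_{L^2}\neq0,$$ and there exists $\epsilon_0>0$ such that, on the solution branch $(-\epsilon_0,\epsilon_0)\ni\epsilon\mapsto u(\epsilon)\in H^2_{\mathrm{per}}([-\pi,\pi],\mathbb{C})$ of $(S_\epsilon)$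 with $u(0)=u_0(\cdot-\sigma_0)$, the solutions $u(\epsilon)$ are spectrally stable if $V_{\mathrm{eff}}'(\sigma_0)\cdot\epsilon>0$ and spectrally unstable if $V_{\mathrm{eff}}'(\sigma_0)\cdot\epsilon<0$.
   Context: $H^2_{\mathrm{per}}([-\pi,\pi],\mathbb{C})$ is the space of $2\pi$-periodic complex-valued $H^2$ functions; functions on $[-\pi,\pi]$ are extended $2\pi$-periodically. Complex-valued functions $u=u_1+\mathrm{i}u_2$ are identified with $\mathbb{R}^2$-valued functions $\bm u=(u_1,u_2)$, with real inner product $\langle\bm f,\bm g\rangle_{L^2}=\int_{-\pi}^\pi\bm f\cdot\bm g\,dx=\operatorname{Re}\int_{-\pi}^\pi f\bar g\,dx$. For a function $u$, $L_u\varphi:=-d\varphi''+(\zeta-\mathrm{i}\mu-2|u|^2)\varphi-u^2\bar\varphi$ is a real-linear index-$0$ Fredholm operator $H^2_{\mathrm{per}}([-\pi,\pi],\mathbb{C})\to L^2([-\pi,\pi],\mathbb{C})$. A non-constant solution $u_0$ of $(S_0)$ is non-degenerate if $\ker L_{u_0}=\operatorname{span}_{\mathbb{R}}\{u_0'\}$; then $\ker L_{u_0}^*$ is one-dimensional and $\phi_0^*$ denotes a spanning element. The linearization at a stationary solution $u$ of the evolution equation $\mathrm{i}\partial_tu=-d\partial_x^2u+\mathrm{i}\epsilon V(x)\partial_xu+(\zeta-\mathrm{i}\mu)u-|u|^2u+\mathrm{i}f_0$ is $$\widetilde L_{u,\epsilon}=JA_u-I(\mu-\epsilon V(x)\partial_x),\quad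 J=\begin{pmatrix}0&1\\-1&0\end{pmatrix},\quad A_u=\begin{pmatrix}-d\partial_x^2+\zeta-(3u_1^2+u_2^2)&-2u_1u_2\\-2u_1u_2&-d\partial_x^2+\zeta-(u_1^2+3u_2^2)\end{pmatrix},$$ with $I$ the $2\times2$ identity, acting in $L^2([-\pi,\pi],\mathbb{C})\times L^2([-\pi,\pi],\mathbb{C})$ with domain $H^2_{\mathrm{per}}([-\pi,\pi],\mathbb{C})\times H^2_{\mathrm{per}}([-\pi,\pi],\mathbb{C})$; $\sigma(\cdot)$ denotes its spectrum. A solution $u$ of $(S_\epsilon)$ is spectrally stable if $\operatorname{Re}\lambda\le0$ for all eigenvalues $\lambda$ of $\widetilde L_{u,\epsilon}$, and spectrally unstable if some eigenvalue $\lambda$ of $\widetilde L_{u,\epsilon}$ has $\operatorname{Re}\lambda>0$. A simple zero $\sigma_0$ means $V_{\mathrm{eff}}(\sigma_0)=0\neq V_{\mathrm{eff}}'(\sigma_0)$. The solution branch is the continuous curve $(-\epsilon^*,\epsilon^* )\ni\epsilon\mapsto u(\epsilon)\in H^2_{\mathrm{per}}([-\pi,\pi],\mathbb{C})$ of solutions of $(S_\epsilon)$ with $u(0)=u_0(\cdot-\sigma_0)$ and $\|u(\epsilon)-u_0(\cdot-\sigma_0)\|_{H^2}\le C|\epsilon|$, which exists for some $\epsilon^*,C>0$ when $\sigma_0$ is a simple zero of $V_{\mathrm{eff}}$. *)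

theory Defs
  imports "HOL-Analysis.Analysis"
begin

abbreviation leb_pi :: "real measure" where
  "leb_pi \<equiv> lebesgue_on {-pi..pi}"

section \<open>Function spaces\<close>

text \<open>Elements of \<open>L\<^sup>2\<close> are represented by functions on the real line of which only the values on
  \<open>[-\<pi>,\<pi>]\<close> matter; identities between them are stated almost everywhere with respect to
  \<^const>\<open>leb_pi\<close>. Taking values in \<^typ>\<open>complex ^ 2\<close> gives the product space
  \<open>L\<^sup>2 \<times> L\<^sup>2\<close> of complex-valued functions. On \<^typ>\<open>complex\<close> the real inner product is
  \<open>Re (f * cnj g)\<close>, so \<open>l2_inner\<close> is the real inner product of the identification
  of complex-valued with planar functions.\<close>

definition L2 :: "(real \<Rightarrow> 'a::euclidean_space) set" where
  "L2 = {f \<in> borel_measurable leb_pi. integrable leb_pi (\<lambda>x. (norm (f x))\<^sup>2)}"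

definition l2_norm :: "(real \<Rightarrow> 'a::euclidean_space) \<Rightarrow> real" where
  "l2_norm f = sqrt (LINT x|leb_pi. (norm (f x))\<^sup>2)"

definition l2_inner :: "(real \<Rightarrow> 'a::euclidean_space) \<Rightarrow> (real \<Rightarrow> 'a) \<Rightarrow> real" where
  "l2_inner f g = (LINT x|leb_pi. f x \<bullet> g x)"

definition periodic_2pi :: "(real \<Rightarrow> 'a) \<Rightarrow> bool" where
  "periodic_2pi f \<longleftrightarrow> (\<forall>x. f (x + 2 * pi) = f x)"

text \<open>\<open>is_weak_deriv f g\<close>: on \<open>[-\<pi>,\<pi>]\<close> the function \<open>f\<close> is absolutely continuous with derivative
  \<open>g\<close> in \<open>L\<^sup>2\<close>. Such a \<open>g\<close> is unique up to null sets; \<open>weak_deriv\<close> selects a representative.\<close>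

definition is_weak_deriv :: "(real \<Rightarrow> 'a::euclidean_space) \<Rightarrow> (real \<Rightarrow> 'a) \<Rightarrow> bool" where
  "is_weak_deriv f g \<longleftrightarrow>
     g \<in> L2 \<and> (\<forall>x\<in>{-pi..pi}. (g has_integral (f x - f (-pi))) {-pi..x})"

definition weak_deriv :: "(real \<Rightarrow> 'a::euclidean_space) \<Rightarrow> real \<Rightarrow> 'a" where
  "weak_deriv f = (SOME g. is_weak_deriv f g)"

definition D1 :: "(real \<Rightarrow> 'a::euclidean_space) \<Rightarrow> real \<Rightarrow> 'a" where
  "D1 u = (\<lambda>x. vector_derivative u (at x))"

definition D2 :: "(real \<Rightarrow> 'a::euclidean_space) \<Rightarrow> real \<Rightarrow> 'a" where
  "D2 u = weak_deriv (D1 u)"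

text \<open>The periodic Sobolev space \<open>H\<^sup>2\<close>, each class being represented by its continuously
  differentiable representative. Continuity of \<open>D1 u\<close> follows from the last condition and
  periodicity.\<close>

definition H2per :: "(real \<Rightarrow> 'a::euclidean_space) set" where
  "H2per = {u. periodic_2pi u \<and> (\<forall>x. u differentiable (at x)) \<and> (\<exists>w. is_weak_deriv (D1 u) w)}"

definition h2_norm :: "(real \<Rightarrow> 'a::euclidean_space) \<Rightarrow> real" where
  "h2_norm u = sqrt ((l2_norm u)\<^sup>2 + (l2_norm (D1 u))\<^sup>2 + (l2_norm (D2 u))\<^sup>2)"

section \<open>The stationary equation and its linearization\<close>

definition solves_S ::
  "real \<Rightarrow> real \<Rightarrow> real \<Rightarrow> real \<Rightarrow> (real \<Rightarrow> real) \<Rightarrow> real \<Rightarrow> (real \<Rightarrow> complex) \<Rightarrow> bool" where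
  "solves_S d f0 \<zeta> \<mu> V \<epsilon> u \<longleftrightarrow> u \<in> H2per \<and>
     (AE x in leb_pi.
        - of_real d * D2 u x + \<i> * of_real (\<epsilon> * V x) * D1 u x
        + (of_real \<zeta> - \<i> * of_real \<mu>) * u x
        - of_real ((cmod (u x))\<^sup>2) * u x + \<i> * of_real f0 = 0)"

definition L_op ::
  "real \<Rightarrow> real \<Rightarrow> real \<Rightarrow> (real \<Rightarrow> complex) \<Rightarrow> (real \<Rightarrow> complex) \<Rightarrow> real \<Rightarrow> complex" where
  "L_op d \<zeta> \<mu> u \<phi> = (\<lambda>x.
     - of_real d * D2 \<phi> x
     + (of_real \<zeta> - \<i> * of_real \<mu> - 2 * of_real ((cmod (u x))\<^sup>2)) * \<phi> x
     - (u x)\<^sup>2 * cnj (\<phi> x))"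

definition ker_H2 :: "((real \<Rightarrow> complex) \<Rightarrow> real \<Rightarrow> complex) \<Rightarrow> (real \<Rightarrow> complex) set" where
  "ker_H2 T = {\<phi> \<in> H2per. AE x in leb_pi. T \<phi> x = 0}"

text \<open>Graph of the adjoint, with respect to the real inner product of \<open>L\<^sup>2\<close>, of a real-linear
  operator with domain \<^const>\<open>H2per\<close>.\<close>

definition adjoint_graph ::
  "((real \<Rightarrow> complex) \<Rightarrow> real \<Rightarrow> complex) \<Rightarrow> ((real \<Rightarrow> complex) \<times> (real \<Rightarrow> complex)) set" where
  "adjoint_graph T = {(\<psi>, \<eta>). \<psi> \<in> L2 \<and> \<eta> \<in> L2 \<and>
     (\<forall>\<phi>\<in>H2per. l2_inner (T \<phi>) \<psi> = l2_inner \<phi> \<eta>)}"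

definition ker_adjoint :: "((real \<Rightarrow> complex) \<Rightarrow> real \<Rightarrow> complex) \<Rightarrow> (real \<Rightarrow> complex) set" where
  "ker_adjoint T = {\<psi>. (\<psi>, \<lambda>_. 0) \<in> adjoint_graph T}"

text \<open>Real span of a single function; in \<open>span_L2\<close> almost everywhere equal functions
  are identified.\<close>

definition span_fun :: "(real \<Rightarrow> complex) \<Rightarrow> (real \<Rightarrow> complex) set" where
  "span_fun f = {(\<lambda>x. c *\<^sub>R f x) | c :: real. True}"

definition span_L2 :: "(real \<Rightarrow> complex) \<Rightarrow> (real \<Rightarrow> complex) set" where
  "span_L2 f = {g. \<exists>c :: real. AE x in leb_pi. g x = c *\<^sub>R f x}"

definition nondegenerate ::
  "real \<Rightarrow> real \<Rightarrow> real \<Rightarrow> (real \<Rightarrow> complex) \<Rightarrow> bool" where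
  "nondegenerate d \<zeta> \<mu> u \<longleftrightarrow> ker_H2 (L_op d \<zeta> \<mu> u) = span_fun (D1 u)"

section \<open>The complexified linearization and its spectrum\<close>

definition vec2 :: "complex \<Rightarrow> real ^ 2" where
  "vec2 z = vector [Re z, Im z]"

definition J_mat :: "'a::comm_ring_1 ^ 2 ^ 2" where
  "J_mat = vector [vector [0, 1], vector [-1, 0]]"

definition potential_mat :: "real \<Rightarrow> complex \<Rightarrow> complex ^ 2 ^ 2" where
  "potential_mat \<zeta> z = vector
     [vector [of_real (\<zeta> - (3 * (Re z)\<^sup>2 + (Im z)\<^sup>2)), of_real (- 2 * Re z * Im z)],
      vector [of_real (- 2 * Re z * Im z), of_real (\<zeta> - ((Re z)\<^sup>2 + 3 * (Im z)\<^sup>2))]]"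

definition A_op ::
  "real \<Rightarrow> real \<Rightarrow> (real \<Rightarrow> complex) \<Rightarrow> (real \<Rightarrow> complex ^ 2) \<Rightarrow> real \<Rightarrow> complex ^ 2" where
  "A_op d \<zeta> u \<phi> = (\<lambda>x. (- d) *\<^sub>R D2 \<phi> x + potential_mat \<zeta> (u x) *v \<phi> x)"

definition Ltilde ::
  "real \<Rightarrow> real \<Rightarrow> real \<Rightarrow> (real \<Rightarrow> real) \<Rightarrow> (real \<Rightarrow> complex) \<Rightarrow> real
    \<Rightarrow> (real \<Rightarrow> complex ^ 2) \<Rightarrow> real \<Rightarrow> complex ^ 2" where
  "Ltilde d \<zeta> \<mu> V u \<epsilon> \<phi> =
     (\<lambda>x. J_mat *v A_op d \<zeta> u \<phi> x - (\<mu> *\<^sub>R \<phi> x - (\<epsilon> * V x) *\<^sub>R D1 \<phi> x))"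

text \<open>Below, \<open>T\<close> is a complex-linear operator in \<open>L\<^sup>2 \<times> L\<^sup>2\<close> with domain
  \<open>H\<^sup>2 \<times> H\<^sup>2\<close>, that is, \<^const>\<open>H2per\<close> over \<^typ>\<open>complex ^ 2\<close>.\<close>

type_synonym oper = "(real \<Rightarrow> complex ^ 2) \<Rightarrow> real \<Rightarrow> complex ^ 2"

definition resolvent_set :: "oper \<Rightarrow> complex set" where
  "resolvent_set T = {z.
     (\<forall>g\<in>L2. \<exists>!\<phi>. \<phi> \<in> H2per \<and> (AE x in leb_pi. T \<phi> x - z *s \<phi> x = g x)) \<and>
     (\<exists>C. \<forall>\<phi>\<in>H2per. l2_norm \<phi> \<le> C * l2_norm (\<lambda>x. T \<phi> x - z *s \<phi> x))}"

definition op_spectrum :: "oper \<Rightarrow> complex set" where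
  "op_spectrum T = - resolvent_set T"

definition is_eigenvalue :: "oper \<Rightarrow> complex \<Rightarrow> bool" where
  "is_eigenvalue T z \<longleftrightarrow>
     (\<exists>\<phi>\<in>H2per. \<phi> \<noteq> (\<lambda>_. 0) \<and> (AE x in leb_pi. T \<phi> x = z *s \<phi> x))"

text \<open>\<open>gen_ker T z k\<close> is the kernel of \<open>(T - z)\<^sup>k\<close>; an eigenvalue is algebraically simple
  if the union of these kernels is one-dimensional.\<close>

primrec gen_ker :: "oper \<Rightarrow> complex \<Rightarrow> nat \<Rightarrow> (real \<Rightarrow> complex ^ 2) set" where
  "gen_ker T z 0 = {\<lambda>_. 0}"
| "gen_ker T z (Suc k) =
     {\<phi> \<in> H2per. \<exists>\<psi>\<in>gen_ker T z k. AE x in leb_pi. T \<phi> x - z *s \<phi> x = \<psi> x}"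

definition algebraically_simple :: "oper \<Rightarrow> complex \<Rightarrow> bool" where
  "algebraically_simple T z \<longleftrightarrow> is_eigenvalue T z \<and>
     (\<exists>\<phi>. \<phi> \<noteq> (\<lambda>_. 0) \<and> (\<Union>k. gen_ker T z k) = {(\<lambda>x. c *s \<phi> x) | c :: complex. True})"

definition spectrally_stable ::
  "real \<Rightarrow> real \<Rightarrow> real \<Rightarrow> (real \<Rightarrow> real) \<Rightarrow> real \<Rightarrow> (real \<Rightarrow> complex) \<Rightarrow> bool" where
  "spectrally_stable d \<zeta> \<mu> V \<epsilon> u \<longleftrightarrow>
     (\<forall>z. is_eigenvalue (Ltilde d \<zeta> \<mu> V u \<epsilon>) z \<longrightarrow> Re z \<le> 0)"

definition spectrally_unstable ::
  "real \<Rightarrow> real \<Rightarrow> real \<Rightarrow> (real \<Rightarrow> real) \<Rightarrow> real \<Rightarrow> (real \<Rightarrow> complex) \<Rightarrow> bool" where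
  "spectrally_unstable d \<zeta> \<mu> V \<epsilon> u \<longleftrightarrow>
     (\<exists>z. is_eigenvalue (Ltilde d \<zeta> \<mu> V u \<epsilon>) z \<and> Re z > 0)"

section \<open>The effective potential and the solution branch\<close>

definition V_eff ::
  "(real \<Rightarrow> real) \<Rightarrow> (real \<Rightarrow> complex) \<Rightarrow> (real \<Rightarrow> complex) \<Rightarrow> real \<Rightarrow> real" where
  "V_eff V u0 \<phi>0 \<sigma> = Re (LINT x|leb_pi. \<i> * of_real (V (x + \<sigma>)) * D1 u0 x * cnj (\<phi>0 x))"

definition simple_zero :: "(real \<Rightarrow> real) \<Rightarrow> real \<Rightarrow> bool" where
  "simple_zero f s \<longleftrightarrow> f s = 0 \<and> f differentiable (at s) \<and> deriv f s \<noteq> 0"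

text \<open>\<open>u\<close> is a curve on \<open>(-\<epsilon>s, \<epsilon>s)\<close>, continuous with respect to the \<open>H\<^sup>2\<close> norm, of solutions
  emanating from \<open>u0(\<cdot> - \<sigma>0)\<close>; values outside the interval are irrelevant.\<close>

definition solution_branch ::
  "real \<Rightarrow> real \<Rightarrow> real \<Rightarrow> real \<Rightarrow> (real \<Rightarrow> real) \<Rightarrow> (real \<Rightarrow> complex) \<Rightarrow> real
    \<Rightarrow> real \<Rightarrow> real \<Rightarrow> (real \<Rightarrow> real \<Rightarrow> complex) \<Rightarrow> bool" where
  "solution_branch d f0 \<zeta> \<mu> V u0 \<sigma>0 \<epsilon>s C u \<longleftrightarrow>
     0 < \<epsilon>s \<and> 0 < C \<and>
     u 0 = (\<lambda>x. u0 (x - \<sigma>0)) \<and>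
     (\<forall>\<epsilon>\<in>{-\<epsilon>s<..<\<epsilon>s}.
        solves_S d f0 \<zeta> \<mu> V \<epsilon> (u \<epsilon>) \<and>
        ((\<lambda>\<eta>. h2_norm (\<lambda>x. u \<eta> x - u \<epsilon> x)) \<longlongrightarrow> 0) (at \<epsilon>) \<and>
        h2_norm (\<lambda>x. u \<epsilon> x - u0 (x - \<sigma>0)) \<le> C * \<bar>\<epsilon>\<bar>)"

end

theory Submission
  imports Defs "HOL-Complex_Analysis.Great_Picard"
begin

text \<open>After translating by \<open>\<sigma>\<^sub>0\<close> one may take the zero of the effective potential at the origin.
  Coefficients are continuous, so solutions and eigenfunctions have classical \<open>C\<^sup>2\<close> representatives,
  and compactness is the Arzela--Ascoli theorem. Because the resolvent exists at every \<open>r > 0\<close>, solving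
  \<open>L w - \<i> r w = h\<close> and letting \<open>r \<rightarrow> 0\<close> shows that the range of \<open>L\<close> is the orthogonal complement of
  \<open>\<phi>\<^sub>0\<close>: a bounded right inverse.

  The branch is sought as \<open>u(x) = v(x - \<sigma>)\<close> with \<open>v = u\<^sub>0 + \<epsilon> w\<close>; after division by \<open>\<epsilon>\<close> the pair
  \<open>(w, \<sigma>)\<close> is a fixed point of a contraction since \<open>V_eff'(\<sigma>\<^sub>0) \<noteq> 0\<close>. A second contraction produces a
  small real eigenvalue of the linearization at \<open>u(\<epsilon>)\<close>.

  Differentiating the stationary equation shows that the linearization maps \<open>u'\<close> to \<open>- \<epsilon> V' u'\<close>.
  Pairing with \<open>J \<phi>\<^sub>0\<close> gives \<open>\<lambda> / \<epsilon> \<rightarrow> - V_eff'(\<sigma>\<^sub>0)\<close> for all eigenvalues \<open>\<lambda> \<rightarrow> 0\<close>. The remaining eigenvalues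
  do not matter: the linearization plus \<open>\<mu>\<close> is Hamiltonian at \<open>\<epsilon> = 0\<close>, which forces \<open>\<mu> > 0\<close>, and then an energy estimate,
  uniform in small \<open>\<epsilon>\<close>, bounds all eigenvalues with nonnegative real part, so by compactness they
  accumulate only at \<open>0\<close>.\<close>


text \<open>Both contractions solve a bordered problem for the same singular operator
  \<open>L\<close>. Its kernel, spanned by \<open>u0'\<close>, is removed by the side condition
  \<open>\<Lambda> (i w) = 0\<close>, which is effective because
  \<open>\<Lambda> (i u0') = 1\<close>. Its range, the null space of \<open>\<Lambda>\<close>, is
  completed by one scalar unknown: the shift, with border \<open>i V' u0'\<close> and pairing
  \<open>\<nu>\<close>, or the eigenvalue, with border \<open>- i u0'\<close> and pairing
  \<open>-1\<close>. Since \<open>V\<close> is only \<open>C\<^sup>1\<close>, its Taylor remainder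
  is not quadratic; the modulus of continuity of \<open>V'\<close> makes the Lipschitz constants
  small instead. \<open>L\<close> contains a complex conjugation and is only real linear. A complex
  eigenvalue therefore enters as a pair of real equations, coupled by the rotation part of the
  eigenvalue. Stability and instability are refuted together: failure of either, along a sequence
  \<epsilon> tending to 0, yields eigenvalues whose real part \<alpha> satisfies \<alpha> \<nu>
  \<epsilon> \<ge> 0, against \<alpha> / \<epsilon> tending to -\<nu>. That limit describes given
  eigenvalues but produces none, so the unstable case needs the second contraction.\<close>

section \<open>Continuous and twice continuously differentiable periodic functions\<close>

definition C0p :: "(real \<Rightarrow> 'a::real_normed_vector) set" where
  "C0p = {f. periodic_2pi f \<and> continuous_on UNIV f}"

text \<open>The derivatives are explicit arguments because \<open>D2\<close> is a chosen
  representative, determined only almost everywhere.\<close>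

definition C2p :: "(real \<Rightarrow> 'a::real_normed_vector) \<Rightarrow> (real \<Rightarrow> 'a) \<Rightarrow> (real \<Rightarrow> 'a) \<Rightarrow> bool" where
  "C2p f f1 f2 \<longleftrightarrow> periodic_2pi f \<and> (\<forall>x. (f has_vector_derivative f1 x) (at x)) \<and>
     (\<forall>x. (f1 has_vector_derivative f2 x) (at x)) \<and> continuous_on UNIV f2"

lemma periodic_shift_int:
  assumes "periodic_2pi f" shows "f (x + 2 * pi * of_int k) = f x"
proof -
  have N: "f (y + 2 * pi * of_nat n) = f y" for n y
  proof (induction n)
    case (Suc n)
    have "f (y + 2 * pi * of_nat (Suc n)) = f ((y + 2 * pi * of_nat n) + 2 * pi)"
      by (simp add: algebra_simps)
    then show ?case using Suc assms by (simp add: periodic_2pi_def)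
  qed simp
  show ?thesis
  proof (cases "k \<ge> 0")
    case True
    then show ?thesis using N[of x "nat k"] by simp
  next
    case False
    then show ?thesis using N[of "x + 2 * pi * of_int k" "nat (-k)"] by simp
  qed
qed

text \<open>The representative of \<open>x\<close> modulo \<open>2 * pi\<close> in the half-open
  interval from \<open>-pi\<close> (excluded) to \<open>pi\<close> (included), written as an integer
  translation so that \<open>periodic_shift_int\<close> applies.\<close>

definition red :: "real \<Rightarrow> real" where
  "red x = x + 2 * pi * of_int (- \<lceil>(x - pi) / (2 * pi)\<rceil>)"

lemma red_bounds: "- pi < red x" "red x \<le> pi" "red x \<in> {-pi..pi}"
proof -
  let ?k = "\<lceil>(x - pi) / (2 * pi)\<rceil>"
  have "(x - pi) / (2 * pi) \<le> ?k" "?k < (x - pi) / (2 * pi) + 1" by linarith+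
  then have "x - pi \<le> ?k * (2 * pi)" "?k * (2 * pi) < ((x - pi) / (2 * pi) + 1) * (2 * pi)"
    by (simp_all only: pos_divide_le_eq[of "2 * pi"] pi_gt_zero mult_pos_pos zero_less_numeral mult_strict_right_mono)
  moreover have "((x - pi) / (2 * pi) + 1) * (2 * pi) = x - pi + 2 * pi" by (simp add: field_simps)
  ultimately show "- pi < red x" "red x \<le> pi" "red x \<in> {-pi..pi}" by (auto simp: red_def algebra_simps)
qed

lemma red_periodic: "periodic_2pi f \<Longrightarrow> f (red x) = f x"
  unfolding red_def by (rule periodic_shift_int)

lemma periodic_vector_derivative:
  assumes "periodic_2pi f" "\<And>x. (f has_vector_derivative f' x) (at x)"
  shows "periodic_2pi f'"
proof -
  have "f' (x + 2 * pi) = f' x" for x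
  proof -
    have "((f \<circ> (\<lambda>y. y + 2 * pi)) has_vector_derivative (1 *\<^sub>R f' (x + 2 * pi))) (at x)"
      by (rule vector_diff_chain_at) (auto intro!: derivative_eq_intros assms)
    moreover have "f \<circ> (\<lambda>y. y + 2 * pi) = f" using assms(1) by (auto simp: periodic_2pi_def)
    ultimately show ?thesis using assms(2)[of x] vector_derivative_unique_at by force
  qed
  then show ?thesis by (simp add: periodic_2pi_def)
qed

lemma has_vd_imp_cont: "(\<And>x. (f has_vector_derivative f' x) (at x)) \<Longrightarrow> continuous_on UNIV f"
  by (meson continuous_at_imp_continuous_on has_vector_derivative_continuous)

lemma C2pD:
  assumes "C2p f f1 f2"
  shows "f \<in> C0p" "f1 \<in> C0p" "f2 \<in> C0p"
    "(f has_vector_derivative f1 x) (at x)" "(f1 has_vector_derivative f2 x) (at x)"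
proof -
  have "periodic_2pi f1" "periodic_2pi f2"
    using assms unfolding C2p_def by (meson periodic_vector_derivative)+
  then show "f \<in> C0p" "f1 \<in> C0p" "f2 \<in> C0p"
    "(f has_vector_derivative f1 x) (at x)" "(f1 has_vector_derivative f2 x) (at x)"
    using assms has_vd_imp_cont[of f f1] has_vd_imp_cont[of f1 f2] by (auto simp: C2p_def C0p_def)
qed

lemma C0pD: assumes "f \<in> C0p" shows "continuous_on S f" "f (x + 2 * pi) = f x" "periodic_2pi f"
  using assms by (auto simp: C0p_def periodic_2pi_def intro: continuous_on_subset)

lemma C0p_compose:
  assumes "f \<in> C0p" "continuous_on UNIV h" shows "(\<lambda>x. h (f x)) \<in> C0p"
  using assms continuous_on_compose2[OF assms(2), of UNIV f] by (auto simp: C0p_def periodic_2pi_def)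

lemma C0p_intros:
  "(\<lambda>x. c) \<in> C0p"
  "f \<in> C0p \<Longrightarrow> g \<in> C0p \<Longrightarrow> (\<lambda>x. f x + g x) \<in> C0p"
  "f \<in> C0p \<Longrightarrow> g \<in> C0p \<Longrightarrow> (\<lambda>x. f x - g x) \<in> C0p"
  "f \<in> C0p \<Longrightarrow> (\<lambda>x. - f x) \<in> C0p"
  "r \<in> C0p \<Longrightarrow> f \<in> C0p \<Longrightarrow> (\<lambda>x. r x *\<^sub>R f x) \<in> C0p"
  "f \<in> C0p \<Longrightarrow> (\<lambda>x. norm (f x)) \<in> C0p"
  by (auto simp: C0p_def periodic_2pi_def intro!: continuous_intros)

lemma C0p_intros_alg:
  fixes a b :: "real \<Rightarrow> 'b::real_normed_algebra_1"
  shows "a \<in> C0p \<Longrightarrow> b \<in> C0p \<Longrightarrow> (\<lambda>x. a x * b x) \<in> C0p"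
    "a \<in> C0p \<Longrightarrow> (\<lambda>x. a x ^ n) \<in> C0p"
    "r \<in> C0p \<Longrightarrow> (\<lambda>x. of_real (r x) :: 'b) \<in> C0p"
  by (auto simp: C0p_def periodic_2pi_def intro!: continuous_intros)

lemma C0p_intros_cx:
  fixes p :: "real \<Rightarrow> complex"
  shows "p \<in> C0p \<Longrightarrow> (\<lambda>x. cnj (p x)) \<in> C0p" "p \<in> C0p \<Longrightarrow> (\<lambda>x. Re (p x)) \<in> C0p"
    "p \<in> C0p \<Longrightarrow> (\<lambda>x. Im (p x)) \<in> C0p"
    "p \<in> C0p \<Longrightarrow> (\<lambda>x. p x / c) \<in> C0p"
  by (auto simp: C0p_def periodic_2pi_def divide_inverse intro!: continuous_intros)

lemmas C0p_ints = C0p_intros C0p_intros_alg C0p_intros_cx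

lemma C0p_shift:
  assumes "f \<in> C0p" shows "(\<lambda>x. f (x + s)) \<in> C0p"
proof -
  have "f (x + 2 * pi + s) = f (x + s)" for x
    using C0pD(2)[OF assms, of "x + s"] by (simp add: add_ac)
  then show ?thesis
    using assms by (auto simp: C0p_def periodic_2pi_def intro!: continuous_on_compose2[of UNIV f] continuous_intros)
qed

lemma C0p_attains:
  fixes f :: "real \<Rightarrow> real"
  assumes "f \<in> C0p" obtains x0 where "\<And>x. f x \<le> f x0"
proof -
  have "\<exists>x\<in>{-pi..pi}. \<forall>y\<in>{-pi..pi}. f y \<le> f x"
    by (rule continuous_attains_sup) (use C0pD[OF assms] in auto)
  then show ?thesis using that red_bounds(3) red_periodic[OF C0pD(3)[OF assms]] by metis
qed

lemma C0p_bounded: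
  assumes "f \<in> C0p" obtains B where "0 < B" "\<And>x. norm (f x) \<le> B"
proof -
  obtain x0 where "\<And>x. norm (f x) \<le> norm (f x0)" using C0p_attains[OF C0p_intros(6)[OF assms]] by blast
  then have "\<And>x. norm (f x) \<le> norm (f x0) + 1" by (meson add_increasing2 zero_le_one)
  then show ?thesis using that[of "norm (f x0) + 1"] by (simp add: add_nonneg_pos)
qed

lemma C0p_bounded_image: "f \<in> C0p \<Longrightarrow> bounded (f ` S)"
  by (metis C0p_bounded bounded_iff imageE)

lemma C0p_uniformly_continuous:
  fixes f :: "real \<Rightarrow> 'a::real_normed_vector"
  assumes f: "f \<in> C0p" and "e > 0"
  obtains d where "d > 0" "\<And>x y. \<bar>x - y\<bar> < d \<Longrightarrow> norm (f x - f y) < e"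
proof -
  \<comment> \<open>One unit of room on either side: after \<open>y\<close> is moved into the basic
    period, a point \<open>x\<close> at distance less than 1 from it stays in the compact
    interval.\<close>
  have "uniformly_continuous_on {-pi-1..pi+1} f"
    by (rule compact_uniformly_continuous) (use C0pD[OF f] in auto)
  then obtain d where d: "d > 0" "\<And>x y. x \<in> {-pi-1..pi+1} \<Longrightarrow> y \<in> {-pi-1..pi+1} \<Longrightarrow> dist y x < d \<Longrightarrow> dist (f y) (f x) < e"
    unfolding uniformly_continuous_on_def using \<open>e > 0\<close> by metis
  have "norm (f x - f y) < e" if "\<bar>x - y\<bar> < min d 1" for x y
  proof -
    let ?s = "red y - y"
    have s: "?s = 2 * pi * of_int (- \<lceil>(y - pi) / (2 * pi)\<rceil>)" by (simp add: red_def)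
    have "f (x + ?s) = f x" "f (y + ?s) = f y"
      unfolding s by (rule periodic_shift_int[OF C0pD(3)[OF f]])+
    moreover have "dist (f (x + ?s)) (f (y + ?s)) < e"
      using that red_bounds(3)[of y] by (intro d(2)) (auto simp: dist_real_def)
    ultimately show ?thesis by (simp add: dist_norm)
  qed
  then show ?thesis using that[of "min d 1"] d(1) by auto
qed

lemma C2p_linear:
  assumes "bounded_linear h" "C2p f f1 f2"
  shows "C2p (\<lambda>x. h (f x)) (\<lambda>x. h (f1 x)) (\<lambda>x. h (f2 x))"
  using assms bounded_linear.has_vector_derivative[OF assms(1)]
  by (auto simp: C2p_def periodic_2pi_def bounded_linear.linear
      intro!: bounded_linear.continuous_on[OF assms(1)])

lemma C2p_add: "C2p f f1 f2 \<Longrightarrow> C2p g g1 g2 \<Longrightarrow> C2p (\<lambda>x. f x + g x) (\<lambda>x. f1 x + g1 x) (\<lambda>x. f2 x + g2 x)"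
  by (auto simp: C2p_def periodic_2pi_def intro!: continuous_intros derivative_intros)

lemma C2p_diff: "C2p f f1 f2 \<Longrightarrow> C2p g g1 g2 \<Longrightarrow> C2p (\<lambda>x. f x - g x) (\<lambda>x. f1 x - g1 x) (\<lambda>x. f2 x - g2 x)"
  by (auto simp: C2p_def periodic_2pi_def intro!: continuous_intros derivative_intros)

lemma C2p_mult: fixes f :: "real \<Rightarrow> complex"
  shows "C2p f f1 f2 \<Longrightarrow> C2p (\<lambda>x. c * f x) (\<lambda>x. c * f1 x) (\<lambda>x. c * f2 x)"
  by (rule C2p_linear[OF bounded_linear_mult_right])

lemma C2p_zero: "C2p (\<lambda>x. 0) (\<lambda>x. 0) (\<lambda>x. 0)"
  by (auto simp: C2p_def periodic_2pi_def)

lemma C2p_shift: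
  assumes "C2p f f1 f2"
  shows "C2p (\<lambda>x. f (x + s)) (\<lambda>x. f1 (x + s)) (\<lambda>x. f2 (x + s))"
proof -
  have "((\<lambda>x. g (x + s)) has_vector_derivative g' (x + s)) (at x)"
    if "\<And>x. (g has_vector_derivative g' x) (at x)" for g g' :: "real \<Rightarrow> 'a" and x
  proof -
    have "((\<lambda>x. x + s) has_vector_derivative 1) (at x)" by (auto intro!: derivative_eq_intros)
    from vector_diff_chain_at[OF this, of g "g' (x + s)"] that[of "x + s"] show ?thesis
      by (simp add: o_def)
  qed
  then show ?thesis using C2pD[OF assms] C0p_shift unfolding C2p_def C0p_def by blast
qed

lemma C2p_unique:
  assumes "C2p f f1 f2" "C2p f g1 g2" shows "f1 = g1" "f2 = g2"
proof -
  show "f1 = g1" using C2pD(4)[OF assms(1)] C2pD(4)[OF assms(2)] vector_derivative_unique_at by blast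
  then show "f2 = g2" using C2pD(5)[OF assms(1)] C2pD(5)[OF assms(2)] vector_derivative_unique_at by blast
qed

lemma has_integral_deriv:
  fixes f :: "real \<Rightarrow> 'a::banach"
  assumes "\<And>x. (f has_vector_derivative f' x) (at x)" "a \<le> b"
  shows "(f' has_integral (f b - f a)) {a..b}"
  by (rule fundamental_theorem_of_calculus[OF assms(2)])
     (use assms(1) in \<open>auto intro: has_vector_derivative_at_within\<close>)

section \<open>Classical representatives of the Sobolev functions\<close>

lemma measurable_continuous_leb_pi:
  fixes f :: "real \<Rightarrow> 'a::euclidean_space"
  shows "continuous_on {-pi..pi} f \<Longrightarrow> f \<in> borel_measurable leb_pi"
  by (simp add: continuous_imp_measurable_on_sets_lebesgue)

lemma integrable_continuous_leb_pi:
  fixes f :: "real \<Rightarrow> 'a::euclidean_space"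
  assumes "continuous_on {-pi..pi} f"
  shows "integrable leb_pi f" "(LINT x|leb_pi. f x) = integral {-pi..pi} f"
proof -
  have "f absolutely_integrable_on {-pi..pi}"
    using absolutely_integrable_continuous[of "-pi" pi f] assms by simp
  then show "integrable leb_pi f"
    by (simp add: integrable_restrict_space set_integrable_def)
  then show "(LINT x|leb_pi. f x) = integral {-pi..pi} f"
    by (intro lebesgue_integral_eq_integral) auto
qed

lemma C0p_L2:
  fixes f :: "real \<Rightarrow> 'a::euclidean_space"
  assumes "f \<in> C0p" shows "f \<in> L2"
  unfolding L2_def using C0pD(1)[OF assms]
  by (auto intro!: measurable_continuous_leb_pi integrable_continuous_leb_pi continuous_intros)

lemma finite_measure_leb_pi: "finite_measure leb_pi"
  by standard (simp add: emeasure_restrict_space)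

lemma L2_integrable:
  fixes f :: "real \<Rightarrow> 'a::euclidean_space"
  assumes "f \<in> L2" shows "integrable leb_pi f"
proof -
  interpret finite_measure leb_pi by (rule finite_measure_leb_pi)
  have "integrable leb_pi (\<lambda>x. norm (f x))"
    by (rule square_integrable_imp_integrable) (use assms in \<open>auto simp: L2_def\<close>)
  then show ?thesis using assms by (auto simp: L2_def integrable_norm_iff)
qed

text \<open>The difference of two weak derivatives has zero integral over every subinterval, so
  Lebesgue differentiation makes it vanish almost everywhere.\<close>

lemma is_weak_deriv_AE_eq:
  fixes f :: "real \<Rightarrow> 'a::euclidean_space"
  assumes "is_weak_deriv f g" "is_weak_deriv f h"
  shows "AE x in leb_pi. g x = h x"
proof -
  define k where "k x = (if x \<in> {-pi..pi} then g x - h x else 0)" for x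
  have 0: "((\<lambda>t. g t - h t) has_integral 0) {-pi..x}" if "x \<in> {-pi..pi}" for x
    using assms that has_integral_diff[of g "f x - f (-pi)" "{-pi..x}" h "f x - f (-pi)"]
    by (auto simp: is_weak_deriv_def)
  have k0: "(k has_integral 0) {-pi..x}" if "x \<in> {-pi..pi}" for x
    using 0[OF that] by (rule has_integral_eq[rotated]) (use that in \<open>auto simp: k_def\<close>)
  have "(k has_integral 0) UNIV"
    unfolding k_def has_integral_restrict_UNIV using 0[of pi] by simp
  then have int: "k integrable_on cbox a b" for a b
    by (meson has_integral_integrable integrable_on_subcbox subset_UNIV)
  have kab: "integral {a..b} k = 0" if "-pi \<le> a" "a \<le> b" "b \<le> pi" for a b
  proof -
    have "integral {-pi..a} k + integral {a..b} k = integral {-pi..b} k"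
      using int[of "-pi" b] that by (intro Henstock_Kurzweil_Integration.integral_combine) auto
    then show ?thesis using k0[of a] k0[of b] that by (auto simp: integral_unique)
  qed
  \<comment> \<open>This is the Lebesgue differentiation theorem: off a null set the averages over
    \<open>{x..x + h}\<close> tend to \<open>k x\<close>.\<close>
  obtain N where N: "negligible N" and
    "\<And>x e. x \<notin> N \<Longrightarrow> 0 < e \<Longrightarrow>
       \<exists>d>0. \<forall>h. 0 < h \<and> h < d \<longrightarrow> norm (integral (cbox x (x + h *\<^sub>R One)) k /\<^sub>R h ^ DIM(real) - k x) < e"
    using integrable_ccontinuous_explicit[of k, OF int] by metis
  then have D: "\<exists>d>0. \<forall>h. 0 < h \<and> h < d \<longrightarrow> norm (integral {x..x + h} k /\<^sub>R h - k x) < e"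
    if "x \<notin> N" "e > 0" for x e
    using that by simp
  \<comment> \<open>The averages are taken to the right of \<open>x\<close>, so the endpoint
    \<open>pi\<close> is excluded here and later joins the null set.\<close>
  have "k x = 0" if xN: "x \<notin> N" and "x \<in> {-pi..<pi}" for x
  proof (rule ccontr)
    assume "k x \<noteq> 0"
    then obtain d where "d > 0" and d: "\<And>h. 0 < h \<and> h < d \<Longrightarrow> norm (integral {x..x + h} k /\<^sub>R h - k x) < norm (k x)"
      using D[OF xN, of "norm (k x)"] zero_less_norm_iff[of "k x"] by blast
    define h where "h = min (d / 2) (pi - x)"
    have "0 < h" "h < d" "x + h \<le> pi" using \<open>d > 0\<close> that by (auto simp: h_def)
    then show False using d[of h] kab[of x "x + h"] that by auto
  qed
  then have *: "{x \<in> {-pi..pi}. \<not> g x = h x} \<subseteq> insert pi N" by (force simp: k_def)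
  have "insert pi N \<in> null_sets lebesgue" using N by (simp add: negligible_iff_null_sets[symmetric])
  then have "AE x in lebesgue. x \<notin> insert pi N" by (rule AE_not_in)
  then show ?thesis using * by (subst AE_restrict_space_iff) auto
qed

lemma C2p_D1: "C2p f f1 f2 \<Longrightarrow> D1 f = f1"
  by (auto simp: D1_def C2p_def vector_derivative_at)

lemma C2p_is_weak_deriv:
  fixes f :: "real \<Rightarrow> 'a::euclidean_space"
  assumes "C2p f f1 f2" shows "is_weak_deriv f1 f2"
  unfolding is_weak_deriv_def using C2pD(3,5)[OF assms] by (auto intro: C0p_L2 has_integral_deriv)

lemma C2p_H2:
  fixes f :: "real \<Rightarrow> 'a::euclidean_space"
  assumes "C2p f f1 f2"
  shows "f \<in> H2per" "AE x in leb_pi. D2 f x = f2 x"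
proof -
  have w: "is_weak_deriv (D1 f) f2" using C2p_is_weak_deriv[OF assms] C2p_D1[OF assms] by simp
  show "f \<in> H2per" unfolding H2per_def
    using w C2pD(4)[OF assms] assms by (auto simp: C2p_def intro: differentiableI_vector)
  have "is_weak_deriv (D1 f) (D2 f)" unfolding D2_def weak_deriv_def using w by (rule someI[of "is_weak_deriv (D1 f)"])
  then show "AE x in leb_pi. D2 f x = f2 x" using w by (rule is_weak_deriv_AE_eq)
qed

lemma H2per_D1:
  fixes f :: "real \<Rightarrow> 'a::euclidean_space"
  assumes "f \<in> H2per"
  shows "(f has_vector_derivative D1 f x) (at x)" "periodic_2pi (D1 f)" "f \<in> C0p"
    "is_weak_deriv (D1 f) (D2 f)"
proof -
  show *: "(f has_vector_derivative D1 f x) (at x)" for x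
    using assms by (auto simp: H2per_def D1_def vector_derivative_works)
  then show "periodic_2pi (D1 f)" "f \<in> C0p"
    using assms periodic_vector_derivative[of f "D1 f"] has_vd_imp_cont[of f "D1 f"]
    by (auto simp: H2per_def C0p_def)
  show "is_weak_deriv (D1 f) (D2 f)" unfolding D2_def weak_deriv_def
    using assms by (auto simp: H2per_def intro: someI[of "is_weak_deriv (D1 f)"])
qed

text \<open>Only the seam needs care. The translate of the basic interval carries continuity to
  \<open>{pi..3*pi}\<close>, and the interior of the union contains every point
  \<open>red x\<close>, including \<open>pi\<close>.\<close>

lemma continuous_on_periodic_glue:
  fixes f :: "real \<Rightarrow> 'a::real_normed_vector"
  assumes "periodic_2pi f" "continuous_on {-pi..pi} f"
  shows "continuous_on UNIV f"
proof -
  have s: "f = f \<circ> (\<lambda>y. y - 2 * pi)"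
    using periodic_shift_int[OF assms(1), of _ "-1"] by (auto simp: fun_eq_iff)
  have "continuous_on {pi..3*pi} (f \<circ> (\<lambda>y. y - 2 * pi))"
    by (rule continuous_on_compose) (auto intro!: continuous_intros continuous_on_subset[OF assms(2)])
  then have "continuous_on {pi..3*pi} f" using s by simp
  then have "continuous_on ({-pi..pi} \<union> {pi..3*pi}) f"
    using assms(2) by (intro continuous_on_closed_Un) auto
  then have c: "continuous_on {-pi<..<3*pi} f"
    by (rule continuous_on_subset) auto
  have "isCont f x" for x
  proof -
    have "isCont f (red x)"
      using c red_bounds[of x] pi_gt_zero by (subst (asm) continuous_on_eq_continuous_at) auto
    then have "isCont (f \<circ> (\<lambda>y. y + (red x - x))) x"
      by (intro continuous_at_compose) (auto intro!: continuous_intros)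
    moreover have "f \<circ> (\<lambda>y. y + (red x - x)) = f"
      using periodic_shift_int[OF assms(1), of _ "- \<lceil>(x - pi) / (2 * pi)\<rceil>"] by (auto simp: fun_eq_iff red_def)
    ultimately show ?thesis by simp
  qed
  then show ?thesis by (simp add: continuous_at_imp_continuous_on)
qed

text \<open>At \<open>pi\<close> the derivative from the left comes from the basic interval, that
  from the right from its translate; both equal \<open>g pi\<close> because \<open>g\<close> is
  periodic.\<close>

lemma has_vector_derivative_periodic_glue:
  fixes f g :: "real \<Rightarrow> 'a::real_normed_vector"
  assumes f: "periodic_2pi f" and g: "periodic_2pi g"
    and d: "\<And>x. x \<in> {-pi..pi} \<Longrightarrow> (f has_vector_derivative g x) (at x within {-pi..pi})"
  shows "(f has_vector_derivative g x) (at x)"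
proof -
  have sh: "((\<lambda>y. f (y + c)) has_vector_derivative g (z + c)) (at z within T)"
    if "(f has_vector_derivative g (z + c)) (at (z + c) within S)" "(\<lambda>y. y + c) ` T \<subseteq> S" for c z S T
  proof -
    have "((\<lambda>y. y + c) has_vector_derivative 1) (at z within T)" by (auto intro!: derivative_eq_intros)
    from vector_diff_chain_within[OF this, of f "g (z + c)"] show ?thesis
      using has_vector_derivative_within_subset[OF that] by (simp add: o_def)
  qed
  have per: "f (y - 2*pi) = f y" "g (y - 2*pi) = g y" for y
    using periodic_shift_int[OF f, of y "-1"] periodic_shift_int[OF g, of y "-1"] by simp_all
  have d': "(f has_vector_derivative g z) (at z)" if z: "-pi < z" "z \<le> pi" for z
  proof (cases "z = pi")
    case False
    then have "z \<in> interior {-pi..pi}" using z by simp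
    then show ?thesis using d[of z] z at_within_interior by (metis atLeastAtMost_iff less_eq_real_def)
  next
    case True
    have "(f has_vector_derivative g (pi + (-2*pi))) (at (pi + (-2*pi)) within {-pi..pi})"
      using d[of "-pi"] by simp
    from sh[OF this, of "{pi..3*pi}"]
    have "(f has_vector_derivative g pi) (at pi within {pi..3*pi})"
      using per(2)[of pi] per(1) by (simp add: image_subset_iff)
    moreover have "(f has_vector_derivative g pi) (at pi within {-pi..pi})" using d by simp
    ultimately have "(f has_vector_derivative g pi) (at pi within {-pi..pi} \<union> {pi..3*pi})"
      unfolding has_vector_derivative_def has_derivative_within by (auto intro: Lim_Un)
    then have "(f has_vector_derivative g pi) (at pi within {-pi..3*pi})"
      by (rule has_vector_derivative_within_subset) auto
    moreover have "at pi within {-pi..3*pi} = at pi" by (rule at_within_interior) auto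
    ultimately show ?thesis using True by simp
  qed
  have "(f has_vector_derivative g (x + (red x - x))) (at (x + (red x - x)) within UNIV)"
    using d'[of "red x"] red_bounds[of x] by simp
  from sh[OF this, of UNIV] show ?thesis
    using periodic_shift_int[OF f, of _ "- \<lceil>(x - pi) / (2 * pi)\<rceil>"] red_periodic[OF g, of x] by (simp add: red_def)
qed

text \<open>The regularity gain: if the equation identifies \<open>D2 f\<close> almost everywhere
  with a continuous periodic function, then \<open>D1 f\<close> is a primitive of that function and
  hence classically differentiable.\<close>

lemma H2_C2p:
  fixes f :: "real \<Rightarrow> 'a::euclidean_space"
  assumes f: "f \<in> H2per" and ae: "AE x in leb_pi. D2 f x = g x" and g: "g \<in> C0p"
  shows "C2p f (D1 f) g"
proof -
  have "((D2 f) has_integral (D1 f x - D1 f (-pi))) {-pi..x}" if "x \<in> {-pi..pi}" for x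
    using H2per_D1(4)[OF f] that by (auto simp: is_weak_deriv_def)
  moreover obtain N where N: "N \<in> null_sets lebesgue" "\<And>x. x \<in> {-pi..pi} - N \<Longrightarrow> D2 f x = g x"
  proof -
    have "AE x in lebesgue. x \<in> {-pi..pi} \<longrightarrow> D2 f x = g x"
      using ae by (subst (asm) AE_restrict_space_iff) auto
    then obtain M where M: "M \<in> null_sets lebesgue"
        "{x \<in> space lebesgue. \<not> (x \<in> {-pi..pi} \<longrightarrow> D2 f x = g x)} \<subseteq> M"
      unfolding eventually_ae_filter by blast
    have "D2 f x = g x" if "x \<in> {-pi..pi} - M" for x using M(2) that by auto
    then show ?thesis using M(1) that by blast
  qed
  ultimately have I: "(g has_integral (D1 f x - D1 f (-pi))) {-pi..x}" if "x \<in> {-pi..pi}" for x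
    using that has_integral_spike[of N "{-pi..x}" g "D2 f"]
    by (auto simp: negligible_iff_null_sets)
  have "(D1 f has_vector_derivative g x) (at x within {-pi..pi})" if "x \<in> {-pi..pi}" for x
  proof -
    have "((\<lambda>u. integral {-pi..u} g) has_vector_derivative g x) (at x within {-pi..pi})"
      by (rule integral_has_vector_derivative) (use C0pD(1)[OF g] that in auto)
    then have "((\<lambda>u. integral {-pi..u} g + D1 f (-pi)) has_vector_derivative g x) (at x within {-pi..pi})"
      by (auto intro!: derivative_eq_intros)
    then show ?thesis
      using integral_unique[OF I] that by (elim has_vector_derivative_transform[rotated 2]) auto
  qed
  then have "(D1 f has_vector_derivative g x) (at x)" for x
    using has_vector_derivative_periodic_glue[OF H2per_D1(2)[OF f] C0pD(3)[OF g]] by blast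
  then show ?thesis using H2per_D1[OF f] g f by (auto simp: C2p_def C0p_def)
qed

lemma H2per_D1_C0p:
  fixes f :: "real \<Rightarrow> 'a::euclidean_space"
  assumes f: "f \<in> H2per" shows "D1 f \<in> C0p"
proof -
  have I: "((D2 f) has_integral (D1 f x - D1 f (-pi))) {-pi..x}" if "x \<in> {-pi..pi}" for x
    using H2per_D1(4)[OF f] that by (auto simp: is_weak_deriv_def)
  have "continuous_on {-pi..pi} (\<lambda>x. integral {-pi..x} (D2 f) + D1 f (-pi))"
    using has_integral_integrable[OF I[of pi]]
    by (intro continuous_intros indefinite_integral_continuous_1) auto
  then have "continuous_on {-pi..pi} (D1 f)"
    by (rule continuous_on_eq) (use integral_unique[OF I] in simp)
  then show ?thesis using H2per_D1(2)[OF f] continuous_on_periodic_glue by (auto simp: C0p_def)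
qed

section \<open>Real and imaginary parts of the linearization\<close>

text \<open>A vector over the complex numbers is \<open>a + i b\<close> with \<open>a\<close>,
  \<open>b\<close> real planar vectors, and each planar vector is identified with a complex number.
  \<open>reP\<close> and \<open>imP\<close> extract \<open>a\<close> and \<open>b\<close>,
  \<open>emb\<close> reassembles them; the imaginary unit of the scalar field is thus distinct from
  the one of the plane.\<close>

definition reP :: "complex ^ 2 \<Rightarrow> complex" where "reP p = Complex (Re (p $ 1)) (Re (p $ 2))"
definition imP :: "complex ^ 2 \<Rightarrow> complex" where "imP p = Complex (Im (p $ 1)) (Im (p $ 2))"
definition emb :: "complex \<Rightarrow> complex \<Rightarrow> complex ^ 2" where
  "emb a b = vector [Complex (Re a) (Re b), Complex (Im a) (Im b)]"

lemma emb_simps [simp]: "reP (emb a b) = a" "imP (emb a b) = b" "emb (reP p) (imP p) = p"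
  by (auto simp: reP_def imP_def emb_def vector_2 vec_eq_iff forall_2 complex_eq_iff)

lemma eq_iff_reP_imP: "p = q \<longleftrightarrow> reP p = reP q \<and> imP p = imP q"
  by (metis emb_simps(3))

lemma bounded_linear_reP: "bounded_linear reP" and bounded_linear_imP: "bounded_linear imP"
  by (auto intro!: linearI simp: linear_conv_bounded_linear[symmetric] reP_def imP_def complex_eq_iff)

lemma bounded_linear_emb: "bounded_linear (\<lambda>z. emb z 0)" "bounded_linear (\<lambda>z. emb 0 z)"
  by (auto intro!: linearI simp: linear_conv_bounded_linear[symmetric] emb_def complex_eq_iff
      vec_eq_iff forall_2 vector_2)

lemma reP_simps: "reP (p + q) = reP p + reP q" "reP (p - q) = reP p - reP q"
  "reP (r *\<^sub>R p) = of_real r * reP p" "reP 0 = 0" "reP (z *s p) = of_real (Re z) * reP p - of_real (Im z) * imP p"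
  by (auto simp: reP_def imP_def complex_eq_iff)

lemma imP_simps: "imP (p + q) = imP p + imP q" "imP (p - q) = imP p - imP q"
  "imP (r *\<^sub>R p) = of_real r * imP p" "imP 0 = 0" "imP (z *s p) = of_real (Im z) * reP p + of_real (Re z) * imP p"
  by (auto simp: reP_def imP_def complex_eq_iff)

lemma emb_add: "emb a b = emb a 0 + emb 0 b"
  by (simp add: eq_iff_reP_imP reP_simps imP_simps)

lemma C2p_emb:
  assumes "C2p a a1 a2" "C2p b b1 b2"
  shows "C2p (\<lambda>x. emb (a x) (b x)) (\<lambda>x. emb (a1 x) (b1 x)) (\<lambda>x. emb (a2 x) (b2 x))"
  using C2p_add[OF C2p_linear[OF bounded_linear_emb(1) assms(1)] C2p_linear[OF bounded_linear_emb(2) assms(2)]]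
  by (simp flip: emb_add)

lemma C0p_linear: "bounded_linear h \<Longrightarrow> f \<in> C0p \<Longrightarrow> (\<lambda>x. h (f x)) \<in> C0p"
  by (auto intro: C0p_compose linear_continuous_on)

lemma C0p_emb: "a \<in> C0p \<Longrightarrow> b \<in> C0p \<Longrightarrow> (\<lambda>x. emb (a x) (b x)) \<in> C0p"
  using C0p_intros(2)[OF C0p_linear[OF bounded_linear_emb(1)] C0p_linear[OF bounded_linear_emb(2)], of a b]
  by (simp flip: emb_add)

definition lin :: "real \<Rightarrow> real \<Rightarrow> real \<Rightarrow> complex \<Rightarrow> complex \<Rightarrow> complex \<Rightarrow> complex" where
  "lin d \<zeta> \<mu> z w w2 = - of_real d * w2
     + (of_real \<zeta> - \<i> * of_real \<mu> - 2 * of_real ((cmod z)\<^sup>2)) * w - z\<^sup>2 * cnj w"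

text \<open>\<open>lin\<close> and \<open>evo\<close> evaluate \<open>L\<^sub>u\<close> and the linearized evolution \<open>- \<i> L\<^sub>u w + c w'\<close> pointwise, given the
  values of \<open>u\<close>, \<open>w\<close>, \<open>w'\<close>, \<open>w''\<close>; \<open>acc\<close> is the second derivative for which \<open>evo\<close> equals \<open>y\<close>.\<close>
definition evo :: "real \<Rightarrow> real \<Rightarrow> real \<Rightarrow> real \<Rightarrow> complex \<Rightarrow> complex \<Rightarrow> complex \<Rightarrow> complex \<Rightarrow> complex" where
  "evo d \<zeta> \<mu> c z w w1 w2 = - \<i> * lin d \<zeta> \<mu> z w w2 + of_real c * w1"

definition acc :: "real \<Rightarrow> real \<Rightarrow> real \<Rightarrow> real \<Rightarrow> complex \<Rightarrow> complex \<Rightarrow> complex \<Rightarrow> complex \<Rightarrow> complex" where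
  "acc d \<zeta> \<mu> c z w w1 y = ((of_real \<zeta> - \<i> * of_real \<mu> - 2 * of_real ((cmod z)\<^sup>2)) * w
     - z\<^sup>2 * cnj w - \<i> * y + \<i> * of_real c * w1) / of_real d"

lemma evo_eq_iff_acc:
  assumes "d \<noteq> 0"
  shows "evo d \<zeta> \<mu> c z w w1 w2 = y \<longleftrightarrow> w2 = acc d \<zeta> \<mu> c z w w1 y"
proof -
  have "evo d \<zeta> \<mu> c z w w1 w2 = y \<longleftrightarrow> \<i> * evo d \<zeta> \<mu> c z w w1 w2 = \<i> * y" by simp
  also have "\<dots> \<longleftrightarrow> of_real d * w2 = of_real d * acc d \<zeta> \<mu> c z w w1 y"
  proof -
    define X where "X = (of_real \<zeta> - \<i> * of_real \<mu> - 2 * of_real ((cmod z)\<^sup>2)) * w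
      - z\<^sup>2 * cnj w + \<i> * of_real c * w1"
    have 1: "of_real d * acc d \<zeta> \<mu> c z w w1 y = X - \<i> * y"
      using assms by (simp add: acc_def X_def)
    have 2: "\<i> * evo d \<zeta> \<mu> c z w w1 w2 = X - of_real d * w2"
      by (simp add: evo_def lin_def X_def algebra_simps)
    show ?thesis unfolding 1 2 by (auto simp: algebra_simps)
  qed
  finally show ?thesis using assms by simp
qed

lemma C0p_acc:
  assumes "c \<in> C0p" "z \<in> C0p" "w \<in> C0p" "w1 \<in> C0p" "y \<in> C0p"
  shows "(\<lambda>x. acc d \<zeta> \<mu> (c x) (z x) (w x) (w1 x) (y x)) \<in> C0p"
  unfolding acc_def by (intro C0p_ints assms)

lemma C0p_lin:
  assumes "z \<in> C0p" "w \<in> C0p" "w2 \<in> C0p"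
  shows "(\<lambda>x. lin d \<zeta> \<mu> (z x) (w x) (w2 x)) \<in> C0p"
  unfolding lin_def by (intro C0p_ints assms)

definition Lsym :: "real \<Rightarrow> real \<Rightarrow> real \<Rightarrow> real \<Rightarrow> complex \<Rightarrow> complex ^ 2 \<Rightarrow> complex ^ 2 \<Rightarrow> complex ^ 2 \<Rightarrow> complex ^ 2" where
  "Lsym d \<zeta> \<mu> c z p p1 p2 = J_mat *v ((- d) *\<^sub>R p2 + potential_mat \<zeta> z *v p) - (\<mu> *\<^sub>R p - c *\<^sub>R p1)"

lemma Ltilde_Lsym: "Ltilde d \<zeta> \<mu> V u \<epsilon> \<phi> x = Lsym d \<zeta> \<mu> (\<epsilon> * V x) (u x) (\<phi> x) (D1 \<phi> x) (D2 \<phi> x)"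
  by (simp add: Ltilde_def Lsym_def A_op_def)

lemma mat2_mult: "(vector [vector [a, b], vector [c, e]] :: complex^2^2) *v p
   = vector [a * p $ 1 + b * p $ 2, c * p $ 1 + e * p $ 2]"
  by (simp add: vec_eq_iff forall_2 matrix_vector_mult_def sum_2 vector_2)

lemma cmod_square: "(cmod z)\<^sup>2 = Re z * Re z + Im z * Im z"
  unfolding cmod_power2 by (simp add: power2_eq_square)

text \<open>The system has real coefficients, so it acts on \<open>reP\<close> and
  \<open>imP\<close> separately. In the plane \<open>J_mat\<close> is multiplication by
  \<open>- i\<close>, which turns the matrix operator into \<open>- i L\<close> plus the transport
  term.\<close>

lemma Lsym_parts:
  "reP (Lsym d \<zeta> \<mu> c z p p1 p2) = evo d \<zeta> \<mu> c z (reP p) (reP p1) (reP p2)"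
  "imP (Lsym d \<zeta> \<mu> c z p p1 p2) = evo d \<zeta> \<mu> c z (imP p) (imP p1) (imP p2)"
  unfolding evo_def lin_def cmod_square
  by (simp_all add: Lsym_def J_mat_def potential_mat_def mat2_mult complex_eq_iff reP_def imP_def
      vector_2 algebra_simps power2_eq_square)

text \<open>Solved for the second derivative, the equation has a continuous right-hand side, so
  \<open>H2_C2p\<close> applies and the equation then holds at every point.\<close>

lemma classical_resolvent_solution:
  assumes d: "d \<noteq> 0" and \<phi>: "\<phi> \<in> H2per" and V: "V \<in> C0p" and u: "u \<in> C0p" and g: "g \<in> C0p"
    and ae: "AE x in leb_pi. Ltilde d \<zeta> \<mu> V u \<epsilon> \<phi> x - z *s \<phi> x = g x"
  obtains \<phi>1 \<phi>2 where "C2p \<phi> \<phi>1 \<phi>2"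
    "\<And>x. Lsym d \<zeta> \<mu> (\<epsilon> * V x) (u x) (\<phi> x) (\<phi>1 x) (\<phi>2 x) - z *s \<phi> x = g x"
proof -
  \<comment> \<open>The only value of the second derivative at \<open>x\<close> compatible with the
    equation.\<close>
  define G where "G x = emb
      (acc d \<zeta> \<mu> (\<epsilon> * V x) (u x) (reP (\<phi> x)) (reP (D1 \<phi> x)) (reP (g x + z *s \<phi> x)))
      (acc d \<zeta> \<mu> (\<epsilon> * V x) (u x) (imP (\<phi> x)) (imP (D1 \<phi> x)) (imP (g x + z *s \<phi> x)))" for x
  note c = C0p_linear[OF bounded_linear_reP H2per_D1(3)[OF \<phi>]] C0p_linear[OF bounded_linear_imP H2per_D1(3)[OF \<phi>]]
    C0p_linear[OF bounded_linear_reP g] C0p_linear[OF bounded_linear_imP g]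
    C0p_linear[OF bounded_linear_reP H2per_D1_C0p[OF \<phi>]] C0p_linear[OF bounded_linear_imP H2per_D1_C0p[OF \<phi>]]
  have G: "G \<in> C0p" unfolding G_def
    by (intro C0p_emb C0p_acc C0p_ints V u c) (simp_all only: reP_simps imP_simps, (intro C0p_ints c)+)
  have iff: "Lsym d \<zeta> \<mu> (\<epsilon> * V x) (u x) (\<phi> x) (D1 \<phi> x) q - z *s \<phi> x = g x \<longleftrightarrow> q = G x" for x q
    unfolding diff_eq_eq eq_iff_reP_imP[of _ "g x + _"] eq_iff_reP_imP[of q]
    by (simp only: Lsym_parts evo_eq_iff_acc[OF d] G_def emb_simps)
  have "AE x in leb_pi. D2 \<phi> x = G x" using ae by (simp add: Ltilde_Lsym iff)
  from H2_C2p[OF \<phi> this G] show ?thesis using that iff by blast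
qed

text \<open>With the eigenfunction written as \<open>a + i b\<close>, multiplication by
  \<open>z\<close> becomes a real two-by-two matrix acting on the pair
  \<open>(a, b)\<close>.\<close>

lemma eigenvalue_parts:
  assumes d: "d \<noteq> 0" and V: "V \<in> C0p" and u: "u \<in> C0p"
    and ev: "is_eigenvalue (Ltilde d \<zeta> \<mu> V u \<epsilon>) z"
  obtains a a1 a2 b b1 b2 where "C2p a a1 a2" "C2p b b1 b2" "\<not> (\<forall>x. a x = 0 \<and> b x = 0)"
    "\<And>x. evo d \<zeta> \<mu> (\<epsilon> * V x) (u x) (a x) (a1 x) (a2 x) = of_real (Re z) * a x - of_real (Im z) * b x"
    "\<And>x. evo d \<zeta> \<mu> (\<epsilon> * V x) (u x) (b x) (b1 x) (b2 x) = of_real (Im z) * a x + of_real (Re z) * b x"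
proof -
  obtain \<phi> where \<phi>: "\<phi> \<in> H2per" "\<phi> \<noteq> (\<lambda>_. 0)" "AE x in leb_pi. Ltilde d \<zeta> \<mu> V u \<epsilon> \<phi> x = z *s \<phi> x"
    using ev by (auto simp: is_eigenvalue_def)
  then have "AE x in leb_pi. Ltilde d \<zeta> \<mu> V u \<epsilon> \<phi> x - z *s \<phi> x = 0" by simp
  then obtain \<phi>1 \<phi>2 where c: "C2p \<phi> \<phi>1 \<phi>2"
    and eq: "\<And>x. Lsym d \<zeta> \<mu> (\<epsilon> * V x) (u x) (\<phi> x) (\<phi>1 x) (\<phi>2 x) - z *s \<phi> x = 0"
    by (rule classical_resolvent_solution[OF d \<phi>(1) V u C0p_intros(1)]) (rule that)
  show ?thesis
  proof (rule that[OF C2p_linear[OF bounded_linear_reP c] C2p_linear[OF bounded_linear_imP c]])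
    show "\<not> (\<forall>x. reP (\<phi> x) = 0 \<and> imP (\<phi> x) = 0)"
      using \<phi>(2) by (auto simp: eq_iff_reP_imP reP_simps imP_simps)
    fix x
    have eq: "Lsym d \<zeta> \<mu> (\<epsilon> * V x) (u x) (\<phi> x) (\<phi>1 x) (\<phi>2 x) = z *s \<phi> x" using eq[of x] by simp
    show "evo d \<zeta> \<mu> (\<epsilon> * V x) (u x) (reP (\<phi> x)) (reP (\<phi>1 x)) (reP (\<phi>2 x))
        = of_real (Re z) * reP (\<phi> x) - of_real (Im z) * imP (\<phi> x)"
      "evo d \<zeta> \<mu> (\<epsilon> * V x) (u x) (imP (\<phi> x)) (imP (\<phi>1 x)) (imP (\<phi>2 x))
        = of_real (Im z) * reP (\<phi> x) + of_real (Re z) * imP (\<phi> x)"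
      using arg_cong[OF eq, of reP] arg_cong[OF eq, of imP] by (simp_all add: Lsym_parts reP_simps imP_simps)
  qed
qed

lemma eigenvalueI:
  assumes "C2p a a1 a2" "C2p b b1 b2" "\<not> (\<forall>x. a x = 0 \<and> b x = 0)"
    "\<And>x. evo d \<zeta> \<mu> (\<epsilon> * V x) (u x) (a x) (a1 x) (a2 x) = of_real (Re z) * a x - of_real (Im z) * b x"
    "\<And>x. evo d \<zeta> \<mu> (\<epsilon> * V x) (u x) (b x) (b1 x) (b2 x) = of_real (Im z) * a x + of_real (Re z) * b x"
  shows "is_eigenvalue (Ltilde d \<zeta> \<mu> V u \<epsilon>) z"
proof -
  note c = C2p_emb[OF assms(1,2)]
  have eq: "Lsym d \<zeta> \<mu> (\<epsilon> * V x) (u x) (emb (a x) (b x)) (emb (a1 x) (b1 x)) (emb (a2 x) (b2 x)) = z *s emb (a x) (b x)" for x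
    using assms(4,5)[of x] by (subst eq_iff_reP_imP) (simp add: Lsym_parts reP_simps imP_simps)
  have "(\<lambda>x. emb (a x) (b x)) \<noteq> (\<lambda>_. 0)"
    using assms(3) by (metis emb_simps(1,2) imP_simps(4) reP_simps(4))
  moreover have "AE x in leb_pi. Ltilde d \<zeta> \<mu> V u \<epsilon> (\<lambda>x. emb (a x) (b x)) x = z *s emb (a x) (b x)"
    using C2p_H2(2)[OF c] by (auto simp: Ltilde_Lsym C2p_D1[OF c] eq elim!: eventually_mono)
  ultimately show ?thesis using C2p_H2(1)[OF c] unfolding is_eigenvalue_def by blast
qed

text \<open>An eigenfunction and the zero function would both solve the resolvent problem with zero
  data. As \<open>T\<close> is an arbitrary map, its value at the zero function is a separate
  assumption.\<close>

lemma resolvent_set_no_eigenvalue: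
  assumes "z \<in> resolvent_set T" "AE x in leb_pi. T (\<lambda>_. 0) x = 0"
  shows "\<not> is_eigenvalue T z"
proof
  assume "is_eigenvalue T z"
  then obtain \<phi> where "\<phi> \<in> H2per" "\<phi> \<noteq> (\<lambda>_. 0)" "AE x in leb_pi. T \<phi> x - z *s \<phi> x = 0"
    by (auto simp: is_eigenvalue_def)
  moreover have "(\<lambda>_. 0) \<in> H2per" using C2p_H2(1)[OF C2p_zero] .
  moreover have "AE x in leb_pi. T (\<lambda>_. 0) x - z *s 0 = 0" using assms(2) by auto
  moreover have "(\<lambda>_. 0 :: complex^2) \<in> L2" by (rule C0p_L2[OF C0p_intros(1)])
  ultimately show False using assms(1) unfolding resolvent_set_def by fast
qed

text \<open>Only almost everywhere, because \<open>D2\<close> of the zero function is some chosen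
  weak derivative.\<close>

lemma Ltilde_zero: "AE x in leb_pi. Ltilde d \<zeta> \<mu> V u \<epsilon> (\<lambda>_. 0) x = 0"
proof -
  have "Lsym d \<zeta> \<mu> c z 0 0 0 = 0" for c z
    by (simp add: eq_iff_reP_imP Lsym_parts reP_simps imP_simps evo_def lin_def)
  then show ?thesis
    using C2p_H2(2)[OF C2p_zero, where 'a="complex^2"]
    by (auto simp: Ltilde_Lsym C2p_D1[OF C2p_zero] elim!: eventually_mono)
qed

text \<open>For a real spectral parameter the two halves decouple, so the \<open>reP\<close> half of
  the solution with data \<open>emb (h x) 0\<close> solves the equation for planar
  functions.\<close>

lemma resolvent_set_solve_real:
  fixes r :: real
  assumes d: "d \<noteq> 0" and V: "V \<in> C0p" and u: "u \<in> C0p" and h: "h \<in> C0p"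
    and r: "of_real r \<in> resolvent_set (Ltilde d \<zeta> \<mu> V u \<epsilon>)"
  obtains w w1 w2 where "C2p w w1 w2" "\<And>x. evo d \<zeta> \<mu> (\<epsilon> * V x) (u x) (w x) (w1 x) (w2 x) - of_real r * w x = h x"
proof -
  have g: "(\<lambda>x. emb (h x) 0) \<in> C0p" by (intro C0p_emb h C0p_ints)
  obtain \<phi> where \<phi>: "\<phi> \<in> H2per" "AE x in leb_pi. Ltilde d \<zeta> \<mu> V u \<epsilon> \<phi> x - of_real r *s \<phi> x = emb (h x) 0"
    using r C0p_L2[OF g] unfolding resolvent_set_def by blast
  obtain \<phi>1 \<phi>2 where c: "C2p \<phi> \<phi>1 \<phi>2"
    and eq: "\<And>x. Lsym d \<zeta> \<mu> (\<epsilon> * V x) (u x) (\<phi> x) (\<phi>1 x) (\<phi>2 x) - of_real r *s \<phi> x = emb (h x) 0"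
    by (rule classical_resolvent_solution[OF d \<phi>(1) V u g \<phi>(2)]) (rule that)
  show ?thesis
    using arg_cong[OF eq, of reP]
    by (intro that[OF C2p_linear[OF bounded_linear_reP c]]) (simp add: Lsym_parts reP_simps)
qed

lemma solves_S_classical:
  assumes d: "d \<noteq> 0" and V: "V \<in> C0p" and s: "solves_S d f0 \<zeta> \<mu> V \<epsilon> u"
  obtains u2 where "C2p u (D1 u) u2"
    "\<And>x. - of_real d * u2 x + \<i> * of_real (\<epsilon> * V x) * D1 u x + (of_real \<zeta> - \<i> * of_real \<mu>) * u x
        - of_real ((cmod (u x))\<^sup>2) * u x + \<i> * of_real f0 = 0"
proof -
  have u: "u \<in> H2per" using s by (simp add: solves_S_def)
  define g where "g x = (\<i> * of_real (\<epsilon> * V x) * D1 u x + (of_real \<zeta> - \<i> * of_real \<mu>) * u x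
        - of_real ((cmod (u x))\<^sup>2) * u x + \<i> * of_real f0) / of_real d" for x
  have g: "g \<in> C0p" unfolding g_def
    by (intro C0p_ints V H2per_D1(3)[OF u] H2per_D1_C0p[OF u])
  have iff: "- of_real d * q + \<i> * of_real (\<epsilon> * V x) * D1 u x + (of_real \<zeta> - \<i> * of_real \<mu>) * u x
        - of_real ((cmod (u x))\<^sup>2) * u x + \<i> * of_real f0 = 0 \<longleftrightarrow> q = g x" for q x
    using d by (auto simp: g_def field_simps)
  have "AE x in leb_pi. D2 u x = g x" using s by (simp only: solves_S_def iff)
  from H2_C2p[OF u this g] show ?thesis using that iff by blast
qed

lemma solves_S_I:
  assumes c: "C2p u u1 u2"
    "\<And>x. - of_real d * u2 x + \<i> * of_real (\<epsilon> * V x) * u1 x + (of_real \<zeta> - \<i> * of_real \<mu>) * u x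
        - of_real ((cmod (u x))\<^sup>2) * u x + \<i> * of_real f0 = 0"
  shows "solves_S d f0 \<zeta> \<mu> V \<epsilon> u"
  using C2p_H2[OF c(1)] c(2) unfolding solves_S_def by (auto simp: C2p_D1[OF c(1)] elim!: eventually_mono)

section \<open>Pairing with the adjoint kernel\<close>

lemma L2_mult_bounded:
  fixes h p :: "real \<Rightarrow> complex"
  assumes h: "h \<in> C0p" and p: "p \<in> L2"
  shows "integrable leb_pi (\<lambda>x. h x * p x)" "integrable leb_pi (\<lambda>x. h x \<bullet> p x)"
proof -
  obtain B where B: "\<And>x. norm (h x) \<le> B" "B > 0" using C0p_bounded[OF h] by metis
  note m = measurable_continuous_leb_pi[OF C0pD(1)[OF h]]
  have pm: "p \<in> borel_measurable leb_pi" using p by (simp add: L2_def)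
  have i: "integrable leb_pi (\<lambda>x. B * norm (p x))" using L2_integrable[OF p] by auto
  show "integrable leb_pi (\<lambda>x. h x * p x)"
    by (rule Bochner_Integration.integrable_bound[OF i])
       (use m pm B in \<open>auto simp: norm_mult intro!: mult_right_mono\<close>)
  show "integrable leb_pi (\<lambda>x. h x \<bullet> p x)"
  proof (rule Bochner_Integration.integrable_bound[OF i])
    have "norm (h x \<bullet> p x) \<le> norm (B * norm (p x))" for x
      using Cauchy_Schwarz_ineq2[of "h x" "p x"] mult_right_mono[OF B(1)[of x], of "norm (p x)"] B(2) by simp
    then show "AE x in leb_pi. norm (h x \<bullet> p x) \<le> norm (B * norm (p x))" by simp
  qed (use m pm in auto)
qed

text \<open>Linearity and continuity in the supremum norm, the form in which the pairing with
  \<open>\<phi>0\<close> is handed to the locale \<open>wave\<close> as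
  \<open>\<Lambda>\<close>.\<close>

lemma l2_inner_C0p:
  fixes g h p :: "real \<Rightarrow> complex"
  assumes "g \<in> C0p" "h \<in> C0p" and p: "p \<in> L2"
  shows "l2_inner (\<lambda>x. g x + h x) p = l2_inner g p + l2_inner h p"
    "l2_inner (\<lambda>x. of_real c * g x) p = c * l2_inner g p"
    "(\<And>x. norm (h x) \<le> B) \<Longrightarrow> \<bar>l2_inner h p\<bar> \<le> (LINT x|leb_pi. norm (p x)) * B"
proof -
  note i = L2_mult_bounded(2)[OF assms(1) p] L2_mult_bounded(2)[OF assms(2) p]
  show "l2_inner (\<lambda>x. g x + h x) p = l2_inner g p + l2_inner h p"
    using i by (simp add: l2_inner_def inner_add_left)
  have "(of_real c * g x) \<bullet> p x = c * (g x \<bullet> p x)" for x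
    by (simp add: inner_complex_def algebra_simps)
  then show "l2_inner (\<lambda>x. of_real c * g x) p = c * l2_inner g p" by (simp add: l2_inner_def)
  show "\<bar>l2_inner h p\<bar> \<le> (LINT x|leb_pi. norm (p x)) * B" if B: "\<And>x. norm (h x) \<le> B"
  proof -
    have "norm (l2_inner h p) \<le> (LINT x|leb_pi. B * norm (p x))"
      unfolding l2_inner_def
    proof (rule Bochner_Integration.integral_norm_bound_integral[OF i(2)])
      show "integrable leb_pi (\<lambda>x. B * norm (p x))" using L2_integrable[OF p] by auto
      show "norm (h x \<bullet> p x) \<le> B * norm (p x)" for x
        using Cauchy_Schwarz_ineq2[of "h x" "p x"] mult_right_mono[OF B[of x], of "norm (p x)"] by simp
    qed
    then show ?thesis by (simp add: mult.commute)
  qed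
qed

text \<open>Moved to the left factor, \<open>J_mat\<close> becomes its transpose, which is
  multiplication by \<open>i\<close>.\<close>

lemma vec2_J_inner: "(vec2 f) \<bullet> (J_mat *v vec2 p) = (\<i> * f) \<bullet> p"
  by (simp add: vec2_def J_mat_def inner_vec_def sum_2 matrix_vector_mult_def vector_2 inner_complex_def)

lemma l2_inner_vec2_J:
  "l2_inner (\<lambda>x. r x *\<^sub>R vec2 (f x)) (\<lambda>x. J_mat *v vec2 (p x)) = l2_inner (\<lambda>x. \<i> * of_real (r x) * f x) p"
  unfolding l2_inner_def inner_scaleR_left vec2_J_inner
  by (rule Bochner_Integration.integral_cong) (auto simp: inner_complex_def algebra_simps)

lemma Re_LINT_eq_l2_inner:
  assumes "h \<in> C0p" "p \<in> L2"
  shows "Re (LINT x|leb_pi. h x * cnj (p x)) = l2_inner h p"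
proof -
  have "(\<lambda>x. cnj (p x)) \<in> L2"
    using assms(2) by (auto simp: L2_def intro: borel_measurable_continuous_on[of cnj] continuous_intros)
  from L2_mult_bounded(1)[OF assms(1) this] show ?thesis
    unfolding l2_inner_def by (subst integral_Re[symmetric]) (simp_all add: inner_complex_def)
qed

lemma integration_by_parts:
  fixes f g :: "real \<Rightarrow> complex"
  assumes f: "C2p f f1 f2" and g: "C2p g g1 g2"
  shows "integral {-pi..pi} (\<lambda>x. f2 x \<bullet> g x) = integral {-pi..pi} (\<lambda>x. f x \<bullet> g2 x)"
    "integral {-pi..pi} (\<lambda>x. f2 x * cnj (g x)) = - integral {-pi..pi} (\<lambda>x. f1 x * cnj (g1 x))"
proof -
  note C = C0pD(1)[OF C2pD(1)[OF f]] C0pD(1)[OF C2pD(2)[OF f]] C0pD(1)[OF C2pD(3)[OF f]]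
    C0pD(1)[OF C2pD(1)[OF g]] C0pD(1)[OF C2pD(2)[OF g]] C0pD(1)[OF C2pD(3)[OF g]]
  have P: "f pi = f (-pi)" "f1 pi = f1 (-pi)" "g pi = g (-pi)" "g1 pi = g1 (-pi)"
    using C0pD(2)[OF C2pD(1)[OF f], of "-pi"] C0pD(2)[OF C2pD(2)[OF f], of "-pi"]
     C0pD(2)[OF C2pD(1)[OF g], of "-pi"] C0pD(2)[OF C2pD(2)[OF g], of "-pi"] by simp_all
  have "((\<lambda>x. f1 x \<bullet> g x - f x \<bullet> g1 x) has_vector_derivative (f2 x \<bullet> g x - f x \<bullet> g2 x)) (at x)" for x
    using C2pD(4,5)[OF f, of x] C2pD(4,5)[OF g, of x]
    by (auto simp: has_vector_derivative_def intro!: derivative_eq_intros simp: fun_eq_iff algebra_simps)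
  from has_integral_deriv[of _ _ "-pi" pi, OF this]
  have "((\<lambda>x. f2 x \<bullet> g x - f x \<bullet> g2 x) has_integral 0) {-pi..pi}" by (simp add: P)
  moreover have "(\<lambda>x. f2 x \<bullet> g x) integrable_on {-pi..pi}" "(\<lambda>x. f x \<bullet> g2 x) integrable_on {-pi..pi}"
    by (auto intro!: integrable_continuous_real continuous_intros C)
  ultimately show "integral {-pi..pi} (\<lambda>x. f2 x \<bullet> g x) = integral {-pi..pi} (\<lambda>x. f x \<bullet> g2 x)"
    by (simp add: has_integral_iff integral_diff)
  have "((\<lambda>x. f1 x * cnj (g x)) has_vector_derivative (f2 x * cnj (g x) + f1 x * cnj (g1 x))) (at x)" for x
    using C2pD(4,5)[OF f, of x] C2pD(4,5)[OF g, of x]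
    by (auto simp: has_vector_derivative_def intro!: derivative_eq_intros simp: fun_eq_iff algebra_simps)
  from has_integral_deriv[of _ _ "-pi" pi, OF this]
  have "((\<lambda>x. f2 x * cnj (g x) + f1 x * cnj (g1 x)) has_integral 0) {-pi..pi}" by (simp add: P)
  moreover have "(\<lambda>x. f2 x * cnj (g x)) integrable_on {-pi..pi}" "(\<lambda>x. f1 x * cnj (g1 x)) integrable_on {-pi..pi}"
    by (auto intro!: integrable_continuous_real continuous_intros C)
  ultimately show "integral {-pi..pi} (\<lambda>x. f2 x * cnj (g x)) = - integral {-pi..pi} (\<lambda>x. f1 x * cnj (g1 x))"
    by (simp add: has_integral_iff integral_add eq_neg_iff_add_eq_0)
qed

lemma integral_norm_square_eq_0:
  fixes f :: "real \<Rightarrow> complex"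
  assumes "f \<in> C0p" "integral {-pi..pi} (\<lambda>x. (norm (f x))\<^sup>2) = 0"
  shows "f x = 0"
proof -
  have "(norm (f (red x)))\<^sup>2 = 0"
  proof (rule has_integral_0_cbox_imp_0[of "-pi" pi "\<lambda>x. (norm (f x))\<^sup>2"])
    have c: "continuous_on {-pi..pi} (\<lambda>x. (norm (f x))\<^sup>2)"
      by (intro continuous_intros C0pD(1)[OF assms(1)])
    then show "continuous_on (cbox (-pi) pi) (\<lambda>x. (norm (f x))\<^sup>2)" by simp
    show "((\<lambda>x. (norm (f x))\<^sup>2) has_integral 0) (cbox (-pi) pi)"
      using integrable_integral[OF integrable_continuous_real[OF c]] assms(2) by simp
    show "red x \<in> cbox (-pi) pi" using red_bounds(3) by simp
    show "box (-pi) pi \<noteq> {}" using pi_gt_zero by (simp del: pi_gt_zero)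
  qed simp
  then show ?thesis using red_periodic[OF C0pD(3)[OF assms(1)]] by simp
qed

text \<open>Real multiples and \<open>w \<mapsto> z\<^sup>2 cnj w\<close> are symmetric for the real
  inner product, so only the second derivatives remain, and they are settled by integration by
  parts. The damping \<open>- i \<mu>\<close> is skew, hence the parameter 0.\<close>

lemma lin_symmetric:
  assumes f: "C2p f f1 f2" and g: "C2p g g1 g2" and z: "z \<in> C0p"
  shows "integral {-pi..pi} (\<lambda>x. lin d \<zeta> 0 (z x) (f x) (f2 x) \<bullet> g x)
       = integral {-pi..pi} (\<lambda>x. f x \<bullet> lin d \<zeta> 0 (z x) (g x) (g2 x))"
proof -
  note C = C0pD(1)[OF C2pD(1)[OF f]] C0pD(1)[OF C2pD(2)[OF f]] C0pD(1)[OF C2pD(3)[OF f]]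
    C0pD(1)[OF C2pD(1)[OF g]] C0pD(1)[OF C2pD(2)[OF g]] C0pD(1)[OF C2pD(3)[OF g]] C0pD(1)[OF z]
  have eq: "lin d \<zeta> 0 (z x) (f x) (f2 x) \<bullet> g x - f x \<bullet> lin d \<zeta> 0 (z x) (g x) (g2 x)
      = d * (f x \<bullet> g2 x - f2 x \<bullet> g x)" for x
    unfolding lin_def inner_complex_def cmod_square by (simp add: power2_eq_square algebra_simps)
  have i: "(\<lambda>x. lin d \<zeta> 0 (z x) (f x) (f2 x) \<bullet> g x) integrable_on {-pi..pi}"
    "(\<lambda>x. f x \<bullet> lin d \<zeta> 0 (z x) (g x) (g2 x)) integrable_on {-pi..pi}"
    "(\<lambda>x. f2 x \<bullet> g x) integrable_on {-pi..pi}" "(\<lambda>x. f x \<bullet> g2 x) integrable_on {-pi..pi}"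
    by (auto simp: lin_def intro!: integrable_continuous_real continuous_intros C)
  have "integral {-pi..pi} (\<lambda>x. lin d \<zeta> 0 (z x) (f x) (f2 x) \<bullet> g x)
       - integral {-pi..pi} (\<lambda>x. f x \<bullet> lin d \<zeta> 0 (z x) (g x) (g2 x))
      = integral {-pi..pi} (\<lambda>x. d * (f x \<bullet> g2 x - f2 x \<bullet> g x))"
    unfolding integral_diff[OF i(1,2), symmetric] eq ..
  also have "\<dots> = d * (integral {-pi..pi} (\<lambda>x. f x \<bullet> g2 x) - integral {-pi..pi} (\<lambda>x. f2 x \<bullet> g x))"
    using i(3,4) by (simp add: integral_diff)
  finally show ?thesis using integration_by_parts(1)[OF f g] by simp
qed

text \<open>The linearization plus \<open>\<mu>\<close> is Hamiltonian, so \<open>0\<close> being an eigenvalue with eigenfunction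
  \<open>w\<close> forces \<open>-2\<mu>\<close> into the spectrum, with \<open>-\<i> w\<close> orthogonal to the range.\<close>
lemma hamiltonian_symmetry:
  assumes d: "d \<noteq> 0" and V: "V \<in> C0p" and z: "z \<in> C0p" and w: "C2p w w1 w2"
    and eq: "\<And>x. lin d \<zeta> \<mu> (z x) (w x) (w2 x) = 0" and nz: "w x0 \<noteq> 0"
  shows "of_real (- 2 * \<mu>) \<in> op_spectrum (Ltilde d \<zeta> \<mu> V z 0)"
proof (rule ccontr)
  assume "\<not> ?thesis"
  then have r: "of_real (- 2 * \<mu>) \<in> resolvent_set (Ltilde d \<zeta> \<mu> V z 0)" by (simp add: op_spectrum_def)
  have "(\<lambda>x. - \<i> * w x) \<in> C0p" by (intro C0p_ints C2pD(1)[OF w])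
  from resolvent_set_solve_real[OF d V z this r] obtain f f1 f2 where f: "C2p f f1 f2"
    and feq: "\<And>x. evo d \<zeta> \<mu> (0 * V x) (z x) (f x) (f1 x) (f2 x) - of_real (- 2 * \<mu>) * f x = - \<i> * w x" by blast
  \<comment> \<open>The shift by \<open>2 * \<mu>\<close> reverses the sign of the damping felt by
    \<open>f\<close>. The two skew terms then combine so that the squared norm of \<open>w\<close>
    becomes a difference of symmetric expressions, with integral zero.\<close>
  have a: "w x = lin d \<zeta> 0 (z x) (f x) (f2 x) + \<i> * of_real \<mu> * f x" for x
    using arg_cong[OF feq[of x], of "\<lambda>y. \<i> * y"] by (simp add: evo_def lin_def algebra_simps)
  have b: "lin d \<zeta> 0 (z x) (w x) (w2 x) = \<i> * of_real \<mu> * w x" for x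
    using eq[of x] by (simp add: lin_def algebra_simps)
  have "(norm (w x))\<^sup>2 = lin d \<zeta> 0 (z x) (f x) (f2 x) \<bullet> w x - f x \<bullet> lin d \<zeta> 0 (z x) (w x) (w2 x)" for x
  proof -
    have "(norm (w x))\<^sup>2 = w x \<bullet> w x" by (simp add: power2_norm_eq_inner)
    also have "\<dots> = (lin d \<zeta> 0 (z x) (f x) (f2 x) + \<i> * of_real \<mu> * f x) \<bullet> w x" using a by simp
    also have "\<dots> = lin d \<zeta> 0 (z x) (f x) (f2 x) \<bullet> w x - f x \<bullet> (\<i> * of_real \<mu> * w x)"
      by (simp add: inner_add_left) (simp add: inner_complex_def algebra_simps)
    finally show ?thesis by (simp only: b)
  qed
  moreover have "(\<lambda>x. lin d \<zeta> 0 (z x) (f x) (f2 x) \<bullet> w x) integrable_on {-pi..pi}"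
    "(\<lambda>x. f x \<bullet> lin d \<zeta> 0 (z x) (w x) (w2 x)) integrable_on {-pi..pi}"
    using C0pD(1)[OF C2pD(1)[OF f]] C0pD(1)[OF C2pD(1)[OF w]]
      C0pD(1)[OF C0p_lin[OF z C2pD(1,3)[OF f]]] C0pD(1)[OF C0p_lin[OF z C2pD(1,3)[OF w]]]
    by (auto intro!: integrable_continuous_real continuous_intros)
  ultimately have "integral {-pi..pi} (\<lambda>x. (norm (w x))\<^sup>2) = 0"
    using lin_symmetric[OF f w z, of d \<zeta>] by (simp add: integral_diff)
  from integral_norm_square_eq_0[OF C2pD(1)[OF w] this] nz show False by blast
qed

section \<open>Compactness\<close>

abbreviation ulim :: "(nat \<Rightarrow> real \<Rightarrow> 'a::real_normed_vector) \<Rightarrow> (real \<Rightarrow> 'a) \<Rightarrow> bool" where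
  "ulim f g \<equiv> uniform_limit UNIV f g sequentially"

lemma ulim_subseq: "ulim f g \<Longrightarrow> strict_mono r \<Longrightarrow> ulim (\<lambda>n. f (r n)) g"
  using filterlim_compose[OF _ filterlim_subseq] by blast

lemma ulim_D: "ulim f g \<Longrightarrow> e > 0 \<Longrightarrow> \<forall>\<^sub>F n in sequentially. \<forall>x. norm (f n x - g x) < e"
  using uniform_limitD[where S = UNIV and f = f and l = g and F = sequentially and e = e] by (simp add: dist_norm)

lemma ulim_const: "s \<longlonglongrightarrow> l \<Longrightarrow> ulim (\<lambda>n x. s n) (\<lambda>x. l)"
  by (auto simp: uniform_limit_iff tendsto_iff)

lemma ulim_mult:
  fixes f g :: "nat \<Rightarrow> real \<Rightarrow> complex"
  assumes "ulim f f'" "ulim g g'" "f' \<in> C0p" "g' \<in> C0p"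
  shows "ulim (\<lambda>n x. f n x * g n x) (\<lambda>x. f' x * g' x)"
  by (intro uniform_lim_mult assms C0p_bounded_image)

lemma ulim_pointwise: "ulim f g \<Longrightarrow> (\<lambda>n. f n x) \<longlonglongrightarrow> g x"
  by (rule tendsto_uniform_limitI) auto

lemma C0p_ulim:
  assumes "ulim f g" "\<And>n. f n \<in> C0p" shows "g \<in> C0p"
proof -
  have "continuous_on UNIV g"
    by (rule uniform_limit_theorem[OF _ assms(1)]) (use C0pD(1)[OF assms(2)] in auto)
  moreover have "g (x + 2 * pi) = g x" for x
    using ulim_pointwise[OF assms(1), of "x + 2 * pi"] ulim_pointwise[OF assms(1), of x]
    by (simp add: C0pD(2)[OF assms(2)] LIMSEQ_unique)
  ultimately show ?thesis by (simp add: C0p_def periodic_2pi_def)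
qed

lemma ulim_uniformly_bounded:
  assumes "ulim f g" "\<And>n. f n \<in> C0p"
  obtains B where "B > 0" "\<And>n x. norm (f n x) \<le> B"
proof -
  obtain N where N: "\<And>n x. n \<ge> N \<Longrightarrow> norm (f n x - g x) < 1"
    using ulim_D[OF assms(1), of 1] by (auto simp: eventually_sequentially)
  obtain G where G: "G > 0" "\<And>x. norm (g x) \<le> G" using C0p_bounded[OF C0p_ulim[OF assms]] by blast
  have "\<exists>b. \<forall>n. 0 < b n \<and> (\<forall>x. norm (f n x) \<le> b n)" using C0p_bounded[OF assms(2)] by (intro choice) metis
  then obtain b where b: "\<And>n. 0 < b n" "\<And>n x. norm (f n x) \<le> b n" by blast
  \<comment> \<open>The sum stands in for the maximum of the first \<open>N\<close> bounds and also
    covers \<open>N = 0\<close>.\<close>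
  have "norm (f n x) \<le> G + 1 + sum b {..<N}" for n x
  proof (cases "n < N")
    case True
    then have "b n \<le> sum b {..<N}" using b(1) by (intro member_le_sum) (auto intro: less_imp_le)
    then show ?thesis using b(2)[of n x] G(1) by linarith
  next
    case False
    have "sum b {..<N} \<ge> 0" using b(1) by (intro sum_nonneg) (auto intro: less_imp_le)
    moreover have "norm (f n x) \<le> norm (f n x - g x) + norm (g x)" by norm
    ultimately show ?thesis using N[of n x] False G(2)[of x] by linarith
  qed
  moreover have "G + 1 + sum b {..<N} > 0" using G(1) b(1) by (intro add_pos_nonneg sum_nonneg) (auto intro: less_imp_le)
  ultimately show ?thesis using that by blast
qed

lemma C2p_lipschitz:
  fixes f :: "real \<Rightarrow> 'a::real_normed_vector"
  assumes "\<And>x. (f has_vector_derivative f1 x) (at x)" "\<And>x. norm (f1 x) \<le> M"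
  shows "norm (f x - f y) \<le> M * \<bar>x - y\<bar>"
proof -
  have "norm (f x - f y) \<le> M * norm (x - y)"
  proof (rule differentiable_bound[where S = UNIV and f' = "\<lambda>x h. h *\<^sub>R f1 x"])
    show "onorm (\<lambda>h. h *\<^sub>R f1 z) \<le> M" for z
      by (rule onorm_le) (simp add: mult.commute[of M] mult_left_mono[OF assms(2)[of z]])
  qed (use assms(1) in \<open>auto simp: has_vector_derivative_def\<close>)
  then show ?thesis by simp
qed

text \<open>Values and first derivatives are treated as one equi-Lipschitz family of pairs, so a
  single subsequence serves both. Convergence of the second derivatives is not claimed; it is
  recovered from the equation in \<open>evo_compactness\<close>.\<close>

lemma C2p_compactness:
  fixes f f1 f2 :: "nat \<Rightarrow> real \<Rightarrow> complex"
  assumes C: "\<And>n. C2p (f n) (f1 n) (f2 n)"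
    and M: "\<And>n x. norm (f n x) \<le> M" "\<And>n x. norm (f1 n x) \<le> M" "\<And>n x. norm (f2 n x) \<le> M"
  obtains r g g1 where "strict_mono r" "ulim (\<lambda>n. f (r n)) g" "ulim (\<lambda>n. f1 (r n)) g1"
proof -
  define F where "F n x = (f n x, f1 n x)" for n x
  have M0: "M \<ge> 0" using M(1)[of 0 0] norm_ge_zero order_trans by blast
  have nF: "norm (p, q) \<le> norm p + norm q" for p q :: complex by (rule norm_Pair_le)
  have lip: "norm (F n x - F n y) \<le> 2 * M * \<bar>x - y\<bar>" for n x y
    using nF[of "f n x - f n y" "f1 n x - f1 n y"] C2p_lipschitz[OF C2pD(4)[OF C] M(2), of n x y]
      C2p_lipschitz[OF C2pD(5)[OF C] M(3), of n x y] by (simp add: F_def)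
  obtain G r where r: "strict_mono (r :: nat \<Rightarrow> nat)"
    and lim: "\<And>e. 0 < e \<Longrightarrow> \<exists>N. \<forall>n x. n \<ge> N \<and> x \<in> {-pi..pi} \<longrightarrow> norm (F (r n) x - G x) < e"
  proof (rule Arzela_Ascoli[of "{-pi..pi}" F "2 * M"])
    show "norm (F n x) \<le> 2 * M" for n x
      using nF[of "f n x" "f1 n x"] M(1)[of n x] M(2)[of n x] by (simp add: F_def)
    show "\<exists>\<delta>>0. \<forall>n y. y \<in> {-pi..pi} \<and> norm (x - y) < \<delta> \<longrightarrow> norm (F n x - F n y) < e" if "0 < e" for x e
    proof (intro exI conjI allI impI)
      \<comment> \<open>The summand 1 keeps the denominator positive when
        \<open>M = 0\<close>.\<close>
      show "0 < e / (2 * M + 1)" using that M0 by simp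
      fix n y assume "y \<in> {-pi..pi} \<and> norm (x - y) < e / (2 * M + 1)"
      then have "\<bar>x - y\<bar> * (2 * M + 1) < e" using M0 by (simp add: field_simps)
      moreover have "2 * M * \<bar>x - y\<bar> \<le> \<bar>x - y\<bar> * (2 * M + 1)" by (simp add: algebra_simps)
      ultimately show "norm (F n x - F n y) < e" using lip[of n x y] by linarith
    qed
  qed auto
  \<comment> \<open>The limit is controlled only on the basic interval; composing with
    \<open>red\<close> extends it, and periodicity of the sequence makes the convergence uniform on
    the line.\<close>
  have U: "ulim (\<lambda>n. F (r n)) (\<lambda>x. G (red x))"
  proof (rule uniform_limitI)
    fix e :: real assume "e > 0"
    then obtain N where N: "\<And>n x. n \<ge> N \<Longrightarrow> x \<in> {-pi..pi} \<Longrightarrow> norm (F (r n) x - G x) < e"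
      using lim by blast
    have "F n (red x) = F n x" for n x
      using red_periodic[OF C0pD(3)[OF C2pD(1)[OF C]]] red_periodic[OF C0pD(3)[OF C2pD(2)[OF C]]] by (simp add: F_def)
    then show "\<forall>\<^sub>F n in sequentially. \<forall>x\<in>UNIV. dist (F (r n) x) (G (red x)) < e"
      using N red_bounds(3) unfolding eventually_sequentially dist_norm by metis
  qed
  show ?thesis
    using that[OF r] bounded_linear.uniform_limit[OF bounded_linear_fst U] bounded_linear.uniform_limit[OF bounded_linear_snd U]
    by (simp add: F_def)
qed

lemma has_vector_derivative_ulim:
  fixes f f' :: "nat \<Rightarrow> real \<Rightarrow> complex"
  assumes "ulim f g" "ulim f' g'" "\<And>n x. (f n has_vector_derivative f' n x) (at x)"
  shows "(g has_vector_derivative g' x) (at x)"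
proof -
  have "\<exists>h. \<forall>x\<in>UNIV. (\<lambda>n. f n x) \<longlonglongrightarrow> h x \<and> (h has_derivative (\<lambda>t. t *\<^sub>R g' x)) (at x within UNIV)"
  proof (rule has_derivative_sequence[where f' = "\<lambda>n x t. t *\<^sub>R f' n x" and ?x0.0 = 0])
    fix e :: real assume "e > 0"
    from ulim_D[OF assms(2) this] show "\<forall>\<^sub>F n in sequentially. \<forall>x\<in>UNIV. \<forall>h. norm (h *\<^sub>R f' n x - h *\<^sub>R g' x) \<le> e * norm h"
    proof eventually_elim
      case (elim n)
      have "norm (h *\<^sub>R f' n x - h *\<^sub>R g' x) = norm (f' n x - g' x) * \<bar>h\<bar>" for h x
        by (metis mult.commute norm_scaleR scaleR_right_diff_distrib)
      then show ?case using elim by (simp add: mult_right_mono less_imp_le)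
    qed
  qed (use assms(3) ulim_pointwise[OF assms(1)] in \<open>auto simp: has_vector_derivative_def\<close>)
  then obtain h where h: "\<And>x. (\<lambda>n. f n x) \<longlonglongrightarrow> h x" "\<And>x. (h has_derivative (\<lambda>t. t *\<^sub>R g' x)) (at x)"
    by auto
  have "h = g" using h(1) ulim_pointwise[OF assms(1)] LIMSEQ_unique by blast
  then show ?thesis using h(2) by (simp add: has_vector_derivative_def)
qed

lemma C2p_ulim:
  fixes f f1 f2 :: "nat \<Rightarrow> real \<Rightarrow> complex"
  assumes C: "\<And>n. C2p (f n) (f1 n) (f2 n)" and "ulim f g" "ulim f1 g1" "ulim f2 g2"
  shows "C2p g g1 g2"
  using C0p_ulim[OF assms(2) C2pD(1)[OF C]] C0p_ulim[OF assms(4) C2pD(3)[OF C]]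
    has_vector_derivative_ulim[OF assms(2,3) C2pD(4)[OF C]] has_vector_derivative_ulim[OF assms(3,4) C2pD(5)[OF C]]
  by (auto simp: C2p_def C0p_def)

lemma acc_alt: "acc d \<zeta> \<mu> c z w w1 y = ((of_real \<zeta> - \<i> * of_real \<mu> - 2 * (z * cnj z)) * w
     - (z * z) * cnj w - \<i> * y + \<i> * (of_real c * w1)) / of_real d"
  unfolding acc_def complex_norm_square power2_eq_square[of z] by (simp add: mult.assoc)

lemma ulim_acc:
  assumes "ulim c c'" "ulim z z'" "ulim w w'" "ulim w1 w1'" "ulim y y'"
    and "c' \<in> C0p" "z' \<in> C0p" "w' \<in> C0p" "w1' \<in> C0p" "y' \<in> C0p"
  shows "ulim (\<lambda>n x. acc d \<zeta> \<mu> (c n x) (z n x) (w n x) (w1 n x) (y n x))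
    (\<lambda>x. acc d \<zeta> \<mu> (c' x) (z' x) (w' x) (w1' x) (y' x))"
  unfolding acc_alt
  by (intro bounded_linear.uniform_limit[OF bounded_linear_divide] uniform_limit_add uniform_limit_minus
      bounded_linear.uniform_limit[OF bounded_linear_mult_right]
      ulim_mult uniform_limit_const bounded_linear.uniform_limit[OF bounded_linear_cnj]
      bounded_linear.uniform_limit[OF bounded_linear_of_real] assms C0p_ints)

lemma norm_acc_le:
  assumes "\<bar>c\<bar> \<le> B" "norm z \<le> B" "norm w \<le> B" "norm w1 \<le> B" "norm y \<le> B"
  shows "norm (acc d \<zeta> \<mu> c z w w1 y) \<le> ((\<bar>\<zeta>\<bar> + \<bar>\<mu>\<bar> + 2 * (B * B)) * B + (B * B) * B + B + B * B) / \<bar>d\<bar>"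
proof -
  have B: "B \<ge> 0" using assms(1) by linarith
  let ?p = "of_real \<zeta> - \<i> * of_real \<mu> - 2 * (z * cnj z)"
  have zz: "norm z * norm z \<le> B * B" using assms(2) B by (intro mult_mono) auto
  have "norm ?p \<le> norm (of_real \<zeta> :: complex) + norm (\<i> * of_real \<mu>) + norm (2 * (z * cnj z))" by norm
  then have p: "norm ?p \<le> \<bar>\<zeta>\<bar> + \<bar>\<mu>\<bar> + 2 * (B * B)" using zz by (simp add: norm_mult)
  have 1: "norm (?p * w) \<le> (\<bar>\<zeta>\<bar> + \<bar>\<mu>\<bar> + 2 * (B * B)) * B"
    unfolding norm_mult using p assms(3) B by (intro mult_mono) auto
  have 2: "norm ((z * z) * cnj w) \<le> (B * B) * B"
    using mult_mono[OF zz assms(3)] B by (simp add: norm_mult)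
  have 3: "norm (\<i> * y) \<le> B" using assms(5) by (simp add: norm_mult)
  have 4: "norm (\<i> * (of_real c * w1)) \<le> B * B"
    using mult_mono[OF assms(1,4)] B by (simp add: norm_mult)
  have "norm (?p * w - (z * z) * cnj w - \<i> * y + \<i> * (of_real c * w1))
    \<le> norm (?p * w) + norm ((z * z) * cnj w) + norm (\<i> * y) + norm (\<i> * (of_real c * w1))" by norm
  also have "\<dots> \<le> (\<bar>\<zeta>\<bar> + \<bar>\<mu>\<bar> + 2 * (B * B)) * B + (B * B) * B + B + B * B"
    using 1 2 3 4 by linarith
  finally show ?thesis unfolding acc_alt norm_divide norm_of_real by (rule divide_right_mono) simp
qed

lemma bounded_seq_subseq:
  fixes s :: "nat \<Rightarrow> real"
  assumes "\<And>n. \<bar>s n\<bar> \<le> M" obtains r l where "strict_mono r" "(\<lambda>n. s (r n)) \<longlonglongrightarrow> l"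
proof -
  have "seq_compact {-M..M}" by (simp add: compact_imp_seq_compact)
  moreover have "\<forall>n. s n \<in> {-M..M}" using assms by (simp add: abs_le_iff minus_le_iff)
  ultimately show ?thesis using that unfolding seq_compact_def o_def by metis
qed

text \<open>Through \<open>acc\<close> the equation bounds the second derivatives by lower-order
  data, so the compactness lemma applies. It then also transfers the uniform convergence to the
  second derivatives, and the limits satisfy the limit equation.\<close>

lemma evo_compactness:
  fixes a a1 a2 b b1 b2 z h k :: "nat \<Rightarrow> real \<Rightarrow> complex" and c :: "nat \<Rightarrow> real \<Rightarrow> real"
  assumes d: "d \<noteq> 0" and A: "\<And>n. C2p (a n) (a1 n) (a2 n)" and B: "\<And>n. C2p (b n) (b1 n) (b2 n)"
    and eqa: "\<And>n x. evo d \<zeta> \<mu> (c n x) (z n x) (a n x) (a1 n x) (a2 n x)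
        = of_real (\<alpha> n) * a n x - of_real (\<beta> n) * b n x + h n x"
    and eqb: "\<And>n x. evo d \<zeta> \<mu> (c n x) (z n x) (b n x) (b1 n x) (b2 n x)
        = of_real (\<beta> n) * a n x + of_real (\<alpha> n) * b n x + k n x"
    and bd: "\<And>n x. norm (a n x) \<le> M" "\<And>n x. norm (a1 n x) \<le> M" "\<And>n x. norm (b n x) \<le> M" "\<And>n x. norm (b1 n x) \<le> M"
      "\<And>n. \<bar>\<alpha> n\<bar> \<le> M" "\<And>n. \<bar>\<beta> n\<bar> \<le> M"
    and cz: "ulim c c'" "ulim z z'" "ulim h h'" "ulim k k'"
      "\<And>n. c n \<in> C0p" "\<And>n. z n \<in> C0p" "\<And>n. h n \<in> C0p" "\<And>n. k n \<in> C0p"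
  obtains r p p1 p2 q q1 q2 \<alpha>' \<beta>' where "strict_mono r" "(\<lambda>n. \<alpha> (r n)) \<longlonglongrightarrow> \<alpha>'" "(\<lambda>n. \<beta> (r n)) \<longlonglongrightarrow> \<beta>'"
    "C2p p p1 p2" "C2p q q1 q2" "ulim (\<lambda>n. a (r n)) p" "ulim (\<lambda>n. a1 (r n)) p1" "ulim (\<lambda>n. b (r n)) q" "ulim (\<lambda>n. b1 (r n)) q1"
    "\<And>x. evo d \<zeta> \<mu> (c' x) (z' x) (p x) (p1 x) (p2 x) = of_real \<alpha>' * p x - of_real \<beta>' * q x + h' x"
    "\<And>x. evo d \<zeta> \<mu> (c' x) (z' x) (q x) (q1 x) (q2 x) = of_real \<beta>' * p x + of_real \<alpha>' * q x + k' x"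
proof -
  define y where "y n x = of_real (\<alpha> n) * a n x - of_real (\<beta> n) * b n x + h n x" for n x
  define l where "l n x = of_real (\<beta> n) * a n x + of_real (\<alpha> n) * b n x + k n x" for n x
  have a2: "a2 n = (\<lambda>x. acc d \<zeta> \<mu> (c n x) (z n x) (a n x) (a1 n x) (y n x))" for n
    using eqa by (auto simp: evo_eq_iff_acc[OF d] y_def)
  have b2: "b2 n = (\<lambda>x. acc d \<zeta> \<mu> (c n x) (z n x) (b n x) (b1 n x) (l n x))" for n
    using eqb by (auto simp: evo_eq_iff_acc[OF d] l_def)
  obtain Bc where Bc: "Bc > 0" "\<And>n x. norm (c n x) \<le> Bc" using ulim_uniformly_bounded[OF cz(1,5)] by blast
  obtain Bz where Bz: "Bz > 0" "\<And>n x. norm (z n x) \<le> Bz" using ulim_uniformly_bounded[OF cz(2,6)] by blast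
  obtain Bh where Bh: "Bh > 0" "\<And>n x. norm (h n x) \<le> Bh" using ulim_uniformly_bounded[OF cz(3,7)] by blast
  obtain Bk where Bk: "Bk > 0" "\<And>n x. norm (k n x) \<le> Bk" using ulim_uniformly_bounded[OF cz(4,8)] by blast
  have M: "M \<ge> 0" using bd(5)[of 0] by linarith
  \<comment> \<open>One bound for every argument of \<open>acc\<close>; the products
    \<open>M * M\<close> come from the eigenvalue terms, \<open>Bh\<close> and \<open>Bk\<close>
    from the inhomogeneities.\<close>
  define N where "N = M + Bc + Bz + (M * M + M * M + Bh + Bk)"
  have m: "norm (of_real s * t) \<le> M * M" if "\<bar>s\<bar> \<le> M" "norm t \<le> M" for s :: real and t :: complex
    using mult_mono[OF that] M by (simp add: norm_mult)
  have yl: "norm (y n x) \<le> N" "norm (l n x) \<le> N" for n x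
  proof -
    have "norm (y n x) \<le> norm (of_real (\<alpha> n) * a n x) + norm (of_real (\<beta> n) * b n x) + norm (h n x)"
      unfolding y_def by norm
    then show "norm (y n x) \<le> N"
      using m[OF bd(5,1), of n n x] m[OF bd(6,3), of n n x] Bh(2)[of n x] Bc(1) Bz(1) Bk(1) M unfolding N_def by linarith
    have "norm (l n x) \<le> norm (of_real (\<beta> n) * a n x) + norm (of_real (\<alpha> n) * b n x) + norm (k n x)"
      unfolding l_def by norm
    then show "norm (l n x) \<le> N"
      using m[OF bd(6,1), of n n x] m[OF bd(5,3), of n n x] Bk(2)[of n x] Bc(1) Bz(1) Bh(1) M unfolding N_def by linarith
  qed
  have MN: "M \<le> N" "Bc \<le> N" "Bz \<le> N" using M Bc(1) Bz(1) Bh(1) Bk(1) mult_nonneg_nonneg[OF M M] unfolding N_def by linarith+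
  define Q where "Q = ((\<bar>\<zeta>\<bar> + \<bar>\<mu>\<bar> + 2 * (N * N)) * N + (N * N) * N + N + N * N) / \<bar>d\<bar>"
  have Q: "norm (a2 n x) \<le> Q" "norm (b2 n x) \<le> Q" for n x
    unfolding a2 b2 Q_def
    using order_trans[OF bd(1) MN(1)] order_trans[OF bd(2) MN(1)] order_trans[OF bd(3) MN(1)] order_trans[OF bd(4) MN(1)]
      order_trans[OF Bc(2) MN(2)] order_trans[OF Bz(2) MN(3)] yl
    by (auto intro!: norm_acc_le)
  let ?M = "max M Q"
  \<comment> \<open>Four successive subsequences, for \<open>a\<close>, \<open>b\<close>, \<alpha>
    and \<beta>; their composition is \<open>r\<close>.\<close>
  obtain r1 p p1 where r1: "strict_mono r1" and p: "ulim (\<lambda>n. a (r1 n)) p" "ulim (\<lambda>n. a1 (r1 n)) p1"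
    by (rule C2p_compactness[where f = a and ?f1.0 = a1 and ?f2.0 = a2 and M = ?M, OF A]) (use bd Q in \<open>auto simp: le_max_iff_disj\<close>)
  obtain r2 q q1 where r2: "strict_mono r2" and q: "ulim (\<lambda>n. b (r1 (r2 n))) q" "ulim (\<lambda>n. b1 (r1 (r2 n))) q1"
    by (rule C2p_compactness[where f = "\<lambda>n. b (r1 n)" and ?f1.0 = "\<lambda>n. b1 (r1 n)" and ?f2.0 = "\<lambda>n. b2 (r1 n)" and M = ?M, OF B]) (use bd Q in \<open>auto simp: le_max_iff_disj\<close>)
  obtain r3 \<alpha>' where r3: "strict_mono r3" and al: "(\<lambda>n. \<alpha> (r1 (r2 (r3 n)))) \<longlonglongrightarrow> \<alpha>'"
    by (rule bounded_seq_subseq[of "\<lambda>n. \<alpha> (r1 (r2 n))" M]) (use bd(5) in auto)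
  obtain r4 \<beta>' where r4: "strict_mono r4" and be: "(\<lambda>n. \<beta> (r1 (r2 (r3 (r4 n))))) \<longlonglongrightarrow> \<beta>'"
    by (rule bounded_seq_subseq[of "\<lambda>n. \<beta> (r1 (r2 (r3 n)))" M]) (use bd(6) in auto)
  define r where "r n = r1 (r2 (r3 (r4 n)))" for n
  have r34: "strict_mono (\<lambda>n. r3 (r4 n))" and r234: "strict_mono (\<lambda>n. r2 (r3 (r4 n)))" and r: "strict_mono r"
    using r1 r2 r3 r4 by (auto simp: strict_mono_def r_def)
  have al: "(\<lambda>n. \<alpha> (r n)) \<longlonglongrightarrow> \<alpha>'"
    unfolding r_def using LIMSEQ_subseq_LIMSEQ[OF al r4] by (simp add: o_def)
  have be: "(\<lambda>n. \<beta> (r n)) \<longlonglongrightarrow> \<beta>'" unfolding r_def by (rule be)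
  have p: "ulim (\<lambda>n. a (r n)) p" "ulim (\<lambda>n. a1 (r n)) p1"
    unfolding r_def using ulim_subseq[OF p(1) r234] ulim_subseq[OF p(2) r234] by auto
  have q: "ulim (\<lambda>n. b (r n)) q" "ulim (\<lambda>n. b1 (r n)) q1"
    unfolding r_def using ulim_subseq[OF q(1) r34] ulim_subseq[OF q(2) r34] by auto
  have c0: "p \<in> C0p" "p1 \<in> C0p" "q \<in> C0p" "q1 \<in> C0p" "c' \<in> C0p" "z' \<in> C0p" "h' \<in> C0p" "k' \<in> C0p"
    using C0p_ulim[OF p(1) C2pD(1)[OF A]] C0p_ulim[OF p(2) C2pD(2)[OF A]]
      C0p_ulim[OF q(1) C2pD(1)[OF B]] C0p_ulim[OF q(2) C2pD(2)[OF B]]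
      C0p_ulim[OF cz(1,5)] C0p_ulim[OF cz(2,6)] C0p_ulim[OF cz(3,7)] C0p_ulim[OF cz(4,8)] by auto
  define y' where "y' x = of_real \<alpha>' * p x - of_real \<beta>' * q x + h' x" for x
  define l' where "l' x = of_real \<beta>' * p x + of_real \<alpha>' * q x + k' x" for x
  have y: "ulim (\<lambda>n. y (r n)) y'" "y' \<in> C0p" and l: "ulim (\<lambda>n. l (r n)) l'" "l' \<in> C0p"
    unfolding y_def l_def y'_def l'_def
    by (intro uniform_limit_add uniform_limit_minus ulim_mult ulim_const tendsto_of_real al be p q c0 C0p_ints
        ulim_subseq[OF cz(3) r] ulim_subseq[OF cz(4) r])+
  \<comment> \<open>The candidate second derivative is read off from the limit equation;
    \<open>C2p_ulim\<close> then certifies it.\<close>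
  define p2 where "p2 x = acc d \<zeta> \<mu> (c' x) (z' x) (p x) (p1 x) (y' x)" for x
  define q2 where "q2 x = acc d \<zeta> \<mu> (c' x) (z' x) (q x) (q1 x) (l' x)" for x
  have "ulim (\<lambda>n. a2 (r n)) p2" "ulim (\<lambda>n. b2 (r n)) q2"
    unfolding a2 b2 p2_def q2_def
    by (intro ulim_acc ulim_subseq[OF cz(1) r] ulim_subseq[OF cz(2) r] p q y l c0)+
  then have "C2p p p1 p2" "C2p q q1 q2"
    using C2p_ulim[OF A p] C2p_ulim[OF B q] by auto
  moreover have "evo d \<zeta> \<mu> (c' x) (z' x) (p x) (p1 x) (p2 x) = y' x"
     "evo d \<zeta> \<mu> (c' x) (z' x) (q x) (q1 x) (q2 x) = l' x" for x
    using d by (simp_all add: evo_eq_iff_acc p2_def q2_def)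
  ultimately show ?thesis using that[OF r al be _ _ p q] by (simp add: y'_def l'_def)
qed

text \<open>Convergence of the first derivatives as well is what prevents a zero limit: were both
  limit functions zero, their derivatives would vanish too, and all four normalized quantities would
  eventually lie below one quarter.\<close>

lemma ulim_nonzero:
  fixes a b :: "nat \<Rightarrow> real \<Rightarrow> complex"
  assumes A: "C2p p p1 p2" and B: "C2p q q1 q2"
    and u: "ulim a p" "ulim a1 p1" "ulim b q" "ulim b1 q1"
    and x: "\<And>n. \<exists>x. norm (a n x) + norm (a1 n x) + norm (b n x) + norm (b1 n x) \<ge> 1"
  shows "\<not> (\<forall>x. p x = 0 \<and> q x = 0)"
proof
  assume 0: "\<forall>x. p x = 0 \<and> q x = 0"
  then have "p = (\<lambda>x. 0)" "q = (\<lambda>x. 0)" by auto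
  then have 1: "p = (\<lambda>x. 0)" "q = (\<lambda>x. 0)" "p1 = (\<lambda>x. 0)" "q1 = (\<lambda>x. 0)"
    using C2p_unique(1)[OF A] C2p_unique(1)[OF B] C2p_zero by blast+
  have "\<forall>\<^sub>F n in sequentially. \<forall>x. norm (a n x) < 1/4" "\<forall>\<^sub>F n in sequentially. \<forall>x. norm (a1 n x) < 1/4"
    "\<forall>\<^sub>F n in sequentially. \<forall>x. norm (b n x) < 1/4" "\<forall>\<^sub>F n in sequentially. \<forall>x. norm (b1 n x) < 1/4"
    using ulim_D[OF u(1), of "1/4"] ulim_D[OF u(2), of "1/4"] ulim_D[OF u(3), of "1/4"] ulim_D[OF u(4), of "1/4"]
    by (simp_all add: 1)
  then have "\<forall>\<^sub>F n in sequentially. False"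
  proof eventually_elim
    case (elim n)
    obtain x where "norm (a n x) + norm (a1 n x) + norm (b n x) + norm (b1 n x) \<ge> 1" using x by blast
    moreover have "norm (a n x) < 1/4" "norm (a1 n x) < 1/4" "norm (b n x) < 1/4" "norm (b1 n x) < 1/4"
      using elim by auto
    ultimately show ?case by linarith
  qed
  then show False by simp
qed

section \<open>The Fredholm alternative\<close>

text \<open>The classical setting: \<open>V\<close> stands for the translate \<open>V(\<cdot> + \<sigma>\<^sub>0)\<close>, \<open>\<Lambda>\<close> for the pairing with
  \<open>\<phi>\<^sub>0\<close> and \<open>\<nu>\<close> for the slope of the effective potential.\<close>
locale wave =
  fixes d \<zeta> \<mu> f0 :: real and u0 u1 u2 u3 :: "real \<Rightarrow> complex" and V V1 :: "real \<Rightarrow> real"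
    and \<Lambda> :: "(real \<Rightarrow> complex) \<Rightarrow> real" and \<Lambda>B \<nu> :: real
  assumes d0: "d \<noteq> 0" and mu: "\<mu> > 0" and u0: "C2p u0 u1 u2" and u1: "C2p u1 u2 u3"
    and eq0: "- of_real d * u2 x + (of_real \<zeta> - \<i> * of_real \<mu>) * u0 x
        - of_real ((cmod (u0 x))\<^sup>2) * u0 x + \<i> * of_real f0 = 0"
    and kernel: "\<lbrakk>C2p a a1 a2; \<forall>x. lin d \<zeta> \<mu> (u0 x) (a x) (a2 x) = 0\<rbrakk> \<Longrightarrow> \<exists>c. \<forall>x. a x = of_real c * u1 x"
    and no_eigenvalue: "\<lbrakk>C2p a a1 a2; C2p b b1 b2; 0 \<le> \<alpha>; \<alpha> \<noteq> 0 \<or> \<beta> \<noteq> 0;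
        \<forall>x. evo d \<zeta> \<mu> 0 (u0 x) (a x) (a1 x) (a2 x) = of_real \<alpha> * a x - of_real \<beta> * b x;
        \<forall>x. evo d \<zeta> \<mu> 0 (u0 x) (b x) (b1 x) (b2 x) = of_real \<beta> * a x + of_real \<alpha> * b x\<rbrakk>
        \<Longrightarrow> \<forall>x. a x = 0 \<and> b x = 0"
    and resolvent: "\<lbrakk>0 < r; h \<in> C0p\<rbrakk> \<Longrightarrow> \<exists>w w1 w2. C2p w w1 w2 \<and>
        (\<forall>x. evo d \<zeta> \<mu> 0 (u0 x) (w x) (w1 x) (w2 x) - of_real r * w x = h x)"
    and \<Lambda>_add: "\<lbrakk>h \<in> C0p; k \<in> C0p\<rbrakk> \<Longrightarrow> \<Lambda> (\<lambda>x. h x + k x) = \<Lambda> h + \<Lambda> k"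
    and \<Lambda>_scale: "h \<in> C0p \<Longrightarrow> \<Lambda> (\<lambda>x. of_real c * h x) = c * \<Lambda> h"
    and \<Lambda>_bound: "\<lbrakk>h \<in> C0p; \<And>x. norm (h x) \<le> B\<rbrakk> \<Longrightarrow> \<bar>\<Lambda> h\<bar> \<le> \<Lambda>B * B"
    and \<Lambda>_lin: "C2p w w1 w2 \<Longrightarrow> \<Lambda> (\<lambda>x. lin d \<zeta> \<mu> (u0 x) (w x) (w2 x)) = 0"
    and \<Lambda>_u1: "\<Lambda> (\<lambda>x. \<i> * u1 x) = 1"
    and V: "V \<in> C0p" and V1: "V1 \<in> C0p" and V_deriv: "(V has_vector_derivative V1 x) (at x)"
    and \<Lambda>_V: "\<Lambda> (\<lambda>x. \<i> * of_real (V x) * u1 x) = 0"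
    and \<Lambda>_V1: "\<Lambda> (\<lambda>x. \<i> * of_real (V1 x) * u1 x) = \<nu>" and nu: "\<nu> \<noteq> 0"
begin

lemmas u_C0p = C2pD(1)[OF u0] C2pD(2)[OF u0] C2pD(3)[OF u0] C2pD(3)[OF u1]

lemma \<Lambda>_diff: "h \<in> C0p \<Longrightarrow> k \<in> C0p \<Longrightarrow> \<Lambda> (\<lambda>x. h x - k x) = \<Lambda> h - \<Lambda> k"
  using \<Lambda>_add[of h "\<lambda>x. of_real (-1) * k x"] \<Lambda>_scale[of k "-1"] C0p_intros(4)[of k] by simp

lemma \<Lambda>_ulim:
  assumes "ulim h k" "\<And>n. h n \<in> C0p"
  shows "(\<lambda>n. \<Lambda> (h n)) \<longlonglongrightarrow> \<Lambda> k"
proof (rule LIMSEQ_I)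
  fix e :: real assume e: "e > 0"
  have k: "k \<in> C0p" using C0p_ulim[OF assms] .
  have L: "\<Lambda>B \<ge> 0" using \<Lambda>_bound[OF C0p_intros(1)[of 0], of 1] by simp
  let ?d = "e / (\<Lambda>B + 1)"
  have d: "?d > 0" using e L by simp
  obtain N where N: "\<And>n x. n \<ge> N \<Longrightarrow> norm (h n x - k x) < ?d"
    using ulim_D[OF assms(1) d] by (auto simp: eventually_sequentially)
  have "norm (\<Lambda> (h n) - \<Lambda> k) < e" if "n \<ge> N" for n
  proof -
    have "\<bar>\<Lambda> (\<lambda>x. h n x - k x)\<bar> \<le> \<Lambda>B * ?d"
      by (intro \<Lambda>_bound C0p_ints assms k) (use N that in \<open>auto intro: less_imp_le\<close>)
    also have "\<dots> < (\<Lambda>B + 1) * ?d" using d by (intro mult_strict_right_mono) auto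
    finally show ?thesis using L by (simp add: \<Lambda>_diff assms(2) k)
  qed
  then show "\<exists>N. \<forall>n\<ge>N. norm (\<Lambda> (h n) - \<Lambda> k) < e" by blast
qed

lemma evo_lin: "evo d \<zeta> \<mu> 0 z w w1 w2 = - \<i> * lin d \<zeta> \<mu> z w w2" by (simp add: evo_def)

lemma evo_cmult:
  "evo d' \<zeta>' \<mu>' c z (of_real m * w) (of_real m * w1) (of_real m * w2) = of_real m * evo d' \<zeta>' \<mu>' c z w w1 w2"
  by (simp add: evo_def lin_def algebra_simps)

text \<open>The instance of \<open>evo_compactness\<close> with \<open>b = 0\<close> and
  \<open>\<beta> = 0\<close>, where the coupled system reduces to one equation with real spectral
  parameter.\<close>

lemma resolvent_compactness:
  assumes w: "\<And>n. C2p (w n) (w1 n) (w2 n)" and r: "\<And>n. 0 \<le> r n" "\<And>n. r n \<le> 1"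
    and eq: "\<And>n x. evo d \<zeta> \<mu> 0 (u0 x) (w n x) (w1 n x) (w2 n x) - of_real (r n) * w n x = h n x"
    and bd: "\<And>n x. norm (w n x) \<le> M" "\<And>n x. norm (w1 n x) \<le> M"
    and h: "ulim h h'" "\<And>n. h n \<in> C0p"
  obtains \<rho> p p1 p2 r' where "strict_mono \<rho>" "(\<lambda>n. r (\<rho> n)) \<longlonglongrightarrow> r'" "C2p p p1 p2"
    "ulim (\<lambda>n. w (\<rho> n)) p" "ulim (\<lambda>n. w1 (\<rho> n)) p1"
    "\<And>x. evo d \<zeta> \<mu> 0 (u0 x) (p x) (p1 x) (p2 x) = of_real r' * p x + h' x"
proof -
  let ?z = "\<lambda>(n::nat) (x::real). 0 :: complex"
  have 1: "evo d \<zeta> \<mu> 0 (u0 x) (w n x) (w1 n x) (w2 n x) = of_real (r n) * w n x - of_real 0 * ?z n x + h n x" for n x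
    using eq[where n = n and x = x] by (simp add: algebra_simps)
  have 2: "evo d \<zeta> \<mu> 0 (u0 x) (?z n x) (?z n x) (?z n x) = of_real 0 * w n x + of_real (r n) * ?z n x + ?z n x" for n x
    by (simp add: evo_def lin_def)
  have b: "norm (w n x) \<le> max M 1" "norm (w1 n x) \<le> max M 1" "norm (?z n x) \<le> max M 1" "\<bar>r n\<bar> \<le> max M 1" "\<bar>0::real\<bar> \<le> max M 1" for n x
    using bd[of n x] r(1)[of n] r(2)[of n] by (auto simp: le_max_iff_disj)
  obtain \<rho> p p1 p2 q q1 q2 \<alpha>' \<beta>' where rho: "strict_mono \<rho>" and al: "(\<lambda>n. r (\<rho> n)) \<longlonglongrightarrow> \<alpha>'"
    and p: "C2p p p1 p2" and lim: "ulim (\<lambda>n. w (\<rho> n)) p" "ulim (\<lambda>n. w1 (\<rho> n)) p1" "ulim (\<lambda>n. ?z (\<rho> n)) q"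
    and eqp: "\<And>x. evo d \<zeta> \<mu> 0 (u0 x) (p x) (p1 x) (p2 x) = of_real \<alpha>' * p x - of_real \<beta>' * q x + h' x"
    by (rule evo_compactness[OF d0 w C2p_zero 1 2 b(1,2,3,3,4,5) uniform_limit_const uniform_limit_const h(1) uniform_limit_const
        C0p_intros(1) u_C0p(1) h(2) C0p_intros(1)]) (rule that)
  have "q x = 0" for x using ulim_pointwise[OF lim(3), of x] by (simp add: LIMSEQ_const_iff)
  then show ?thesis using that[OF rho al p lim(1,2)] eqp by simp
qed

text \<open>Otherwise normalized solutions with data tending to zero would converge to a nonzero
  solution of the homogeneous equation. A positive limit parameter contradicts
  \<open>no_eigenvalue\<close>; for parameter 0 the limit is a multiple of \<open>u1\<close>, which
  the side condition kills since \<open>\<Lambda> (i u1) = 1\<close>. The constant is uniform up to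
  and including \<open>r = 0\<close>.\<close>

lemma fredholm_estimate:
  obtains K where "K > 0"
    "\<And>r w w1 w2 h B x. \<lbrakk>0 \<le> r; r \<le> 1; C2p w w1 w2; h \<in> C0p; \<Lambda> (\<lambda>x. \<i> * w x) = 0;
        \<And>x. evo d \<zeta> \<mu> 0 (u0 x) (w x) (w1 x) (w2 x) - of_real r * w x = h x; \<And>x. norm (h x) \<le> B\<rbrakk>
       \<Longrightarrow> norm (w x) + norm (w1 x) \<le> K * B"
proof -
  define P where "P K \<longleftrightarrow> (\<forall>r w w1 w2 h B x. 0 \<le> r \<and> r \<le> 1 \<and> C2p w w1 w2 \<and> h \<in> C0p \<and> \<Lambda> (\<lambda>x. \<i> * w x) = 0 \<and>
        (\<forall>x. evo d \<zeta> \<mu> 0 (u0 x) (w x) (w1 x) (w2 x) - of_real r * w x = h x) \<and> (\<forall>x. norm (h x) \<le> B)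
       \<longrightarrow> norm (w x) + norm (w1 x) \<le> K * B)" for K
  have "\<exists>n. P (real (Suc n))"
  proof (rule ccontr)
    assume "\<nexists>n. P (real (Suc n))"
    then have "\<forall>n. \<exists>r w w1 w2 h B x. 0 \<le> r \<and> r \<le> 1 \<and> C2p w w1 w2 \<and> h \<in> C0p \<and> \<Lambda> (\<lambda>x. \<i> * w x) = 0 \<and>
        (\<forall>x. evo d \<zeta> \<mu> 0 (u0 x) (w x) (w1 x) (w2 x) - of_real r * w x = h x) \<and> (\<forall>x. norm (h x) \<le> B)
       \<and> norm (w x) + norm (w1 x) > real (Suc n) * B"
      unfolding P_def by (auto simp: not_le)
    then obtain r w w1 w2 h B x where *: "\<And>n. 0 \<le> r n" "\<And>n. r n \<le> 1" "\<And>n. C2p (w n) (w1 n) (w2 n)" "\<And>n. h n \<in> C0p"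
      "\<And>n. \<Lambda> (\<lambda>x. \<i> * w n x) = 0" "\<And>n x. evo d \<zeta> \<mu> 0 (u0 x) (w n x) (w1 n x) (w2 n x) - of_real (r n) * w n x = h n x"
      "\<And>n x. norm (h n x) \<le> B n" "\<And>n. norm (w n (x n)) + norm (w1 n (x n)) > real (Suc n) * B n"
      by metis
    have B0: "B n \<ge> 0" for n using *(7)[of n 0] norm_ge_zero order_trans by blast
    have "\<exists>y. \<forall>n z. norm (w n z) + norm (w1 n z) \<le> norm (w n (y n)) + norm (w1 n (y n))"
    proof (intro choice allI)
      fix n
      have "(\<lambda>z. norm (w n z) + norm (w1 n z)) \<in> C0p" using C2pD[OF *(3)] by (intro C0p_ints) auto
      from C0p_attains[OF this] show "\<exists>y. \<forall>z. norm (w n z) + norm (w1 n z) \<le> norm (w n y) + norm (w1 n y)" by metis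
    qed
    then obtain y where y: "\<And>n z. norm (w n z) + norm (w1 n z) \<le> norm (w n (y n)) + norm (w1 n (y n))" by blast
    \<comment> \<open>Dividing by the maximum over the period makes the rescaled sum at most 1
      everywhere and equal to 1 at \<open>y n\<close>. Strictness in the negated estimate makes
      \<open>m n\<close> positive.\<close>
    define m where "m n = norm (w n (y n)) + norm (w1 n (y n))" for n
    have m: "real (Suc n) * B n < m n" "m n > 0" for n
    proof -
      show "real (Suc n) * B n < m n" using *(8)[of n] y[of n "x n"] by (simp add: m_def)
      then show "m n > 0" using B0[of n] by (meson le_less_trans mult_nonneg_nonneg of_nat_0_le_iff)
    qed
    define a where "a n z = of_real (1 / m n) * w n z" for n z
    define a1 where "a1 n z = of_real (1 / m n) * w1 n z" for n z
    define a2 where "a2 n z = of_real (1 / m n) * w2 n z" for n z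
    define k where "k n z = of_real (1 / m n) * h n z" for n z
    have A: "C2p (a n) (a1 n) (a2 n)" for n
      unfolding a_def a1_def a2_def using C2p_mult[OF *(3)] .
    have k0: "k n \<in> C0p" for n unfolding k_def by (intro C0p_ints *(4))
    have eqa: "evo d \<zeta> \<mu> 0 (u0 z) (a n z) (a1 n z) (a2 n z) - of_real (r n) * a n z = k n z" for n z
    proof -
      have "evo d \<zeta> \<mu> 0 (u0 z) (w n z) (w1 n z) (w2 n z) = of_real (r n) * w n z + h n z"
        using *(6)[where n = n and x = z] by (simp add: algebra_simps)
      then show ?thesis unfolding a_def a1_def a2_def k_def evo_cmult by (simp add: algebra_simps)
    qed
    have kb: "norm (k n z) \<le> 1 / real (Suc n)" for n z
    proof -
      have "norm (k n z) = norm (h n z) / m n" using m(2)[of n] by (simp add: k_def norm_mult norm_divide)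
      also have "\<dots> \<le> B n / m n" using *(7) m(2)[of n] by (intro divide_right_mono) (auto intro: less_imp_le)
      also have "\<dots> \<le> 1 / real (Suc n)" using m[of n] by (simp add: field_simps)
      finally show ?thesis .
    qed
    have kl: "ulim k (\<lambda>x. 0)"
    proof (rule uniform_limitI)
      fix e :: real assume "e > 0"
      with LIMSEQ_Suc[OF lim_inverse_n'] have "\<forall>\<^sub>F n in sequentially. 1 / real (Suc n) < e"
        by (rule order_tendstoD(2))
      then show "\<forall>\<^sub>F n in sequentially. \<forall>x\<in>UNIV. dist (k n x) 0 < e"
      proof eventually_elim
        case (elim n)
        then show ?case using le_less_trans[OF kb elim] by (simp add: dist_norm)
      qed
    qed
    have s: "norm (a n z) + norm (a1 n z) = (norm (w n z) + norm (w1 n z)) / m n" for n z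
      using m(2)[of n] by (simp add: a_def a1_def norm_mult norm_divide add_divide_distrib)
    have s1: "norm (a n z) + norm (a1 n z) \<le> 1" for n z
      unfolding s using y[of n z] m(2)[of n] by (simp add: m_def)
    have ab: "norm (a n z) \<le> 1" "norm (a1 n z) \<le> 1" for n z
      using s1[of n z] norm_ge_zero[of "a n z"] norm_ge_zero[of "a1 n z"] by linarith+
    obtain \<rho> p p1 p2 \<alpha>' where rho: "strict_mono \<rho>" and al: "(\<lambda>n. r (\<rho> n)) \<longlonglongrightarrow> \<alpha>'"
      and p: "C2p p p1 p2" and lim: "ulim (\<lambda>n. a (\<rho> n)) p" "ulim (\<lambda>n. a1 (\<rho> n)) p1"
      and eqp: "\<And>x. evo d \<zeta> \<mu> 0 (u0 x) (p x) (p1 x) (p2 x) = of_real \<alpha>' * p x + 0"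
      by (rule resolvent_compactness[OF A *(1,2) eqa ab kl k0]) (rule that)
    have "\<not> (\<forall>x. p x = 0 \<and> (0::complex) = 0)"
    proof (rule ulim_nonzero[OF p C2p_zero lim uniform_limit_const uniform_limit_const])
      fix n
      show "\<exists>x. 1 \<le> norm (a (\<rho> n) x) + norm (a1 (\<rho> n) x) + norm (0::complex) + norm (0::complex)"
        using m(2)[of "\<rho> n"] by (intro exI[of _ "y (\<rho> n)"]) (simp add: s m_def)
    qed
    then have nz: "\<not> (\<forall>x. p x = 0)" by simp
    have al0: "\<alpha>' \<ge> 0" using al *(1) by (intro LIMSEQ_le_const[OF al]) auto
    have "(\<lambda>n. \<Lambda> (\<lambda>x. \<i> * a (\<rho> n) x)) \<longlonglongrightarrow> \<Lambda> (\<lambda>x. \<i> * p x)"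
      by (rule \<Lambda>_ulim) (auto intro!: bounded_linear.uniform_limit[OF bounded_linear_mult_right] lim(1) C0p_ints C2pD(1)[OF A])
    moreover have "\<Lambda> (\<lambda>x. \<i> * a n x) = 0" for n
    proof -
      have "(\<lambda>x. \<i> * a n x) = (\<lambda>x. of_real (1 / m n) * (\<i> * w n x))" by (auto simp: a_def)
      moreover have "(\<lambda>x. \<i> * w n x) \<in> C0p" by (intro C0p_ints C2pD(1)[OF *(3)])
      ultimately show ?thesis by (simp only: \<Lambda>_scale *(5) mult_zero_right)
    qed
    ultimately have Lp: "\<Lambda> (\<lambda>x. \<i> * p x) = 0" by (simp add: LIMSEQ_const_iff)
    show False
    proof (cases "\<alpha>' = 0")
      case False
      have "\<forall>x. p x = 0 \<and> (0::complex) = 0"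
        by (rule no_eigenvalue[OF p C2p_zero al0, of 0]) (use False eqp in \<open>auto simp: evo_def lin_def\<close>)
      then show False using nz by blast
    next
      case True
      have "\<forall>x. lin d \<zeta> \<mu> (u0 x) (p x) (p2 x) = 0" using eqp True by (auto simp: evo_lin)
      from kernel[OF p this] obtain c where c: "\<And>x. p x = of_real c * u1 x" by blast
      have "(\<lambda>x. \<i> * p x) = (\<lambda>x. of_real c * (\<i> * u1 x))" by (auto simp: c)
      moreover have "(\<lambda>x. \<i> * u1 x) \<in> C0p" by (intro C0p_ints u_C0p)
      ultimately have "c = 0" using Lp by (simp add: \<Lambda>_scale \<Lambda>_u1)
      then show False using nz c by simp
    qed
  qed
  then obtain n where "P (real (Suc n))" ..
  then show ?thesis using that[of "real (Suc n)"] unfolding P_def by simp blast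
qed

text \<open>Applying \<open>\<Lambda>\<close> to the regularized equation removes both
  \<open>L w\<close> and \<open>h\<close> and leaves \<open>r \<Lambda> (i w) = 0\<close>. The
  regularized solutions thus satisfy the side condition by themselves, and
  \<open>fredholm_estimate\<close> keeps them bounded as \<open>r\<close> tends to 0.\<close>

lemma fredholm_solve:
  assumes h: "h \<in> C0p" and Lh: "\<Lambda> h = 0"
  obtains w w1 w2 where "C2p w w1 w2" "\<And>x. lin d \<zeta> \<mu> (u0 x) (w x) (w2 x) = h x" "\<Lambda> (\<lambda>x. \<i> * w x) = 0"
proof -
  obtain K where K: "K > 0"
    "\<And>r w w1 w2 h B x. \<lbrakk>0 \<le> r; r \<le> 1; C2p w w1 w2; h \<in> C0p; \<Lambda> (\<lambda>x. \<i> * w x) = 0;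
        \<And>x. evo d \<zeta> \<mu> 0 (u0 x) (w x) (w1 x) (w2 x) - of_real r * w x = h x; \<And>x. norm (h x) \<le> B\<rbrakk>
       \<Longrightarrow> norm (w x) + norm (w1 x) \<le> K * B"
    using fredholm_estimate by metis
  define g where "g x = - \<i> * h x" for x
  have g: "g \<in> C0p" unfolding g_def by (intro C0p_ints h)
  define r where "r n = 1 / real (Suc n)" for n
  have r: "0 < r n" "r n \<le> 1" for n by (auto simp: r_def)
  obtain w w1 w2 where w: "\<And>n. C2p (w n) (w1 n) (w2 n)"
    and eq: "\<And>n x. evo d \<zeta> \<mu> 0 (u0 x) (w n x) (w1 n x) (w2 n x) - of_real (r n) * w n x = g x"
    using resolvent[OF r(1) g] by metis
  have Lw: "\<Lambda> (\<lambda>x. \<i> * w n x) = 0" for n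
  proof -
    have c: "(\<lambda>x. \<i> * w n x) \<in> C0p" by (intro C0p_ints C2pD(1)[OF w])
    have "of_real (r n) * (\<i> * w n x) = lin d \<zeta> \<mu> (u0 x) (w n x) (w2 n x) - h x" for x
    proof -
      have "\<i> * (evo d \<zeta> \<mu> 0 (u0 x) (w n x) (w1 n x) (w2 n x) - of_real (r n) * w n x) = \<i> * g x" using eq by simp
      then show ?thesis by (simp add: evo_lin g_def algebra_simps)
    qed
    then have "r n * \<Lambda> (\<lambda>x. \<i> * w n x) = \<Lambda> (\<lambda>x. lin d \<zeta> \<mu> (u0 x) (w n x) (w2 n x) - h x)"
      using \<Lambda>_scale[OF c, of "r n"] by simp
    also have "\<dots> = 0"
      using \<Lambda>_diff[OF C0p_lin[OF u_C0p(1) C2pD(1,3)[OF w]] h] \<Lambda>_lin[OF w] Lh by simp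
    finally show ?thesis using r(1)[of n] by simp
  qed
  obtain B where B: "B > 0" "\<And>x. norm (g x) \<le> B" using C0p_bounded[OF g] by blast
  have "norm (w n x) + norm (w1 n x) \<le> K * B" for n x
    by (rule K(2)[OF less_imp_le[OF r(1)] r(2) w g Lw eq B(2)])
  then have wb: "norm (w n x) \<le> K * B" "norm (w1 n x) \<le> K * B" for n x
    using norm_ge_zero[of "w n x"] norm_ge_zero[of "w1 n x"] by (meson add_increasing add_increasing2 order_trans order_refl)+
  obtain \<rho> p p1 p2 \<alpha>' where rho: "strict_mono \<rho>" and al: "(\<lambda>n. r (\<rho> n)) \<longlonglongrightarrow> \<alpha>'"
    and p: "C2p p p1 p2" and lim: "ulim (\<lambda>n. w (\<rho> n)) p"
    and eqp: "\<And>x. evo d \<zeta> \<mu> 0 (u0 x) (p x) (p1 x) (p2 x) = of_real \<alpha>' * p x + g x"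
    by (rule resolvent_compactness[OF w less_imp_le[OF r(1)] r(2) eq wb uniform_limit_const g]) (rule that)
  have "r \<longlonglongrightarrow> 0" unfolding r_def using LIMSEQ_Suc[OF lim_inverse_n'] .
  then have "\<alpha>' = 0" using LIMSEQ_subseq_LIMSEQ[OF _ rho] al LIMSEQ_unique by (force simp: o_def)
  have "lin d \<zeta> \<mu> (u0 x) (p x) (p2 x) = h x" for x
    using eqp[of x] \<open>\<alpha>' = 0\<close> by (simp add: evo_lin g_def)
  moreover have "(\<lambda>n. \<Lambda> (\<lambda>x. \<i> * w (\<rho> n) x)) \<longlonglongrightarrow> \<Lambda> (\<lambda>x. \<i> * p x)"
    by (rule \<Lambda>_ulim) (auto intro!: bounded_linear.uniform_limit[OF bounded_linear_mult_right] lim C0p_ints C2pD(1)[OF w])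
  then have "\<Lambda> (\<lambda>x. \<i> * p x) = 0" by (simp add: Lw LIMSEQ_const_iff)
  ultimately show ?thesis using that[OF p] by blast
qed

text \<open>Applying \<open>\<Lambda>\<close> gives \<open>s \<Lambda> e = \<Lambda> h\<close>,
  which bounds \<open>s\<close>; what remains is the Fredholm estimate at \<open>r = 0\<close> for
  \<open>h - s e\<close>. The second derivative is then bounded through the equation.\<close>

lemma bordered_estimate:
  assumes e: "e \<in> C0p" and Le: "\<Lambda> e \<noteq> 0"
  obtains K where "K > 0"
    "\<And>w w1 w2 s h B x. \<lbrakk>C2p w w1 w2; h \<in> C0p; \<Lambda> (\<lambda>x. \<i> * w x) = 0;
        \<And>x. lin d \<zeta> \<mu> (u0 x) (w x) (w2 x) + of_real s * e x = h x; \<And>x. norm (h x) \<le> B\<rbrakk>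
       \<Longrightarrow> norm (w x) \<le> K * B \<and> norm (w1 x) \<le> K * B \<and> norm (w2 x) \<le> K * B \<and> \<bar>s\<bar> \<le> K * B"
proof -
  obtain K where K: "K > 0"
    "\<And>r w w1 w2 h B x. \<lbrakk>0 \<le> r; r \<le> 1; C2p w w1 w2; h \<in> C0p; \<Lambda> (\<lambda>x. \<i> * w x) = 0;
        \<And>x. evo d \<zeta> \<mu> 0 (u0 x) (w x) (w1 x) (w2 x) - of_real r * w x = h x; \<And>x. norm (h x) \<le> B\<rbrakk>
       \<Longrightarrow> norm (w x) + norm (w1 x) \<le> K * B"
    using fredholm_estimate by metis
  obtain E where E: "E > 0" "\<And>x. norm (e x) \<le> E" using C0p_bounded[OF e] by blast
  obtain U where U: "U > 0" "\<And>x. norm (u0 x) \<le> U" using C0p_bounded[OF u_C0p(1)] by blast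
  have L: "\<Lambda>B \<ge> 0" using \<Lambda>_bound[OF C0p_intros(1)[of 0], of 1] by simp
  define S where "S = \<Lambda>B / \<bar>\<Lambda> e\<bar>"
  have S: "S \<ge> 0" using L by (simp add: S_def)
  define K1 where "K1 = K * (1 + S * E)"
  have K1: "K1 > 0" unfolding K1_def using K(1) S E(1) by (intro mult_pos_pos add_pos_nonneg) auto
  \<comment> \<open>From solving for \<open>w2\<close>: the factor 3 adds the 2 of the term with
    \<open>w\<close> and the 1 of the term with \<open>cnj w\<close>, and \<open>1 + S * E\<close>
    bounds the corrected data.\<close>
  define K2 where "K2 = ((\<bar>\<zeta>\<bar> + \<bar>\<mu>\<bar> + 3 * (U * U)) * K1 + (1 + S * E)) / \<bar>d\<bar>"
  show ?thesis
  proof (rule that[of "max K1 (max K2 S)"])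
    show "max K1 (max K2 S) > 0" using K1 by simp
    fix w w1 w2 h x and s B :: real
    assume w: "C2p w w1 w2" and h: "h \<in> C0p" and Lw: "\<Lambda> (\<lambda>x. \<i> * w x) = 0"
      and eq: "\<And>x. lin d \<zeta> \<mu> (u0 x) (w x) (w2 x) + of_real s * e x = h x" and B: "\<And>x. norm (h x) \<le> B"
    have B0: "B \<ge> 0" using B[of 0] norm_ge_zero order_trans by blast
    have se: "(\<lambda>x. of_real s * e x) \<in> C0p" by (intro C0p_ints e)
    have "\<Lambda> h = \<Lambda> (\<lambda>x. lin d \<zeta> \<mu> (u0 x) (w x) (w2 x) + of_real s * e x)" using eq by simp
    also have "\<dots> = s * \<Lambda> e"
      using \<Lambda>_add[OF C0p_lin[OF u_C0p(1) C2pD(1,3)[OF w]] se] \<Lambda>_lin[OF w] \<Lambda>_scale[OF e] by simp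
    finally have "\<bar>s\<bar> * \<bar>\<Lambda> e\<bar> \<le> \<Lambda>B * B" using \<Lambda>_bound[OF h B] by (simp add: abs_mult)
    then have s: "\<bar>s\<bar> \<le> S * B" using Le by (simp add: S_def field_simps)
    define g where "g x = h x - of_real s * e x" for x
    have g: "g \<in> C0p" unfolding g_def by (intro C0p_ints h e)
    have gb: "norm (g x) \<le> (1 + S * E) * B" for x
    proof -
      have "norm (g x) \<le> norm (h x) + norm (of_real s * e x)" unfolding g_def by norm
      also have "norm (of_real s * e x) \<le> (S * B) * E" unfolding norm_mult norm_of_real
        using s E S B0 by (intro mult_mono) auto
      finally show ?thesis using B[of x] by (simp add: algebra_simps)
    qed
    have lg: "lin d \<zeta> \<mu> (u0 x) (w x) (w2 x) = g x" for x using eq[of x] by (simp add: g_def algebra_simps)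
    have "norm (w x) + norm (w1 x) \<le> K * ((1 + S * E) * B)" for x
      by (rule K(2)[of 0 w w1 w2 "\<lambda>x. - \<i> * g x"]) (use w Lw gb lg in \<open>auto simp: evo_lin norm_mult intro!: C0p_ints g\<close>)
    then have wK: "norm (w x) + norm (w1 x) \<le> K1 * B" for x by (simp add: K1_def mult.assoc)
    then have w01: "norm (w x) \<le> K1 * B" "norm (w1 x) \<le> K1 * B" for x
      using norm_ge_zero[of "w x"] norm_ge_zero[of "w1 x"] wK[of x] by linarith+
    have "norm (w2 x) \<le> K2 * B"
    proof -
      have "of_real d * w2 x = (of_real \<zeta> - \<i> * of_real \<mu> - 2 * of_real ((cmod (u0 x))\<^sup>2)) * w x - (u0 x)\<^sup>2 * cnj (w x) - g x"
        using lg[of x] by (simp add: lin_def algebra_simps)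
      then have "\<bar>d\<bar> * norm (w2 x) = norm ((of_real \<zeta> - \<i> * of_real \<mu> - 2 * of_real ((cmod (u0 x))\<^sup>2)) * w x - (u0 x)\<^sup>2 * cnj (w x) - g x)"
        by (metis norm_mult norm_of_real)
      also have "\<dots> \<le> norm ((of_real \<zeta> - \<i> * of_real \<mu> - 2 * of_real ((cmod (u0 x))\<^sup>2)) * w x) + norm ((u0 x)\<^sup>2 * cnj (w x)) + norm (g x)"
        by norm
      also have "norm ((of_real \<zeta> - \<i> * of_real \<mu> - 2 * of_real ((cmod (u0 x))\<^sup>2)) * w x)
          \<le> (\<bar>\<zeta>\<bar> + \<bar>\<mu>\<bar> + 2 * (U * U)) * (K1 * B)"
      proof -
        have "norm (of_real \<zeta> - \<i> * of_real \<mu> - 2 * of_real ((cmod (u0 x))\<^sup>2) :: complex)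
          \<le> norm (of_real \<zeta> :: complex) + norm (\<i> * of_real \<mu>) + norm (2 * of_real ((cmod (u0 x))\<^sup>2) :: complex)" by norm
        also have "\<dots> = \<bar>\<zeta>\<bar> + \<bar>\<mu>\<bar> + 2 * (cmod (u0 x))\<^sup>2" by (simp add: norm_mult norm_power)
        finally have "norm (of_real \<zeta> - \<i> * of_real \<mu> - 2 * of_real ((cmod (u0 x))\<^sup>2) :: complex) \<le> \<bar>\<zeta>\<bar> + \<bar>\<mu>\<bar> + 2 * (U * U)"
          using mult_mono[OF U(2)[of x] U(2)[of x]] U(1) by (simp add: power2_eq_square)
        then show ?thesis unfolding norm_mult using w01(1)[of x] U(1) by (intro mult_mono) auto
      qed
      also have "norm ((u0 x)\<^sup>2 * cnj (w x)) \<le> (U * U) * (K1 * B)"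
        unfolding norm_mult complex_mod_cnj norm_power power2_eq_square
        by (rule mult_mono) (use w01(1)[of x] mult_mono[OF U(2)[of x] U(2)[of x]] U(1) in auto)
      finally have "\<bar>d\<bar> * norm (w2 x) \<le> ((\<bar>\<zeta>\<bar> + \<bar>\<mu>\<bar> + 3 * (U * U)) * K1 + (1 + S * E)) * B"
        using gb[of x] by (simp add: algebra_simps)
      then show ?thesis using d0 by (simp add: K2_def field_simps)
    qed
    moreover have "K1 * B \<le> max K1 (max K2 S) * B" "K2 * B \<le> max K1 (max K2 S) * B" "S * B \<le> max K1 (max K2 S) * B"
      using B0 by (auto intro: mult_right_mono)
    ultimately show "norm (w x) \<le> max K1 (max K2 S) * B \<and> norm (w1 x) \<le> max K1 (max K2 S) * B
       \<and> norm (w2 x) \<le> max K1 (max K2 S) * B \<and> \<bar>s\<bar> \<le> max K1 (max K2 S) * B"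
      using w01[of x] s by (meson order_trans)
  qed
qed

lemma bordered_solve:
  assumes e: "e \<in> C0p" and Le: "\<Lambda> e \<noteq> 0" and h: "h \<in> C0p"
  obtains w w1 w2 s where "C2p w w1 w2" "\<Lambda> (\<lambda>x. \<i> * w x) = 0"
    "\<And>x. lin d \<zeta> \<mu> (u0 x) (w x) (w2 x) + of_real s * e x = h x"
proof -
  define s where "s = \<Lambda> h / \<Lambda> e"
  have se: "(\<lambda>x. of_real s * e x) \<in> C0p" by (intro C0p_ints e)
  have "\<Lambda> (\<lambda>x. h x - of_real s * e x) = 0"
    unfolding \<Lambda>_diff[OF h se] \<Lambda>_scale[OF e] using Le by (simp add: s_def)
  from fredholm_solve[OF C0p_intros(3)[OF h se] this] obtain w w1 w2 where "C2p w w1 w2"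
    "\<And>x. lin d \<zeta> \<mu> (u0 x) (w x) (w2 x) = h x - of_real s * e x" "\<Lambda> (\<lambda>x. \<i> * w x) = 0" by metis
  then show ?thesis using that[of w w1 w2 s] by simp
qed

end

section \<open>A contraction argument\<close>

text \<open>The complete metric space of the fixed-point argument, inside the Banach space of
  bounded continuous functions; periodicity survives uniform limits.\<close>

definition C0p_ball :: "real \<Rightarrow> (real \<Rightarrow>\<^sub>C complex) set" where
  "C0p_ball \<rho> = {f. apply_bcontfun f \<in> C0p \<and> (\<forall>x. norm (apply_bcontfun f x) \<le> \<rho>)}"

lemma closed_C0p_ball: "closed (C0p_ball \<rho>)"
proof (unfold closed_sequential_limits, intro allI impI)
  fix f l assume *: "(\<forall>n. f n \<in> C0p_ball \<rho>) \<and> f \<longlonglongrightarrow> l"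
  then have u: "ulim (\<lambda>n. apply_bcontfun (f n)) (apply_bcontfun l)" using tendsto_bcontfun_uniform_limit by blast
  have "apply_bcontfun l \<in> C0p" using C0p_ulim[OF u] * by (auto simp: C0p_ball_def)
  moreover have "norm (apply_bcontfun l x) \<le> \<rho>" for x
    using tendsto_norm[OF ulim_pointwise[OF u, of x]] * by (intro LIMSEQ_le_const2) (auto simp: C0p_ball_def)
  ultimately show "l \<in> C0p_ball \<rho>" by (simp add: C0p_ball_def)
qed

lemma apply_Bcontfun_C0p: "f \<in> C0p \<Longrightarrow> apply_bcontfun (Bcontfun f) = f"
  by (rule Bcontfun_inverse) (auto simp: bcontfun_def C0p_bounded_image dest: C0pD(1))

context wave begin

text \<open>With Lipschitz constant \<open>1 / (18 K)\<close> each of the three components contracts by \<open>1/6\<close>, hence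
  the product metric by \<open>1/2\<close>.\<close>
definition admissible :: "(real \<Rightarrow> complex \<Rightarrow> complex \<Rightarrow> real \<Rightarrow> complex) \<Rightarrow> real \<Rightarrow> real \<Rightarrow> bool" where
  "admissible n K \<rho> \<longleftrightarrow> (\<forall>w\<in>C0p. \<forall>w1\<in>C0p. \<forall>s. (\<lambda>x. n x (w x) (w1 x) s) \<in> C0p) \<and>
     (\<forall>x p q s p' q' s'. norm p \<le> \<rho> \<and> norm q \<le> \<rho> \<and> \<bar>s\<bar> \<le> \<rho> \<and> norm p' \<le> \<rho> \<and> norm q' \<le> \<rho> \<and> \<bar>s'\<bar> \<le> \<rho>
       \<longrightarrow> norm (n x p q s - n x p' q' s') \<le> (norm (p - p') + norm (q - q') + \<bar>s - s'\<bar>) / (18 * K))"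

text \<open>The perturbation \<open>n\<close> contains no second derivative, so it suffices to
  iterate on \<open>(w, w1, s)\<close> in supremum norms.\<close>

definition bordered_solution :: "(real \<Rightarrow> complex) \<Rightarrow> (real \<Rightarrow> complex \<Rightarrow> complex \<Rightarrow> real \<Rightarrow> complex) \<Rightarrow> real
    \<Rightarrow> (real \<Rightarrow> complex) \<Rightarrow> (real \<Rightarrow> complex) \<Rightarrow> (real \<Rightarrow> complex) \<Rightarrow> real \<Rightarrow> bool" where
  "bordered_solution e n \<rho> w w1 w2 s \<longleftrightarrow> C2p w w1 w2 \<and> \<Lambda> (\<lambda>x. \<i> * w x) = 0 \<and> \<bar>s\<bar> \<le> \<rho> \<and>
     (\<forall>x. norm (w x) \<le> \<rho> \<and> norm (w1 x) \<le> \<rho> \<and>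
        lin d \<zeta> \<mu> (u0 x) (w x) (w2 x) + of_real s * e x + n x (w x) (w1 x) s = 0)"

lemma admissibleD:
  assumes "admissible n K \<rho>"
  shows "\<And>w w1 s. \<lbrakk>w \<in> C0p; w1 \<in> C0p\<rbrakk> \<Longrightarrow> (\<lambda>x. n x (w x) (w1 x) s) \<in> C0p"
    "\<And>x p q s p' q' s'. \<lbrakk>norm p \<le> \<rho>; norm q \<le> \<rho>; \<bar>s\<bar> \<le> \<rho>; norm p' \<le> \<rho>; norm q' \<le> \<rho>; \<bar>s'\<bar> \<le> \<rho>\<rbrakk>
       \<Longrightarrow> norm (n x p q s - n x p' q' s') \<le> (norm (p - p') + norm (q - q') + \<bar>s - s'\<bar>) / (18 * K)"
  using assms unfolding admissible_def by blast+

lemma bordered_solutionD: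
  assumes "bordered_solution e n \<rho> w w1 w2 s"
  shows "C2p w w1 w2" "\<Lambda> (\<lambda>x. \<i> * w x) = 0" "\<bar>s\<bar> \<le> \<rho>"
    "norm (w x) \<le> \<rho> \<and> norm (w1 x) \<le> \<rho> \<and> lin d \<zeta> \<mu> (u0 x) (w x) (w2 x) + of_real s * e x + n x (w x) (w1 x) s = 0"
  using assms unfolding bordered_solution_def by blast+

text \<open>The ball is mapped into itself since
  \<open>\<rho> / (2 * K) + 3 * \<rho> / (18 * K) \<le> \<rho> / K\<close>, and \<open>K\<close>
  times the right-hand side is \<rho>. The last conclusion compares solutions for two perturbations;
  it gives uniqueness as well as Lipschitz dependence on a parameter.\<close>

lemma bordered_contraction:
  assumes e: "e \<in> C0p" and Le: "\<Lambda> e \<noteq> 0"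
  obtains K where "K > 0"
    "\<And>n \<rho>. \<lbrakk>\<rho> > 0; admissible n K \<rho>; \<And>x. norm (n x 0 0 0) \<le> \<rho> / (2 * K)\<rbrakk>
      \<Longrightarrow> \<exists>w w1 w2 s. bordered_solution e n \<rho> w w1 w2 s"
    "\<And>n n' \<rho> B w w1 w2 s w' w1' w2' s' x.
      \<lbrakk>admissible n K \<rho>; admissible n' K \<rho>;
       \<And>x p q s. \<lbrakk>norm p \<le> \<rho>; norm q \<le> \<rho>; \<bar>s\<bar> \<le> \<rho>\<rbrakk> \<Longrightarrow> norm (n x p q s - n' x p q s) \<le> B;
       bordered_solution e n \<rho> w w1 w2 s; bordered_solution e n' \<rho> w' w1' w2' s'\<rbrakk>
      \<Longrightarrow> norm (w x - w' x) \<le> 4 * K * B \<and> norm (w1 x - w1' x) \<le> 4 * K * B \<and> norm (w2 x - w2' x) \<le> 4 * K * B \<and> \<bar>s - s'\<bar> \<le> 4 * K * B"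
proof -
  obtain K where K: "K > 0"
    and est: "\<And>w w1 w2 s h B x. \<lbrakk>C2p w w1 w2; h \<in> C0p; \<Lambda> (\<lambda>x. \<i> * w x) = 0;
        \<And>x. lin d \<zeta> \<mu> (u0 x) (w x) (w2 x) + of_real s * e x = h x; \<And>x. norm (h x) \<le> B\<rbrakk>
       \<Longrightarrow> norm (w x) \<le> K * B \<and> norm (w1 x) \<le> K * B \<and> norm (w2 x) \<le> K * B \<and> \<bar>s\<bar> \<le> K * B"
    using bordered_estimate[OF e Le] by metis
  have lin_diff: "lin d \<zeta> \<mu> z (w - w') (w2 - w2') = lin d \<zeta> \<mu> z w w2 - lin d \<zeta> \<mu> z w' w2'" for z w w' w2 w2'
    by (simp add: lin_def algebra_simps)
  have \<Lambda>d: "\<Lambda> (\<lambda>x. \<i> * (w x - w' x)) = 0" if "\<Lambda> (\<lambda>x. \<i> * w x) = 0" "\<Lambda> (\<lambda>x. \<i> * w' x) = 0" "w \<in> C0p" "w' \<in> C0p" for w w'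
    using that \<Lambda>_diff[of "\<lambda>x. \<i> * w x" "\<lambda>x. \<i> * w' x"] by (simp add: right_diff_distrib C0p_ints)
  show ?thesis
  proof (rule that[OF K])
    fix n :: "real \<Rightarrow> complex \<Rightarrow> complex \<Rightarrow> real \<Rightarrow> complex" and \<rho> :: real
    assume rho: "\<rho> > 0" and adm: "admissible n K \<rho>" and zero: "\<And>x. norm (n x 0 0 0) \<le> \<rho> / (2 * K)"
    note cont = admissibleD(1)[OF adm] and lip = admissibleD(2)[OF adm]
    define S where "S = C0p_ball \<rho> \<times> C0p_ball \<rho> \<times> {-\<rho>..\<rho>}"
    have "\<exists>F. \<forall>f g s. (f, g, s) \<in> S \<longrightarrow> (case F f g s of (w, w1, w2, t) \<Rightarrow>
        C2p w w1 w2 \<and> \<Lambda> (\<lambda>x. \<i> * w x) = 0 \<and>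
        (\<forall>x. lin d \<zeta> \<mu> (u0 x) (w x) (w2 x) + of_real t * e x = - n x (apply_bcontfun f x) (apply_bcontfun g x) s))"
    proof (intro choice allI impI)
      fix f g s
      show "\<exists>y. (f, g, s) \<in> S \<longrightarrow> (case y of (w, w1, w2, t) \<Rightarrow>
        C2p w w1 w2 \<and> \<Lambda> (\<lambda>x. \<i> * w x) = 0 \<and>
        (\<forall>x. lin d \<zeta> \<mu> (u0 x) (w x) (w2 x) + of_real t * e x = - n x (apply_bcontfun f x) (apply_bcontfun g x) s))"
      proof (cases "(f, g, s) \<in> S")
        case True
        then have "(\<lambda>x. - n x (apply_bcontfun f x) (apply_bcontfun g x) s) \<in> C0p"
          by (intro C0p_ints cont) (auto simp: S_def C0p_ball_def)
        from bordered_solve[OF e Le this] obtain w w1 w2 t where "C2p w w1 w2" "\<Lambda> (\<lambda>x. \<i> * w x) = 0"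
          "\<And>x. lin d \<zeta> \<mu> (u0 x) (w x) (w2 x) + of_real t * e x = - n x (apply_bcontfun f x) (apply_bcontfun g x) s"
          by blast
        then show ?thesis by (intro exI[of _ "(w, w1, w2, t)"]) simp
      qed auto
    qed
    then obtain F where F: "\<And>f g s. (f, g, s) \<in> S \<Longrightarrow> (case F f g s of (w, w1, w2, t) \<Rightarrow>
        C2p w w1 w2 \<and> \<Lambda> (\<lambda>x. \<i> * w x) = 0 \<and>
        (\<forall>x. lin d \<zeta> \<mu> (u0 x) (w x) (w2 x) + of_real t * e x = - n x (apply_bcontfun f x) (apply_bcontfun g x) s))"
      by blast
    \<comment> \<open>\<open>g\<close> takes the place of the derivative but is independent of
      \<open>f\<close> on the domain; only at the fixed point is it the derivative of
      \<open>f\<close>.\<close>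
    define \<Phi> where "\<Phi> y = (case y of (f, g, s) \<Rightarrow> case F f g s of (w, w1, w2, t) \<Rightarrow> (Bcontfun w, Bcontfun w1, t))" for y
    have D: "dist (\<Phi> y) (\<Phi> y') \<le> 1/2 * dist y y'" if "y \<in> S" "y' \<in> S" for y y'
    proof -
      obtain f g s f' g' s' where y: "y = (f, g, s)" "y' = (f', g', s')" by (metis prod_cases3)
      obtain w w1 w2 t where w: "F f g s = (w, w1, w2, t)" by (metis prod_cases4)
      obtain w' w1' w2' t' where w': "F f' g' s' = (w', w1', w2', t')" by (metis prod_cases4)
      note P = F[OF that(1)[unfolded y(1)], unfolded w prod.case]
      note P' = F[OF that(2)[unfolded y(2)], unfolded w' prod.case]
      let ?h = "\<lambda>x. - n x (apply_bcontfun f x) (apply_bcontfun g x) s - - n x (apply_bcontfun f' x) (apply_bcontfun g' x) s'"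
      have B: "apply_bcontfun f \<in> C0p" "apply_bcontfun g \<in> C0p" "apply_bcontfun f' \<in> C0p" "apply_bcontfun g' \<in> C0p"
        "\<And>x. norm (apply_bcontfun f x) \<le> \<rho>" "\<And>x. norm (apply_bcontfun g x) \<le> \<rho>"
        "\<And>x. norm (apply_bcontfun f' x) \<le> \<rho>" "\<And>x. norm (apply_bcontfun g' x) \<le> \<rho>" "\<bar>s\<bar> \<le> \<rho>" "\<bar>s'\<bar> \<le> \<rho>"
        using that by (auto simp: S_def C0p_ball_def y)
      have c: "dist f f' \<le> dist y y'" "dist g g' \<le> dist y y'" "dist s s' \<le> dist y y'"
        using dist_fst_le[of y y'] order_trans[OF dist_fst_le dist_snd_le[of y y']] order_trans[OF dist_snd_le dist_snd_le[of y y']]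
        by (auto simp: y)
      have hb: "norm (?h x) \<le> dist y y' / (6 * K)" for x
      proof -
        have "norm (?h x) = norm (n x (apply_bcontfun f x) (apply_bcontfun g x) s - n x (apply_bcontfun f' x) (apply_bcontfun g' x) s')"
          by (simp add: norm_minus_commute)
        also have "\<dots> \<le> (dist (apply_bcontfun f x) (apply_bcontfun f' x) + dist (apply_bcontfun g x) (apply_bcontfun g' x) + dist s s') / (18 * K)"
          using lip[OF B(5)[of x] B(6)[of x] B(9) B(7)[of x] B(8)[of x] B(10), of x] by (simp add: dist_norm)
        also have "\<dots> \<le> (3 * dist y y') / (18 * K)"
          using c dist_bounded[of f x f'] dist_bounded[of g x g'] K by (intro divide_right_mono) auto
        finally show ?thesis by simp
      qed
      have "norm (w x - w' x) \<le> K * (dist y y' / (6 * K)) \<and> norm (w1 x - w1' x) \<le> K * (dist y y' / (6 * K)) \<and>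
        norm (w2 x - w2' x) \<le> K * (dist y y' / (6 * K)) \<and> \<bar>t - t'\<bar> \<le> K * (dist y y' / (6 * K))" for x
      proof (rule est[OF C2p_diff])
        show "C2p w w1 w2" "C2p w' w1' w2'" using P P' by auto
        show "?h \<in> C0p" by (intro C0p_ints cont B)
        show "\<Lambda> (\<lambda>x. \<i> * (w x - w' x)) = 0" using P P' by (intro \<Lambda>d) (auto dest: C2pD(1))
        show "lin d \<zeta> \<mu> (u0 x) (w x - w' x) (w2 x - w2' x) + of_real (t - t') * e x = ?h x" for x
        proof -
          have "lin d \<zeta> \<mu> (u0 x) (w x - w' x) (w2 x - w2' x) + of_real (t - t') * e x =
            (lin d \<zeta> \<mu> (u0 x) (w x) (w2 x) + of_real t * e x) - (lin d \<zeta> \<mu> (u0 x) (w' x) (w2' x) + of_real t' * e x)"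
            by (simp add: lin_diff algebra_simps)
          then show ?thesis using P P' by simp
        qed
      qed (use hb in auto)
      then have R: "norm (w x - w' x) \<le> dist y y' / 6" "norm (w1 x - w1' x) \<le> dist y y' / 6" "\<bar>t - t'\<bar> \<le> dist y y' / 6" for x
        using K by (auto simp: field_simps)
      have A: "apply_bcontfun (Bcontfun w) = w" "apply_bcontfun (Bcontfun w1) = w1"
        "apply_bcontfun (Bcontfun w') = w'" "apply_bcontfun (Bcontfun w1') = w1'"
        using P P' by (auto intro!: apply_Bcontfun_C0p dest: C2pD)
      \<comment> \<open>The product distance is at most the sum of the three component distances,
        each bounded by a sixth.\<close>
      have "dist (\<Phi> y) (\<Phi> y') \<le> dist (Bcontfun w) (Bcontfun w') + (dist (Bcontfun w1) (Bcontfun w1') + dist t t')"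
      proof -
        have "dist (p, q) (p', q') \<le> dist p p' + dist q q'" for p p' :: "'x::metric_space" and q q' :: "'y::metric_space"
          unfolding dist_prod_def using sqrt_sum_squares_le_sum by simp
        then show ?thesis unfolding \<Phi>_def y prod.case w w' by (meson add_left_mono order_trans)
      qed
      also have "\<dots> \<le> dist y y' / 6 + (dist y y' / 6 + dist y y' / 6)"
        using R by (intro add_mono dist_bound) (auto simp: A dist_norm)
      finally show ?thesis by simp
    qed
    have M: "\<Phi> ` S \<subseteq> S"
    proof
      fix z assume "z \<in> \<Phi> ` S"
      then obtain f g s where y: "(f, g, s) \<in> S" "z = \<Phi> (f, g, s)" by auto
      obtain w w1 w2 t where w: "F f g s = (w, w1, w2, t)" by (metis prod_cases4)
      note P = F[OF y(1), unfolded w prod.case]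
      have B: "apply_bcontfun f \<in> C0p" "apply_bcontfun g \<in> C0p"
        "\<And>x. norm (apply_bcontfun f x) \<le> \<rho>" "\<And>x. norm (apply_bcontfun g x) \<le> \<rho>" "\<bar>s\<bar> \<le> \<rho>"
        using y by (auto simp: S_def C0p_ball_def y)
      let ?h = "\<lambda>x. - n x (apply_bcontfun f x) (apply_bcontfun g x) s"
      have hb: "norm (?h x) \<le> \<rho> / K" for x
      proof -
        have "norm (?h x) \<le> norm (n x (apply_bcontfun f x) (apply_bcontfun g x) s - n x 0 0 0) + norm (n x 0 0 0)" by norm
        also have "\<dots> \<le> (norm (apply_bcontfun f x) + norm (apply_bcontfun g x) + \<bar>s\<bar>) / (18 * K) + \<rho> / (2 * K)"
          using lip[OF B(3)[of x] B(4)[of x] B(5), where p' = 0 and q' = 0 and s' = 0] rho zero by (intro add_mono) auto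
        also have "\<dots> \<le> (3 * \<rho>) / (18 * K) + \<rho> / (2 * K)"
          using B(3)[of x] B(4)[of x] B(5) K by (intro add_right_mono divide_right_mono) auto
        also have "\<dots> \<le> \<rho> / K" using K rho by (simp add: field_simps)
        finally show ?thesis .
      qed
      have "norm (w x) \<le> K * (\<rho> / K) \<and> norm (w1 x) \<le> K * (\<rho> / K) \<and> norm (w2 x) \<le> K * (\<rho> / K) \<and> \<bar>t\<bar> \<le> K * (\<rho> / K)" for x
        by (rule est[of w w1 w2 ?h]) (use P hb in \<open>auto intro!: C0p_ints cont B\<close>)
      then have R: "norm (w x) \<le> \<rho>" "norm (w1 x) \<le> \<rho>" "\<bar>t\<bar> \<le> \<rho>" for x using K by force+
      have C: "w \<in> C0p" "w1 \<in> C0p" using P by (auto dest: C2pD)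
      show "z \<in> S" unfolding y(2) \<Phi>_def prod.case w using R C
        by (auto simp: S_def C0p_ball_def apply_Bcontfun_C0p abs_le_iff)
    qed
    have "complete S" unfolding S_def complete_eq_closed
      by (intro closed_Times closed_C0p_ball closed_real_atLeastAtMost)
    moreover have "(Bcontfun (\<lambda>_. 0), Bcontfun (\<lambda>_. 0), 0) \<in> S"
      using rho by (auto simp: S_def C0p_ball_def apply_Bcontfun_C0p C0p_intros)
    then have "S \<noteq> {}" by blast
    ultimately have "\<exists>!y\<in>S. \<Phi> y = y" by (intro Banach_fix[where c = "1/2"] M D) auto
    then obtain f g s where y: "(f, g, s) \<in> S" "\<Phi> (f, g, s) = (f, g, s)" by auto
    obtain w w1 w2 t where w: "F f g s = (w, w1, w2, t)" by (metis prod_cases4)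
    note P = F[OF y(1), unfolded w prod.case]
    have E: "Bcontfun w = f" "Bcontfun w1 = g" "t = s" using y(2) by (auto simp: \<Phi>_def w)
    then have "apply_bcontfun f = w" "apply_bcontfun g = w1"
      using P apply_Bcontfun_C0p C2pD(1,2) by metis+
    then show "\<exists>w w1 w2 s. bordered_solution e n \<rho> w w1 w2 s"
      using P y(1) E unfolding bordered_solution_def
      by (intro exI[of _ w] exI[of _ w1] exI[of _ w2] exI[of _ s]) (auto simp: S_def C0p_ball_def)
  next
    fix n n' :: "real \<Rightarrow> complex \<Rightarrow> complex \<Rightarrow> real \<Rightarrow> complex" and \<rho> B s s' x :: real
      and w w1 w2 w' w1' w2' :: "real \<Rightarrow> complex"
    assume adm: "admissible n K \<rho>" "admissible n' K \<rho>"
      and nb: "\<And>x p q s. \<lbrakk>norm p \<le> \<rho>; norm q \<le> \<rho>; \<bar>s\<bar> \<le> \<rho>\<rbrakk> \<Longrightarrow> norm (n x p q s - n' x p q s) \<le> B"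
      and sol: "bordered_solution e n \<rho> w w1 w2 s" "bordered_solution e n' \<rho> w' w1' w2' s'"
    note cont = admissibleD(1)[OF adm(1)] admissibleD(1)[OF adm(2)] and lip = admissibleD(2)[OF adm(1)]
    note w = bordered_solutionD[OF sol(1)] and w' = bordered_solutionD[OF sol(2)]
    \<comment> \<open>Evaluated at its maximum, \<open>G\<close> can be absorbed: the three
      components of the estimate add up to \<open>G x0 \<le> 3 * (K * B + G x0 / 18)\<close>, hence
      \<open>G x0 \<le> 18 / 5 * (K * B)\<close>. The factor 4 is generous.\<close>
    define G where "G x = norm (w x - w' x) + norm (w1 x - w1' x) + norm (s - s')" for x
    have "G \<in> C0p" unfolding G_def by (intro C0p_ints C2pD(1,2)[OF w(1)] C2pD(1,2)[OF w'(1)])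
    then obtain x0 where x0: "\<And>x. G x \<le> G x0" using C0p_attains by blast
    have B0: "B \<ge> 0" using order_trans[OF norm_ge_zero nb[of "w 0" "w1 0" s 0]] w by blast
    let ?h = "\<lambda>x. n' x (w' x) (w1' x) s' - n x (w x) (w1 x) s"
    have hb: "norm (?h x) \<le> B + G x0 / (18 * K)" for x
    proof -
      have "norm (?h x) \<le> norm (n x (w x) (w1 x) s - n x (w' x) (w1' x) s') + norm (n x (w' x) (w1' x) s' - n' x (w' x) (w1' x) s')" by norm
      also have "\<dots> \<le> G x / (18 * K) + B"
        using lip[of "w x" "w1 x" s "w' x" "w1' x" s' x] nb[of "w' x" "w1' x" s' x] w w' by (intro add_mono) (auto simp: G_def)
      also have "\<dots> \<le> G x0 / (18 * K) + B" using x0 K by (intro add_right_mono divide_right_mono) auto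
      finally show ?thesis by simp
    qed
    have Kh: "K * (B + G x0 / (18 * K)) = K * B + G x0 / 18" using K by (simp add: field_simps)
    have R: "norm (w x - w' x) \<le> K * (B + G x0 / (18 * K)) \<and> norm (w1 x - w1' x) \<le> K * (B + G x0 / (18 * K)) \<and>
      norm (w2 x - w2' x) \<le> K * (B + G x0 / (18 * K)) \<and> \<bar>s - s'\<bar> \<le> K * (B + G x0 / (18 * K))" for x
    proof (rule est[OF C2p_diff[OF w(1) w'(1)]])
      show "?h \<in> C0p" by (intro C0p_ints cont C2pD(1,2)[OF w(1)] C2pD(1,2)[OF w'(1)])
      show "\<Lambda> (\<lambda>x. \<i> * (w x - w' x)) = 0" using w w' by (intro \<Lambda>d) (auto dest: C2pD(1))
      show "lin d \<zeta> \<mu> (u0 x) (w x - w' x) (w2 x - w2' x) + of_real (s - s') * e x = ?h x" for x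
      proof -
        have "lin d \<zeta> \<mu> (u0 x) (w x - w' x) (w2 x - w2' x) + of_real (s - s') * e x =
          (lin d \<zeta> \<mu> (u0 x) (w x) (w2 x) + of_real s * e x) - (lin d \<zeta> \<mu> (u0 x) (w' x) (w2' x) + of_real s' * e x)"
          by (simp add: lin_diff algebra_simps)
        also have "\<dots> = ?h x" using w(4)[of x] w'(4)[of x] by (simp add: add_eq_0_iff2)
        finally show ?thesis .
      qed
    qed (rule hb)
    have "G x0 = norm (w x0 - w' x0) + norm (w1 x0 - w1' x0) + \<bar>s - s'\<bar>" by (simp add: G_def)
    moreover have "K * B \<ge> 0" using K B0 by simp
    ultimately have "K * B + G x0 / 18 \<le> 4 * (K * B)" using R[of x0] unfolding Kh by argo
    then have "K * B + G x0 / 18 \<le> 4 * K * B" by (simp only: mult.assoc)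
    then show "norm (w x - w' x) \<le> 4 * K * B \<and> norm (w1 x - w1' x) \<le> 4 * K * B \<and> norm (w2 x - w2' x) \<le> 4 * K * B \<and> \<bar>s - s'\<bar> \<le> 4 * K * B"
      using R[of x] unfolding Kh by (meson order_trans)
  qed
qed

end

section \<open>Existence of the solution branch\<close>

text \<open>The equation expresses \<open>w2\<close> through \<open>V\<close>, \<open>w\<close>,
  \<open>cnj w\<close> and \<open>w1\<close>, all differentiable, so a third derivative exists. The
  result stands outside \<open>wave\<close> because it also supplies the third derivative of
  \<open>u0\<close> that the locale presupposes.\<close>

lemma stationary_derivative:
  assumes d0: "d \<noteq> 0" and V: "V \<in> C0p" and V1: "V1 \<in> C0p"
    and V_deriv: "\<And>x. (V has_vector_derivative V1 x) (at x)"
    and w: "C2p w w1 w2"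
    and eq: "\<And>x. - of_real d * w2 x + \<i> * of_real (\<epsilon> * V x) * w1 x + (of_real \<zeta> - \<i> * of_real \<mu>) * w x
        - of_real ((cmod (w x))\<^sup>2) * w x + \<i> * of_real f0 = 0"
  obtains w3 where "C2p w1 w2 w3"
    "\<And>x. lin d \<zeta> \<mu> (w x) (w1 x) (w3 x) + \<i> * of_real (\<epsilon> * V x) * w2 x = - \<i> * of_real (\<epsilon> * V1 x) * w1 x"
proof -
  define w3 where "w3 x = (\<i> * of_real \<epsilon> * (of_real (V x) * w2 x + of_real (V1 x) * w1 x) + (of_real \<zeta> - \<i> * of_real \<mu>) * w1 x
     - (w x * cnj (w x) * w1 x + (w x * cnj (w1 x) + w1 x * cnj (w x)) * w x)) / of_real d" for x
  have w2: "w2 x = (\<i> * of_real \<epsilon> * (of_real (V x) * w1 x) + (of_real \<zeta> - \<i> * of_real \<mu>) * w x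
     - w x * cnj (w x) * w x + \<i> * of_real f0) / of_real d" for x
    using eq[of x] d0 unfolding complex_norm_square by (simp add: field_simps)
  have w2': "w2 = (\<lambda>x. (\<i> * of_real \<epsilon> * (of_real (V x) * w1 x) + (of_real \<zeta> - \<i> * of_real \<mu>) * w x
     - w x * cnj (w x) * w x + \<i> * of_real f0) / of_real d)" by (rule ext) (rule w2)
  note D = C2pD(4)[OF w] C2pD(5)[OF w]
  note Dc = bounded_linear.has_vector_derivative[OF bounded_linear_cnj D(1)]
  note DV = bounded_linear.has_vector_derivative[OF bounded_linear_of_real[where 'a=complex] V_deriv]
  have "((\<lambda>x. (\<i> * of_real \<epsilon> * (of_real (V x) * w1 x) + (of_real \<zeta> - \<i> * of_real \<mu>) * w x
     - w x * cnj (w x) * w x + \<i> * of_real f0) / of_real d) has_vector_derivative w3 x) (at x)" for x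
    unfolding w3_def divide_inverse
    apply (rule has_vector_derivative_mult_left)
    apply (rule has_vector_derivative_eq_rhs)
     apply (rule has_vector_derivative_add[OF has_vector_derivative_diff[OF has_vector_derivative_add[OF
          has_vector_derivative_mult_right[OF has_vector_derivative_mult[OF DV D(2)]]
          has_vector_derivative_mult_right[OF D(1)]]
          has_vector_derivative_mult[OF has_vector_derivative_mult[OF D(1) Dc] D(1)]] has_vector_derivative_const])
    apply simp
    done
  then have D3: "(w2 has_vector_derivative w3 x) (at x)" for x
    by (subst w2')
  have "w3 \<in> C0p" unfolding w3_def by (intro C0p_ints V V1 C2pD(1,2,3)[OF w])
  then have "C2p w1 w2 w3" using C2pD[OF w] D3 by (auto simp: C2p_def C0p_def)
  moreover have "lin d \<zeta> \<mu> (w x) (w1 x) (w3 x) + \<i> * of_real (\<epsilon> * V x) * w2 x = - \<i> * of_real (\<epsilon> * V1 x) * w1 x" for x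
  proof -
    have "of_real d * w3 x = \<i> * of_real \<epsilon> * (of_real (V x) * w2 x + of_real (V1 x) * w1 x) + (of_real \<zeta> - \<i> * of_real \<mu>) * w1 x
     - (w x * cnj (w x) * w1 x + (w x * cnj (w1 x) + w1 x * cnj (w x)) * w x)"
      using d0 by (simp add: w3_def)
    then show ?thesis unfolding lin_def complex_norm_square by (simp add: algebra_simps power2_eq_square)
  qed
  ultimately show ?thesis using that by blast
qed

text \<open>The mean value inequality for \<open>V (x + t) - c * t\<close>. With
  \<open>c = V1 x\<close> it bounds the difference of two Taylor remainders by the oscillation
  \<omega> of the derivative, with \<open>c = 0\<close> it is a Lipschitz bound.\<close>

lemma increment_bound:
  fixes V V1 :: "real \<Rightarrow> real"
  assumes V_deriv: "\<And>x. (V has_vector_derivative V1 x) (at x)"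
    and bd: "\<And>t. \<bar>t\<bar> \<le> \<rho> \<Longrightarrow> \<bar>V1 (x + t) - c\<bar> \<le> \<omega>" "\<bar>s\<bar> \<le> \<rho>" "\<bar>s'\<bar> \<le> \<rho>"
  shows "\<bar>V (x + s) - V (x + s') - c * (s - s')\<bar> \<le> \<omega> * \<bar>s - s'\<bar>"
proof -
  have "norm ((V (x + s) - c * s) - (V (x + s') - c * s')) \<le> \<omega> * norm (s - s')"
  proof (rule differentiable_bound[where S = "{-\<rho>..\<rho>}" and f = "\<lambda>t. V (x + t) - c * t" and f' = "\<lambda>t h. h * (V1 (x + t) - c)"])
    fix t assume t: "t \<in> {-\<rho>..\<rho>}"
    have "(V has_field_derivative V1 (x + t)) (at (x + t))" using V_deriv by (simp add: has_real_derivative_iff_has_vector_derivative)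
    have "((\<lambda>t. V (x + t)) has_field_derivative V1 (x + t)) (at t within {-\<rho>..\<rho>})"
    proof -
      have "((\<lambda>t. x + t) has_field_derivative 1) (at t within {-\<rho>..\<rho>})" by (auto intro!: derivative_eq_intros)
      from DERIV_chain2[OF \<open>(V has_field_derivative V1 (x + t)) (at (x + t))\<close> this] show ?thesis by simp
    qed
    then have "((\<lambda>t. V (x + t) - c * t) has_field_derivative (V1 (x + t) - c)) (at t within {-\<rho>..\<rho>})"
      by (auto intro!: derivative_eq_intros)
    then show "((\<lambda>t. V (x + t) - c * t) has_derivative (\<lambda>h. h * (V1 (x + t) - c))) (at t within {-\<rho>..\<rho>})"
      by (simp add: has_field_derivative_def mult.commute[of _ "V1 (x + t) - c"])
    have "\<bar>V1 (x + t) - c\<bar> \<le> \<omega>" using bd(1) t by auto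
    then show "onorm (\<lambda>h. h * (V1 (x + t) - c)) \<le> \<omega>"
      by (intro onorm_le) (simp add: abs_mult mult.commute[of \<omega>] mult_left_mono)
  qed (use bd in auto)
  then show ?thesis by (simp add: algebra_simps)
qed

context wave begin

lemmas solution_derivative = stationary_derivative[OF d0 V V1 V_deriv]
lemmas V_mean_value = increment_bound[OF V_deriv]

lemma lin_u1: "lin d \<zeta> \<mu> (u0 x) (u1 x) (u3 x) = 0"
proof -
  have e: "- of_real d * u2 x + \<i> * of_real (0 * V x) * u1 x + (of_real \<zeta> - \<i> * of_real \<mu>) * u0 x
        - of_real ((cmod (u0 x))\<^sup>2) * u0 x + \<i> * of_real f0 = 0" for x
    using eq0[of x] by simp
  obtain w3 where w3: "C2p u1 u2 w3" "\<And>x. lin d \<zeta> \<mu> (u0 x) (u1 x) (w3 x) + \<i> * of_real (0 * V x) * u2 x = - \<i> * of_real (0 * V1 x) * u1 x"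
    by (rule solution_derivative[OF u0 e]) (rule that)
  then show ?thesis using C2p_unique(2)[OF w3(1) u1] w3(2)[of x] by simp
qed

lemma norm_cube_diff:
  fixes z w :: complex
  assumes "norm z \<le> A" "norm w \<le> A"
  shows "norm (of_real ((cmod z)\<^sup>2) - of_real ((cmod w)\<^sup>2) :: complex) \<le> 2 * A * norm (z - w)"
    "norm (z\<^sup>2 - w\<^sup>2) \<le> 2 * A * norm (z - w)"
    "norm (of_real ((cmod z)\<^sup>2) * z - of_real ((cmod w)\<^sup>2) * w) \<le> 3 * (A * A) * norm (z - w)"
proof -
  have A: "A \<ge> 0" using assms(1) norm_ge_zero order_trans by blast
  have eq: "of_real ((cmod z)\<^sup>2) - of_real ((cmod w)\<^sup>2) = z * cnj (z - w) + cnj w * (z - w)"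
    unfolding complex_norm_square by (simp add: algebra_simps)
  have "norm (of_real ((cmod z)\<^sup>2) - of_real ((cmod w)\<^sup>2) :: complex) \<le> norm z * norm (z - w) + norm w * norm (z - w)"
    unfolding eq by (rule order_trans[OF norm_triangle_ineq]) (simp only: norm_mult complex_mod_cnj order_refl)
  also have "\<dots> \<le> A * norm (z - w) + A * norm (z - w)" using assms by (intro add_mono mult_right_mono) auto
  finally show 1: "norm (of_real ((cmod z)\<^sup>2) - of_real ((cmod w)\<^sup>2) :: complex) \<le> 2 * A * norm (z - w)" by simp
  have "z\<^sup>2 - w\<^sup>2 = (z + w) * (z - w)" by (simp add: power2_eq_square algebra_simps)
  then have "norm (z\<^sup>2 - w\<^sup>2) = norm (z + w) * norm (z - w)" by (simp only: norm_mult)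
  also have "\<dots> \<le> (2 * A) * norm (z - w)"
    using norm_triangle_ineq[of z w] assms by (intro mult_right_mono) auto
  finally show "norm (z\<^sup>2 - w\<^sup>2) \<le> 2 * A * norm (z - w)" .
  have eq: "of_real ((cmod z)\<^sup>2) * z - of_real ((cmod w)\<^sup>2) * w = of_real ((cmod z)\<^sup>2) * (z - w) + (of_real ((cmod z)\<^sup>2) - of_real ((cmod w)\<^sup>2)) * w"
    by (simp add: algebra_simps)
  have "norm (of_real ((cmod z)\<^sup>2) * z - of_real ((cmod w)\<^sup>2) * w) \<le>
     norm (of_real ((cmod z)\<^sup>2) :: complex) * norm (z - w) + norm (of_real ((cmod z)\<^sup>2) - of_real ((cmod w)\<^sup>2) :: complex) * norm w"
    unfolding eq by (rule order_trans[OF norm_triangle_ineq]) (simp only: norm_mult order_refl)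
  also have "\<dots> \<le> (A * A) * norm (z - w) + (2 * A * norm (z - w)) * A"
    using 1 assms A mult_mono[OF assms(1) assms(1)] by (intro add_mono mult_mono mult_right_mono) (auto simp: power2_eq_square norm_mult)
  finally show "norm (of_real ((cmod z)\<^sup>2) * z - of_real ((cmod w)\<^sup>2) * w) \<le> 3 * (A * A) * norm (z - w)"
    by (simp add: algebra_simps)
qed

lemma norm_sq: "norm (of_real ((cmod z)\<^sup>2) :: complex) = (cmod z)\<^sup>2"
  by (simp only: norm_of_real abs_power2)

text \<open>Insert \<open>v = u\<^sub>0 + \<epsilon> (W + p)\<close> into the equation with potential \<open>V(\<cdot> + s)\<close>, where \<open>L W = - \<i> V u\<^sub>0'\<close>. The terms
  of order one vanish, and division by \<open>\<epsilon>\<close> leaves \<open>L p + \<i> s V' u\<^sub>0' + brn = 0\<close>; the argument \<open>q\<close> takes the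
  place of \<open>p'\<close>.\<close>
definition br1 :: "(real \<Rightarrow> complex) \<Rightarrow> (real \<Rightarrow> complex) \<Rightarrow> real \<Rightarrow> complex \<Rightarrow> complex \<Rightarrow> real \<Rightarrow> complex" where
  "br1 W W1 x p q s = \<i> * of_real (V (x + s)) * (W1 x + q)
     - (2 * u0 x * of_real ((cmod (W x + p))\<^sup>2) + cnj (u0 x) * (W x + p)\<^sup>2)"

definition br2 :: "(real \<Rightarrow> complex) \<Rightarrow> real \<Rightarrow> complex \<Rightarrow> complex" where
  "br2 W x p = of_real ((cmod (W x + p))\<^sup>2) * (W x + p)"

definition brn :: "(real \<Rightarrow> complex) \<Rightarrow> (real \<Rightarrow> complex) \<Rightarrow> real \<Rightarrow> real \<Rightarrow> complex \<Rightarrow> complex \<Rightarrow> real \<Rightarrow> complex" where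
  "brn W W1 \<epsilon> x p q s = \<i> * of_real (V (x + s) - V x - s * V1 x) * u1 x
     + of_real \<epsilon> * br1 W W1 x p q s - of_real (\<epsilon>\<^sup>2) * br2 W x p"

lemma brn_C0p:
  assumes "W \<in> C0p" "W1 \<in> C0p" "p \<in> C0p" "q \<in> C0p"
  shows "(\<lambda>x. brn W W1 \<epsilon> x (p x) (q x) s) \<in> C0p"
  unfolding brn_def br1_def br2_def
  by (intro C0p_ints C0p_shift[OF V] V V1 assms u_C0p)

lemma br_bounds:
  assumes W: "W \<in> C0p" "W1 \<in> C0p"
  obtains C where "C > 0"
    "\<And>x p q s. norm p \<le> 1 \<Longrightarrow> norm q \<le> 1 \<Longrightarrow> norm (br1 W W1 x p q s) \<le> C"
    "\<And>x p. norm p \<le> 1 \<Longrightarrow> norm (br2 W x p) \<le> C"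
    "\<And>x p q s p' q' s'. norm p \<le> 1 \<Longrightarrow> norm q \<le> 1 \<Longrightarrow> norm p' \<le> 1 \<Longrightarrow> norm q' \<le> 1 \<Longrightarrow>
       norm (br1 W W1 x p q s - br1 W W1 x p' q' s') \<le> C * (norm (p - p') + norm (q - q') + \<bar>s - s'\<bar>)"
    "\<And>x p p'. norm p \<le> 1 \<Longrightarrow> norm p' \<le> 1 \<Longrightarrow> norm (br2 W x p - br2 W x p') \<le> C * norm (p - p')"
proof -
  obtain BW where BW: "BW > 0" "\<And>x. norm (W x) \<le> BW" using C0p_bounded[OF W(1)] by blast
  obtain BW1 where BW1: "BW1 > 0" "\<And>x. norm (W1 x) \<le> BW1" using C0p_bounded[OF W(2)] by blast
  obtain U where U: "U > 0" "\<And>x. norm (u0 x) \<le> U" using C0p_bounded[OF u_C0p(1)] by blast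
  obtain B where B: "B > 0" "\<And>x. norm (V x) \<le> B" using C0p_bounded[OF V] by blast
  obtain B1 where B1: "B1 > 0" "\<And>x. norm (V1 x) \<le> B1" using C0p_bounded[OF V1] by blast
  define A where "A = BW + 1"
  define Q where "Q = BW1 + 1"
  have A: "A > 0" "norm (W x + p) \<le> A" if "norm p \<le> 1" for x p
    using BW(1) norm_triangle_ineq[of "W x" p] BW(2)[of x] that by (auto simp: A_def)
  have Q: "Q > 0" "norm (W1 x + p) \<le> Q" if "norm p \<le> 1" for x p
    using BW1(1) norm_triangle_ineq[of "W1 x" p] BW1(2)[of x] that by (auto simp: Q_def)
  have A0: "A > 0" and Q0: "Q > 0" using BW(1) BW1(1) by (auto simp: A_def Q_def)
  \<comment> \<open>The sum of the bounds and Lipschitz constants of all individual terms of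
    \<open>br1\<close> and \<open>br2\<close> on the unit ball.\<close>
  define C where "C = B * Q + 3 * U * (A * A) + A * A * A + B + B1 * Q + 6 * U * A + 3 * (A * A)"
  have pos: "B * Q > 0" "3 * U * (A * A) > 0" "A * A * A > 0" "B1 * Q > 0" "6 * U * A > 0" "3 * (A * A) > 0"
    using B(1) B1(1) U(1) A0 Q0 by auto
  show ?thesis
  proof (rule that[of C])
    show "C > 0" unfolding C_def using pos B(1) by linarith
    fix x s s' :: real and p q p' q' :: complex
    assume p: "norm p \<le> 1"
    have sq: "(cmod (W x + p))\<^sup>2 \<le> A * A" using A[OF p] mult_mono[OF A(2)[OF p] A(2)[OF p]] by (simp add: power2_eq_square)
    have "norm (br2 W x p) \<le> (A * A) * A"
      unfolding br2_def norm_mult norm_sq using sq A(2)[OF p] A0 by (intro mult_mono) auto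
    then show "norm (br2 W x p) \<le> C" unfolding C_def using pos B(1) by linarith
    { assume q: "norm q \<le> 1"
      have 1: "norm (\<i> * of_real (V (x + s)) * (W1 x + q)) \<le> B * Q"
        using mult_mono[OF B(2)[of "x + s"] Q(2)[OF q, of x]] B(1) by (simp add: norm_mult)
      have 2: "norm (2 * u0 x * of_real ((cmod (W x + p))\<^sup>2)) \<le> 2 * (U * (A * A))"
        using mult_mono[OF U(2)[of x] sq] U(1) by (simp add: norm_mult norm_power)
      have 3: "norm (cnj (u0 x) * (W x + p)\<^sup>2) \<le> U * (A * A)"
        using mult_mono[OF U(2)[of x] sq] U(1) by (simp add: norm_mult norm_power)
      have "norm (br1 W W1 x p q s) \<le> norm (\<i> * of_real (V (x + s)) * (W1 x + q)) + norm (2 * u0 x * of_real ((cmod (W x + p))\<^sup>2)) + norm (cnj (u0 x) * (W x + p)\<^sup>2)"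
        unfolding br1_def by norm
      then show "norm (br1 W W1 x p q s) \<le> C" unfolding C_def using 1 2 3 pos B(1) by linarith
    }
    assume p': "norm p' \<le> 1"
    note c = norm_cube_diff[OF A(2)[OF p, of x] A(2)[OF p', of x], unfolded add_diff_cancel_left]
    have "norm (br2 W x p - br2 W x p') \<le> 3 * (A * A) * norm (p - p')"
      unfolding br2_def by (rule c(3))
    also have "\<dots> \<le> C * norm (p - p')" unfolding C_def using pos B(1) by (intro mult_right_mono) auto
    finally show "norm (br2 W x p - br2 W x p') \<le> C * norm (p - p')" .
    assume q: "norm q \<le> 1" and q': "norm q' \<le> 1"
    have Vd: "\<bar>V (x + s) - V (x + s')\<bar> \<le> B1 * \<bar>s - s'\<bar>"
      using V_mean_value[of "max \<bar>s\<bar> \<bar>s'\<bar>" x 0 B1 s s'] B1(2) by auto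
    have eq: "br1 W W1 x p q s - br1 W W1 x p' q' s' = \<i> * of_real (V (x + s)) * (q - q') + \<i> * of_real (V (x + s) - V (x + s')) * (W1 x + q')
      - (2 * u0 x * (of_real ((cmod (W x + p))\<^sup>2) - of_real ((cmod (W x + p'))\<^sup>2)) + cnj (u0 x) * ((W x + p)\<^sup>2 - (W x + p')\<^sup>2))"
      unfolding br1_def by (simp add: algebra_simps)
    have 1: "norm (\<i> * of_real (V (x + s)) * (q - q')) \<le> B * norm (q - q')"
      using mult_right_mono[OF B(2)[of "x + s"], of "norm (q - q')"] by (simp add: norm_mult)
    have 2: "norm (\<i> * of_real (V (x + s) - V (x + s')) * (W1 x + q')) \<le> (B1 * \<bar>s - s'\<bar>) * Q"
      using mult_mono[OF Vd Q(2)[OF q', of x]] B1(1) by (simp add: norm_mult del: of_real_diff)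
    have 3: "norm (2 * u0 x * (of_real ((cmod (W x + p))\<^sup>2) - of_real ((cmod (W x + p'))\<^sup>2))) \<le> 2 * U * (2 * A * norm (p - p'))"
    proof -
      have "norm (2 * u0 x * (of_real ((cmod (W x + p))\<^sup>2) - of_real ((cmod (W x + p'))\<^sup>2)))
        = 2 * norm (u0 x) * norm (of_real ((cmod (W x + p))\<^sup>2) - of_real ((cmod (W x + p'))\<^sup>2) :: complex)"
        by (simp only: norm_mult norm_numeral)
      also have "\<dots> \<le> 2 * U * (2 * A * norm (p - p'))" using c(1) U by (intro mult_mono) auto
      finally show ?thesis .
    qed
    have 4: "norm (cnj (u0 x) * ((W x + p)\<^sup>2 - (W x + p')\<^sup>2)) \<le> U * (2 * A * norm (p - p'))"
      unfolding norm_mult complex_mod_cnj using c(2) U by (intro mult_mono) auto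
    have "norm (br1 W W1 x p q s - br1 W W1 x p' q' s') \<le> norm (\<i> * of_real (V (x + s)) * (q - q')) + norm (\<i> * of_real (V (x + s) - V (x + s')) * (W1 x + q'))
      + norm (2 * u0 x * (of_real ((cmod (W x + p))\<^sup>2) - of_real ((cmod (W x + p'))\<^sup>2))) + norm (cnj (u0 x) * ((W x + p)\<^sup>2 - (W x + p')\<^sup>2))"
      unfolding eq by norm
    also have "\<dots> \<le> B * norm (q - q') + (B1 * Q) * \<bar>s - s'\<bar> + (6 * U * A) * norm (p - p')"
      using 1 2 3 4 by (simp add: algebra_simps)
    also have "\<dots> \<le> C * norm (q - q') + C * \<bar>s - s'\<bar> + C * norm (p - p')"
      unfolding C_def using pos B(1) by (intro add_mono mult_right_mono) auto
    finally show "norm (br1 W W1 x p q s - br1 W W1 x p' q' s') \<le> C * (norm (p - p') + norm (q - q') + \<bar>s - s'\<bar>)"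
      by (simp add: algebra_simps)
  qed
qed

text \<open>The cubic term is expanded in powers of \<epsilon>: order zero is the equation for
  \<open>z\<close>, order one the linearization at \<open>z\<close>, and the rest is what
  \<open>br1\<close> and \<open>br2\<close> collect. Formulated for numbers at a single point, all
  of this is ring algebra.\<close>

lemma brn_solution:
  assumes W: "lin d \<zeta> \<mu> z W W2 = - \<i> * of_real Vx * z1"
    and n: "lin d \<zeta> \<mu> z p p2 + of_real s * (\<i> * of_real V1x * z1) + (\<i> * of_real (Vs - Vx - s * V1x) * z1
      + of_real \<epsilon> * (\<i> * of_real Vs * (W1 + q) - (2 * z * of_real ((cmod (W + p))\<^sup>2) + cnj z * (W + p)\<^sup>2))
      - of_real (\<epsilon>\<^sup>2) * (of_real ((cmod (W + p))\<^sup>2) * (W + p))) = 0"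
    and z: "- of_real d * z2 + (of_real \<zeta> - \<i> * of_real \<mu>) * z - of_real ((cmod z)\<^sup>2) * z + \<i> * of_real f0 = 0"
  shows "- of_real d * (z2 + of_real \<epsilon> * (W2 + p2)) + \<i> * of_real (\<epsilon> * Vs) * (z1 + of_real \<epsilon> * (W1 + q))
     + (of_real \<zeta> - \<i> * of_real \<mu>) * (z + of_real \<epsilon> * (W + p))
     - of_real ((cmod (z + of_real \<epsilon> * (W + p)))\<^sup>2) * (z + of_real \<epsilon> * (W + p)) + \<i> * of_real f0 = 0"
proof -
  define P where "P = W + p"
  define P2 where "P2 = W2 + p2"
  have 1: "lin d \<zeta> \<mu> z P P2 + \<i> * of_real Vs * z1
      + of_real \<epsilon> * (\<i> * of_real Vs * (W1 + q) - (2 * z * (P * cnj P) + cnj z * P\<^sup>2)) - of_real (\<epsilon>\<^sup>2) * ((P * cnj P) * P) = 0"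
  proof -
    have "lin d \<zeta> \<mu> z P P2 = lin d \<zeta> \<mu> z p p2 - \<i> * of_real Vx * z1"
      using W by (simp add: lin_def P_def P2_def algebra_simps)
    then have "lin d \<zeta> \<mu> z P P2 + \<i> * of_real Vs * z1
      + of_real \<epsilon> * (\<i> * of_real Vs * (W1 + q) - (2 * z * (P * cnj P) + cnj z * P\<^sup>2)) - of_real (\<epsilon>\<^sup>2) * ((P * cnj P) * P)
      = lin d \<zeta> \<mu> z p p2 + of_real s * (\<i> * of_real V1x * z1) + (\<i> * of_real (Vs - Vx - s * V1x) * z1
      + of_real \<epsilon> * (\<i> * of_real Vs * (W1 + q) - (2 * z * (P * cnj P) + cnj z * P\<^sup>2))
      - of_real (\<epsilon>\<^sup>2) * ((P * cnj P) * P))"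
      by (simp add: algebra_simps)
    then show ?thesis using n unfolding P_def[symmetric] complex_norm_square by (rule trans)
  qed
  have "- of_real d * (z2 + of_real \<epsilon> * P2) + \<i> * of_real (\<epsilon> * Vs) * (z1 + of_real \<epsilon> * (W1 + q))
     + (of_real \<zeta> - \<i> * of_real \<mu>) * (z + of_real \<epsilon> * P)
     - ((z + of_real \<epsilon> * P) * cnj (z + of_real \<epsilon> * P)) * (z + of_real \<epsilon> * P) + \<i> * of_real f0
    = (- of_real d * z2 + (of_real \<zeta> - \<i> * of_real \<mu>) * z - (z * cnj z) * z + \<i> * of_real f0)
     + of_real \<epsilon> * (lin d \<zeta> \<mu> z P P2 + \<i> * of_real Vs * z1
      + of_real \<epsilon> * (\<i> * of_real Vs * (W1 + q) - (2 * z * (P * cnj P) + cnj z * P\<^sup>2)) - of_real (\<epsilon>\<^sup>2) * ((P * cnj P) * P))"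
    unfolding lin_def complex_norm_square by (simp add: algebra_simps power2_eq_square)
  also have "\<dots> = 0" using z 1 unfolding complex_norm_square by simp
  finally show ?thesis unfolding P_def P2_def complex_norm_square .
qed

text \<open>The two halves of the simple-zero hypothesis enter separately: the vanishing of the
  effective potential makes the first-order equation for \<open>W\<close> solvable, and its nonzero
  slope makes the border \<open>e\<close> transversal to the range.\<close>

lemma branch_exists:
  obtains \<epsilon>1 C v v1 v2 s where "\<epsilon>1 > 0" "C > 0" "v 0 = u0" "s 0 = 0"
    "\<And>\<epsilon>. \<bar>\<epsilon>\<bar> < \<epsilon>1 \<Longrightarrow> C2p (v \<epsilon>) (v1 \<epsilon>) (v2 \<epsilon>)"
    "\<And>\<epsilon> x. \<bar>\<epsilon>\<bar> < \<epsilon>1 \<Longrightarrow> - of_real d * v2 \<epsilon> x + \<i> * of_real (\<epsilon> * V (x + s \<epsilon>)) * v1 \<epsilon> x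
      + (of_real \<zeta> - \<i> * of_real \<mu>) * v \<epsilon> x - of_real ((cmod (v \<epsilon> x))\<^sup>2) * v \<epsilon> x + \<i> * of_real f0 = 0"
    "\<And>\<epsilon> \<eta> x. \<bar>\<epsilon>\<bar> < \<epsilon>1 \<Longrightarrow> \<bar>\<eta>\<bar> < \<epsilon>1 \<Longrightarrow> norm (v \<epsilon> x - v \<eta> x) \<le> C * \<bar>\<epsilon> - \<eta>\<bar> \<and>
      norm (v1 \<epsilon> x - v1 \<eta> x) \<le> C * \<bar>\<epsilon> - \<eta>\<bar> \<and> norm (v2 \<epsilon> x - v2 \<eta> x) \<le> C * \<bar>\<epsilon> - \<eta>\<bar> \<and> \<bar>s \<epsilon> - s \<eta>\<bar> \<le> C * \<bar>\<epsilon> - \<eta>\<bar>"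
proof -
  define e where "e x = \<i> * of_real (V1 x) * u1 x" for x
  have e: "e \<in> C0p" unfolding e_def by (intro C0p_ints V1 u_C0p)
  have Le: "\<Lambda> e \<noteq> 0" unfolding e_def \<Lambda>_V1 by (rule nu)
  have hV: "(\<lambda>x. - 1 * (\<i> * of_real (V x) * u1 x)) \<in> C0p" and hV': "(\<lambda>x. \<i> * of_real (V x) * u1 x) \<in> C0p"
    by (intro C0p_ints V u_C0p)+
  have "\<Lambda> (\<lambda>x. - 1 * (\<i> * of_real (V x) * u1 x)) = 0"
    using \<Lambda>_scale[OF hV', of "-1"] \<Lambda>_V by simp
  obtain W W1 W2 where W: "C2p W W1 W2"
    and Weq: "\<And>x. lin d \<zeta> \<mu> (u0 x) (W x) (W2 x) = - 1 * (\<i> * of_real (V x) * u1 x)"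
    by (rule fredholm_solve[OF hV \<open>\<Lambda> _ = 0\<close>]) (rule that)
  note W0 = C2pD(1)[OF W] C2pD(2)[OF W] C2pD(3)[OF W]
  obtain K where K: "K > 0"
    and solve: "\<And>n \<rho>. \<lbrakk>\<rho> > 0; admissible n K \<rho>; \<And>x. norm (n x 0 0 0) \<le> \<rho> / (2 * K)\<rbrakk>
      \<Longrightarrow> \<exists>w w1 w2 s. bordered_solution e n \<rho> w w1 w2 s"
    and stab: "\<And>n n' \<rho> B w w1 w2 s w' w1' w2' s' x.
      \<lbrakk>admissible n K \<rho>; admissible n' K \<rho>;
       \<And>x p q s. \<lbrakk>norm p \<le> \<rho>; norm q \<le> \<rho>; \<bar>s\<bar> \<le> \<rho>\<rbrakk> \<Longrightarrow> norm (n x p q s - n' x p q s) \<le> B;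
       bordered_solution e n \<rho> w w1 w2 s; bordered_solution e n' \<rho> w' w1' w2' s'\<rbrakk>
      \<Longrightarrow> norm (w x - w' x) \<le> 4 * K * B \<and> norm (w1 x - w1' x) \<le> 4 * K * B \<and> norm (w2 x - w2' x) \<le> 4 * K * B \<and> \<bar>s - s'\<bar> \<le> 4 * K * B"
    by (rule bordered_contraction[OF e Le]) (rule that; blast)
  show ?thesis
  proof (rule br_bounds[OF W0(1,2)])
    fix C :: real assume C: "C > 0"
      "\<And>x p q s. norm p \<le> 1 \<Longrightarrow> norm q \<le> 1 \<Longrightarrow> norm (br1 W W1 x p q s) \<le> C"
      "\<And>x p. norm p \<le> 1 \<Longrightarrow> norm (br2 W x p) \<le> C"
      "\<And>x p q s p' q' s'. norm p \<le> 1 \<Longrightarrow> norm q \<le> 1 \<Longrightarrow> norm p' \<le> 1 \<Longrightarrow> norm q' \<le> 1 \<Longrightarrow>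
         norm (br1 W W1 x p q s - br1 W W1 x p' q' s') \<le> C * (norm (p - p') + norm (q - q') + \<bar>s - s'\<bar>)"
      "\<And>x p p'. norm p \<le> 1 \<Longrightarrow> norm p' \<le> 1 \<Longrightarrow> norm (br2 W x p - br2 W x p') \<le> C * norm (p - p')"
    obtain U1 where U1: "U1 > 0" "\<And>x. norm (u1 x) \<le> U1" using C0p_bounded[OF u_C0p(2)] by blast
    \<comment> \<open>The Taylor remainder of \<open>V\<close> may use half of the permitted
      Lipschitz constant \<open>1 / (18 * K)\<close>; the terms carrying \<epsilon> use the other
      half.\<close>
    define \<omega> where "\<omega> = 1 / (36 * K * U1)"
    have om: "\<omega> > 0" using K U1(1) by (simp add: \<omega>_def)
    obtain \<delta> where \<delta>: "\<delta> > 0" "\<And>x y. \<bar>x - y\<bar> < \<delta> \<Longrightarrow> norm (V1 x - V1 y) < \<omega>"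
      using C0p_uniformly_continuous[OF V1 om] by blast
    define \<rho> where "\<rho> = min (\<delta> / 2) 1"
    have rho: "\<rho> > 0" "\<rho> < \<delta>" "\<rho> \<le> 1" using \<delta>(1) by (auto simp: \<rho>_def)
    \<comment> \<open>With \<open>\<epsilon>\<^sup>2 \<le> \<bar>\<epsilon>\<bar>\<close> both
      perturbation terms together cost \<open>2 * \<bar>\<epsilon>\<bar> * C\<close>. The second
      entry fits this into \<open>1 / (36 * K)\<close> for the Lipschitz constant, the third into
      \<open>\<rho> / (2 * K)\<close> at the origin.\<close>
    define \<epsilon>1 where "\<epsilon>1 = min 1 (min (1 / (72 * K * C)) (\<rho> / (4 * K * C)))"
    have e1: "\<epsilon>1 > 0" "\<epsilon>1 \<le> 1" "\<epsilon>1 \<le> 1 / (72 * K * C)" "\<epsilon>1 \<le> \<rho> / (4 * K * C)" using K C(1) rho by (auto simp: \<epsilon>1_def)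
    have small: "\<epsilon>\<^sup>2 \<le> \<bar>\<epsilon>\<bar>" "2 * \<bar>\<epsilon>\<bar> * C \<le> 1 / (36 * K)" "2 * \<bar>\<epsilon>\<bar> * C \<le> \<rho> / (2 * K)" if "\<bar>\<epsilon>\<bar> < \<epsilon>1" for \<epsilon>
    proof -
      have "\<bar>\<epsilon>\<bar> \<le> 1" using that e1 by linarith
      then show "\<epsilon>\<^sup>2 \<le> \<bar>\<epsilon>\<bar>" using mult_left_mono[of "\<bar>\<epsilon>\<bar>" 1 "\<bar>\<epsilon>\<bar>"] by (simp add: power2_eq_square)
      have "\<bar>\<epsilon>\<bar> \<le> 1 / (72 * K * C)" "\<bar>\<epsilon>\<bar> \<le> \<rho> / (4 * K * C)" using that e1 by linarith+
      then show "2 * \<bar>\<epsilon>\<bar> * C \<le> 1 / (36 * K)" "2 * \<bar>\<epsilon>\<bar> * C \<le> \<rho> / (2 * K)" using K C(1) by (auto simp: field_simps)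
    qed
    note cont = brn_C0p[OF W0(1,2)]
    have lip: "norm (brn W W1 \<epsilon> x p q s - brn W W1 \<epsilon> x p' q' s') \<le> (norm (p - p') + norm (q - q') + \<bar>s - s'\<bar>) / (18 * K)"
      if "\<bar>\<epsilon>\<bar> < \<epsilon>1" "norm p \<le> \<rho>" "norm q \<le> \<rho>" "\<bar>s\<bar> \<le> \<rho>" "norm p' \<le> \<rho>" "norm q' \<le> \<rho>" "\<bar>s'\<bar> \<le> \<rho>" for \<epsilon> x p q s p' q' s'
    proof -
      let ?S = "norm (p - p') + norm (q - q') + \<bar>s - s'\<bar>"
      have 1: "norm p \<le> 1" "norm q \<le> 1" "norm p' \<le> 1" "norm q' \<le> 1" using that rho by linarith+
      have "\<bar>V (x + s) - V (x + s') - V1 x * (s - s')\<bar> \<le> \<omega> * \<bar>s - s'\<bar>"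
      proof (rule V_mean_value[OF _ that(4,7)])
        show "\<bar>V1 (x + t) - V1 x\<bar> \<le> \<omega>" if "\<bar>t\<bar> \<le> \<rho>" for t using \<delta>(2)[of "x + t" x] that rho by auto
      qed
      from mult_mono[OF this U1(2)[of x]] om
      have a: "\<bar>V (x + s) - V (x + s') - V1 x * (s - s')\<bar> * norm (u1 x) \<le> \<bar>s - s'\<bar> / (36 * K)"
        using U1(1) by (simp add: \<omega>_def)
      have a': "norm (\<i> * of_real (V (x + s) - V (x + s') - V1 x * (s - s')) * u1 x) \<le> \<bar>s - s'\<bar> / (36 * K)"
        using a unfolding norm_mult norm_of_real by simp
      have b: "norm (of_real \<epsilon> * (br1 W W1 x p q s - br1 W W1 x p' q' s')) \<le> \<bar>\<epsilon>\<bar> * (C * ?S)"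
        unfolding norm_mult norm_of_real by (intro mult_left_mono C(4) 1) auto
      have c: "norm (of_real (\<epsilon>\<^sup>2) * (br2 W x p - br2 W x p')) \<le> \<bar>\<epsilon>\<bar> * (C * ?S)"
      proof -
        have "norm (of_real (\<epsilon>\<^sup>2) * (br2 W x p - br2 W x p')) = \<epsilon>\<^sup>2 * norm (br2 W x p - br2 W x p')"
          unfolding norm_mult norm_of_real by simp
        also have "\<dots> \<le> \<bar>\<epsilon>\<bar> * (C * norm (p - p'))" using small(1)[OF that(1)] C(5)[OF 1(1,3)] by (intro mult_mono) auto
        also have "\<dots> \<le> \<bar>\<epsilon>\<bar> * (C * ?S)" using C(1) by (intro mult_left_mono) auto
        finally show ?thesis .
      qed
      have eq: "brn W W1 \<epsilon> x p q s - brn W W1 \<epsilon> x p' q' s' = \<i> * of_real (V (x + s) - V (x + s') - V1 x * (s - s')) * u1 x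
        + of_real \<epsilon> * (br1 W W1 x p q s - br1 W W1 x p' q' s') - of_real (\<epsilon>\<^sup>2) * (br2 W x p - br2 W x p')"
        unfolding brn_def by (simp add: algebra_simps)
      have "norm (brn W W1 \<epsilon> x p q s - brn W W1 \<epsilon> x p' q' s') \<le> norm (\<i> * of_real (V (x + s) - V (x + s') - V1 x * (s - s')) * u1 x)
        + norm (of_real \<epsilon> * (br1 W W1 x p q s - br1 W W1 x p' q' s')) + norm (of_real (\<epsilon>\<^sup>2) * (br2 W x p - br2 W x p'))"
        unfolding eq by norm
      also have "\<dots> \<le> \<bar>s - s'\<bar> / (36 * K) + (2 * \<bar>\<epsilon>\<bar> * C) * ?S" using a' b c by (simp add: algebra_simps)
      also have "\<dots> \<le> ?S / (36 * K) + (1 / (36 * K)) * ?S"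
        using small(2)[OF that(1)] K by (intro add_mono mult_right_mono divide_right_mono) auto
      finally show ?thesis by (simp add: field_simps)
    qed
    have zero: "norm (brn W W1 \<epsilon> x 0 0 0) \<le> \<rho> / (2 * K)" if "\<bar>\<epsilon>\<bar> < \<epsilon>1" for \<epsilon> x
    proof -
      have "norm (brn W W1 \<epsilon> x 0 0 0) \<le> norm (of_real \<epsilon> * br1 W W1 x 0 0 0) + norm (of_real (\<epsilon>\<^sup>2) * br2 W x 0)"
        unfolding brn_def by (simp add: norm_triangle_ineq4 del: of_real_power)
      also have "\<dots> = \<bar>\<epsilon>\<bar> * norm (br1 W W1 x 0 0 0) + \<epsilon>\<^sup>2 * norm (br2 W x 0)" unfolding norm_mult norm_of_real by simp
      also have "\<dots> \<le> \<bar>\<epsilon>\<bar> * C + \<bar>\<epsilon>\<bar> * C"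
        using small(1)[OF that] C(2)[of 0 0 x 0] C(3)[of 0 x] by (intro add_mono mult_mono) auto
      finally show ?thesis using small(3)[OF that] by linarith
    qed
    have adm: "admissible (brn W W1 \<epsilon>) K \<rho>" if "\<bar>\<epsilon>\<bar> < \<epsilon>1" for \<epsilon>
      unfolding admissible_def using cont lip[OF that] by blast
    have "\<exists>w w1 w2 s. bordered_solution e (brn W W1 \<epsilon>) \<rho> w w1 w2 s" if "\<bar>\<epsilon>\<bar> < \<epsilon>1" for \<epsilon>
      by (rule solve[OF rho(1) adm[OF that] zero[OF that]])
    then obtain p p1 p2 s where p: "\<And>\<epsilon>. \<bar>\<epsilon>\<bar> < \<epsilon>1 \<Longrightarrow> bordered_solution e (brn W W1 \<epsilon>) \<rho> (p \<epsilon>) (p1 \<epsilon>) (p2 \<epsilon>) (s \<epsilon>)"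
      by metis
    have nb: "norm (brn W W1 \<epsilon> x a b t - brn W W1 \<eta> x a b t) \<le> 3 * C * \<bar>\<epsilon> - \<eta>\<bar>"
      if "\<bar>\<epsilon>\<bar> < \<epsilon>1" "\<bar>\<eta>\<bar> < \<epsilon>1" "norm a \<le> \<rho>" "norm b \<le> \<rho>" for \<epsilon> \<eta> x a b t
    proof -
      have 1: "norm a \<le> 1" "norm b \<le> 1" using that rho by linarith+
      have eq: "brn W W1 \<epsilon> x a b t - brn W W1 \<eta> x a b t = of_real (\<epsilon> - \<eta>) * br1 W W1 x a b t - of_real ((\<epsilon> + \<eta>) * (\<epsilon> - \<eta>)) * br2 W x a"
        unfolding brn_def by (simp add: algebra_simps power2_eq_square)
      have "\<bar>\<epsilon> + \<eta>\<bar> \<le> 2" using that e1 by linarith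
      then have 2: "\<bar>(\<epsilon> + \<eta>) * (\<epsilon> - \<eta>)\<bar> \<le> 2 * \<bar>\<epsilon> - \<eta>\<bar>" unfolding abs_mult by (rule mult_right_mono) simp
      have "norm (brn W W1 \<epsilon> x a b t - brn W W1 \<eta> x a b t) \<le> norm (of_real (\<epsilon> - \<eta>) * br1 W W1 x a b t) + norm (of_real ((\<epsilon> + \<eta>) * (\<epsilon> - \<eta>)) * br2 W x a)"
        unfolding eq by (rule norm_triangle_ineq4)
      also have "\<dots> \<le> \<bar>\<epsilon> - \<eta>\<bar> * C + (2 * \<bar>\<epsilon> - \<eta>\<bar>) * C"
        unfolding norm_mult norm_of_real using C(2)[OF 1, of x t] C(3)[OF 1(1), of x] 2 by (intro add_mono mult_mono) auto
      finally show ?thesis by (simp add: algebra_simps)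
    qed
    \<comment> \<open>The stability factor \<open>4 * K\<close> times the Lipschitz constant
      \<open>3 * C\<close> of the perturbation in \<epsilon>.\<close>
    define D where "D = 12 * K * C"
    have D0: "D > 0" using K C(1) by (simp add: D_def)
    have st: "norm (p \<epsilon> x - p \<eta> x) \<le> D * \<bar>\<epsilon> - \<eta>\<bar> \<and> norm (p1 \<epsilon> x - p1 \<eta> x) \<le> D * \<bar>\<epsilon> - \<eta>\<bar> \<and>
        norm (p2 \<epsilon> x - p2 \<eta> x) \<le> D * \<bar>\<epsilon> - \<eta>\<bar> \<and> \<bar>s \<epsilon> - s \<eta>\<bar> \<le> D * \<bar>\<epsilon> - \<eta>\<bar>"
      if "\<bar>\<epsilon>\<bar> < \<epsilon>1" "\<bar>\<eta>\<bar> < \<epsilon>1" for \<epsilon> \<eta> x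
      using stab[OF adm[OF that(1)] adm[OF that(2)] nb[OF that] p[OF that(1)] p[OF that(2)], where x = x]
      unfolding D_def by (simp add: mult.assoc mult.left_commute)
    have z: "\<bar>0 :: real\<bar> < \<epsilon>1" using e1 by simp
    have z0: "\<Lambda> (\<lambda>x. \<i> * 0) = 0" using \<Lambda>_scale[OF C0p_intros(1)[of 0], of 0] by simp
    \<comment> \<open>At \<epsilon> = 0 the zero function with zero shift is a solution. Comparison
      with the chosen one, with \<open>B = 0\<close>, shows that they coincide, which gives
      \<open>s 0 = 0\<close>.\<close>
    have nz: "bordered_solution e (brn W W1 0) \<rho> (\<lambda>x. 0) (\<lambda>x. 0) (\<lambda>x. 0) 0"
      using rho C2p_zero z0 by (simp add: bordered_solution_def lin_def brn_def)
    have s0: "norm (p 0 x - 0) \<le> 4 * K * 0 \<and> norm (p1 0 x - 0) \<le> 4 * K * 0 \<and> norm (p2 0 x - 0) \<le> 4 * K * 0 \<and> \<bar>s 0 - 0\<bar> \<le> 4 * K * 0" for x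
      by (rule stab[OF adm[OF z] adm[OF z] _ p[OF z] nz]) simp
    have bd: "norm (p \<epsilon> x) \<le> D" "norm (p1 \<epsilon> x) \<le> D" "norm (p2 \<epsilon> x) \<le> D" if "\<bar>\<epsilon>\<bar> < \<epsilon>1" for \<epsilon> x
    proof -
      have "D * \<bar>\<epsilon> - 0\<bar> \<le> D * 1" using that e1 D0 by (intro mult_left_mono) auto
      then show "norm (p \<epsilon> x) \<le> D" "norm (p1 \<epsilon> x) \<le> D" "norm (p2 \<epsilon> x) \<le> D"
        using st[OF that z, of x] s0[of x] by auto
    qed
    obtain BW BW1 BW2 where BW: "BW > 0" "\<And>x. norm (W x) \<le> BW" "BW1 > 0" "\<And>x. norm (W1 x) \<le> BW1" "BW2 > 0" "\<And>x. norm (W2 x) \<le> BW2"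
      using C0p_bounded[OF W0(1)] C0p_bounded[OF W0(2)] C0p_bounded[OF W0(3)] by metis
    define CC where "CC = BW + BW1 + BW2 + 2 * D"
    \<comment> \<open>Stated for arbitrary numbers to serve the function and both of its
      derivatives. One summand varies the factor \<epsilon>, the other varies the corrector.\<close>
    have L: "norm ((y + of_real \<epsilon> * (A + a)) - (y + of_real \<eta> * (A + b))) \<le> CC * \<bar>\<epsilon> - \<eta>\<bar>"
      if "norm (a - b) \<le> D * \<bar>\<epsilon> - \<eta>\<bar>" "norm a \<le> D" "norm A \<le> BW + BW1 + BW2" "\<bar>\<eta>\<bar> < \<epsilon>1" for a b A y :: complex and \<epsilon> \<eta>
    proof -
      have eq: "(y + of_real \<epsilon> * (A + a)) - (y + of_real \<eta> * (A + b)) = of_real (\<epsilon> - \<eta>) * (A + a) + of_real \<eta> * (a - b)"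
        by (simp add: algebra_simps)
      have "norm ((y + of_real \<epsilon> * (A + a)) - (y + of_real \<eta> * (A + b))) \<le> \<bar>\<epsilon> - \<eta>\<bar> * norm (A + a) + \<bar>\<eta>\<bar> * norm (a - b)"
        unfolding eq by (rule order_trans[OF norm_triangle_ineq]) (simp only: norm_mult norm_of_real order_refl)
      also have "\<dots> \<le> \<bar>\<epsilon> - \<eta>\<bar> * (BW + BW1 + BW2 + D) + 1 * (D * \<bar>\<epsilon> - \<eta>\<bar>)"
        using that e1 norm_triangle_ineq[of A a] by (intro add_mono mult_mono) auto
      finally show ?thesis by (simp add: CC_def algebra_simps)
    qed
    show ?thesis
    proof (rule that[of \<epsilon>1 CC "\<lambda>\<epsilon> x. u0 x + of_real \<epsilon> * (W x + p \<epsilon> x)" s "\<lambda>\<epsilon> x. u1 x + of_real \<epsilon> * (W1 x + p1 \<epsilon> x)"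
          "\<lambda>\<epsilon> x. u2 x + of_real \<epsilon> * (W2 x + p2 \<epsilon> x)"])
      show "\<epsilon>1 > 0" by (rule e1)
      show "CC > 0" using BW D0 by (simp add: CC_def)
      show "s 0 = 0" using s0 by simp
      show "(\<lambda>x. u0 x + of_real 0 * (W x + p 0 x)) = u0" by simp
      fix \<epsilon> :: real assume ep: "\<bar>\<epsilon>\<bar> < \<epsilon>1"
      show "C2p (\<lambda>x. u0 x + of_real \<epsilon> * (W x + p \<epsilon> x)) (\<lambda>x. u1 x + of_real \<epsilon> * (W1 x + p1 \<epsilon> x)) (\<lambda>x. u2 x + of_real \<epsilon> * (W2 x + p2 \<epsilon> x))"
        by (intro C2p_add u0 C2p_mult W bordered_solutionD(1)[OF p[OF ep]])
      fix x
      show "- of_real d * (u2 x + of_real \<epsilon> * (W2 x + p2 \<epsilon> x)) + \<i> * of_real (\<epsilon> * V (x + s \<epsilon>)) * (u1 x + of_real \<epsilon> * (W1 x + p1 \<epsilon> x))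
        + (of_real \<zeta> - \<i> * of_real \<mu>) * (u0 x + of_real \<epsilon> * (W x + p \<epsilon> x))
        - of_real ((cmod (u0 x + of_real \<epsilon> * (W x + p \<epsilon> x)))\<^sup>2) * (u0 x + of_real \<epsilon> * (W x + p \<epsilon> x)) + \<i> * of_real f0 = 0"
      proof (rule brn_solution[OF _ _ eq0])
        show "lin d \<zeta> \<mu> (u0 x) (W x) (W2 x) = - \<i> * of_real (V x) * u1 x" using Weq by simp
        show "lin d \<zeta> \<mu> (u0 x) (p \<epsilon> x) (p2 \<epsilon> x) + of_real (s \<epsilon>) * (\<i> * of_real (V1 x) * u1 x) +
          (\<i> * of_real (V (x + s \<epsilon>) - V x - s \<epsilon> * V1 x) * u1 x + of_real \<epsilon> *
           (\<i> * of_real (V (x + s \<epsilon>)) * (W1 x + p1 \<epsilon> x) - (2 * u0 x * of_real ((cmod (W x + p \<epsilon> x))\<^sup>2) + cnj (u0 x) * (W x + p \<epsilon> x)\<^sup>2))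
           - of_real (\<epsilon>\<^sup>2) * (of_real ((cmod (W x + p \<epsilon> x))\<^sup>2) * (W x + p \<epsilon> x))) = 0"
          using bordered_solutionD(4)[OF p[OF ep], of x] unfolding e_def brn_def br1_def br2_def by blast
      qed
      fix \<eta> :: real assume et: "\<bar>\<eta>\<bar> < \<epsilon>1"
      have "D * \<bar>\<epsilon> - \<eta>\<bar> \<le> CC * \<bar>\<epsilon> - \<eta>\<bar>" using BW D0 by (intro mult_right_mono) (auto simp: CC_def)
      moreover have "norm (W x) \<le> BW + BW1 + BW2" "norm (W1 x) \<le> BW + BW1 + BW2" "norm (W2 x) \<le> BW + BW1 + BW2"
        using BW(2)[of x] BW(4)[of x] BW(6)[of x] BW(1,3,5) by linarith+
      ultimately show "norm (u0 x + of_real \<epsilon> * (W x + p \<epsilon> x) - (u0 x + of_real \<eta> * (W x + p \<eta> x))) \<le> CC * \<bar>\<epsilon> - \<eta>\<bar> \<and>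
        norm (u1 x + of_real \<epsilon> * (W1 x + p1 \<epsilon> x) - (u1 x + of_real \<eta> * (W1 x + p1 \<eta> x))) \<le> CC * \<bar>\<epsilon> - \<eta>\<bar> \<and>
        norm (u2 x + of_real \<epsilon> * (W2 x + p2 \<epsilon> x) - (u2 x + of_real \<eta> * (W2 x + p2 \<eta> x))) \<le> CC * \<bar>\<epsilon> - \<eta>\<bar> \<and> \<bar>s \<epsilon> - s \<eta>\<bar> \<le> CC * \<bar>\<epsilon> - \<eta>\<bar>"
        using st[OF ep et, of x] bd[OF ep, of x] et by (intro conjI L) auto
    qed
  qed
qed

section \<open>The small real eigenvalue\<close>

lemma lin_perturbation:
  assumes "norm z \<le> A" "norm z' \<le> A"
  shows "norm (lin d \<zeta> \<mu> z w w2 - lin d \<zeta> \<mu> z' w w2) \<le> 6 * A * norm (z - z') * norm w"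
proof -
  let ?t = "(2 * (of_real ((cmod z)\<^sup>2) - of_real ((cmod z')\<^sup>2))) * w"
  have eq: "lin d \<zeta> \<mu> z w w2 - lin d \<zeta> \<mu> z' w w2
      = - ((2 * (of_real ((cmod z)\<^sup>2) - of_real ((cmod z')\<^sup>2))) * w) - (z\<^sup>2 - z'\<^sup>2) * cnj w"
    by (simp add: lin_def algebra_simps)
  have "norm (lin d \<zeta> \<mu> z w w2 - lin d \<zeta> \<mu> z' w w2)
      \<le> norm ((2 * (of_real ((cmod z)\<^sup>2) - of_real ((cmod z')\<^sup>2))) * w) + norm ((z\<^sup>2 - z'\<^sup>2) * cnj w)"
    unfolding eq using norm_triangle_ineq4[of "- ?t"] by (simp only: norm_minus_cancel)
  also have "\<dots> = 2 * norm (of_real ((cmod z)\<^sup>2) - of_real ((cmod z')\<^sup>2) :: complex) * norm w + norm (z\<^sup>2 - z'\<^sup>2) * norm w"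
    by (simp only: norm_mult complex_mod_cnj norm_numeral)
  also have "\<dots> \<le> 2 * (2 * A * norm (z - z')) * norm w + (2 * A * norm (z - z')) * norm w"
    using norm_cube_diff(1,2)[OF assms] by (intro add_mono mult_right_mono mult_left_mono) auto
  finally show ?thesis by (simp add: algebra_simps)
qed

text \<open>The eigenfunction is sought as \<open>u1 + w\<close> with
  \<open>\<Lambda> (i w) = 0\<close>, and the eigenvalue \<open>s\<close> is the scalar unknown. Its
  leading contribution is \<open>- i s u1\<close>, which is transversal to the range because
  \<open>\<Lambda> (i u1) = 1\<close>. The bound \<delta> depends on \<eta> only, not on the
  particular coefficients \<open>z\<close> and \<open>c\<close>.\<close>

lemma real_eigenvalue_exists:
  assumes eta: "\<eta> > 0"
  obtains \<delta> where "\<delta> > 0" "\<And>z c. \<lbrakk>z \<in> C0p; c \<in> C0p; \<And>x. norm (z x - u0 x) \<le> \<delta>; \<And>x. \<bar>c x\<bar> \<le> \<delta>\<rbrakk> \<Longrightarrow>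
    \<exists>a a1 a2 s. C2p a a1 a2 \<and> \<not> (\<forall>x. a x = 0) \<and> \<bar>s\<bar> \<le> \<eta> \<and>
      (\<forall>x. evo d \<zeta> \<mu> (c x) (z x) (a x) (a1 x) (a2 x) = of_real s * a x)"
proof -
  define e where "e x = - \<i> * u1 x" for x
  have e: "e \<in> C0p" unfolding e_def by (intro C0p_ints u_C0p)
  have iu1: "(\<lambda>x. \<i> * u1 x) \<in> C0p" by (intro C0p_ints u_C0p)
  have Le: "\<Lambda> e \<noteq> 0" using \<Lambda>_scale[OF iu1, of "-1"] \<Lambda>_u1 by (simp add: e_def[abs_def])
  obtain K where K: "K > 0"
    and solve: "\<And>n \<rho>. \<lbrakk>\<rho> > 0; admissible n K \<rho>; \<And>x. norm (n x 0 0 0) \<le> \<rho> / (2 * K)\<rbrakk>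
      \<Longrightarrow> \<exists>w w1 w2 s. bordered_solution e n \<rho> w w1 w2 s"
    by (rule bordered_contraction[OF e Le]) (rule that; blast)
  obtain U where U: "U > 0" "\<And>x. norm (u0 x) \<le> U" using C0p_bounded[OF u_C0p(1)] by blast
  obtain U1 where U1: "U1 > 0" "\<And>x. norm (u1 x) \<le> U1" using C0p_bounded[OF u_C0p(2)] by blast
  obtain U2 where U2: "U2 > 0" "\<And>x. norm (u2 x) \<le> U2" using C0p_bounded[OF u_C0p(3)] by blast
  obtain x0 where x0: "u1 x0 \<noteq> 0"
  proof (rule ccontr)
    assume "\<not> thesis"
    then have "u1 = (\<lambda>x. 0)" using that by blast
    then show False using \<Lambda>_u1 \<Lambda>_scale[OF C0p_intros(1)[of 0], of 0] by simp
  qed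
  define A where "A = U + 1"
  have A: "A \<ge> 1" using U by (simp add: A_def)
  \<comment> \<open>The entries bound the eigenvalue by \<eta>, keep \<open>u1 + w\<close> nonzero
    at \<open>x0\<close>, and make the bilinear term \<open>s p\<close> a small Lipschitz
    perturbation.\<close>
  define \<rho> where "\<rho> = min (min \<eta> (norm (u1 x0) / 2)) (1 / (36 * K))"
  have rho: "\<rho> > 0" "\<rho> \<le> \<eta>" "\<rho> < norm (u1 x0)" "\<rho> \<le> 1 / (36 * K)"
  proof -
    show "\<rho> > 0" "\<rho> \<le> \<eta>" "\<rho> \<le> 1 / (36 * K)" using eta x0 K by (auto simp: \<rho>_def)
    have "\<rho> \<le> norm (u1 x0) / 2" by (auto simp: \<rho>_def)
    then show "\<rho> < norm (u1 x0)" using zero_less_norm_iff[of "u1 x0"] x0 by linarith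
  qed
  \<comment> \<open>Here \<open>6 * A\<close> is the constant of \<open>lin_perturbation\<close>.
    The second entry gives \<open>6 * A * \<delta> \<le> 1 / (36 * K)\<close>, the third makes the
    defect of \<open>u1\<close> itself at most \<open>\<rho> / (2 * K)\<close>.\<close>
  define \<delta> where "\<delta> = min 1 (min (1 / (216 * A * K)) (\<rho> / (2 * K * (6 * A * U1 + U2))))"
  have P: "6 * A * U1 + U2 > 0" using A U1 U2 by (intro add_nonneg_pos) auto
  have \<delta>: "\<delta> > 0" "\<delta> \<le> 1" "\<delta> \<le> 1 / (216 * A * K)" "\<delta> \<le> \<rho> / (2 * K * (6 * A * U1 + U2))"
    using A K rho P by (auto simp: \<delta>_def)
  have \<delta>1: "6 * A * \<delta> \<le> 1 / (36 * K)" using \<delta>(3) A K by (simp add: field_simps)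
  have "\<delta> * (6 * A * U1 + U2) \<le> \<rho> / (2 * K * (6 * A * U1 + U2)) * (6 * A * U1 + U2)"
    using \<delta>(4) P by (intro mult_right_mono) auto
  then have \<delta>3: "\<delta> * (6 * A * U1 + U2) \<le> \<rho> / (2 * K)" using P by simp
  have "\<delta> \<le> 6 * A * \<delta>" using A \<delta>(1) by simp
  also note \<delta>1
  also have "1 / (36 * K) \<le> 1 / (18 * K)" using K by (simp add: field_simps)
  finally have \<delta>2: "\<delta> \<le> 1 / (18 * K)" .
  show ?thesis
  proof (rule that[OF \<delta>(1)])
    fix z :: "real \<Rightarrow> complex" and c :: "real \<Rightarrow> real"
    assume z: "z \<in> C0p" and c: "c \<in> C0p" and zb: "\<And>x. norm (z x - u0 x) \<le> \<delta>" and cb: "\<And>x. \<bar>c x\<bar> \<le> \<delta>"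
    \<comment> \<open>The second-derivative parts cancel in the difference, so 0 is inserted for
      that argument.\<close>
    define pert where "pert x w = lin d \<zeta> \<mu> (z x) w 0 - lin d \<zeta> \<mu> (u0 x) w 0" for x w
    have lp: "lin d \<zeta> \<mu> (z x) w w2 = lin d \<zeta> \<mu> (u0 x) w w2 + pert x w" for x w w2
      by (simp add: lin_def pert_def algebra_simps)
    have pd: "pert x (w - w') = pert x w - pert x w'" for x w w'
      by (simp add: lin_def pert_def algebra_simps)
    have pb: "norm (pert x w) \<le> 6 * A * \<delta> * norm w" for x w
    proof -
      have "norm (z x) \<le> A" "norm (u0 x) \<le> A"
        using norm_triangle_ineq[of "z x - u0 x" "u0 x"] zb[of x] U(2)[of x] \<delta>(2) by (auto simp: A_def)
      then have "norm (pert x w) \<le> 6 * A * norm (z x - u0 x) * norm w"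
        unfolding pert_def by (rule lin_perturbation)
      also have "\<dots> \<le> 6 * A * \<delta> * norm w" using zb[of x] A by (intro mult_right_mono mult_left_mono) auto
      finally show ?thesis .
    qed
    define n where "n x p q s = pert x (u1 x + p) + \<i> * of_real (c x) * (u2 x + q) - \<i> * of_real s * p" for x p q and s :: real
    have "\<exists>w w1 w2 s. bordered_solution e n \<rho> w w1 w2 s"
    proof (rule solve[OF rho(1)])
      show "norm (n x 0 0 0) \<le> \<rho> / (2 * K)" for x
      proof -
        have "norm (n x 0 0 0) \<le> norm (pert x (u1 x)) + \<bar>c x\<bar> * norm (u2 x)"
          unfolding n_def by (simp, rule order_trans[OF norm_triangle_ineq]) (simp add: norm_mult)
        also have "\<dots> \<le> 6 * A * \<delta> * U1 + \<delta> * U2"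
          using order_trans[OF pb mult_left_mono[OF U1(2)], of x] cb[of x] U2(2)[of x] A \<delta>(1) by (intro add_mono mult_mono) auto
        finally show ?thesis using \<delta>3 by (simp add: algebra_simps)
      qed
      have "norm (n x p q s - n x p' q' s') \<le> (norm (p - p') + norm (q - q') + \<bar>s - s'\<bar>) / (18 * K)"
        if b: "norm p \<le> \<rho>" "norm q \<le> \<rho>" "\<bar>s\<bar> \<le> \<rho>" "norm p' \<le> \<rho>" "norm q' \<le> \<rho>" "\<bar>s'\<bar> \<le> \<rho>" for x s s' p q p' q'
      proof -
        have eq: "n x p q s - n x p' q' s' = pert x (p - p') + \<i> * of_real (c x) * (q - q') - (\<i> * of_real s * (p - p') + \<i> * of_real (s - s') * p')"
          using pd[of x "u1 x + p" "u1 x + p'"] by (simp add: n_def algebra_simps)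
        have "norm (n x p q s - n x p' q' s') \<le> norm (pert x (p - p')) + norm (\<i> * of_real (c x) * (q - q')) + (norm (\<i> * of_real s * (p - p')) + norm (\<i> * of_real (s - s') * p'))"
          unfolding eq by norm
        also have "\<dots> = norm (pert x (p - p')) + \<bar>c x\<bar> * norm (q - q') + (\<bar>s\<bar> * norm (p - p') + \<bar>s - s'\<bar> * norm p')"
          unfolding norm_mult norm_of_real by simp
        also have "\<dots> \<le> 6 * A * \<delta> * norm (p - p') + \<delta> * norm (q - q') + (\<rho> * norm (p - p') + \<bar>s - s'\<bar> * \<rho>)"
          using pb cb[of x] b by (intro add_mono mult_right_mono mult_left_mono) auto
        also have "\<dots> \<le> (1 / (36 * K)) * norm (p - p') + (1 / (18 * K)) * norm (q - q') + ((1 / (36 * K)) * norm (p - p') + \<bar>s - s'\<bar> * (1 / (18 * K)))"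
        proof -
          have "\<rho> \<le> 1 / (18 * K)" using rho(4) K by (auto intro: order_trans[of _ "1 / (36 * K)"] simp: field_simps)
          then show ?thesis using \<delta>1 \<delta>2 rho(4) by (intro add_mono mult_right_mono mult_left_mono) auto
      qed
      also have "\<dots> = (norm (p - p') + norm (q - q') + \<bar>s - s'\<bar>) / (18 * K)" using K by (simp add: field_simps)
      finally show ?thesis .
      qed
      moreover have "(\<lambda>x. n x (w x) (w1 x) s) \<in> C0p" if "w \<in> C0p" "w1 \<in> C0p" for w w1 s
        unfolding n_def pert_def by (intro C0p_ints C0p_lin z c that u_C0p)
      ultimately show "admissible n K \<rho>" unfolding admissible_def by blast
    qed
    then obtain w w1 w2 s where w: "C2p w w1 w2" "\<bar>s\<bar> \<le> \<rho>" "\<And>x. norm (w x) \<le> \<rho>"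
      and weq: "\<And>x. lin d \<zeta> \<mu> (u0 x) (w x) (w2 x) + of_real s * e x + n x (w x) (w1 x) s = 0"
      unfolding bordered_solution_def by blast
    show "\<exists>a a1 a2 s. C2p a a1 a2 \<and> \<not> (\<forall>x. a x = 0) \<and> \<bar>s\<bar> \<le> \<eta> \<and>
      (\<forall>x. evo d \<zeta> \<mu> (c x) (z x) (a x) (a1 x) (a2 x) = of_real s * a x)"
    proof (intro exI conjI allI)
      show "C2p (\<lambda>x. u1 x + w x) (\<lambda>x. u2 x + w1 x) (\<lambda>x. u3 x + w2 x)" by (intro C2p_add u1 w)
      show "\<bar>s\<bar> \<le> \<eta>" using w(2) rho(2) by simp
      show "\<not> (\<forall>x. u1 x + w x = 0)"
      proof
        assume "\<forall>x. u1 x + w x = 0"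
        then have "norm (u1 x0) = norm (w x0)" by (metis add_eq_0_iff norm_minus_cancel)
        then show False using w(3)[of x0] rho(3) by simp
      qed
      fix x
      have "lin d \<zeta> \<mu> (u0 x) (u1 x + w x) (u3 x + w2 x) = lin d \<zeta> \<mu> (u0 x) (w x) (w2 x)"
        using lin_u1[of x] by (simp add: lin_def algebra_simps)
      then have "lin d \<zeta> \<mu> (z x) (u1 x + w x) (u3 x + w2 x) = lin d \<zeta> \<mu> (u0 x) (w x) (w2 x) + pert x (u1 x + w x)" by (simp add: lp)
      moreover have "lin d \<zeta> \<mu> (u0 x) (w x) (w2 x) = - of_real s * e x - n x (w x) (w1 x) s"
        using weq[of x] by (simp add: algebra_simps add_eq_0_iff)
      ultimately have L: "lin d \<zeta> \<mu> (z x) (u1 x + w x) (u3 x + w2 x)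
          = \<i> * of_real s * (u1 x + w x) - \<i> * of_real (c x) * (u2 x + w1 x)"
        by (simp add: n_def e_def algebra_simps)
      show "evo d \<zeta> \<mu> (c x) (z x) (u1 x + w x) (u2 x + w1 x) (u3 x + w2 x) = of_real s * (u1 x + w x)"
        unfolding evo_def L by (simp add: algebra_simps)
    qed
  qed
qed

end

section \<open>Energy estimates and the critical eigenvalue\<close>

lemma ulim_dominated:
  assumes "ulim f (\<lambda>x. 0)" "ulim g (\<lambda>x. 0)" "\<And>n x. norm (h n x) \<le> C * (norm (f n x) + norm (g n x))"
  shows "ulim h (\<lambda>x. 0)"
proof (rule uniform_limitI)
  fix e :: real assume e: "e > 0"
  let ?C = "\<bar>C\<bar> + 1"
  define k where "k = e / ?C"
  have "k / 2 > 0" using e by (simp add: k_def)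
  from ulim_D[OF assms(1) this] ulim_D[OF assms(2) this]
  show "\<forall>\<^sub>F n in sequentially. \<forall>x\<in>UNIV. dist (h n x) 0 < e"
  proof eventually_elim
    case (elim n)
    have "norm (h n x) < e" for x
    proof -
      have "norm (f n x) < k / 2" "norm (g n x) < k / 2" using elim by auto
      then have l: "norm (f n x) + norm (g n x) < k" by linarith
      have "norm (h n x) \<le> C * (norm (f n x) + norm (g n x))" by (rule assms(3))
      also have "\<dots> \<le> ?C * (norm (f n x) + norm (g n x))" by (intro mult_right_mono) auto
      also have "\<dots> < ?C * k" using l by (intro mult_strict_left_mono) auto
      finally show ?thesis by (simp add: k_def)
    qed
    then show ?case by (simp add: dist_norm)
  qed
qed

text \<open>Integration by parts in pointwise form: the derivative of a periodic function integrates
  to zero, so the inequality has to hold only up to such a derivative.\<close>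

lemma integral_le_periodic_primitive:
  fixes P Q :: "real \<Rightarrow> complex" and F F' :: "real \<Rightarrow> real"
  assumes P: "P \<in> C0p" and Q: "Q \<in> C0p" and F: "periodic_2pi F" "\<And>x. (F has_vector_derivative F' x) (at x)"
    and le: "\<And>x. k * (norm (P x))\<^sup>2 - F' x \<le> c * (norm (P x) * norm (Q x))"
  shows "k * integral {-pi..pi} (\<lambda>x. (norm (P x))\<^sup>2) \<le> c * integral {-pi..pi} (\<lambda>x. norm (P x) * norm (Q x))"
proof -
  have I: "((\<lambda>x. (norm (P x))\<^sup>2) has_integral integral {-pi..pi} (\<lambda>x. (norm (P x))\<^sup>2)) {-pi..pi}"
    "((\<lambda>x. norm (P x) * norm (Q x)) has_integral integral {-pi..pi} (\<lambda>x. norm (P x) * norm (Q x))) {-pi..pi}"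
    using C0pD(1)[OF P] C0pD(1)[OF Q] by (auto intro!: integrable_integral integrable_continuous_real continuous_intros)
  have "F pi = F (-pi)" using F(1) unfolding periodic_2pi_def by (metis add_uminus_conv_diff diff_add_cancel minus_add_distrib mult_2 add.commute uminus_add_conv_diff)
  then have "(F' has_integral 0) {-pi..pi}" using has_integral_deriv[of F F' "-pi" pi, OF F(2)] by simp
  from has_integral_diff[OF has_integral_mult_right[OF I(1), of k] this]
  have "((\<lambda>x. k * (norm (P x))\<^sup>2 - F' x) has_integral (k * integral {-pi..pi} (\<lambda>x. (norm (P x))\<^sup>2) - 0)) {-pi..pi}" .
  from has_integral_le[OF this has_integral_mult_right[OF I(2), of c]] le show ?thesis by simp
qed

lemma Cauchy_Schwarz_norms:
  fixes P Q :: "real \<Rightarrow> complex"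
  assumes P: "P \<in> C0p" and Q: "Q \<in> C0p"
  shows "(integral {-pi..pi} (\<lambda>x. norm (P x) * norm (Q x)))\<^sup>2
    \<le> integral {-pi..pi} (\<lambda>x. (norm (P x))\<^sup>2) * integral {-pi..pi} (\<lambda>x. (norm (Q x))\<^sup>2)"
    (is "?X\<^sup>2 \<le> ?p * ?q")
proof -
  have I: "((\<lambda>x. (norm (P x))\<^sup>2) has_integral ?p) {-pi..pi}" "((\<lambda>x. (norm (Q x))\<^sup>2) has_integral ?q) {-pi..pi}"
    "((\<lambda>x. norm (P x) * norm (Q x)) has_integral ?X) {-pi..pi}"
    using C0pD(1)[OF P] C0pD(1)[OF Q] by (auto intro!: integrable_integral integrable_continuous_real continuous_intros)
  have t: "2 * t * ?X \<le> t\<^sup>2 * ?p + ?q" for t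
  proof (rule has_integral_le[OF has_integral_mult_right[OF I(3)] has_integral_add[OF has_integral_mult_right[OF I(1)] I(2)]])
    fix x
    have "0 \<le> (t * norm (P x) - norm (Q x))\<^sup>2" by simp
    then show "2 * t * (norm (P x) * norm (Q x)) \<le> t\<^sup>2 * (norm (P x))\<^sup>2 + (norm (Q x))\<^sup>2"
      by (simp add: power2_eq_square algebra_simps)
  qed
  have "?p \<ge> 0" by (rule integral_nonneg) (use I in auto)
  show ?thesis
  proof (cases "?p = 0")
    case True
    then have "P x = 0" for x by (rule integral_norm_square_eq_0[OF P])
    then show ?thesis using True by simp
  next
    case False
    with \<open>?p \<ge> 0\<close> have p: "?p > 0" by simp
    \<comment> \<open>The parameter \<open>?X / ?p\<close> optimizes the quadratic
      inequality.\<close>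
    have "2 * (?X / ?p) * ?X \<le> (?X / ?p)\<^sup>2 * ?p + ?q" by (rule t)
    then show ?thesis using p by (simp add: field_simps power2_eq_square)
  qed
qed

context wave begin

text \<open>In the variables \<open>P = a + \<i> b\<close>, \<open>Q = a - \<i> b\<close> the eigenvalue problem for \<open>\<alpha> + \<i> \<beta>\<close>
  decouples up to the bounded term \<open>\<i> z\<^sup>2 cnj Q\<close>. The first estimate comes from the real part of
  the pairing with \<open>P\<close>, the second from the imaginary part.\<close>
lemma energy_estimates:
  assumes P: "C2p P P1 P2" and Q: "Q \<in> C0p" and z: "\<And>x. norm (z x) \<le> Z"
    and B: "\<And>x. \<bar>V x\<bar> \<le> B" "\<And>x. \<bar>V1 x\<bar> \<le> B1" and e: "\<bar>\<epsilon>\<bar> \<le> 1" "\<bar>\<epsilon>\<bar> * B1 \<le> \<mu>"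
    and eq: "\<And>x. \<i> * of_real d * P2 x - (\<i> * of_real \<zeta> + of_real \<mu>) * P x + 2 * \<i> * of_real ((cmod (z x))\<^sup>2) * P x
      + of_real (\<epsilon> * V x) * P1 x + \<i> * (z x)\<^sup>2 * cnj (Q x) = Complex \<alpha> \<beta> * P x"
  shows "(\<alpha> + \<mu> / 2) * integral {-pi..pi} (\<lambda>x. (norm (P x))\<^sup>2) \<le> Z\<^sup>2 * integral {-pi..pi} (\<lambda>x. norm (P x) * norm (Q x))"
    "d * \<beta> \<ge> 0 \<Longrightarrow> (\<bar>\<beta>\<bar> - (2 * Z\<^sup>2 + \<bar>\<zeta>\<bar> + B\<^sup>2 / (4 * \<bar>d\<bar>))) * integral {-pi..pi} (\<lambda>x. (norm (P x))\<^sup>2)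
      \<le> Z\<^sup>2 * integral {-pi..pi} (\<lambda>x. norm (P x) * norm (Q x))"
proof -
  note D = C2pD(4)[OF P] C2pD(5)[OF P]
  have z2: "(cmod (z x))\<^sup>2 \<le> Z\<^sup>2" for x using z[of x] by (intro power_mono) auto
  have zQ: "cmod (\<i> * (z x)\<^sup>2 * cnj (Q x) * cnj (P x)) \<le> Z\<^sup>2 * (norm (P x) * norm (Q x))" for x
  proof -
    have "cmod (\<i> * (z x)\<^sup>2 * cnj (Q x) * cnj (P x)) = (cmod (z x))\<^sup>2 * (norm (P x) * norm (Q x))"
      by (simp add: norm_mult norm_power)
    then show ?thesis using z2[of x] by (simp add: mult_right_mono)
  qed
  have PP: "P x * cnj (P x) = of_real ((norm (P x))\<^sup>2)" for x by (simp only: complex_norm_square)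
  have eq': "Complex \<alpha> \<beta> * of_real ((norm (P x))\<^sup>2) = \<i> * of_real d * (P2 x * cnj (P x))
     - (\<i> * of_real \<zeta> + of_real \<mu>) * of_real ((norm (P x))\<^sup>2)
     + 2 * \<i> * of_real ((cmod (z x))\<^sup>2) * of_real ((norm (P x))\<^sup>2)
      + of_real (\<epsilon> * V x) * (P1 x * cnj (P x)) + \<i> * (z x)\<^sup>2 * cnj (Q x) * cnj (P x)" for x
    using arg_cong[OF eq[of x], of "\<lambda>y. y * cnj (P x)"] unfolding PP[symmetric] by (simp only: algebra_simps)
  have Dn: "((\<lambda>x. (norm (P x))\<^sup>2) has_vector_derivative 2 * Re (P1 x * cnj (P x))) (at x)" for x
  proof -
    have "((\<lambda>x. P x \<bullet> P x) has_vector_derivative (P x \<bullet> P1 x + P1 x \<bullet> P x)) (at x)"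
      using D(1)[of x] by (auto simp: has_vector_derivative_def intro!: derivative_eq_intros simp: fun_eq_iff algebra_simps)
    then show ?thesis by (simp add: power2_norm_eq_inner inner_complex_def algebra_simps)
  qed
  have Dm: "((\<lambda>x. P1 x * cnj (P x)) has_vector_derivative (P1 x * cnj (P1 x) + P2 x * cnj (P x))) (at x)" for x
    by (rule has_vector_derivative_mult[OF D(2) bounded_linear.has_vector_derivative[OF bounded_linear_cnj D(1)]])
  have per: "periodic_2pi P" "periodic_2pi P1" "periodic_2pi V"
    using C2pD(1,2)[OF P] V by (auto dest: C0pD(3))
  \<comment> \<open>The first term removes the dispersion. The second turns the transport term into
    \<open>- \<epsilon> / 2 * V1 x\<close> times the squared norm of \<open>P\<close>, which costs
    at most half of the damping and explains \<open>\<mu> / 2\<close>.\<close>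
  let ?F = "\<lambda>x. (- d) * Im (P1 x * cnj (P x)) + \<epsilon> / 2 * (V x * (norm (P x))\<^sup>2)"
  let ?F' = "\<lambda>x. (- d) * Im (P1 x * cnj (P1 x) + P2 x * cnj (P x)) + \<epsilon> / 2 * (V x * (2 * Re (P1 x * cnj (P x))) + V1 x * (norm (P x))\<^sup>2)"
  show "(\<alpha> + \<mu> / 2) * integral {-pi..pi} (\<lambda>x. (norm (P x))\<^sup>2) \<le> Z\<^sup>2 * integral {-pi..pi} (\<lambda>x. norm (P x) * norm (Q x))"
  proof (rule integral_le_periodic_primitive[OF C2pD(1)[OF P] Q])
    show "periodic_2pi ?F" using per by (simp add: periodic_2pi_def)
    show "(?F has_vector_derivative ?F' x) (at x)" for x
      by (rule has_vector_derivative_add[OF has_vector_derivative_mult_right[OF bounded_linear.has_vector_derivative[OF bounded_linear_Im Dm]]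
            has_vector_derivative_mult_right[OF has_vector_derivative_mult[OF V_deriv Dn]]])
    fix x
    have "\<alpha> * (norm (P x))\<^sup>2 = - d * Im (P2 x * cnj (P x)) - \<mu> * (norm (P x))\<^sup>2 + \<epsilon> * V x * Re (P1 x * cnj (P x))
        + Re (\<i> * (z x)\<^sup>2 * cnj (Q x) * cnj (P x))"
      using arg_cong[OF eq'[of x], of Re] by simp
    moreover have "Im (P1 x * cnj (P1 x)) = 0" by simp
    moreover have "Re (\<i> * (z x)\<^sup>2 * cnj (Q x) * cnj (P x)) \<le> Z\<^sup>2 * (norm (P x) * norm (Q x))"
      using complex_Re_le_cmod zQ order_trans by blast
    moreover have "- (\<epsilon> * V1 x) * (norm (P x))\<^sup>2 \<le> \<mu> * (norm (P x))\<^sup>2"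
    proof (rule mult_right_mono)
      have "\<bar>\<epsilon> * V1 x\<bar> \<le> \<bar>\<epsilon>\<bar> * B1" unfolding abs_mult using B(2) by (intro mult_left_mono) auto
      then show "- (\<epsilon> * V1 x) \<le> \<mu>" using e(2) by linarith
    qed simp
    ultimately show "(\<alpha> + \<mu> / 2) * (norm (P x))\<^sup>2 - ?F' x \<le> Z\<^sup>2 * (norm (P x) * norm (Q x))"
      by (simp add: algebra_simps)
  qed
  \<comment> \<open>Its derivative contains the squared norm of \<open>P1\<close> with factor
    \<open>\<bar>d\<bar>\<close>. When \<open>d * \<beta> \<ge> 0\<close>, this gradient term
    appears on the same side as \<open>\<bar>\<beta>\<bar>\<close> and can absorb the
    transport.\<close>
  let ?G = "\<lambda>x. \<bar>d\<bar> * Re (P1 x * cnj (P x))"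
  let ?G' = "\<lambda>x. \<bar>d\<bar> * Re (P1 x * cnj (P1 x) + P2 x * cnj (P x))"
  assume db: "d * \<beta> \<ge> 0"
  show "(\<bar>\<beta>\<bar> - (2 * Z\<^sup>2 + \<bar>\<zeta>\<bar> + B\<^sup>2 / (4 * \<bar>d\<bar>))) * integral {-pi..pi} (\<lambda>x. (norm (P x))\<^sup>2)
      \<le> Z\<^sup>2 * integral {-pi..pi} (\<lambda>x. norm (P x) * norm (Q x))"
  proof (rule integral_le_periodic_primitive[OF C2pD(1)[OF P] Q])
    show "periodic_2pi ?G" using per by (simp add: periodic_2pi_def)
    show "(?G has_vector_derivative ?G' x) (at x)" for x
      by (rule has_vector_derivative_mult_right[OF bounded_linear.has_vector_derivative[OF bounded_linear_Re Dm]])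
    fix x
    define N where "N = (norm (P x))\<^sup>2"
    define N1 where "N1 = (norm (P1 x))\<^sup>2"
    have N: "N \<ge> 0" "N1 \<ge> 0" by (auto simp: N_def N1_def)
    have im: "\<beta> * N = d * Re (P2 x * cnj (P x)) + (2 * (cmod (z x))\<^sup>2 - \<zeta>) * N + \<epsilon> * V x * Im (P1 x * cnj (P x))
        + Im (\<i> * (z x)\<^sup>2 * cnj (Q x) * cnj (P x))"
      using arg_cong[OF eq'[of x], of Im] by (simp add: N_def algebra_simps)
    have "\<bar>\<beta>\<bar> * N - \<bar>d\<bar> * Re (P2 x * cnj (P x)) = sgn d * (\<beta> * N - d * Re (P2 x * cnj (P x)))"
      if "d \<noteq> 0"
    proof -
      have "\<bar>\<beta>\<bar> = sgn d * \<beta>" using db that by (auto simp: sgn_if abs_if zero_le_mult_iff)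
      moreover have "\<bar>d\<bar> = sgn d * d" by (simp add: abs_sgn mult.commute)
      ultimately show ?thesis by (simp add: algebra_simps)
    qed
    then have "\<bar>\<beta>\<bar> * N - \<bar>d\<bar> * Re (P2 x * cnj (P x)) \<le> \<bar>\<beta> * N - d * Re (P2 x * cnj (P x))\<bar>"
      using d0 by (metis abs_ge_self abs_mult abs_sgn_eq mult_1)
    also have "\<dots> \<le> \<bar>(2 * (cmod (z x))\<^sup>2 - \<zeta>) * N\<bar> + \<bar>\<epsilon> * V x * Im (P1 x * cnj (P x))\<bar>
        + \<bar>Im (\<i> * (z x)\<^sup>2 * cnj (Q x) * cnj (P x))\<bar>" using im by linarith
    also have "\<bar>(2 * (cmod (z x))\<^sup>2 - \<zeta>) * N\<bar> \<le> (2 * Z\<^sup>2 + \<bar>\<zeta>\<bar>) * N"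
    proof -
      have "\<bar>2 * (cmod (z x))\<^sup>2 - \<zeta>\<bar> \<le> 2 * Z\<^sup>2 + \<bar>\<zeta>\<bar>" using z2[of x] zero_le_power2[of "cmod (z x)"] by linarith
      then show ?thesis unfolding abs_mult using N by (simp add: mult_right_mono)
    qed
    \<comment> \<open>Young's inequality, weighted so that the gradient part is exactly the
      \<open>\<bar>d\<bar> * N1\<close> available in \<open>?G'\<close>.\<close>
    also have "\<bar>\<epsilon> * V x * Im (P1 x * cnj (P x))\<bar> \<le> \<bar>d\<bar> * N1 + B\<^sup>2 / (4 * \<bar>d\<bar>) * N"
    proof -
      have "\<bar>\<epsilon>\<bar> * \<bar>V x\<bar> \<le> 1 * B" using e(1) B(1)[of x] by (intro mult_mono) auto
      moreover have "\<bar>Im (P1 x * cnj (P x))\<bar> \<le> norm (P1 x) * norm (P x)"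
        using abs_Im_le_cmod[of "P1 x * cnj (P x)"] by (simp add: norm_mult)
      ultimately have "\<bar>\<epsilon> * V x * Im (P1 x * cnj (P x))\<bar> \<le> B * (norm (P1 x) * norm (P x))"
        unfolding abs_mult using order_trans[OF abs_ge_zero B(1)] by (intro mult_mono) auto
      also have "\<dots> \<le> \<bar>d\<bar> * N1 + B\<^sup>2 / (4 * \<bar>d\<bar>) * N"
      proof -
        have "0 \<le> (2 * \<bar>d\<bar> * norm (P1 x) - B * norm (P x))\<^sup>2 / (4 * \<bar>d\<bar>)" by simp
        also have "\<dots> = \<bar>d\<bar> * N1 + B\<^sup>2 / (4 * \<bar>d\<bar>) * N - B * (norm (P1 x) * norm (P x))"
          using d0 by (simp add: N_def N1_def power2_eq_square field_simps)
        finally show ?thesis by simp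
      qed
      finally show ?thesis .
    qed
    also have "\<bar>Im (\<i> * (z x)\<^sup>2 * cnj (Q x) * cnj (P x))\<bar> \<le> Z\<^sup>2 * (norm (P x) * norm (Q x))"
      using abs_Im_le_cmod zQ order_trans by blast
    finally have "\<bar>\<beta>\<bar> * N - \<bar>d\<bar> * Re (P2 x * cnj (P x)) \<le> (2 * Z\<^sup>2 + \<bar>\<zeta>\<bar>) * N + (\<bar>d\<bar> * N1 + B\<^sup>2 / (4 * \<bar>d\<bar>) * N) + Z\<^sup>2 * (norm (P x) * norm (Q x))"
      by simp
    moreover have "Re (P1 x * cnj (P1 x)) = N1" unfolding N1_def complex_norm_square[symmetric] by (simp only: Re_complex_of_real)
    ultimately show "(\<bar>\<beta>\<bar> - (2 * Z\<^sup>2 + \<bar>\<zeta>\<bar> + B\<^sup>2 / (4 * \<bar>d\<bar>))) * (norm (P x))\<^sup>2 - ?G' x \<le> Z\<^sup>2 * (norm (P x) * norm (Q x))"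
      unfolding N_def[symmetric] by (simp add: algebra_simps)
  qed
qed

text \<open>\<open>a\<close> and \<open>b\<close> are the real and imaginary parts of an eigenfunction, each a pair of real functions
  encoded as one complex function.\<close>
definition ev_pair :: "real \<Rightarrow> (real \<Rightarrow> complex) \<Rightarrow> real \<Rightarrow> real \<Rightarrow> (real \<Rightarrow> complex) \<Rightarrow> (real \<Rightarrow> complex) \<Rightarrow> (real \<Rightarrow> complex)
    \<Rightarrow> (real \<Rightarrow> complex) \<Rightarrow> (real \<Rightarrow> complex) \<Rightarrow> (real \<Rightarrow> complex) \<Rightarrow> bool" where
  "ev_pair \<epsilon> z \<alpha> \<beta> a a1 a2 b b1 b2 \<longleftrightarrow> C2p a a1 a2 \<and> C2p b b1 b2 \<and> \<not> (\<forall>x. a x = 0 \<and> b x = 0) \<and>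
    (\<forall>x. evo d \<zeta> \<mu> (\<epsilon> * V x) (z x) (a x) (a1 x) (a2 x) = of_real \<alpha> * a x - of_real \<beta> * b x) \<and>
    (\<forall>x. evo d \<zeta> \<mu> (\<epsilon> * V x) (z x) (b x) (b1 x) (b2 x) = of_real \<beta> * a x + of_real \<alpha> * b x)"

text \<open>Adding the damping estimates for \<open>P\<close> and \<open>Q\<close> bounds \<alpha>.
  For \<beta> the sign condition holds for at least one of them, as \<open>Q\<close> belongs to
  \<open>-\<beta>\<close>. Its second estimate is multiplied by the damping estimate of the other,
  and the Cauchy-Schwarz inequality \<open>X\<^sup>2 \<le> p * q\<close> lets the factor
  \<open>p * q\<close> cancel.\<close>

lemma eigenvalue_bound:
  assumes Z: "Z \<ge> 0"
  obtains R \<epsilon>0 where "\<epsilon>0 > 0" "\<And>\<epsilon> z \<alpha> \<beta> a a1 a2 b b1 b2. \<lbrakk>\<bar>\<epsilon>\<bar> \<le> \<epsilon>0; \<And>x. norm (z x) \<le> Z; 0 \<le> \<alpha>; ev_pair \<epsilon> z \<alpha> \<beta> a a1 a2 b b1 b2\<rbrakk>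
     \<Longrightarrow> \<bar>\<alpha>\<bar> \<le> R \<and> \<bar>\<beta>\<bar> \<le> R"
proof -
  obtain B where B: "B > 0" "\<And>x. norm (V x) \<le> B" using C0p_bounded[OF V] by blast
  obtain B1 where B1: "B1 > 0" "\<And>x. norm (V1 x) \<le> B1" using C0p_bounded[OF V1] by blast
  define C1 where "C1 = 2 * Z\<^sup>2 + \<bar>\<zeta>\<bar> + B\<^sup>2 / (4 * \<bar>d\<bar>)"
  have C1: "C1 \<ge> 0" by (simp add: C1_def)
  show ?thesis
  proof (rule that[of "min 1 (\<mu> / B1)" "Z\<^sup>2 + C1 + 2 * (Z\<^sup>2)\<^sup>2 / \<mu>"])
    show "min 1 (\<mu> / B1) > 0" using mu B1 by simp
    fix \<epsilon> \<alpha> \<beta> :: real and z a a1 a2 b b1 b2 :: "real \<Rightarrow> complex"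
    assume e: "\<bar>\<epsilon>\<bar> \<le> min 1 (\<mu> / B1)" and z: "\<And>x. norm (z x) \<le> Z" and al: "0 \<le> \<alpha>" and ev: "ev_pair \<epsilon> z \<alpha> \<beta> a a1 a2 b b1 b2"
    have e1: "\<bar>\<epsilon>\<bar> \<le> 1" "\<bar>\<epsilon>\<bar> * B1 \<le> \<mu>" using e B1(1) by (auto simp: pos_le_divide_eq)
    have a: "C2p a a1 a2" and b: "C2p b b1 b2" and nz: "\<not> (\<forall>x. a x = 0 \<and> b x = 0)"
      and ea: "\<And>x. evo d \<zeta> \<mu> (\<epsilon> * V x) (z x) (a x) (a1 x) (a2 x) = of_real \<alpha> * a x - of_real \<beta> * b x"
      and eb: "\<And>x. evo d \<zeta> \<mu> (\<epsilon> * V x) (z x) (b x) (b1 x) (b2 x) = of_real \<beta> * a x + of_real \<alpha> * b x"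
      using ev unfolding ev_pair_def by blast+
    define P where "P x = a x + \<i> * b x" for x
    define Q where "Q x = a x + (- \<i>) * b x" for x
    have P: "C2p P (\<lambda>x. a1 x + \<i> * b1 x) (\<lambda>x. a2 x + \<i> * b2 x)" unfolding P_def by (intro C2p_add C2p_mult a b)
    have Q: "C2p Q (\<lambda>x. a1 x + (- \<i>) * b1 x) (\<lambda>x. a2 x + (- \<i>) * b2 x)" unfolding Q_def by (intro C2p_add C2p_mult a b)
    have evo': "evo d \<zeta> \<mu> c y w w1 w2 = \<i> * of_real d * w2 - (\<i> * of_real \<zeta> + of_real \<mu>) * w + 2 * \<i> * of_real ((cmod y)\<^sup>2) * w
      + of_real c * w1 + \<i> * y\<^sup>2 * cnj w" for c y w w1 w2
      by (simp add: evo_def lin_def algebra_simps)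
    have cx: "Complex \<alpha> \<beta> = of_real \<alpha> + \<i> * of_real \<beta>" "Complex \<alpha> (- \<beta>) = of_real \<alpha> - \<i> * of_real \<beta>" by (simp_all add: complex_eq_iff)
    have eP: "\<i> * of_real d * (a2 x + \<i> * b2 x) - (\<i> * of_real \<zeta> + of_real \<mu>) * P x + 2 * \<i> * of_real ((cmod (z x))\<^sup>2) * P x
      + of_real (\<epsilon> * V x) * (a1 x + \<i> * b1 x) + \<i> * (z x)\<^sup>2 * cnj (Q x) = Complex \<alpha> \<beta> * P x" for x
    proof -
      have "\<i> * of_real d * (a2 x + \<i> * b2 x) - (\<i> * of_real \<zeta> + of_real \<mu>) * P x + 2 * \<i> * of_real ((cmod (z x))\<^sup>2) * P x
      + of_real (\<epsilon> * V x) * (a1 x + \<i> * b1 x) + \<i> * (z x)\<^sup>2 * cnj (Q x)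
        = evo d \<zeta> \<mu> (\<epsilon> * V x) (z x) (a x) (a1 x) (a2 x) + \<i> * evo d \<zeta> \<mu> (\<epsilon> * V x) (z x) (b x) (b1 x) (b2 x)"
        unfolding evo' P_def Q_def by (simp add: algebra_simps)
      also have "\<dots> = Complex \<alpha> \<beta> * P x" unfolding ea eb cx P_def by (simp add: algebra_simps)
      finally show ?thesis .
    qed
    have eQ: "\<i> * of_real d * (a2 x + (- \<i>) * b2 x) - (\<i> * of_real \<zeta> + of_real \<mu>) * Q x + 2 * \<i> * of_real ((cmod (z x))\<^sup>2) * Q x
      + of_real (\<epsilon> * V x) * (a1 x + (- \<i>) * b1 x) + \<i> * (z x)\<^sup>2 * cnj (P x) = Complex \<alpha> (- \<beta>) * Q x" for x
    proof -
      have "\<i> * of_real d * (a2 x + (- \<i>) * b2 x) - (\<i> * of_real \<zeta> + of_real \<mu>) * Q x + 2 * \<i> * of_real ((cmod (z x))\<^sup>2) * Q x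
      + of_real (\<epsilon> * V x) * (a1 x + (- \<i>) * b1 x) + \<i> * (z x)\<^sup>2 * cnj (P x)
        = evo d \<zeta> \<mu> (\<epsilon> * V x) (z x) (a x) (a1 x) (a2 x) - \<i> * evo d \<zeta> \<mu> (\<epsilon> * V x) (z x) (b x) (b1 x) (b2 x)"
        unfolding evo' P_def Q_def by (simp add: algebra_simps)
      also have "\<dots> = Complex \<alpha> (- \<beta>) * Q x" unfolding ea eb cx Q_def by (simp add: algebra_simps)
      finally show ?thesis .
    qed
    define p where "p = integral {-pi..pi} (\<lambda>x. (norm (P x))\<^sup>2)"
    define q where "q = integral {-pi..pi} (\<lambda>x. (norm (Q x))\<^sup>2)"
    define X where "X = integral {-pi..pi} (\<lambda>x. norm (P x) * norm (Q x))"
    have X': "X = integral {-pi..pi} (\<lambda>x. norm (Q x) * norm (P x))" by (simp add: X_def mult.commute)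
    have B': "\<And>x. \<bar>V x\<bar> \<le> B" "\<And>x. \<bar>V1 x\<bar> \<le> B1" using B B1 by auto
    note EP = energy_estimates[OF P C2pD(1)[OF Q] z B' e1 eP, folded p_def X_def C1_def]
    note EQ = energy_estimates[OF Q C2pD(1)[OF P] z B' e1 eQ, folded q_def X' C1_def]
    have X2: "X\<^sup>2 \<le> p * q" unfolding X_def p_def q_def by (rule Cauchy_Schwarz_norms[OF C2pD(1)[OF P] C2pD(1)[OF Q]])
    have pq0: "p \<ge> 0" "q \<ge> 0" unfolding p_def q_def
      using C0pD(1)[OF C2pD(1)[OF P]] C0pD(1)[OF C2pD(1)[OF Q]]
      by (auto intro!: integral_nonneg integrable_continuous_real continuous_intros)
    \<comment> \<open>If one of the two vanished, \<open>X\<close> would vanish too, and the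
      strictly positive damping would then annihilate both functions.\<close>
    have pq: "p > 0 \<and> q > 0"
    proof (rule ccontr)
      assume "\<not> (p > 0 \<and> q > 0)"
      then have "p * q = 0" using pq0 by auto
      then have "X\<^sup>2 \<le> 0" using X2 by linarith
      then have "X = 0" by simp
      then have "(\<alpha> + \<mu> / 2) * p \<le> 0" "(\<alpha> + \<mu> / 2) * q \<le> 0" using EP(1) EQ(1) by auto
      moreover have "\<alpha> + \<mu> / 2 > 0" using al mu by simp
      ultimately have p0: "p = 0" and q0: "q = 0" using pq0 by (auto simp: mult_le_0_iff)
      have "P x = 0" "Q x = 0" for x
        by (rule integral_norm_square_eq_0[OF C2pD(1)[OF P] p0[unfolded p_def]])
           (rule integral_norm_square_eq_0[OF C2pD(1)[OF Q] q0[unfolded q_def]])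
      moreover have "a x = (P x + Q x) / 2" "b x = (P x - Q x) / (2 * \<i>)" for x by (auto simp: P_def Q_def)
      ultimately show False using nz by auto
    qed
    have X_le: "2 * X \<le> p + q"
    proof -
      have "X \<le> sqrt (p * q)" using X2 by (simp add: real_le_rsqrt)
      also have "\<dots> \<le> (p + q) / 2" by (rule arith_geo_mean_sqrt[OF pq0])
      finally show ?thesis by simp
    qed
    have "(\<alpha> + \<mu> / 2) * (p + q) \<le> Z\<^sup>2 * (p + q)"
    proof -
      have "Z\<^sup>2 * (2 * X) \<le> Z\<^sup>2 * (p + q)" using X_le by (rule mult_left_mono) simp
      then have "2 * (Z\<^sup>2 * X) \<le> Z\<^sup>2 * (p + q)" by (simp only: mult.left_commute[of "Z\<^sup>2" 2])
      then show ?thesis using EP(1) EQ(1) unfolding distrib_left[of "\<alpha> + \<mu> / 2" p q] by linarith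
    qed
    then have "\<alpha> + \<mu> / 2 \<le> Z\<^sup>2" using pq by simp
    then have A: "\<bar>\<alpha>\<bar> \<le> Z\<^sup>2" using al mu by simp
    have mX: "(\<mu> / 2) * p \<le> Z\<^sup>2 * X" "(\<mu> / 2) * q \<le> Z\<^sup>2 * X"
      using EP(1) EQ(1) mult_nonneg_nonneg[OF al pq0(1)] mult_nonneg_nonneg[OF al pq0(2)] by (simp_all add: distrib_right)
    \<comment> \<open>The product argument in symmetric form: \<open>s\<close> belongs to the
      function with the favourable sign, \<open>t\<close> to the other one.\<close>
    have K: "\<bar>\<beta>\<bar> \<le> C1 + 2 * (Z\<^sup>2)\<^sup>2 / \<mu>"
      if h: "(\<bar>\<beta>\<bar> - C1) * s \<le> Z\<^sup>2 * X" "(\<mu> / 2) * t \<le> Z\<^sup>2 * X" "s * t = p * q" "s > 0" "t > 0" for s t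
    proof (cases "\<bar>\<beta>\<bar> \<le> C1")
      case False
      have "((\<bar>\<beta>\<bar> - C1) * s) * ((\<mu> / 2) * t) \<le> (Z\<^sup>2 * X) * (Z\<^sup>2 * X)"
        using h False mu mult_mono[OF h(1,2)] order_trans[OF _ h(2), of 0] by simp
      also have "\<dots> = (Z\<^sup>2)\<^sup>2 * X\<^sup>2" by (simp add: power2_eq_square)
      also have "\<dots> \<le> (Z\<^sup>2)\<^sup>2 * (s * t)" unfolding h(3) using X2 by (rule mult_left_mono) simp
      finally have "((\<bar>\<beta>\<bar> - C1) * (\<mu> / 2)) * (s * t) \<le> (Z\<^sup>2)\<^sup>2 * (s * t)" by (simp add: mult_ac)
      then have "(\<bar>\<beta>\<bar> - C1) * (\<mu> / 2) \<le> (Z\<^sup>2)\<^sup>2" using h(4,5) by (simp add: mult_le_cancel_right)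
      then show ?thesis using mu by (simp add: field_simps)
    qed (use mu in \<open>simp add: add_increasing2\<close>)
    have "\<bar>\<beta>\<bar> \<le> C1 + 2 * (Z\<^sup>2)\<^sup>2 / \<mu>"
    proof (cases "d * \<beta> \<ge> 0")
      case True
      show ?thesis by (rule K[OF EP(2)[OF True] mX(2)]) (use pq in auto)
    next
      case False
      then have "d * - \<beta> \<ge> 0" by simp
      from EQ(2)[OF this] show ?thesis by (intro K[OF _ mX(1)]) (use pq in auto)
    qed
    moreover have "0 \<le> 2 * (Z\<^sup>2)\<^sup>2 / \<mu>" using mu by simp
    ultimately show "\<bar>\<alpha>\<bar> \<le> Z\<^sup>2 + C1 + 2 * (Z\<^sup>2)\<^sup>2 / \<mu> \<and> \<bar>\<beta>\<bar> \<le> Z\<^sup>2 + C1 + 2 * (Z\<^sup>2)\<^sup>2 / \<mu>"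
      using A C1 zero_le_power2[of Z] by linarith
  qed
qed

section \<open>Asymptotics of eigenvalues near zero\<close>

text \<open>From the equation for \<open>w\<close> subtract \<open>c\<close> times the
  differentiated stationary equation and apply \<open>\<Lambda>\<close>, which removes the operator
  at \<open>u0\<close>. The remainder \<open>g\<close> is small when \<open>w\<close> and
  \<open>w1\<close> are close to \<open>c u1\<close> and \<open>c u2\<close>, the quotient by
  \<epsilon> being harmless because \<open>z - u0\<close> is of order \<epsilon> along the
  branch.\<close>

lemma pairing_identity:
  fixes c :: real
  assumes e: "\<epsilon> \<noteq> 0" and z: "C2p z z1 z2"
    and eq: "\<And>x. - of_real d * z2 x + \<i> * of_real (\<epsilon> * V x) * z1 x + (of_real \<zeta> - \<i> * of_real \<mu>) * z x
        - of_real ((cmod (z x))\<^sup>2) * z x + \<i> * of_real f0 = 0"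
    and w: "C2p w w1 w2" and y: "y \<in> C0p" and ew: "\<And>x. evo d \<zeta> \<mu> (\<epsilon> * V x) (z x) (w x) (w1 x) (w2 x) = y x"
  defines "g \<equiv> \<lambda>x. \<i> * of_real (V x) * (w1 x - of_real c * z2 x)
     + of_real (1 / \<epsilon>) * (lin d \<zeta> \<mu> (z x) (w x - of_real c * z1 x) 0 - lin d \<zeta> \<mu> (u0 x) (w x - of_real c * z1 x) 0)"
  shows "g \<in> C0p" "\<Lambda> (\<lambda>x. \<i> * y x) + c * \<epsilon> * \<Lambda> (\<lambda>x. \<i> * of_real (V1 x) * z1 x) = \<epsilon> * \<Lambda> g"
proof -
  obtain z3 where z3: "C2p z1 z2 z3"
    and e3: "\<And>x. lin d \<zeta> \<mu> (z x) (z1 x) (z3 x) + \<i> * of_real (\<epsilon> * V x) * z2 x = - \<i> * of_real (\<epsilon> * V1 x) * z1 x"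
    using solution_derivative[OF z eq] by blast
  define W where "W x = w x - of_real c * z1 x" for x
  define W2 where "W2 x = w2 x - of_real c * z3 x" for x
  have W: "C2p W (\<lambda>x. w1 x - of_real c * z2 x) W2" unfolding W_def W2_def by (intro C2p_diff w C2p_mult z3)
  have c0: "W \<in> C0p" "z \<in> C0p" "z1 \<in> C0p" "z2 \<in> C0p" "w1 \<in> C0p" using W z w by (auto dest: C2pD)
  show g: "g \<in> C0p" unfolding g_def W_def[symmetric] by (intro C0p_ints C0p_lin V c0 u_C0p)
  have iy: "(\<lambda>x. \<i> * y x) \<in> C0p" and iV: "(\<lambda>x. \<i> * of_real (V1 x) * z1 x) \<in> C0p"
    by (intro C0p_ints y V1 c0)+
  have pt: "lin d \<zeta> \<mu> (u0 x) (W x) (W2 x) = (\<i> * y x + of_real (c * \<epsilon>) * (\<i> * of_real (V1 x) * z1 x)) - of_real \<epsilon> * g x" for x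
  proof -
    have "of_real \<epsilon> * g x = \<i> * of_real (\<epsilon> * V x) * (w1 x - of_real c * z2 x)
     + (lin d \<zeta> \<mu> (z x) (W x) 0 - lin d \<zeta> \<mu> (u0 x) (W x) 0)"
      using e by (simp add: g_def W_def algebra_simps)
    moreover have "lin d \<zeta> \<mu> (z x) (W x) 0 - lin d \<zeta> \<mu> (u0 x) (W x) 0 = lin d \<zeta> \<mu> (z x) (W x) (W2 x) - lin d \<zeta> \<mu> (u0 x) (W x) (W2 x)"
      by (simp add: lin_def)
    moreover have "lin d \<zeta> \<mu> (z x) (W x) (W2 x) = lin d \<zeta> \<mu> (z x) (w x) (w2 x) - of_real c * lin d \<zeta> \<mu> (z x) (z1 x) (z3 x)"
      by (simp add: lin_def W_def W2_def algebra_simps)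
    moreover have "lin d \<zeta> \<mu> (z x) (w x) (w2 x) = \<i> * y x - \<i> * of_real (\<epsilon> * V x) * w1 x"
      using arg_cong[OF ew[of x], of "\<lambda>t. \<i> * t"] by (simp add: evo_def algebra_simps)
    moreover have "lin d \<zeta> \<mu> (z x) (z1 x) (z3 x) = - \<i> * of_real (\<epsilon> * V1 x) * z1 x - \<i> * of_real (\<epsilon> * V x) * z2 x"
      using e3[of x] by (simp add: algebra_simps)
    ultimately show ?thesis by (simp add: algebra_simps)
  qed
  have "0 = \<Lambda> (\<lambda>x. lin d \<zeta> \<mu> (u0 x) (W x) (W2 x))" using \<Lambda>_lin[OF W] by simp
  also have "\<dots> = (\<Lambda> (\<lambda>x. \<i> * y x) + c * \<epsilon> * \<Lambda> (\<lambda>x. \<i> * of_real (V1 x) * z1 x)) - \<epsilon> * \<Lambda> g"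
    unfolding pt
    by (subst \<Lambda>_diff, (intro C0p_ints iy iV g)+, subst \<Lambda>_add, (intro C0p_ints iy iV)+)
       (simp only: \<Lambda>_scale[OF iV] \<Lambda>_scale[OF g])
  finally show "\<Lambda> (\<lambda>x. \<i> * y x) + c * \<epsilon> * \<Lambda> (\<lambda>x. \<i> * of_real (V1 x) * z1 x) = \<epsilon> * \<Lambda> g" by simp
qed

lemma ulim_of_le:
  assumes "\<And>n x. norm (f n x - g x) \<le> C * \<bar>\<epsilon> n\<bar>" "\<epsilon> \<longlonglongrightarrow> 0"
  shows "ulim f g"
proof -
  have "ulim (\<lambda>n x. f n x - g x) (\<lambda>x. 0)"
    by (rule ulim_dominated[OF ulim_const[OF assms(2)] ulim_const[OF assms(2)], of _ "\<bar>C\<bar>"])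
       (rule order_trans[OF assms(1)], auto simp: intro!: mult_mono)
  moreover have "ulim (\<lambda>n. g) g" by (rule uniform_limit_const)
  ultimately have "ulim (\<lambda>n x. (f n x - g x) + g x) (\<lambda>x. 0 + g x)" by (rule uniform_limit_add)
  then show ?thesis by simp
qed

text \<open>The two pairing identities say that the matrix of \<alpha> + i \<beta>, applied to
  \<open>(Aa, Ab)\<close>, equals \<epsilon> times a vector tending to
  \<open>- \<nu> (c1, c2)\<close>. The inner product with \<open>(Aa, Ab)\<close> eliminates
  \<beta>, and \<open>(Aa, Ab)\<close> tends to the nonzero vector \<open>(c1, c2)\<close>.\<close>

lemma eigenvalue_quotient_limit:
  assumes e: "\<And>n. \<epsilon> n \<noteq> 0" "\<epsilon> \<longlonglongrightarrow> 0" and z: "\<And>n. C2p (z n) (z1 n) (z2 n)"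
    and eq: "\<And>n x. - of_real d * z2 n x + \<i> * of_real (\<epsilon> n * V x) * z1 n x + (of_real \<zeta> - \<i> * of_real \<mu>) * z n x
        - of_real ((cmod (z n x))\<^sup>2) * z n x + \<i> * of_real f0 = 0"
    and close: "\<And>n x. norm (z n x - u0 x) \<le> C * \<bar>\<epsilon> n\<bar>" "\<And>n x. norm (z1 n x - u1 x) \<le> C * \<bar>\<epsilon> n\<bar>"
    and a: "\<And>n. C2p (a n) (a1 n) (a2 n)" and b: "\<And>n. C2p (b n) (b1 n) (b2 n)"
    and eqa: "\<And>n x. evo d \<zeta> \<mu> (\<epsilon> n * V x) (z n x) (a n x) (a1 n x) (a2 n x) = of_real (\<alpha> n) * a n x - of_real (\<beta> n) * b n x"
    and eqb: "\<And>n x. evo d \<zeta> \<mu> (\<epsilon> n * V x) (z n x) (b n x) (b1 n x) (b2 n x) = of_real (\<beta> n) * a n x + of_real (\<alpha> n) * b n x"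
    and lim: "ulim a (\<lambda>x. of_real c1 * u1 x)" "ulim a1 (\<lambda>x. of_real c1 * u2 x)"
      "ulim b (\<lambda>x. of_real c2 * u1 x)" "ulim b1 (\<lambda>x. of_real c2 * u2 x)"
    and c: "c1 \<noteq> 0 \<or> c2 \<noteq> 0"
  shows "(\<lambda>n. \<alpha> n / \<epsilon> n) \<longlonglongrightarrow> - \<nu>"
proof -
  have zl: "ulim z u0" "ulim z1 u1" using ulim_of_le[OF close(1) e(2)] ulim_of_le[OF close(2) e(2)] by auto
  obtain BV where BV: "BV > 0" "\<And>x. norm (V x) \<le> BV" using C0p_bounded[OF V] by blast
  have eVl: "ulim (\<lambda>n x. \<epsilon> n * V x) (\<lambda>x. 0)"
  proof (rule ulim_dominated[OF ulim_const[OF e(2)] ulim_const[OF e(2)], of _ BV])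
    fix n x
    show "norm (\<epsilon> n * V x) \<le> BV * (norm (\<epsilon> n) + norm (\<epsilon> n))"
      unfolding real_norm_def abs_mult mult.commute[of "\<bar>\<epsilon> n\<bar>"] using BV by (intro mult_mono) auto
  qed
  \<comment> \<open>No closeness of second derivatives is assumed; their convergence follows from
    the two stationary equations.\<close>
  have z2l: "ulim z2 u2"
  proof -
    have z2: "z2 n x = (\<i> * (of_real (\<epsilon> n * V x) * z1 n x) + (of_real \<zeta> - \<i> * of_real \<mu>) * z n x - (z n x * cnj (z n x)) * z n x + \<i> * of_real f0) / of_real d" for n x
      using eq[where n = n and x = x] d0 unfolding complex_norm_square by (simp add: field_simps)
    have u2: "u2 x = (\<i> * (of_real 0 * u1 x) + (of_real \<zeta> - \<i> * of_real \<mu>) * u0 x - (u0 x * cnj (u0 x)) * u0 x + \<i> * of_real f0) / of_real d" for x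
      using eq0[of x] d0 unfolding complex_norm_square by (simp add: field_simps)
    have "ulim (\<lambda>n x. (\<i> * (of_real (\<epsilon> n * V x) * z1 n x) + (of_real \<zeta> - \<i> * of_real \<mu>) * z n x - (z n x * cnj (z n x)) * z n x + \<i> * of_real f0) / of_real d)
      (\<lambda>x. (\<i> * (of_real 0 * u1 x) + (of_real \<zeta> - \<i> * of_real \<mu>) * u0 x - (u0 x * cnj (u0 x)) * u0 x + \<i> * of_real f0) / of_real d)"
      by (intro bounded_linear.uniform_limit[OF bounded_linear_divide] uniform_limit_add uniform_limit_minus
        bounded_linear.uniform_limit[OF bounded_linear_mult_right] ulim_mult uniform_limit_const
        bounded_linear.uniform_limit[OF bounded_linear_cnj] bounded_linear.uniform_limit[OF bounded_linear_of_real] eVl zl C0p_ints u_C0p)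
    then show ?thesis by (simp only: z2[symmetric] u2[symmetric])
  qed
  obtain A where A: "A > 0" "\<And>n x. norm (z n x) \<le> A" using ulim_uniformly_bounded[OF zl(1) C2pD(1)[OF z]] by blast
  have A0: "norm (u0 x) \<le> A" for x
    using LIMSEQ_le_const2[OF tendsto_norm[OF ulim_pointwise[OF zl(1), of x]]] A(2) by blast
  have C0: "C \<ge> 0" using close(1)[of 0 0] e(1)[of 0] norm_ge_zero by (metis order_trans zero_le_mult_iff abs_ge_zero abs_le_zero_iff)
  \<comment> \<open>The factor \<open>1 / \<epsilon> n\<close> is compensated by the bound on
    \<open>z n - u0\<close>, leaving a multiple of differences that tend to zero uniformly.\<close>
  have res: "(\<lambda>n. \<Lambda> (\<lambda>x. \<i> * of_real (V x) * (w1 n x - of_real c * z2 n x)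
     + of_real (1 / \<epsilon> n) * (lin d \<zeta> \<mu> (z n x) (w n x - of_real c * z1 n x) 0 - lin d \<zeta> \<mu> (u0 x) (w n x - of_real c * z1 n x) 0))) \<longlonglongrightarrow> 0"
    if w: "\<And>n. C2p (w n) (w1 n) (w2 n)" and wl: "ulim w (\<lambda>x. of_real c * u1 x)" "ulim w1 (\<lambda>x. of_real c * u2 x)"
      and g: "\<And>n. (\<lambda>x. \<i> * of_real (V x) * (w1 n x - of_real c * z2 n x)
     + of_real (1 / \<epsilon> n) * (lin d \<zeta> \<mu> (z n x) (w n x - of_real c * z1 n x) 0 - lin d \<zeta> \<mu> (u0 x) (w n x - of_real c * z1 n x) 0)) \<in> C0p" for w w1 w2 and c :: real
  proof -
    let ?g = "\<lambda>n. \<lambda>x. \<i> * of_real (V x) * (w1 n x - of_real c * z2 n x)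
     + of_real (1 / \<epsilon> n) * (lin d \<zeta> \<mu> (z n x) (w n x - of_real c * z1 n x) 0 - lin d \<zeta> \<mu> (u0 x) (w n x - of_real c * z1 n x) 0)"
    have "ulim (\<lambda>n x. w n x - of_real c * z1 n x) (\<lambda>x. of_real c * u1 x - of_real c * u1 x)"
      "ulim (\<lambda>n x. w1 n x - of_real c * z2 n x) (\<lambda>x. of_real c * u2 x - of_real c * u2 x)"
      by (intro uniform_limit_minus wl bounded_linear.uniform_limit[OF bounded_linear_mult_right] zl z2l)+
    then have "ulim (\<lambda>n x. w n x - of_real c * z1 n x) (\<lambda>x. 0)" "ulim (\<lambda>n x. w1 n x - of_real c * z2 n x) (\<lambda>x. 0)" by simp_all
    then have "ulim ?g (\<lambda>x. 0)"
    proof (rule ulim_dominated[where C = "6 * A * C + BV"])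
      fix n x
      let ?w = "w n x - of_real c * z1 n x"
      have 1: "norm (\<i> * of_real (V x) * (w1 n x - of_real c * z2 n x)) \<le> BV * norm (w1 n x - of_real c * z2 n x)"
        unfolding norm_mult using BV(2)[of x] by (simp add: mult_right_mono)
      have "norm (lin d \<zeta> \<mu> (z n x) ?w 0 - lin d \<zeta> \<mu> (u0 x) ?w 0) \<le> 6 * A * norm (z n x - u0 x) * norm ?w"
        by (rule lin_perturbation[OF A(2) A0])
      also have "\<dots> \<le> 6 * A * (C * \<bar>\<epsilon> n\<bar>) * norm ?w" using close(1) A(1) by (intro mult_right_mono mult_left_mono) auto
      finally have "\<bar>1 / \<epsilon> n\<bar> * norm (lin d \<zeta> \<mu> (z n x) ?w 0 - lin d \<zeta> \<mu> (u0 x) ?w 0) \<le> \<bar>1 / \<epsilon> n\<bar> * (6 * A * (C * \<bar>\<epsilon> n\<bar>) * norm ?w)"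
        by (rule mult_left_mono) simp
      also have "\<dots> = 6 * A * C * norm ?w" using e(1)[of n] by simp
      finally have 2: "norm (of_real (1 / \<epsilon> n) * (lin d \<zeta> \<mu> (z n x) ?w 0 - lin d \<zeta> \<mu> (u0 x) ?w 0)) \<le> 6 * A * C * norm ?w"
        by (simp only: norm_mult norm_of_real)
      have "norm (?g n x) \<le> BV * norm (w1 n x - of_real c * z2 n x) + 6 * A * C * norm ?w"
        by (rule order_trans[OF norm_triangle_ineq]) (use 1 2 in linarith)
      also have "\<dots> \<le> (6 * A * C + BV) * (norm ?w + norm (w1 n x - of_real c * z2 n x))"
        using A(1) C0 BV(1) by (simp add: algebra_simps)
      finally show "norm (?g n x) \<le> (6 * A * C + BV) * (norm ?w + norm (w1 n x - of_real c * z2 n x))" .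
    qed
    from \<Lambda>_ulim[OF this g] show ?thesis
      using \<Lambda>_scale[OF C0p_intros(1)[of 0], of 0] by simp
  qed
  define Aa where "Aa n = \<Lambda> (\<lambda>x. \<i> * a n x)" for n
  define Ab where "Ab n = \<Lambda> (\<lambda>x. \<i> * b n x)" for n
  define N where "N n = \<Lambda> (\<lambda>x. \<i> * of_real (V1 x) * z1 n x)" for n
  define ga where "ga n x = \<i> * of_real (V x) * (a1 n x - of_real c1 * z2 n x)
     + of_real (1 / \<epsilon> n) * (lin d \<zeta> \<mu> (z n x) (a n x - of_real c1 * z1 n x) 0 - lin d \<zeta> \<mu> (u0 x) (a n x - of_real c1 * z1 n x) 0)" for n x
  define gb where "gb n x = \<i> * of_real (V x) * (b1 n x - of_real c2 * z2 n x)
     + of_real (1 / \<epsilon> n) * (lin d \<zeta> \<mu> (z n x) (b n x - of_real c2 * z1 n x) 0 - lin d \<zeta> \<mu> (u0 x) (b n x - of_real c2 * z1 n x) 0)" for n x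
  have ca: "(\<lambda>x. \<i> * a n x) \<in> C0p" "(\<lambda>x. \<i> * b n x) \<in> C0p" "a n \<in> C0p" "b n \<in> C0p" for n
    using C2pD(1)[OF a] C2pD(1)[OF b] by (auto intro: C0p_ints)
  have ya: "(\<lambda>x. of_real (\<alpha> n) * a n x - of_real (\<beta> n) * b n x) \<in> C0p" and yb: "(\<lambda>x. of_real (\<beta> n) * a n x + of_real (\<alpha> n) * b n x) \<in> C0p" for n
    by (intro C0p_ints ca)+
  note pa = pairing_identity[OF e(1) z eq a ya eqa, where c = c1, folded ga_def N_def]
  note pb = pairing_identity[OF e(1) z eq b yb eqb, where c = c2, folded gb_def N_def]
  have la: "\<Lambda> (\<lambda>x. \<i> * (of_real (\<alpha> n) * a n x - of_real (\<beta> n) * b n x)) = \<alpha> n * Aa n - \<beta> n * Ab n" for n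
  proof -
    have "(\<lambda>x. \<i> * (of_real (\<alpha> n) * a n x - of_real (\<beta> n) * b n x)) = (\<lambda>x. of_real (\<alpha> n) * (\<i> * a n x) - of_real (\<beta> n) * (\<i> * b n x))"
      by (simp add: algebra_simps)
    then show ?thesis unfolding Aa_def Ab_def
      by (simp only: \<Lambda>_diff[OF C0p_intros_alg(1)[OF C0p_intros(1) ca(1)] C0p_intros_alg(1)[OF C0p_intros(1) ca(2)]] \<Lambda>_scale ca)
  qed
  have lb: "\<Lambda> (\<lambda>x. \<i> * (of_real (\<beta> n) * a n x + of_real (\<alpha> n) * b n x)) = \<beta> n * Aa n + \<alpha> n * Ab n" for n
  proof -
    have "(\<lambda>x. \<i> * (of_real (\<beta> n) * a n x + of_real (\<alpha> n) * b n x)) = (\<lambda>x. of_real (\<beta> n) * (\<i> * a n x) + of_real (\<alpha> n) * (\<i> * b n x))"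
      by (simp add: algebra_simps)
    then show ?thesis unfolding Aa_def Ab_def
      by (simp only: \<Lambda>_add[OF C0p_intros_alg(1)[OF C0p_intros(1) ca(1)] C0p_intros_alg(1)[OF C0p_intros(1) ca(2)]] \<Lambda>_scale ca)
  qed
  have ra: "(\<lambda>n. \<Lambda> (ga n)) \<longlonglongrightarrow> 0"
    using res[OF a lim(1,2) pa(1)[unfolded ga_def]] unfolding ga_def .
  have rb: "(\<lambda>n. \<Lambda> (gb n)) \<longlonglongrightarrow> 0"
    using res[OF b lim(3,4) pb(1)[unfolded gb_def]] unfolding gb_def .
  have iu1: "(\<lambda>x. \<i> * u1 x) \<in> C0p" by (intro C0p_ints u_C0p)
  have Al: "Aa \<longlonglongrightarrow> c1" "Ab \<longlonglongrightarrow> c2"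
  proof -
    have "Aa \<longlonglongrightarrow> \<Lambda> (\<lambda>x. \<i> * (of_real c1 * u1 x))" "Ab \<longlonglongrightarrow> \<Lambda> (\<lambda>x. \<i> * (of_real c2 * u1 x))"
      unfolding Aa_def Ab_def by (rule \<Lambda>_ulim; intro bounded_linear.uniform_limit[OF bounded_linear_mult_right] lim ca)+
    moreover have "\<Lambda> (\<lambda>x. \<i> * (of_real k * u1 x)) = k" for k
      using \<Lambda>_scale[OF iu1, of k] \<Lambda>_u1 by (simp add: mult.left_commute)
    ultimately show "Aa \<longlonglongrightarrow> c1" "Ab \<longlonglongrightarrow> c2" by simp_all
  qed
  have Nl: "N \<longlonglongrightarrow> \<nu>"
    unfolding N_def \<Lambda>_V1[symmetric]
    by (rule \<Lambda>_ulim) (intro ulim_mult uniform_limit_const zl u_C0p C0p_ints V1 C2pD(2)[OF z])+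
  have q: "(c1 * (- c1 * \<nu> + 0) + c2 * (- c2 * \<nu> + 0)) / (c1\<^sup>2 + c2\<^sup>2) = - \<nu>" and nz: "c1\<^sup>2 + c2\<^sup>2 \<noteq> 0"
  proof -
    show nz: "c1\<^sup>2 + c2\<^sup>2 \<noteq> 0" using c by (simp add: sum_power2_eq_zero_iff)
    have "c1 * (- c1 * \<nu> + 0) + c2 * (- c2 * \<nu> + 0) = - \<nu> * (c1\<^sup>2 + c2\<^sup>2)" by (simp add: power2_eq_square algebra_simps)
    then show "(c1 * (- c1 * \<nu> + 0) + c2 * (- c2 * \<nu> + 0)) / (c1\<^sup>2 + c2\<^sup>2) = - \<nu>" using nz by simp
  qed
  have den: "(\<lambda>n. (Aa n)\<^sup>2 + (Ab n)\<^sup>2) \<longlonglongrightarrow> c1\<^sup>2 + c2\<^sup>2" by (intro tendsto_intros Al)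
  have "(\<lambda>n. (Aa n * (- c1 * N n + \<Lambda> (ga n)) + Ab n * (- c2 * N n + \<Lambda> (gb n))) / ((Aa n)\<^sup>2 + (Ab n)\<^sup>2)) \<longlonglongrightarrow> - \<nu>"
    unfolding q[symmetric] by (intro tendsto_intros Al Nl ra rb nz)
  moreover have "\<forall>\<^sub>F n in sequentially. (Aa n * (- c1 * N n + \<Lambda> (ga n)) + Ab n * (- c2 * N n + \<Lambda> (gb n))) / ((Aa n)\<^sup>2 + (Ab n)\<^sup>2) = \<alpha> n / \<epsilon> n"
    using tendsto_imp_eventually_ne[OF den nz]
  proof eventually_elim
    case (elim n)
    have 1: "\<alpha> n * Aa n - \<beta> n * Ab n + c1 * \<epsilon> n * N n = \<epsilon> n * \<Lambda> (ga n)" using pa(2)[of n] unfolding la .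
    have 2: "\<beta> n * Aa n + \<alpha> n * Ab n + c2 * \<epsilon> n * N n = \<epsilon> n * \<Lambda> (gb n)" using pb(2)[of n] unfolding lb .
    have "\<epsilon> n * (Aa n * (- c1 * N n + \<Lambda> (ga n)) + Ab n * (- c2 * N n + \<Lambda> (gb n)))
      = Aa n * (\<epsilon> n * \<Lambda> (ga n) - c1 * \<epsilon> n * N n) + Ab n * (\<epsilon> n * \<Lambda> (gb n) - c2 * \<epsilon> n * N n)" by (simp add: algebra_simps)
    also have "\<dots> = \<alpha> n * ((Aa n)\<^sup>2 + (Ab n)\<^sup>2)" unfolding 1[symmetric] 2[symmetric] by (simp add: algebra_simps power2_eq_square)
    finally show ?case using elim e(1)[of n] by (simp add: field_simps)
  qed
  ultimately show ?thesis by (rule Lim_transform_eventually)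
qed

lemma ev_pair_scale:
  assumes "ev_pair \<epsilon> z \<alpha> \<beta> a a1 a2 b b1 b2" "m \<noteq> 0"
  shows "ev_pair \<epsilon> z \<alpha> \<beta> (\<lambda>x. of_real m * a x) (\<lambda>x. of_real m * a1 x) (\<lambda>x. of_real m * a2 x)
    (\<lambda>x. of_real m * b x) (\<lambda>x. of_real m * b1 x) (\<lambda>x. of_real m * b2 x)"
proof -
  have ab: "C2p a a1 a2" "C2p b b1 b2" "\<not> (\<forall>x. a x = 0 \<and> b x = 0)"
    and ea: "\<And>x. evo d \<zeta> \<mu> (\<epsilon> * V x) (z x) (a x) (a1 x) (a2 x) = of_real \<alpha> * a x - of_real \<beta> * b x"
    and eb: "\<And>x. evo d \<zeta> \<mu> (\<epsilon> * V x) (z x) (b x) (b1 x) (b2 x) = of_real \<beta> * a x + of_real \<alpha> * b x"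
    using assms(1) unfolding ev_pair_def by blast+
  show ?thesis unfolding ev_pair_def evo_cmult ea eb
    using ab assms(2) by (auto intro!: C2p_mult simp: right_diff_distrib distrib_left mult.left_commute)
qed

text \<open>First derivatives take part in the normalization, as \<open>ulim_nonzero\<close>
  requires.\<close>

lemma ev_pair_normalize:
  assumes "ev_pair \<epsilon> z \<alpha> \<beta> a a1 a2 b b1 b2"
  obtains p p1 p2 q q1 q2 where "ev_pair \<epsilon> z \<alpha> \<beta> p p1 p2 q q1 q2"
    "\<And>x. norm (p x) + norm (p1 x) + norm (q x) + norm (q1 x) \<le> 1"
    "\<exists>x. norm (p x) + norm (p1 x) + norm (q x) + norm (q1 x) \<ge> 1"
proof -
  have ab: "C2p a a1 a2" "C2p b b1 b2" "\<not> (\<forall>x. a x = 0 \<and> b x = 0)" using assms by (auto simp: ev_pair_def)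
  define G where "G x = norm (a x) + norm (a1 x) + norm (b x) + norm (b1 x)" for x
  have "G \<in> C0p" unfolding G_def by (intro C0p_ints C2pD(1,2)[OF ab(1)] C2pD(1,2)[OF ab(2)])
  then obtain y where y: "\<And>x. G x \<le> G y" using C0p_attains by blast
  obtain x1 where "a x1 \<noteq> 0 \<or> b x1 \<noteq> 0" using ab(3) by blast
  then have "norm (a x1) > 0 \<or> norm (b x1) > 0" by simp
  then have "G x1 > 0" unfolding G_def
    using norm_ge_zero[of "a x1"] norm_ge_zero[of "a1 x1"] norm_ge_zero[of "b x1"] norm_ge_zero[of "b1 x1"] by linarith
  then have m: "G y > 0" using y[of x1] by linarith
  have G: "norm (of_real (1 / G y) * a x) + norm (of_real (1 / G y) * a1 x) + norm (of_real (1 / G y) * b x) + norm (of_real (1 / G y) * b1 x) = G x / G y" for x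
    using m by (simp add: norm_mult norm_divide G_def[of x] add_divide_distrib)
  show ?thesis
  proof (rule that[OF ev_pair_scale[OF assms, of "1 / G y"]], unfold G)
    show "1 / G y \<noteq> 0" "G x / G y \<le> 1" for x using m y[of x] by simp_all
    show "\<exists>x. 1 \<le> G x / G y" using m by (intro exI[of _ y]) simp
  qed
qed

text \<open>The limit eigenvalue has nonnegative real part, so \<open>no_eigenvalue\<close> forces
  it to be 0, and the limit eigenfunctions are multiples of \<open>u1\<close>. A lower bound
  \<open>- \<tau> n\<close> tending to zero, rather than 0, admits the possibly negative eigenvalue
  supplied by the contraction.\<close>

lemma critical_eigenvalue_subsequence:
  assumes e: "\<And>n. \<epsilon> n \<noteq> 0" "\<epsilon> \<longlonglongrightarrow> 0" and z: "\<And>n. C2p (z n) (z1 n) (z2 n)"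
    and eq: "\<And>n x. - of_real d * z2 n x + \<i> * of_real (\<epsilon> n * V x) * z1 n x + (of_real \<zeta> - \<i> * of_real \<mu>) * z n x
        - of_real ((cmod (z n x))\<^sup>2) * z n x + \<i> * of_real f0 = 0"
    and close: "\<And>n x. norm (z n x - u0 x) \<le> C * \<bar>\<epsilon> n\<bar>" "\<And>n x. norm (z1 n x - u1 x) \<le> C * \<bar>\<epsilon> n\<bar>"
    and ev: "\<And>n. ev_pair (\<epsilon> n) (z n) (\<alpha> n) (\<beta> n) (a n) (a1 n) (a2 n) (b n) (b1 n) (b2 n)"
    and bd: "\<And>n. \<bar>\<alpha> n\<bar> \<le> M" "\<And>n. \<bar>\<beta> n\<bar> \<le> M" and low: "\<And>n. - \<tau> n \<le> \<alpha> n" "\<tau> \<longlonglongrightarrow> 0"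
  obtains r where "strict_mono r" "(\<lambda>n. \<alpha> (r n) / \<epsilon> (r n)) \<longlonglongrightarrow> - \<nu>"
proof -
  have "\<forall>n. \<exists>p p1 p2 q q1 q2. ev_pair (\<epsilon> n) (z n) (\<alpha> n) (\<beta> n) p p1 p2 q q1 q2 \<and>
    (\<forall>x. norm (p x) + norm (p1 x) + norm (q x) + norm (q1 x) \<le> 1) \<and>
    (\<exists>x. norm (p x) + norm (p1 x) + norm (q x) + norm (q1 x) \<ge> 1)"
    using ev_pair_normalize[OF ev] by metis
  then obtain p p1 p2 q q1 q2 where evp: "\<And>n. ev_pair (\<epsilon> n) (z n) (\<alpha> n) (\<beta> n) (p n) (p1 n) (p2 n) (q n) (q1 n) (q2 n)"
    and le1: "\<And>n x. norm (p n x) + norm (p1 n x) + norm (q n x) + norm (q1 n x) \<le> 1"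
    and ge1: "\<And>n. \<exists>x. norm (p n x) + norm (p1 n x) + norm (q n x) + norm (q1 n x) \<ge> 1" by metis
  let ?z = "\<lambda>(n::nat) (x::real). 0 :: complex"
  have P: "C2p (p n) (p1 n) (p2 n)" and Q: "C2p (q n) (q1 n) (q2 n)"
    and eqp: "evo d \<zeta> \<mu> (\<epsilon> n * V x) (z n x) (p n x) (p1 n x) (p2 n x) = of_real (\<alpha> n) * p n x - of_real (\<beta> n) * q n x"
    and eqq: "evo d \<zeta> \<mu> (\<epsilon> n * V x) (z n x) (q n x) (q1 n x) (q2 n x) = of_real (\<beta> n) * p n x + of_real (\<alpha> n) * q n x" for n x
    using evp[of n] unfolding ev_pair_def by blast+
  have eqp': "evo d \<zeta> \<mu> (\<epsilon> n * V x) (z n x) (p n x) (p1 n x) (p2 n x) = of_real (\<alpha> n) * p n x - of_real (\<beta> n) * q n x + ?z n x"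
    and eqq': "evo d \<zeta> \<mu> (\<epsilon> n * V x) (z n x) (q n x) (q1 n x) (q2 n x) = of_real (\<beta> n) * p n x + of_real (\<alpha> n) * q n x + ?z n x" for n x
    using eqp eqq by simp_all
  have n1: "norm (p n x) \<le> max M 1" "norm (p1 n x) \<le> max M 1" "norm (q n x) \<le> max M 1" "norm (q1 n x) \<le> max M 1" for n x
  proof -
    have "1 \<le> max M 1" by simp
    then show "norm (p n x) \<le> max M 1" "norm (p1 n x) \<le> max M 1" "norm (q n x) \<le> max M 1" "norm (q1 n x) \<le> max M 1"
      using le1[of n x] norm_ge_zero[of "p n x"] norm_ge_zero[of "p1 n x"] norm_ge_zero[of "q n x"] norm_ge_zero[of "q1 n x"] by linarith+
  qed
  have n2: "\<bar>\<alpha> n\<bar> \<le> max M 1" "\<bar>\<beta> n\<bar> \<le> max M 1" for n using bd[of n] by auto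
  obtain BV where BV: "BV > 0" "\<And>x. norm (V x) \<le> BV" using C0p_bounded[OF V] by blast
  have cl: "ulim (\<lambda>n x. \<epsilon> n * V x) (\<lambda>x. 0)"
  proof (rule ulim_of_le[OF _ e(2)])
    show "norm (\<epsilon> n * V x - 0) \<le> BV * \<bar>\<epsilon> n\<bar>" for n x
      using BV(2)[of x] by (simp add: abs_mult mult.commute mult_right_mono)
  qed
  have c0: "(\<lambda>x. \<epsilon> n * V x) \<in> C0p" "z n \<in> C0p" "?z n \<in> C0p" for n by (intro C0p_ints V C2pD(1)[OF z])+
  obtain r P' P1' P2' Q' Q1' Q2' \<alpha>' \<beta>' where r: "strict_mono r" and al: "(\<lambda>n. \<alpha> (r n)) \<longlonglongrightarrow> \<alpha>'"
    and P': "C2p P' P1' P2'" and Q': "C2p Q' Q1' Q2'"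
    and lim: "ulim (\<lambda>n. p (r n)) P'" "ulim (\<lambda>n. p1 (r n)) P1'" "ulim (\<lambda>n. q (r n)) Q'" "ulim (\<lambda>n. q1 (r n)) Q1'"
    and eP: "\<And>x. evo d \<zeta> \<mu> 0 (u0 x) (P' x) (P1' x) (P2' x) = of_real \<alpha>' * P' x - of_real \<beta>' * Q' x + 0"
    and eQ: "\<And>x. evo d \<zeta> \<mu> 0 (u0 x) (Q' x) (Q1' x) (Q2' x) = of_real \<beta>' * P' x + of_real \<alpha>' * Q' x + 0"
    by (rule evo_compactness[OF d0 P Q eqp' eqq' n1 n2 cl ulim_of_le[OF close(1) e(2)] uniform_limit_const uniform_limit_const c0 c0(3)]) (rule that)
  have nz: "\<not> (\<forall>x. P' x = 0 \<and> Q' x = 0)" by (rule ulim_nonzero[OF P' Q' lim ge1])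
  have tr: "(\<lambda>n. \<tau> (r n)) \<longlonglongrightarrow> 0" using LIMSEQ_subseq_LIMSEQ[OF low(2) r] by (simp add: o_def)
  have "- 0 \<le> \<alpha>'" by (rule LIMSEQ_le[OF tendsto_minus[OF tr] al]) (use low(1) in blast)
  then have a0: "0 \<le> \<alpha>'" by simp
  have z0: "\<alpha>' = 0" "\<beta>' = 0"
  proof -
    have "\<not> (\<alpha>' \<noteq> 0 \<or> \<beta>' \<noteq> 0)"
    proof
      assume "\<alpha>' \<noteq> 0 \<or> \<beta>' \<noteq> 0"
      from no_eigenvalue[OF P' Q' a0 this] eP eQ nz show False by simp
    qed
    then show "\<alpha>' = 0" "\<beta>' = 0" by auto
  qed
  have "\<forall>x. lin d \<zeta> \<mu> (u0 x) (P' x) (P2' x) = 0" "\<forall>x. lin d \<zeta> \<mu> (u0 x) (Q' x) (Q2' x) = 0"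
    using eP eQ by (auto simp: evo_lin z0)
  then obtain c1 c2 where c1: "\<And>x. P' x = of_real c1 * u1 x" and c2: "\<And>x. Q' x = of_real c2 * u1 x"
    using kernel[OF P'] kernel[OF Q'] by blast
  have P'': "P' = (\<lambda>x. of_real c1 * u1 x)" and Q'': "Q' = (\<lambda>x. of_real c2 * u1 x)" using c1 c2 by auto
  have P1'': "P1' = (\<lambda>x. of_real c1 * u2 x)" using C2p_unique(1)[OF P'[unfolded P''] C2p_mult[OF u1, of "of_real c1"]] .
  have Q1'': "Q1' = (\<lambda>x. of_real c2 * u2 x)" using C2p_unique(1)[OF Q'[unfolded Q''] C2p_mult[OF u1, of "of_real c2"]] .
  have "c1 \<noteq> 0 \<or> c2 \<noteq> 0" using nz c1 c2 by auto
  moreover have "(\<lambda>n. \<epsilon> (r n)) \<longlonglongrightarrow> 0" using LIMSEQ_subseq_LIMSEQ[OF e(2) r] by (simp add: o_def)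
  ultimately have "(\<lambda>n. \<alpha> (r n) / \<epsilon> (r n)) \<longlonglongrightarrow> - \<nu>"
    by (intro eigenvalue_quotient_limit[of "\<lambda>n. \<epsilon> (r n)" "\<lambda>n. z (r n)" "\<lambda>n. z1 (r n)" "\<lambda>n. z2 (r n)" C
        "\<lambda>n. p (r n)" "\<lambda>n. p1 (r n)" "\<lambda>n. p2 (r n)" "\<lambda>n. q (r n)" "\<lambda>n. q1 (r n)" "\<lambda>n. q2 (r n)"
        "\<lambda>n. \<alpha> (r n)" "\<lambda>n. \<beta> (r n)" c1 c2])
      (use e(1) z eq close P Q eqp eqq lim[unfolded P'' P1'' Q'' Q1''] in blast)+
  then show ?thesis using that r by blast
qed

text \<open>A counterexample to either claim supplies a bounded eigenvalue with
  \<open>\<alpha> * (\<nu> * \<epsilon>) \<ge> 0\<close>: an unstable one if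
  \<open>\<nu> * \<epsilon> > 0\<close>, otherwise the small real one, which then is not positive.
  Along a sequence this contradicts the limit \<open>- \<nu>\<close> of
  \<open>\<alpha> / \<epsilon>\<close>.\<close>

lemma stability_dichotomy:
  assumes es: "\<epsilon>s > 0" and z: "\<And>\<epsilon>. \<bar>\<epsilon>\<bar> < \<epsilon>s \<Longrightarrow> C2p (z \<epsilon>) (z1 \<epsilon>) (z2 \<epsilon>)"
    and eq: "\<And>\<epsilon> x. \<bar>\<epsilon>\<bar> < \<epsilon>s \<Longrightarrow> - of_real d * z2 \<epsilon> x + \<i> * of_real (\<epsilon> * V x) * z1 \<epsilon> x + (of_real \<zeta> - \<i> * of_real \<mu>) * z \<epsilon> x
        - of_real ((cmod (z \<epsilon> x))\<^sup>2) * z \<epsilon> x + \<i> * of_real f0 = 0"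
    and close: "\<And>\<epsilon> x. \<bar>\<epsilon>\<bar> < \<epsilon>s \<Longrightarrow> norm (z \<epsilon> x - u0 x) \<le> C * \<bar>\<epsilon>\<bar>" "\<And>\<epsilon> x. \<bar>\<epsilon>\<bar> < \<epsilon>s \<Longrightarrow> norm (z1 \<epsilon> x - u1 x) \<le> C * \<bar>\<epsilon>\<bar>"
  obtains \<epsilon>0 where "\<epsilon>0 > 0" "\<epsilon>0 \<le> \<epsilon>s"
    "\<And>\<epsilon> \<alpha> \<beta> a a1 a2 b b1 b2. \<lbrakk>\<bar>\<epsilon>\<bar> < \<epsilon>0; \<nu> * \<epsilon> > 0; ev_pair \<epsilon> (z \<epsilon>) \<alpha> \<beta> a a1 a2 b b1 b2\<rbrakk> \<Longrightarrow> \<alpha> \<le> 0"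
    "\<And>\<epsilon>. \<lbrakk>\<bar>\<epsilon>\<bar> < \<epsilon>0; \<nu> * \<epsilon> < 0\<rbrakk> \<Longrightarrow> \<exists>\<alpha> \<beta> a a1 a2 b b1 b2. ev_pair \<epsilon> (z \<epsilon>) \<alpha> \<beta> a a1 a2 b b1 b2 \<and> \<alpha> > 0"
proof -
  obtain U where U: "U > 0" "\<And>x. norm (u0 x) \<le> U" using C0p_bounded[OF u_C0p(1)] by blast
  obtain BV where BV: "BV > 0" "\<And>x. norm (V x) \<le> BV" using C0p_bounded[OF V] by blast
  have C0: "C \<ge> 0"
  proof -
    have "\<bar>\<epsilon>s / 2\<bar> < \<epsilon>s" using es by simp
    from order_trans[OF norm_ge_zero close(1)[OF this, of 0]] show ?thesis using es by (simp add: zero_le_mult_iff)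
  qed
  have "U + C \<ge> 0" using U C0 by simp
  then obtain R \<epsilon>b where eb: "\<epsilon>b > 0" and R: "\<And>\<epsilon> y \<alpha> \<beta> a a1 a2 b b1 b2. \<lbrakk>\<bar>\<epsilon>\<bar> \<le> \<epsilon>b; \<And>x. norm (y x) \<le> U + C; 0 \<le> \<alpha>; ev_pair \<epsilon> y \<alpha> \<beta> a a1 a2 b b1 b2\<rbrakk>
     \<Longrightarrow> \<bar>\<alpha>\<bar> \<le> R \<and> \<bar>\<beta>\<bar> \<le> R"
    by (rule eigenvalue_bound) (rule that; blast)
  define good where "good \<epsilon> \<longleftrightarrow> (\<nu> * \<epsilon> > 0 \<longrightarrow> (\<forall>\<alpha> \<beta> a a1 a2 b b1 b2. ev_pair \<epsilon> (z \<epsilon>) \<alpha> \<beta> a a1 a2 b b1 b2 \<longrightarrow> \<alpha> \<le> 0)) \<and>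
    (\<nu> * \<epsilon> < 0 \<longrightarrow> (\<exists>\<alpha> \<beta> a a1 a2 b b1 b2. ev_pair \<epsilon> (z \<epsilon>) \<alpha> \<beta> a a1 a2 b b1 b2 \<and> \<alpha> > 0))" for \<epsilon>
  have "\<exists>\<epsilon>0>0. \<epsilon>0 \<le> \<epsilon>s \<and> (\<forall>\<epsilon>. \<bar>\<epsilon>\<bar> < \<epsilon>0 \<longrightarrow> good \<epsilon>)"
  proof (rule ccontr)
    assume neg: "\<not> ?thesis"
    have step: "\<exists>\<epsilon> \<alpha> \<beta> a a1 a2 b b1 b2. \<bar>\<epsilon>\<bar> < \<epsilon>s \<and> \<bar>\<epsilon>\<bar> \<le> 1 / real (Suc n) \<and> \<epsilon> \<noteq> 0 \<and> ev_pair \<epsilon> (z \<epsilon>) \<alpha> \<beta> a a1 a2 b b1 b2 \<and>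
      \<bar>\<alpha>\<bar> \<le> max R 1 \<and> \<bar>\<beta>\<bar> \<le> max R 1 \<and> - (1 / real (Suc n)) \<le> \<alpha> \<and> \<alpha> * (\<nu> * \<epsilon>) \<ge> 0" for n
    proof -
      have n0: "1 / real (Suc n) > 0" by simp
      obtain \<delta> where \<delta>: "\<delta> > 0" and rl: "\<And>y c. \<lbrakk>y \<in> C0p; c \<in> C0p; \<And>x. norm (y x - u0 x) \<le> \<delta>; \<And>x. \<bar>c x\<bar> \<le> \<delta>\<rbrakk> \<Longrightarrow>
        \<exists>a a1 a2 s. C2p a a1 a2 \<and> \<not> (\<forall>x. a x = 0) \<and> \<bar>s\<bar> \<le> 1 / real (Suc n) \<and>
        (\<forall>x. evo d \<zeta> \<mu> (c x) (y x) (a x) (a1 x) (a2 x) = of_real s * a x)"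
        by (rule real_eigenvalue_exists[OF n0]) (rule that; blast)
      \<comment> \<open>Small enough for the branch, for the eigenvalue bound, for the convergence
        to 0, and for both coefficient conditions of the eigenvalue contraction.\<close>
      define e0 where "e0 = min (min \<epsilon>s \<epsilon>b) (min (1 / real (Suc n)) (\<delta> / (C + BV)))"
      have CB: "C + BV > 0" using C0 BV by simp
      have e0: "e0 > 0" "e0 \<le> \<epsilon>s" "e0 \<le> \<epsilon>b" "e0 \<le> 1 / real (Suc n)" "e0 \<le> \<delta> / (C + BV)"
        using es eb n0 \<delta> CB unfolding e0_def by auto
      obtain \<epsilon> where ep: "\<bar>\<epsilon>\<bar> < e0" and bad: "\<not> good \<epsilon>" using neg e0(1,2) by blast
      have es': "\<bar>\<epsilon>\<bar> < \<epsilon>s" "\<bar>\<epsilon>\<bar> \<le> \<epsilon>b" "\<bar>\<epsilon>\<bar> \<le> 1 / real (Suc n)" using ep e0 by linarith+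
      have ed: "(C + BV) * \<bar>\<epsilon>\<bar> \<le> \<delta>"
      proof -
        have "(C + BV) * \<bar>\<epsilon>\<bar> \<le> (C + BV) * e0" using ep CB by (intro mult_left_mono) auto
        also have "\<dots> \<le> \<delta>" using e0(5) CB by (simp add: pos_le_divide_eq mult.commute)
        finally show ?thesis .
      qed
      have e1: "\<bar>\<epsilon>\<bar> \<le> 1" using es'(3) by (rule order_trans) simp
      have zU: "norm (z \<epsilon> x) \<le> U + C" for x
      proof -
        have "C * \<bar>\<epsilon>\<bar> \<le> C * 1" using e1 C0 by (rule mult_left_mono)
        moreover have "norm (z \<epsilon> x) \<le> norm (z \<epsilon> x - u0 x) + norm (u0 x)" using norm_triangle_ineq[of "z \<epsilon> x - u0 x" "u0 x"] by simp
        ultimately show ?thesis using close(1)[OF es'(1), of x] U(2)[of x] by linarith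
      qed
      \<comment> \<open>For a zero product both implications in \<open>good\<close> hold
        vacuously.\<close>
      have nn: "\<nu> * \<epsilon> \<noteq> 0" using bad unfolding good_def by force
      show ?thesis
      proof (cases "\<nu> * \<epsilon> > 0")
        case True
        then obtain \<alpha> \<beta> a a1 a2 b b1 b2 where ev: "ev_pair \<epsilon> (z \<epsilon>) \<alpha> \<beta> a a1 a2 b b1 b2" and al: "\<alpha> > 0"
          using bad unfolding good_def by (auto simp: not_le)
        have "\<bar>\<alpha>\<bar> \<le> R \<and> \<bar>\<beta>\<bar> \<le> R" by (rule R[OF es'(2) zU less_imp_le[OF al] ev])
        moreover have "- (1 / real (Suc n)) \<le> \<alpha>" using n0 al by linarith
        moreover have "\<alpha> * (\<nu> * \<epsilon>) \<ge> 0" using al True by simp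
        ultimately show ?thesis using ev es' nn by (intro exI conjI) (assumption | auto)+
      next
        case False
        then have neg: "\<nu> * \<epsilon> < 0" using nn by linarith
        have "\<exists>a a1 a2 s. C2p a a1 a2 \<and> \<not> (\<forall>x. a x = 0) \<and> \<bar>s\<bar> \<le> 1 / real (Suc n) \<and>
          (\<forall>x. evo d \<zeta> \<mu> (\<epsilon> * V x) (z \<epsilon> x) (a x) (a1 x) (a2 x) = of_real s * a x)"
        proof (rule rl)
          show "z \<epsilon> \<in> C0p" using C2pD(1)[OF z[OF es'(1)]] .
          show "(\<lambda>x. \<epsilon> * V x) \<in> C0p" by (intro C0p_ints V)
          have 1: "C * \<bar>\<epsilon>\<bar> \<le> (C + BV) * \<bar>\<epsilon>\<bar>" "BV * \<bar>\<epsilon>\<bar> \<le> (C + BV) * \<bar>\<epsilon>\<bar>" using C0 BV by (auto intro: mult_right_mono)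
          show "norm (z \<epsilon> x - u0 x) \<le> \<delta>" for x using close(1)[OF es'(1), of x] 1 ed by linarith
          have "\<bar>V x\<bar> * \<bar>\<epsilon>\<bar> \<le> BV * \<bar>\<epsilon>\<bar>" for x using BV(2)[of x] by (simp add: mult_right_mono)
          then show "\<bar>\<epsilon> * V x\<bar> \<le> \<delta>" for x using 1 ed unfolding abs_mult mult.commute[of "\<bar>\<epsilon>\<bar>"] by (meson order_trans)
        qed
        then obtain a a1 a2 s where a: "C2p a a1 a2" "\<not> (\<forall>x. a x = 0)" "\<bar>s\<bar> \<le> 1 / real (Suc n)"
          "\<And>x. evo d \<zeta> \<mu> (\<epsilon> * V x) (z \<epsilon> x) (a x) (a1 x) (a2 x) = of_real s * a x" by blast
        have ev: "ev_pair \<epsilon> (z \<epsilon>) s 0 a a1 a2 (\<lambda>x. 0) (\<lambda>x. 0) (\<lambda>x. 0)"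
          using a C2p_zero unfolding ev_pair_def by (simp add: evo_def lin_def)
        have "s \<le> 0" using bad neg ev unfolding good_def by (auto simp: not_less) (meson linorder_not_less)
        then have "s * (\<nu> * \<epsilon>) \<ge> 0" using neg by (simp add: mult_nonpos_nonpos)
        moreover have "\<bar>s\<bar> \<le> max R 1" using a(3) by (rule order_trans) (simp add: le_max_iff_disj)
        moreover have "- (1 / real (Suc n)) \<le> s" using a(3) by linarith
        moreover have "\<bar>0::real\<bar> \<le> max R 1" "\<epsilon> \<noteq> 0" using nn by auto
        ultimately show ?thesis using ev es'(1,3) by blast
      qed
    qed
    obtain \<epsilon> \<alpha> \<beta> a a1 a2 b b1 b2 where st: "\<And>n. \<bar>\<epsilon> n\<bar> < \<epsilon>s \<and> \<bar>\<epsilon> n\<bar> \<le> 1 / real (Suc n) \<and> \<epsilon> n \<noteq> 0 \<and> ev_pair (\<epsilon> n) (z (\<epsilon> n)) (\<alpha> n) (\<beta> n) (a n) (a1 n) (a2 n) (b n) (b1 n) (b2 n) \<and>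
      \<bar>\<alpha> n\<bar> \<le> max R 1 \<and> \<bar>\<beta> n\<bar> \<le> max R 1 \<and> - (1 / real (Suc n)) \<le> \<alpha> n \<and> \<alpha> n * (\<nu> * \<epsilon> n) \<ge> 0"
      using step by metis
    have lim1: "(\<lambda>n. 1 / real (Suc n)) \<longlonglongrightarrow> 0" using LIMSEQ_Suc[OF lim_inverse_n'] .
    have el: "\<epsilon> \<longlonglongrightarrow> 0" by (rule Lim_null_comparison[OF _ lim1]) (use st in auto)
    obtain r where r: "strict_mono r" "(\<lambda>n. \<alpha> (r n) / \<epsilon> (r n)) \<longlonglongrightarrow> - \<nu>"
    proof (rule critical_eigenvalue_subsequence[of \<epsilon> "\<lambda>n. z (\<epsilon> n)" "\<lambda>n. z1 (\<epsilon> n)" "\<lambda>n. z2 (\<epsilon> n)" C \<alpha> \<beta> a a1 a2 b b1 b2 "max R 1" "\<lambda>n. 1 / real (Suc n)"])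
      show "\<epsilon> n \<noteq> 0" for n using st by blast
      show "\<epsilon> \<longlonglongrightarrow> 0" by (rule el)
      show "(\<lambda>n. 1 / real (Suc n)) \<longlonglongrightarrow> 0" by (rule lim1)
    qed (use st z eq close in blast)+
    have "(\<lambda>n. \<alpha> (r n) / \<epsilon> (r n) * \<nu>) \<longlonglongrightarrow> - \<nu> * \<nu>" by (intro tendsto_intros r(2))
    moreover have "0 \<le> \<alpha> (r n) / \<epsilon> (r n) * \<nu>" for n
    proof -
      have "\<alpha> (r n) / \<epsilon> (r n) * \<nu> = \<alpha> (r n) * (\<nu> * \<epsilon> (r n)) / (\<epsilon> (r n))\<^sup>2" using st[of "r n"] by (simp add: power2_eq_square)
      then show ?thesis using st[of "r n"] by simp
    qed
    ultimately have "0 \<le> - \<nu> * \<nu>" by (intro LIMSEQ_le_const) auto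
    moreover have "\<nu> * \<nu> > 0" using nu by (metis not_real_square_gt_zero)
    ultimately show False by simp
  qed
  then obtain \<epsilon>0 where "\<epsilon>0 > 0" "\<epsilon>0 \<le> \<epsilon>s" "\<And>\<epsilon>. \<bar>\<epsilon>\<bar> < \<epsilon>0 \<Longrightarrow> good \<epsilon>" by blast
  then show ?thesis using that[of \<epsilon>0] unfolding good_def by blast
qed

end

section \<open>Sobolev norms of classical functions\<close>

lemma l2_norm_C0p:
  fixes f :: "real \<Rightarrow> complex"
  assumes "f \<in> C0p" shows "(l2_norm f)\<^sup>2 = integral {-pi..pi} (\<lambda>x. (norm (f x))\<^sup>2)"
proof -
  have c: "continuous_on {-pi..pi} (\<lambda>x. (norm (f x))\<^sup>2)" by (intro continuous_intros C0pD(1)[OF assms])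
  have "(LINT x|leb_pi. (norm (f x))\<^sup>2) \<ge> 0" by (rule Bochner_Integration.integral_nonneg) simp
  then show ?thesis using integrable_continuous_leb_pi(2)[OF c] by (simp add: l2_norm_def)
qed

lemma l2_norm_nonneg: "l2_norm f \<ge> 0"
  by (simp add: l2_norm_def Bochner_Integration.integral_nonneg)

lemma h2_norm_C2p:
  fixes w :: "real \<Rightarrow> complex"
  assumes w: "C2p w w1 w2"
  shows "h2_norm w = sqrt ((l2_norm w)\<^sup>2 + (l2_norm w1)\<^sup>2 + (l2_norm w2)\<^sup>2)"
proof -
  have "D2 w \<in> L2" using H2per_D1(4)[OF C2p_H2(1)[OF w]] by (simp add: is_weak_deriv_def)
  then have m: "D2 w \<in> borel_measurable leb_pi" by (simp add: L2_def)
  have m2: "w2 \<in> borel_measurable leb_pi" by (rule measurable_continuous_leb_pi[OF C0pD(1)[OF C2pD(3)[OF w]]])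
  have "(LINT x|leb_pi. (norm (D2 w x))\<^sup>2) = (LINT x|leb_pi. (norm (w2 x))\<^sup>2)"
    by (rule integral_cong_AE) (use m m2 C2p_H2(2)[OF w] in \<open>auto elim!: eventually_mono\<close>)
  then show ?thesis by (simp add: h2_norm_def C2p_D1[OF w] l2_norm_def)
qed

lemma l2_norm_le_bound:
  fixes f :: "real \<Rightarrow> complex"
  assumes "f \<in> C0p" "\<And>x. norm (f x) \<le> B"
  shows "(l2_norm f)\<^sup>2 \<le> 2 * pi * B\<^sup>2"
proof -
  have c: "continuous_on {-pi..pi} (\<lambda>x. (norm (f x))\<^sup>2)" by (intro continuous_intros C0pD(1)[OF assms(1)])
  have "integral {-pi..pi} (\<lambda>x. (norm (f x))\<^sup>2) \<le> integral {-pi..pi} (\<lambda>x. B\<^sup>2)"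
    by (rule integral_le[OF integrable_continuous_real[OF c]]) (auto intro!: power_mono assms(2))
  then show ?thesis by (simp add: l2_norm_C0p[OF assms(1)] mult.commute)
qed

text \<open>Each of the three squared norms contributes at most
  \<open>2 * pi * B\<^sup>2\<close>.\<close>

lemma h2_norm_le_bound:
  fixes w :: "real \<Rightarrow> complex"
  assumes w: "C2p w w1 w2" and B: "\<And>x. norm (w x) \<le> B" "\<And>x. norm (w1 x) \<le> B" "\<And>x. norm (w2 x) \<le> B"
  shows "h2_norm w \<le> sqrt (6 * pi) * B"
proof -
  have B0: "B \<ge> 0" using B(1)[of 0] norm_ge_zero order_trans by blast
  have "(l2_norm w)\<^sup>2 + (l2_norm w1)\<^sup>2 + (l2_norm w2)\<^sup>2 \<le> 6 * pi * B\<^sup>2"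
    using l2_norm_le_bound[OF C2pD(1)[OF w] B(1)] l2_norm_le_bound[OF C2pD(2)[OF w] B(2)] l2_norm_le_bound[OF C2pD(3)[OF w] B(3)] by linarith
  then have "h2_norm w \<le> sqrt (6 * pi * B\<^sup>2)" unfolding h2_norm_C2p[OF w] by (rule real_sqrt_le_mono)
  then show ?thesis using B0 by (simp add: real_sqrt_mult)
qed

lemma integral_norm_le_l2_norm:
  fixes f :: "real \<Rightarrow> complex"
  assumes "f \<in> C0p" shows "integral {-pi..pi} (\<lambda>x. norm (f x)) \<le> sqrt (2 * pi) * l2_norm f"
proof -
  have "(integral {-pi..pi} (\<lambda>x. norm (f x)))\<^sup>2 \<le> (l2_norm f)\<^sup>2 * (2 * pi)"
    using Cauchy_Schwarz_norms[OF assms C0p_intros(1)[of "1::complex"]] by (simp add: l2_norm_C0p[OF assms])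
  then have "integral {-pi..pi} (\<lambda>x. norm (f x)) \<le> sqrt ((l2_norm f)\<^sup>2 * (2 * pi))" by (rule real_le_rsqrt)
  then show ?thesis using l2_norm_nonneg[of f] by (simp add: real_sqrt_mult mult.commute)
qed

text \<open>At its minimum the norm of \<open>f\<close> is at most its mean value, hence at most its
  integral as the period exceeds 1. From there the fundamental theorem reaches every other
  point.\<close>

lemma sobolev_bound:
  fixes f :: "real \<Rightarrow> complex"
  assumes f: "f \<in> C0p" and f1: "f1 \<in> C0p" and d: "\<And>x. (f has_vector_derivative f1 x) (at x)"
  shows "norm (f x) \<le> sqrt (2 * pi) * (l2_norm f + l2_norm f1)"
proof -
  obtain y where "\<And>z. - norm (f z) \<le> - norm (f y)" using C0p_attains[OF C0p_intros(4)[OF C0p_intros(6)[OF f]]] by blast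
  then have y: "norm (f y) \<le> norm (f z)" for z using minus_le_iff by fastforce
  have If: "(\<lambda>x. norm (f x)) integrable_on {-pi..pi}" "(\<lambda>x. norm (f1 x)) integrable_on {-pi..pi}" "f1 integrable_on {-pi..pi}"
    using C0pD(1)[OF f] C0pD(1)[OF f1] by (auto intro!: integrable_continuous_real continuous_intros)
  have "integral {-pi..pi} (\<lambda>x. norm (f y)) \<le> integral {-pi..pi} (\<lambda>x. norm (f x))"
    by (rule integral_le) (use If y in auto)
  then have "2 * pi * norm (f y) \<le> integral {-pi..pi} (\<lambda>x. norm (f x))" by (simp add: mult.commute)
  moreover have "1 * norm (f y) \<le> 2 * pi * norm (f y)" using pi_gt3 by (intro mult_right_mono) auto
  ultimately have 1: "norm (f y) \<le> integral {-pi..pi} (\<lambda>x. norm (f x))" by linarith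
  have D: "norm (f b - f a) \<le> integral {-pi..pi} (\<lambda>x. norm (f1 x))" if "-pi \<le> a" "a \<le> b" "b \<le> pi" for a b
  proof -
    have sub: "{a..b} \<subseteq> {-pi..pi}" using that by auto
    have i: "f1 integrable_on {a..b}" "(\<lambda>x. norm (f1 x)) integrable_on {a..b}"
      using C0pD(1)[OF f1] by (auto intro!: integrable_continuous_real continuous_intros)
    have "f b - f a = integral {a..b} f1" using has_integral_deriv[OF d that(2)] by (simp add: integral_unique)
    also have "norm \<dots> \<le> integral {a..b} (\<lambda>x. norm (f1 x))" by (rule integral_norm_bound_integral[OF i]) simp
    also have "\<dots> \<le> integral {-pi..pi} (\<lambda>x. norm (f1 x))" by (rule integral_subset_le[OF sub i(2) If(2)]) simp
    finally show ?thesis .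
  qed
  have r: "f (red x) = f x" "f (red y) = f y" using red_periodic[OF C0pD(3)[OF f]] by auto
  have "norm (f x - f y) \<le> integral {-pi..pi} (\<lambda>x. norm (f1 x))"
  proof (cases "red y \<le> red x")
    case True
    then show ?thesis using D[of "red y" "red x"] red_bounds[of x] red_bounds[of y] r by auto
  next
    case False
    then show ?thesis using D[of "red x" "red y"] red_bounds[of x] red_bounds[of y] r by (auto simp: norm_minus_commute)
  qed
  moreover have "norm (f x) \<le> norm (f x - f y) + norm (f y)" using norm_triangle_ineq[of "f x - f y" "f y"] by simp
  ultimately have "norm (f x) \<le> integral {-pi..pi} (\<lambda>x. norm (f1 x)) + integral {-pi..pi} (\<lambda>x. norm (f x))" using 1 by linarith
  also have "\<dots> \<le> sqrt (2 * pi) * l2_norm f1 + sqrt (2 * pi) * l2_norm f"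
    by (intro add_mono integral_norm_le_l2_norm f f1)
  finally show ?thesis by (simp add: algebra_simps)
qed

text \<open>Converts the \<open>H\<^sup>2\<close> bound in \<open>solution_branch\<close> into the
  closeness of values and first derivatives required by \<open>stability_dichotomy\<close>.\<close>

lemma h2_norm_embedding:
  fixes w :: "real \<Rightarrow> complex"
  assumes w: "C2p w w1 w2"
  shows "norm (w x) \<le> 2 * sqrt (2 * pi) * h2_norm w" "norm (w1 x) \<le> 2 * sqrt (2 * pi) * h2_norm w"
proof -
  have "l2_norm w \<le> h2_norm w" "l2_norm w1 \<le> h2_norm w" "l2_norm w2 \<le> h2_norm w"
    unfolding h2_norm_C2p[OF w] by (auto intro!: real_le_rsqrt)
  then have "l2_norm w + l2_norm w1 \<le> 2 * h2_norm w" "l2_norm w1 + l2_norm w2 \<le> 2 * h2_norm w" by linarith+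
  then have "sqrt (2 * pi) * (l2_norm w + l2_norm w1) \<le> 2 * sqrt (2 * pi) * h2_norm w"
    "sqrt (2 * pi) * (l2_norm w1 + l2_norm w2) \<le> 2 * sqrt (2 * pi) * h2_norm w"
    unfolding mult.commute[of 2 "sqrt (2 * pi)"] mult.assoc by (auto intro!: mult_left_mono)
  then show "norm (w x) \<le> 2 * sqrt (2 * pi) * h2_norm w" "norm (w1 x) \<le> 2 * sqrt (2 * pi) * h2_norm w"
    using sobolev_bound[OF C2pD(1,2)[OF w] C2pD(4)[OF w], of x] sobolev_bound[OF C2pD(2,3)[OF w] C2pD(5)[OF w], of x]
    by linarith+
qed

section \<open>Integration by parts against weak derivatives\<close>

lemma weak_deriv_integration_by_parts:
  fixes F g k k1 :: "real \<Rightarrow> complex"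
  assumes Fg: "is_weak_deriv F g" and F: "F \<in> C0p" and k: "k \<in> C0p" "k1 \<in> C0p" "\<And>x. (k has_vector_derivative k1 x) (at x)"
  shows "(LINT x|leb_pi. g x \<bullet> k x) = - integral {-pi..pi} (\<lambda>x. F x \<bullet> k1 x)"
proof -
  have gL: "g \<in> L2" and gI: "\<And>x. x \<in> {-pi..pi} \<Longrightarrow> (g has_integral (F x - F (-pi))) {-pi..x}"
    using Fg by (auto simp: is_weak_deriv_def)
  have S: "{-pi..pi} \<in> sets lebesgue" by simp
  have ig: "integrable leb_pi (\<lambda>x. g x \<bullet> k x)" using L2_mult_bounded(2)[OF k(1) gL] by (simp add: inner_commute)
  have ing: "integrable leb_pi (\<lambda>x. norm (g x))" using L2_integrable[OF gL] by simp
  have hk: "(\<lambda>x. g x \<bullet> k x) integrable_on {-pi..pi}" "(\<lambda>x. norm (g x)) integrable_on {-pi..pi}" "g integrable_on {-pi..pi}"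
    using integrable_on_lebesgue_on[OF ig] integrable_on_lebesgue_on[OF ing] gI[of pi] by (auto intro: has_integral_integrable)
  obtain K where K: "K > 0" "\<And>x. norm (k1 x) \<le> K" using C0p_bounded[OF k(2)] by blast
  define G where "G x = integral {-pi..x} (\<lambda>x. norm (g x))" for x
  define H where "H x = integral {-pi..x} (\<lambda>t. g t \<bullet> k t) - (F x \<bullet> k x - integral {-pi..x} (\<lambda>t. F t \<bullet> k1 t))" for x
  have cont: "continuous_on {-pi..pi} G" unfolding G_def by (rule indefinite_integral_continuous_1[OF hk(2)])
  have sub: "f integrable_on {x..y}" if "f integrable_on {-pi..pi}" "-pi \<le> x" "y \<le> pi" for f :: "real \<Rightarrow> 'b::banach" and x y
    using integrable_on_subinterval[OF that(1), of x y] that by auto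
  have spl: "integral {-pi..y} f - integral {-pi..x} f = integral {x..y} f"
    if "f integrable_on {-pi..pi}" "-pi \<le> x" "x \<le> y" "y \<le> pi" for f :: "real \<Rightarrow> 'b::banach" and x y
    using Henstock_Kurzweil_Integration.integral_combine[OF that(2,3) sub[OF that(1) order_refl that(4)]] by (simp add: algebra_simps)
  have cF: "continuous_on {-pi..pi} (\<lambda>t. F t \<bullet> k1 t)" using C0pD(1)[OF F] C0pD(1)[OF k(2)] by (intro continuous_intros)
  have FI: "F y - F x = integral {x..y} g" if "-pi \<le> x" "x \<le> y" "y \<le> pi" for x y
    using spl[OF hk(3) that] gI[of x] gI[of y] that by (simp add: integral_unique)
  have key: "\<bar>H y - H x\<bar> \<le> (2 * K * \<bar>G y - G x\<bar>) * (y - x)" if xy: "-pi \<le> x" "x \<le> y" "y \<le> pi" for x y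
  proof -
    have GG: "G y - G x = integral {x..y} (\<lambda>t. norm (g t))" unfolding G_def by (rule spl[OF hk(2) xy])
    have G0: "G y - G x \<ge> 0" unfolding GG by (rule integral_nonneg[OF sub[OF hk(2)]]) (use xy in auto)
    have i1: "(\<lambda>t. g t \<bullet> k t) integrable_on {x..y}" "g integrable_on {x..y}" "(\<lambda>t. norm (g t)) integrable_on {x..y}" "(\<lambda>t. F t \<bullet> k1 t) integrable_on {x..y}" "k1 integrable_on {x..y}"
      using sub[OF hk(1)] sub[OF hk(3)] sub[OF hk(2)] sub[OF integrable_continuous_real[OF cF]] sub[OF integrable_continuous_real[OF C0pD(1)[OF k(2)]]] xy by auto
    have kI: "k y - k x = integral {x..y} k1" using has_integral_deriv[OF k(3) xy(2)] by (simp add: integral_unique)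
    have i2: "(\<lambda>t. g t \<bullet> (k t - k x)) integrable_on {x..y}" "(\<lambda>t. (F t - F y) \<bullet> k1 t) integrable_on {x..y}"
      using integrable_diff[OF i1(1) integrable_linear[OF i1(2) bounded_linear_inner_left[of "k x"]]]
        integrable_diff[OF i1(4) integrable_linear[OF i1(5) bounded_linear_inner_right[of "F y"]]]
      by (simp_all add: o_def inner_diff_right inner_diff_left)
    have A: "integral {x..y} (\<lambda>t. g t \<bullet> (k t - k x)) = integral {x..y} (\<lambda>t. g t \<bullet> k t) - (F y - F x) \<bullet> k x"
      using integral_diff[OF i1(1) integrable_linear[OF i1(2) bounded_linear_inner_left[of "k x"]]]
        integral_linear[OF i1(2) bounded_linear_inner_left[of "k x"]] FI[OF xy]
      by (simp add: o_def inner_diff_right)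
    have B: "integral {x..y} (\<lambda>t. (F t - F y) \<bullet> k1 t) = integral {x..y} (\<lambda>t. F t \<bullet> k1 t) - F y \<bullet> (k y - k x)"
      using integral_diff[OF i1(4) integrable_linear[OF i1(5) bounded_linear_inner_right[of "F y"]]]
        integral_linear[OF i1(5) bounded_linear_inner_right[of "F y"]] kI
      by (simp add: o_def inner_diff_left)
    \<comment> \<open>Freezing \<open>k\<close> at \<open>x\<close> and \<open>F\<close> at
      \<open>y\<close> cancels the boundary terms exactly; each remaining integrand carries a small
      difference.\<close>
    have HH: "H y - H x = integral {x..y} (\<lambda>t. g t \<bullet> (k t - k x)) + integral {x..y} (\<lambda>t. (F t - F y) \<bullet> k1 t)"
      unfolding A B using spl[OF hk(1) xy] spl[OF integrable_continuous_real[OF cF] xy]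
      by (simp add: H_def inner_diff_left inner_diff_right)
    have n1: "norm (integral {x..y} (\<lambda>t. g t \<bullet> (k t - k x))) \<le> integral {x..y} (\<lambda>t. norm (g t) * (K * (y - x)))"
    proof (rule integral_norm_bound_integral[OF i2(1) integrable_on_mult_left[OF i1(3)]])
      fix t assume t: "t \<in> {x..y}"
      have "norm (k t - k x) \<le> K * \<bar>t - x\<bar>" by (rule C2p_lipschitz[OF k(3) K(2)])
      also have "\<dots> \<le> K * (y - x)" using t K by (intro mult_left_mono) auto
      finally have "norm (g t) * norm (k t - k x) \<le> norm (g t) * (K * (y - x))" by (rule mult_left_mono) simp
      then show "norm (g t \<bullet> (k t - k x)) \<le> norm (g t) * (K * (y - x))"
        using Cauchy_Schwarz_ineq2[of "g t" "k t - k x"] by simp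
    qed
    have n2: "integral {x..y} (\<lambda>t. norm (g t) * (K * (y - x))) = (G y - G x) * (K * (y - x))" by (simp add: GG)
    have n3: "norm (integral {x..y} (\<lambda>t. (F t - F y) \<bullet> k1 t)) \<le> integral {x..y} (\<lambda>t. (G y - G x) * K)"
    proof (rule integral_norm_bound_integral[OF i2(2)])
      fix t assume t: "t \<in> {x..y}"
      have "F y - F t = integral {t..y} g" using FI t xy by auto
      also have "norm \<dots> \<le> integral {t..y} (\<lambda>t. norm (g t))"
        by (rule integral_norm_bound_integral) (use sub[OF hk(3)] sub[OF hk(2)] t xy in auto)
      also have "\<dots> \<le> G y - G x" unfolding GG
        by (rule integral_subset_le) (use sub[OF hk(2)] t xy in auto)
      finally have "norm (F t - F y) \<le> G y - G x" by (simp add: norm_minus_commute)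
      then have "norm (F t - F y) * norm (k1 t) \<le> (G y - G x) * K" using K G0 by (intro mult_mono) auto
      then show "norm ((F t - F y) \<bullet> k1 t) \<le> (G y - G x) * K"
        using Cauchy_Schwarz_ineq2[of "F t - F y" "k1 t"] by simp
    qed auto
    have n4: "integral {x..y} (\<lambda>t. (G y - G x) * K) = (G y - G x) * K * (y - x)" using xy by simp
    have "2 * K * \<bar>G y - G x\<bar> * (y - x) = (G y - G x) * (K * (y - x)) + (G y - G x) * K * (y - x)"
      using G0 by (simp add: algebra_simps)
    then show ?thesis using n1 n3 unfolding HH n2 n4 real_norm_def by linarith
  qed
  have key': "\<bar>H y - H x\<bar> \<le> (2 * K * \<bar>G y - G x\<bar>) * \<bar>y - x\<bar>" if "x \<in> {-pi..pi}" "y \<in> {-pi..pi}" for x y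
  proof (cases "x \<le> y")
    case True
    then show ?thesis using key[of x y] that by auto
  next
    case False
    then show ?thesis using key[of y x] that by (auto simp: abs_minus_commute)
  qed
  have "(H has_field_derivative 0) (at x within {-pi..pi})" if x: "x \<in> {-pi..pi}" for x
    unfolding has_field_derivative_iff
  proof (rule Lim_null_comparison)
    show "\<forall>\<^sub>F y in at x within {-pi..pi}. norm ((H y - H x) / (y - x)) \<le> 2 * K * \<bar>G y - G x\<bar>"
      unfolding eventually_at_filter
      by (rule always_eventually) (use key'[OF x] in \<open>auto simp: divide_le_eq\<close>)
    have "(G \<longlongrightarrow> G x) (at x within {-pi..pi})" using cont x by (auto simp: continuous_on_def)
    then have "((\<lambda>y. 2 * K * \<bar>G y - G x\<bar>) \<longlongrightarrow> 2 * K * \<bar>G x - G x\<bar>) (at x within {-pi..pi})" by (intro tendsto_intros)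
    then show "((\<lambda>y. 2 * K * \<bar>G y - G x\<bar>) \<longlongrightarrow> 0) (at x within {-pi..pi})" by simp
  qed
  then have "\<exists>c. \<forall>x\<in>{-pi..pi}. H x = c" by (intro has_field_derivative_zero_constant) auto
  then have "H pi = H (-pi)" by force
  moreover have "F pi = F (-pi)" "k pi = k (-pi)" using C0pD(2)[OF F, of "-pi"] C0pD(2)[OF k(1), of "-pi"] by simp_all
  ultimately have "integral {-pi..pi} (\<lambda>t. g t \<bullet> k t) = - integral {-pi..pi} (\<lambda>t. F t \<bullet> k1 t)" by (simp add: H_def)
  moreover have "(LINT x|leb_pi. g x \<bullet> k x) = integral {-pi..pi} (\<lambda>t. g t \<bullet> k t)" by (rule lebesgue_integral_eq_integral[OF ig S])
  ultimately show ?thesis by simp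
qed

lemma L_op_lin: "L_op d \<zeta> \<mu> u \<phi> x = lin d \<zeta> \<mu> (u x) (\<phi> x) (D2 \<phi> x)"
  by (simp add: L_op_def lin_def)

text \<open>Without damping the operator is symmetric, so its kernel lies in the kernel of its
  adjoint. The test functions have only weak second derivatives, hence the two uses of the preceding
  integration by parts.\<close>

lemma ker_adjoint_self:
  assumes u: "u \<in> C0p" and w: "C2p w w1 w2" and eq: "\<And>x. lin d \<zeta> 0 (u x) (w x) (w2 x) = 0"
  shows "w \<in> ker_adjoint (L_op d \<zeta> 0 u)"
proof -
  have "l2_inner (L_op d \<zeta> 0 u \<phi>) w = 0" if \<phi>: "\<phi> \<in> H2per" for \<phi>
  proof -
    note c = H2per_D1(3)[OF \<phi>] H2per_D1_C0p[OF \<phi>] C2pD(1)[OF w] C2pD(2)[OF w] C2pD(3)[OF w]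
    have g: "D2 \<phi> \<in> L2" using H2per_D1(4)[OF \<phi>] by (simp add: is_weak_deriv_def)
    have i: "integrable leb_pi (\<lambda>x. \<phi> x \<bullet> w2 x)" "(LINT x|leb_pi. \<phi> x \<bullet> w2 x) = integral {-pi..pi} (\<lambda>x. \<phi> x \<bullet> w2 x)"
      using C0pD(1)[OF c(1)] C0pD(1)[OF c(5)] by (auto intro!: integrable_continuous_leb_pi continuous_intros)
    have ig: "integrable leb_pi (\<lambda>x. D2 \<phi> x \<bullet> w x)" using L2_mult_bounded(2)[OF c(3) g] by (simp add: inner_commute)
    have "(LINT x|leb_pi. D2 \<phi> x \<bullet> w x) = - integral {-pi..pi} (\<lambda>x. D1 \<phi> x \<bullet> w1 x)"
      by (rule weak_deriv_integration_by_parts[OF H2per_D1(4)[OF \<phi>] c(2,3,4) C2pD(4)[OF w]])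
    moreover have "integral {-pi..pi} (\<lambda>x. D1 \<phi> x \<bullet> w1 x) = - integral {-pi..pi} (\<lambda>x. \<phi> x \<bullet> w2 x)"
    proof -
      have "is_weak_deriv \<phi> (D1 \<phi>)" unfolding is_weak_deriv_def
        using C0p_L2[OF c(2)] H2per_D1(1)[OF \<phi>] by (auto intro: has_integral_deriv)
      from weak_deriv_integration_by_parts[OF this c(1,4,5) C2pD(5)[OF w]]
      have "(LINT x|leb_pi. D1 \<phi> x \<bullet> w1 x) = - integral {-pi..pi} (\<lambda>x. \<phi> x \<bullet> w2 x)" .
      moreover have "(LINT x|leb_pi. D1 \<phi> x \<bullet> w1 x) = integral {-pi..pi} (\<lambda>x. D1 \<phi> x \<bullet> w1 x)"
        using C0pD(1)[OF c(2)] C0pD(1)[OF c(4)] by (auto intro!: integrable_continuous_leb_pi continuous_intros)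
      ultimately show ?thesis by simp
    qed
    ultimately have I: "(LINT x|leb_pi. D2 \<phi> x \<bullet> w x) = (LINT x|leb_pi. \<phi> x \<bullet> w2 x)" using i(2) by simp
    have "L_op d \<zeta> 0 u \<phi> x \<bullet> w x = d * (\<phi> x \<bullet> w2 x) - d * (D2 \<phi> x \<bullet> w x)" for x
    proof -
      have "lin d \<zeta> 0 (u x) (\<phi> x) (D2 \<phi> x) \<bullet> w x - \<phi> x \<bullet> lin d \<zeta> 0 (u x) (w x) (w2 x)
        = d * (\<phi> x \<bullet> w2 x) - d * (D2 \<phi> x \<bullet> w x)"
        unfolding lin_def inner_complex_def cmod_square by (simp add: power2_eq_square algebra_simps)
      then show ?thesis by (simp add: L_op_lin eq)
    qed
    then have "l2_inner (L_op d \<zeta> 0 u \<phi>) w = (LINT x|leb_pi. d * (\<phi> x \<bullet> w2 x) - d * (D2 \<phi> x \<bullet> w x))"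
      by (simp add: l2_inner_def)
    also have "\<dots> = d * (LINT x|leb_pi. \<phi> x \<bullet> w2 x) - d * (LINT x|leb_pi. D2 \<phi> x \<bullet> w x)"
      using i(1) ig by simp
    finally show ?thesis using I by simp
  qed
  moreover have "w \<in> L2" "(\<lambda>_. 0) \<in> L2" using C0p_L2[OF C2pD(1)[OF w]] C0p_L2[OF C0p_intros(1)] by auto
  ultimately show ?thesis by (auto simp: ker_adjoint_def adjoint_graph_def l2_inner_def)
qed

text \<open>\<open>L_op\<close> is built on the chosen representative \<open>D2 w\<close>,
  \<open>lin\<close> on the classical \<open>w2\<close>; the pairing sees no difference.\<close>

lemma ker_adjoint_annihilates:
  assumes p: "p \<in> ker_adjoint (L_op d \<zeta> \<mu> u)" and u: "u \<in> C0p" and w: "C2p w w1 w2"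
  shows "l2_inner (\<lambda>x. lin d \<zeta> \<mu> (u x) (w x) (w2 x)) p = 0"
proof -
  note c = C2pD(1,2,3)[OF w]
  have pL: "p \<in> L2" and "l2_inner (L_op d \<zeta> \<mu> u w) p = l2_inner w (\<lambda>_. 0)"
    using p C2p_H2(1)[OF w] by (auto simp: ker_adjoint_def adjoint_graph_def)
  then have z: "l2_inner (L_op d \<zeta> \<mu> u w) p = 0" by (simp add: l2_inner_def)
  have "D2 w \<in> L2" using H2per_D1(4)[OF C2p_H2(1)[OF w]] by (simp add: is_weak_deriv_def)
  then have m: "D2 w \<in> borel_measurable leb_pi" by (simp add: L2_def)
  have pm: "p \<in> borel_measurable leb_pi" using pL by (simp add: L2_def)
  have "(\<lambda>x. lin d \<zeta> \<mu> (u x) (w x) 0) \<in> borel_measurable leb_pi"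
    by (rule measurable_continuous_leb_pi[OF C0pD(1)[OF C0p_lin[OF u c(1) C0p_intros(1)]]])
  then have "(\<lambda>x. - of_real d * D2 w x + lin d \<zeta> \<mu> (u x) (w x) 0) \<in> borel_measurable leb_pi" using m by auto
  moreover have "- of_real d * D2 w x + lin d \<zeta> \<mu> (u x) (w x) 0 = L_op d \<zeta> \<mu> u w x" for x by (simp add: L_op_lin lin_def)
  ultimately have m1: "L_op d \<zeta> \<mu> u w \<in> borel_measurable leb_pi" by simp
  have m2: "(\<lambda>x. lin d \<zeta> \<mu> (u x) (w x) (w2 x)) \<in> borel_measurable leb_pi"
    by (rule measurable_continuous_leb_pi[OF C0pD(1)[OF C0p_lin[OF u c(1,3)]]])
  have "l2_inner (\<lambda>x. lin d \<zeta> \<mu> (u x) (w x) (w2 x)) p = l2_inner (L_op d \<zeta> \<mu> u w) p"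
    unfolding l2_inner_def
  proof (rule integral_cong_AE)
    show "AE x in leb_pi. lin d \<zeta> \<mu> (u x) (w x) (w2 x) \<bullet> p x = L_op d \<zeta> \<mu> u w x \<bullet> p x"
      using C2p_H2(2)[OF w] by (auto simp: L_op_lin elim!: eventually_mono)
  qed (use m1 m2 pm in auto)
  then show ?thesis using z by simp
qed

section \<open>The effective potential\<close>

lemma V_eff_l2_inner:
  assumes "V \<in> C0p" "D1 u0 \<in> C0p" "p \<in> L2"
  shows "V_eff V u0 p \<sigma> = l2_inner (\<lambda>x. \<i> * of_real (V (x + \<sigma>)) * D1 u0 x) p"
proof -
  have "(\<lambda>x. \<i> * of_real (V (x + \<sigma>)) * D1 u0 x) \<in> C0p" by (intro C0p_ints C0p_shift assms)
  from Re_LINT_eq_l2_inner[OF this assms(3)] show ?thesis by (simp add: V_eff_def)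
qed

text \<open>The remainder of the difference quotient is the pairing with a function that is
  uniformly of size \<open>\<omega> * \<bar>h\<bar>\<close>, by uniform continuity of
  \<open>V1\<close>. Boundedness of the pairing in the supremum norm does the rest.\<close>

lemma V_eff_has_derivative:
  assumes V: "V \<in> C0p" and V1: "V1 \<in> C0p" and V_deriv: "\<And>x. (V has_vector_derivative V1 x) (at x)"
    and u: "D1 u0 \<in> C0p" and p: "p \<in> L2"
  shows "(V_eff V u0 p has_field_derivative l2_inner (\<lambda>x. \<i> * of_real (V1 (x + \<sigma>)) * D1 u0 x) p) (at \<sigma>)"
proof -
  define L where "L = (LINT x|leb_pi. norm (p x))"
  have L0: "L \<ge> 0" unfolding L_def by (rule Bochner_Integration.integral_nonneg) simp
  obtain U where U: "U > 0" "\<And>x. norm (D1 u0 x) \<le> U" using C0p_bounded[OF u] by blast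
  let ?D = "l2_inner (\<lambda>x. \<i> * of_real (V1 (x + \<sigma>)) * D1 u0 x) p"
  show ?thesis unfolding DERIV_def
  proof (rule LIM_I)
    fix e :: real assume e: "e > 0"
    define M where "M = L + 1"
    have M: "M > 0" using L0 by (simp add: M_def)
    \<comment> \<open>Chosen so that the final bound is \<open>e / 2\<close>; \<open>M\<close>
      exceeds the norm \<open>L\<close> by 1 to be positive.\<close>
    define \<omega> where "\<omega> = e / (2 * M * U)"
    have om: "\<omega> > 0" using e M U by (simp add: \<omega>_def)
    obtain \<delta> where \<delta>: "\<delta> > 0" "\<And>x y. \<bar>x - y\<bar> < \<delta> \<Longrightarrow> norm (V1 x - V1 y) < \<omega>"
      using C0p_uniformly_continuous[OF V1 om] by blast
    show "\<exists>s>0. \<forall>h. h \<noteq> 0 \<and> norm (h - 0) < s \<longrightarrow> norm ((V_eff V u0 p (\<sigma> + h) - V_eff V u0 p \<sigma>) / h - ?D) < e"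
    proof (intro exI[of _ \<delta>] conjI allI impI \<delta>(1))
      fix h :: real assume h: "h \<noteq> 0 \<and> norm (h - 0) < \<delta>"
      define g where "g y = \<i> * of_real (V (y + (\<sigma> + h))) * D1 u0 y + of_real (- 1) * (\<i> * of_real (V (y + \<sigma>)) * D1 u0 y)
         + of_real (- h) * (\<i> * of_real (V1 (y + \<sigma>)) * D1 u0 y)" for y
      have c: "(\<lambda>y. \<i> * of_real (V (y + (\<sigma> + h))) * D1 u0 y) \<in> C0p" "(\<lambda>y. \<i> * of_real (V (y + \<sigma>)) * D1 u0 y) \<in> C0p"
        "(\<lambda>y. \<i> * of_real (V1 (y + \<sigma>)) * D1 u0 y) \<in> C0p"
        by (intro C0p_ints C0p_shift[OF V] C0p_shift[OF V1] u)+
      have g: "g \<in> C0p" unfolding g_def by (intro C0p_ints C0p_shift[OF V] C0p_shift[OF V1] u)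
      have "l2_inner g p = V_eff V u0 p (\<sigma> + h) + (- 1) * V_eff V u0 p \<sigma> + (- h) * ?D"
        unfolding g_def V_eff_l2_inner[OF V u p]
        by (subst l2_inner_C0p(1), (intro C0p_ints c p)+, subst l2_inner_C0p(1), (intro C0p_ints c p)+)
           (simp only: l2_inner_C0p(2)[OF c(2) c(2) p] l2_inner_C0p(2)[OF c(3) c(3) p])
      moreover have gb: "norm (g y) \<le> (\<omega> * \<bar>h\<bar>) * U" for y
      proof -
        have eq: "g y = \<i> * of_real (V ((y + \<sigma>) + h) - V ((y + \<sigma>) + 0) - V1 (y + \<sigma>) * (h - 0)) * D1 u0 y"
          by (simp add: g_def algebra_simps)
        have "\<bar>V ((y + \<sigma>) + h) - V ((y + \<sigma>) + 0) - V1 (y + \<sigma>) * (h - 0)\<bar> \<le> \<omega> * \<bar>h - 0\<bar>"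
        proof (rule increment_bound[OF V_deriv, of "\<bar>h\<bar>"])
          show "\<bar>V1 (y + \<sigma> + t) - V1 (y + \<sigma>)\<bar> \<le> \<omega>" if "\<bar>t\<bar> \<le> \<bar>h\<bar>" for t
            using \<delta>(2)[of "y + \<sigma> + t" "y + \<sigma>"] that h by auto
        qed auto
        then show ?thesis unfolding eq norm_mult norm_of_real using U om by (auto intro!: mult_mono)
      qed
      ultimately have "\<bar>V_eff V u0 p (\<sigma> + h) - V_eff V u0 p \<sigma> - h * ?D\<bar> \<le> L * (\<omega> * \<bar>h\<bar> * U)"
        using l2_inner_C0p(3)[OF g g p gb] by (simp add: L_def)
      also have "\<dots> \<le> M * (\<omega> * \<bar>h\<bar> * U)" unfolding M_def using om U by (intro mult_right_mono) auto
      also have "\<dots> = e / 2 * \<bar>h\<bar>" using M U(1) by (simp add: \<omega>_def field_simps)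
      finally have *: "\<bar>V_eff V u0 p (\<sigma> + h) - V_eff V u0 p \<sigma> - h * ?D\<bar> \<le> e / 2 * \<bar>h\<bar>" .
      have "norm ((V_eff V u0 p (\<sigma> + h) - V_eff V u0 p \<sigma>) / h - ?D) = \<bar>V_eff V u0 p (\<sigma> + h) - V_eff V u0 p \<sigma> - h * ?D\<bar> / \<bar>h\<bar>"
        using h by (simp add: abs_divide[symmetric] diff_divide_distrib)
      also have "\<dots> \<le> e / 2" using * h by (simp add: pos_divide_le_eq)
      also have "\<dots> < e" using e by simp
      finally show "norm ((V_eff V u0 p (\<sigma> + h) - V_eff V u0 p \<sigma>) / h - ?D) < e" .
    qed
  qed
qed

section \<open>The main result\<close>

lemma C1_periodic_derivative:
  assumes "periodic_2pi V" "V C1_differentiable_on UNIV"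
  shows "V \<in> C0p" "deriv V \<in> C0p" "\<And>x. (V has_vector_derivative deriv V x) (at x)"
proof -
  obtain D where D: "\<And>x. (V has_vector_derivative D x) (at x)" "continuous_on UNIV D"
    using assms(2) unfolding C1_differentiable_on_def by auto
  have "deriv V = D"
    using D(1) by (intro ext DERIV_imp_deriv) (simp add: has_real_derivative_iff_has_vector_derivative)
  then show "\<And>x. (V has_vector_derivative deriv V x) (at x)" using D(1) by simp
  show "V \<in> C0p" using assms(1) has_vd_imp_cont[OF D(1)] by (simp add: C0p_def)
  show "deriv V \<in> C0p"
    using \<open>deriv V = D\<close> D periodic_vector_derivative[OF assms(1) D(1)] by (simp add: C0p_def)
qed

lemma has_vector_derivative_shift:
  assumes "\<And>x. (f has_vector_derivative f' x) (at x)"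
  shows "((\<lambda>x. f (x + s)) has_vector_derivative f' (x + s)) (at x)"
proof -
  have "((\<lambda>x. x + s) has_vector_derivative 1) (at x)" by (auto intro!: derivative_eq_intros)
  from vector_diff_chain_at[OF this, of f "f' (x + s)"] assms[of "x + s"] show ?thesis by (simp add: o_def)
qed

context wave begin

text \<open>The branch is \<open>v \<epsilon>\<close> translated back by
  \<open>\<sigma> + s \<epsilon>\<close>, so a change of \<epsilon> also moves the argument.
  Continuity at a general \<epsilon> uses uniform continuity of \<open>v2 \<epsilon>\<close>; the
  bound linear in \<epsilon> around 0 uses that \<open>u2\<close> is Lipschitz, which is where the
  bound on \<open>u3\<close> enters.\<close>

lemma branch_classical:
  assumes V: "\<And>x. W (x + \<sigma>) = V x"
  shows "\<exists>\<epsilon>s C u. solution_branch d f0 \<zeta> \<mu> W u0 \<sigma> \<epsilon>s C u"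
proof (rule branch_exists)
  fix \<epsilon>1 C :: real and v v1 v2 :: "real \<Rightarrow> real \<Rightarrow> complex" and s :: "real \<Rightarrow> real"
  assume e1: "\<epsilon>1 > 0" and C: "C > 0" and v0: "v 0 = u0" and s0: "s 0 = 0"
    and vC: "\<And>\<epsilon>. \<bar>\<epsilon>\<bar> < \<epsilon>1 \<Longrightarrow> C2p (v \<epsilon>) (v1 \<epsilon>) (v2 \<epsilon>)"
    and veq: "\<And>\<epsilon> x. \<bar>\<epsilon>\<bar> < \<epsilon>1 \<Longrightarrow> - of_real d * v2 \<epsilon> x + \<i> * of_real (\<epsilon> * V (x + s \<epsilon>)) * v1 \<epsilon> x
      + (of_real \<zeta> - \<i> * of_real \<mu>) * v \<epsilon> x - of_real ((cmod (v \<epsilon> x))\<^sup>2) * v \<epsilon> x + \<i> * of_real f0 = 0"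
    and lip: "\<And>\<epsilon> \<eta> x. \<bar>\<epsilon>\<bar> < \<epsilon>1 \<Longrightarrow> \<bar>\<eta>\<bar> < \<epsilon>1 \<Longrightarrow> norm (v \<epsilon> x - v \<eta> x) \<le> C * \<bar>\<epsilon> - \<eta>\<bar> \<and>
      norm (v1 \<epsilon> x - v1 \<eta> x) \<le> C * \<bar>\<epsilon> - \<eta>\<bar> \<and> norm (v2 \<epsilon> x - v2 \<eta> x) \<le> C * \<bar>\<epsilon> - \<eta>\<bar> \<and> \<bar>s \<epsilon> - s \<eta>\<bar> \<le> C * \<bar>\<epsilon> - \<eta>\<bar>"
  define t where "t \<epsilon> = - \<sigma> - s \<epsilon>" for \<epsilon>
  define u where "u \<epsilon> x = v \<epsilon> (x + t \<epsilon>)" for \<epsilon> x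
  have uC: "C2p (u \<epsilon>) (\<lambda>x. v1 \<epsilon> (x + t \<epsilon>)) (\<lambda>x. v2 \<epsilon> (x + t \<epsilon>))" if "\<bar>\<epsilon>\<bar> < \<epsilon>1" for \<epsilon>
    unfolding u_def by (rule C2p_shift[OF vC[OF that]])
  have sol: "solves_S d f0 \<zeta> \<mu> W \<epsilon> (u \<epsilon>)" if e: "\<bar>\<epsilon>\<bar> < \<epsilon>1" for \<epsilon>
  proof (rule solves_S_I[OF uC[OF e]])
    fix x
    have "V (x + t \<epsilon> + s \<epsilon>) = W x" using V[of "x - \<sigma>"] by (simp add: t_def)
    then show "- of_real d * v2 \<epsilon> (x + t \<epsilon>) + \<i> * of_real (\<epsilon> * W x) * v1 \<epsilon> (x + t \<epsilon>)
      + (of_real \<zeta> - \<i> * of_real \<mu>) * u \<epsilon> x - of_real ((cmod (u \<epsilon> x))\<^sup>2) * u \<epsilon> x + \<i> * of_real f0 = 0"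
      using veq[OF e, of "x + t \<epsilon>"] by (simp add: u_def)
  qed
  have u00: "u 0 = (\<lambda>x. u0 (x - \<sigma>))" by (simp add: u_def t_def v0 s0 fun_eq_iff)
  have z: "\<bar>0::real\<bar> < \<epsilon>1" using e1 by simp
  have lims: "((\<lambda>\<eta>. h2_norm (\<lambda>x. u \<eta> x - u \<epsilon> x)) \<longlongrightarrow> 0) (at \<epsilon>)" if e: "\<bar>\<epsilon>\<bar> < \<epsilon>1" for \<epsilon>
  proof (rule tendstoI)
    fix r :: real assume r: "r > 0"
    define k where "k = r / (2 * sqrt (6 * pi))"
    have k: "k > 0" "sqrt (6 * pi) * k < r" using r by (auto simp: k_def)
    note c = C2pD(1,2,3)[OF vC[OF e]]
    obtain d0 where d0: "d0 > 0" "\<And>x y. \<bar>x - y\<bar> < d0 \<Longrightarrow> norm (v \<epsilon> x - v \<epsilon> y) < k / 2"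
      using C0p_uniformly_continuous[OF c(1), of "k / 2"] k by auto
    obtain d1 where d1: "d1 > 0" "\<And>x y. \<bar>x - y\<bar> < d1 \<Longrightarrow> norm (v1 \<epsilon> x - v1 \<epsilon> y) < k / 2"
      using C0p_uniformly_continuous[OF c(2), of "k / 2"] k by auto
    obtain d2 where d2: "d2 > 0" "\<And>x y. \<bar>x - y\<bar> < d2 \<Longrightarrow> norm (v2 \<epsilon> x - v2 \<epsilon> y) < k / 2"
      using C0p_uniformly_continuous[OF c(3), of "k / 2"] k by auto
    \<comment> \<open>The first entry keeps \<eta> in the interval of existence. The second limits
      both the change of \<open>v\<close> and the displacement of the argument, each bounded by
      \<open>C * \<bar>\<eta> - \<epsilon>\<bar>\<close>.\<close>
    define m where "m = min (\<epsilon>1 - \<bar>\<epsilon>\<bar>) (min (k / 2) (min d0 (min d1 d2)) / (C + 1))"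
    have m: "m > 0" using e k d0(1) d1(1) d2(1) C by (simp add: m_def)
    have "dist (h2_norm (\<lambda>x. u \<eta> x - u \<epsilon> x)) 0 < r" if eta: "dist \<eta> \<epsilon> < m" for \<eta>
    proof -
      have et: "\<bar>\<eta> - \<epsilon>\<bar> < m" using eta by (simp add: dist_real_def)
      have "m \<le> \<epsilon>1 - \<bar>\<epsilon>\<bar>" by (simp add: m_def)
      then have e': "\<bar>\<eta>\<bar> < \<epsilon>1" using et by linarith
      have "C * \<bar>\<eta> - \<epsilon>\<bar> \<le> (C + 1) * \<bar>\<eta> - \<epsilon>\<bar>" by (intro mult_right_mono) auto
      also have "\<dots> < (C + 1) * m" using et C by (intro mult_strict_left_mono) auto
      also have "\<dots> \<le> (C + 1) * (min (k / 2) (min d0 (min d1 d2)) / (C + 1))" using C by (intro mult_left_mono) (auto simp: m_def)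
      finally have "C * \<bar>\<eta> - \<epsilon>\<bar> < min (k / 2) (min d0 (min d1 d2))" using C by simp
      then have b: "C * \<bar>\<eta> - \<epsilon>\<bar> < k / 2" "C * \<bar>\<eta> - \<epsilon>\<bar> < d0" "C * \<bar>\<eta> - \<epsilon>\<bar> < d1" "C * \<bar>\<eta> - \<epsilon>\<bar> < d2" by auto
      have tt: "\<bar>(x + t \<eta>) - (x + t \<epsilon>)\<bar> \<le> C * \<bar>\<eta> - \<epsilon>\<bar>" for x
        using lip[OF e' e, of 0] by (auto simp: t_def abs_minus_commute)
      have tri: "norm (f - g) \<le> k" if "norm (f - h) \<le> C * \<bar>\<eta> - \<epsilon>\<bar>" "norm (h - g) < k / 2" for f g h :: complex
        using norm_triangle_ineq[of "f - h" "h - g"] that b(1) by simp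
      have "h2_norm (\<lambda>x. u \<eta> x - u \<epsilon> x) \<le> sqrt (6 * pi) * k"
      proof (rule h2_norm_le_bound[OF C2p_diff[OF uC[OF e'] uC[OF e]]])
        fix x
        show "norm (u \<eta> x - u \<epsilon> x) \<le> k" unfolding u_def
          by (rule tri[of _ "v \<epsilon> (x + t \<eta>)"]) (use lip[OF e' e] d0(2) tt[of x] b in auto)
        show "norm (v1 \<eta> (x + t \<eta>) - v1 \<epsilon> (x + t \<epsilon>)) \<le> k"
          by (rule tri[of _ "v1 \<epsilon> (x + t \<eta>)"]) (use lip[OF e' e] d1(2) tt[of x] b in auto)
        show "norm (v2 \<eta> (x + t \<eta>) - v2 \<epsilon> (x + t \<epsilon>)) \<le> k"
          by (rule tri[of _ "v2 \<epsilon> (x + t \<eta>)"]) (use lip[OF e' e] d2(2) tt[of x] b in auto)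
      qed
      moreover have "h2_norm (\<lambda>x. u \<eta> x - u \<epsilon> x) \<ge> 0" by (simp add: h2_norm_def)
      ultimately show ?thesis using k by (simp add: dist_real_def)
    qed
    then show "\<forall>\<^sub>F \<eta> in at \<epsilon>. dist (h2_norm (\<lambda>x. u \<eta> x - u \<epsilon> x)) 0 < r"
      unfolding eventually_at using m by blast
  qed
  obtain U1 where U1: "U1 > 0" "\<And>x. norm (u1 x) \<le> U1" using C0p_bounded[OF u_C0p(2)] by blast
  obtain U2 where U2: "U2 > 0" "\<And>x. norm (u2 x) \<le> U2" using C0p_bounded[OF u_C0p(3)] by blast
  obtain U3 where U3: "U3 > 0" "\<And>x. norm (u3 x) \<le> U3" using C0p_bounded[OF u_C0p(4)] by blast
  define U where "U = U1 + U2 + U3"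
  have U: "U > 0" "norm (u1 x) \<le> U" "norm (u2 x) \<le> U" "norm (u3 x) \<le> U" for x
    using U1(1) U2(1) U3(1) U1(2)[of x] U2(2)[of x] U3(2)[of x] unfolding U_def by linarith+
  define C' where "C' = sqrt (6 * pi) * (C + U * C)"
  have bound: "h2_norm (\<lambda>x. u \<epsilon> x - u0 (x - \<sigma>)) \<le> C' * \<bar>\<epsilon>\<bar>" if e: "\<bar>\<epsilon>\<bar> < \<epsilon>1" for \<epsilon>
  proof -
    have v00: "v1 0 = u1" "v2 0 = u2" using C2p_unique[OF vC[OF z, unfolded v0] u0] by auto
    have L: "norm (v \<epsilon> x - u0 x) \<le> C * \<bar>\<epsilon>\<bar>" "norm (v1 \<epsilon> x - u1 x) \<le> C * \<bar>\<epsilon>\<bar>" "norm (v2 \<epsilon> x - u2 x) \<le> C * \<bar>\<epsilon>\<bar>" "\<bar>s \<epsilon>\<bar> \<le> C * \<bar>\<epsilon>\<bar>" for x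
      using lip[OF e z, of x] by (auto simp: v00 v0 s0)
    have tri: "norm (f - g) \<le> (C + U * C) * \<bar>\<epsilon>\<bar>" if "norm (f - h) \<le> C * \<bar>\<epsilon>\<bar>" "norm (h - g) \<le> U * \<bar>(x + t \<epsilon>) - (x - \<sigma>)\<bar>" for f g h :: complex and x
    proof -
      have "U * \<bar>(x + t \<epsilon>) - (x - \<sigma>)\<bar> \<le> U * (C * \<bar>\<epsilon>\<bar>)" using L(4) U(1) by (intro mult_left_mono) (auto simp: t_def)
      then show ?thesis using norm_triangle_ineq[of "f - h" "h - g"] that by (simp add: algebra_simps)
    qed
    have "h2_norm (\<lambda>x. u \<epsilon> x - u0 (x + - \<sigma>)) \<le> sqrt (6 * pi) * ((C + U * C) * \<bar>\<epsilon>\<bar>)"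
    proof (rule h2_norm_le_bound[OF C2p_diff[OF uC[OF e] C2p_shift[OF u0]]])
      fix x
      show "norm (u \<epsilon> x - u0 (x + - \<sigma>)) \<le> (C + U * C) * \<bar>\<epsilon>\<bar>" unfolding u_def
        using tri[OF L(1) C2p_lipschitz[OF C2pD(4)[OF u0] U(2)], of x] by simp
      show "norm (v1 \<epsilon> (x + t \<epsilon>) - u1 (x + - \<sigma>)) \<le> (C + U * C) * \<bar>\<epsilon>\<bar>"
        using tri[OF L(2) C2p_lipschitz[OF C2pD(5)[OF u0] U(3)], of x] by simp
      show "norm (v2 \<epsilon> (x + t \<epsilon>) - u2 (x + - \<sigma>)) \<le> (C + U * C) * \<bar>\<epsilon>\<bar>"
        using tri[OF L(3) C2p_lipschitz[OF C2pD(5)[OF u1] U(4)], of x] by simp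
    qed
    then show ?thesis by (simp add: C'_def mult.assoc)
  qed
  have "C' > 0" using C U(1) by (simp add: C'_def add_pos_pos)
  then have "solution_branch d f0 \<zeta> \<mu> W u0 \<sigma> \<epsilon>1 C' u"
    unfolding solution_branch_def using e1 u00 sol lims bound by (auto simp: abs_less_iff)
  then show ?thesis by blast
qed

text \<open>Applies to an arbitrary branch, not just to the constructed one: the
  \<open>H\<^sup>2\<close> bound is all that is used. Translation by \<sigma> turns the potential
  into that of the locale and preserves eigenvalues.\<close>

lemma branch_stability:
  assumes V: "\<And>x. W (x + \<sigma>) = V x" and W: "W \<in> C0p" and br: "solution_branch d f0 \<zeta> \<mu> W u0 \<sigma> \<epsilon>s C u"
  shows "\<exists>\<epsilon>0>0. \<epsilon>0 \<le> \<epsilon>s \<and> (\<forall>\<epsilon>\<in>{-\<epsilon>0<..<\<epsilon>0}.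
    (\<nu> * \<epsilon> > 0 \<longrightarrow> spectrally_stable d \<zeta> \<mu> W \<epsilon> (u \<epsilon>)) \<and> (\<nu> * \<epsilon> < 0 \<longrightarrow> spectrally_unstable d \<zeta> \<mu> W \<epsilon> (u \<epsilon>)))"
proof -
  have es: "\<epsilon>s > 0" using br by (simp add: solution_branch_def)
  have sol: "solves_S d f0 \<zeta> \<mu> W \<epsilon> (u \<epsilon>)" and h2: "h2_norm (\<lambda>x. u \<epsilon> x - u0 (x - \<sigma>)) \<le> C * \<bar>\<epsilon>\<bar>" if "\<bar>\<epsilon>\<bar> < \<epsilon>s" for \<epsilon>
    using br that by (auto simp: solution_branch_def abs_less_iff)
  have "\<forall>\<epsilon>. \<exists>y. \<bar>\<epsilon>\<bar> < \<epsilon>s \<longrightarrow> C2p (u \<epsilon>) (D1 (u \<epsilon>)) y \<and>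
    (\<forall>x. - of_real d * y x + \<i> * of_real (\<epsilon> * W x) * D1 (u \<epsilon>) x + (of_real \<zeta> - \<i> * of_real \<mu>) * u \<epsilon> x
        - of_real ((cmod (u \<epsilon> x))\<^sup>2) * u \<epsilon> x + \<i> * of_real f0 = 0)"
    using solves_S_classical[OF d0 W sol] by metis
  then obtain w2 where uC: "\<And>\<epsilon>. \<bar>\<epsilon>\<bar> < \<epsilon>s \<Longrightarrow> C2p (u \<epsilon>) (D1 (u \<epsilon>)) (w2 \<epsilon>)"
    and ueq: "\<And>\<epsilon> x. \<bar>\<epsilon>\<bar> < \<epsilon>s \<Longrightarrow> - of_real d * w2 \<epsilon> x + \<i> * of_real (\<epsilon> * W x) * D1 (u \<epsilon>) x + (of_real \<zeta> - \<i> * of_real \<mu>) * u \<epsilon> x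
        - of_real ((cmod (u \<epsilon> x))\<^sup>2) * u \<epsilon> x + \<i> * of_real f0 = 0" by metis
  have uc: "u \<epsilon> \<in> C0p" if "\<bar>\<epsilon>\<bar> < \<epsilon>s" for \<epsilon> using C2pD(1)[OF uC[OF that]] .
  define S where "S = 2 * sqrt (2 * pi)"
  have S: "S > 0" by (simp add: S_def)
  have close: "norm (u \<epsilon> (x + \<sigma>) - u0 x) \<le> S * C * \<bar>\<epsilon>\<bar>" "norm (D1 (u \<epsilon>) (x + \<sigma>) - u1 x) \<le> S * C * \<bar>\<epsilon>\<bar>" if e: "\<bar>\<epsilon>\<bar> < \<epsilon>s" for \<epsilon> x
  proof -
    have c: "C2p (\<lambda>x. u \<epsilon> x - u0 (x + - \<sigma>)) (\<lambda>x. D1 (u \<epsilon>) x - u1 (x + - \<sigma>)) (\<lambda>x. w2 \<epsilon> x - u2 (x + - \<sigma>))"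
      by (rule C2p_diff[OF uC[OF e] C2p_shift[OF u0]])
    have "S * h2_norm (\<lambda>x. u \<epsilon> x - u0 (x + - \<sigma>)) \<le> S * (C * \<bar>\<epsilon>\<bar>)" using h2[OF e] S by (intro mult_left_mono) auto
    then show "norm (u \<epsilon> (x + \<sigma>) - u0 x) \<le> S * C * \<bar>\<epsilon>\<bar>" "norm (D1 (u \<epsilon>) (x + \<sigma>) - u1 x) \<le> S * C * \<bar>\<epsilon>\<bar>"
      using h2_norm_embedding[OF c, of "x + \<sigma>", folded S_def] by (simp_all add: mult.assoc)
  qed
  have to_ev: "ev_pair \<epsilon> (\<lambda>x. u \<epsilon> (x + \<sigma>)) \<alpha> \<beta> (\<lambda>x. a (x + \<sigma>)) (\<lambda>x. a1 (x + \<sigma>)) (\<lambda>x. a2 (x + \<sigma>)) (\<lambda>x. b (x + \<sigma>)) (\<lambda>x. b1 (x + \<sigma>)) (\<lambda>x. b2 (x + \<sigma>))"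
    if "C2p a a1 a2" "C2p b b1 b2" "\<not> (\<forall>x. a x = 0 \<and> b x = 0)"
    "\<And>x. evo d \<zeta> \<mu> (\<epsilon> * W x) (u \<epsilon> x) (a x) (a1 x) (a2 x) = of_real \<alpha> * a x - of_real \<beta> * b x"
    "\<And>x. evo d \<zeta> \<mu> (\<epsilon> * W x) (u \<epsilon> x) (b x) (b1 x) (b2 x) = of_real \<beta> * a x + of_real \<alpha> * b x" for \<epsilon> \<alpha> \<beta> a a1 a2 b b1 b2
    unfolding ev_pair_def
  proof (intro conjI allI)
    show "\<not> (\<forall>x. a (x + \<sigma>) = 0 \<and> b (x + \<sigma>) = 0)" using that(3) by (metis diff_add_cancel)
  qed (use C2p_shift[OF that(1)] C2p_shift[OF that(2)] that(4,5) in \<open>auto simp: V[symmetric]\<close>)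
  obtain \<epsilon>0 where e0: "\<epsilon>0 > 0" "\<epsilon>0 \<le> \<epsilon>s"
    and st: "\<And>\<epsilon> \<alpha> \<beta> a a1 a2 b b1 b2. \<lbrakk>\<bar>\<epsilon>\<bar> < \<epsilon>0; \<nu> * \<epsilon> > 0; ev_pair \<epsilon> (\<lambda>x. u \<epsilon> (x + \<sigma>)) \<alpha> \<beta> a a1 a2 b b1 b2\<rbrakk> \<Longrightarrow> \<alpha> \<le> 0"
    and un: "\<And>\<epsilon>. \<lbrakk>\<bar>\<epsilon>\<bar> < \<epsilon>0; \<nu> * \<epsilon> < 0\<rbrakk> \<Longrightarrow> \<exists>\<alpha> \<beta> a a1 a2 b b1 b2. ev_pair \<epsilon> (\<lambda>x. u \<epsilon> (x + \<sigma>)) \<alpha> \<beta> a a1 a2 b b1 b2 \<and> \<alpha> > 0"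
  proof (rule stability_dichotomy[OF es, of "\<lambda>\<epsilon> x. u \<epsilon> (x + \<sigma>)" "\<lambda>\<epsilon> x. D1 (u \<epsilon>) (x + \<sigma>)" "\<lambda>\<epsilon> x. w2 \<epsilon> (x + \<sigma>)" "S * C"])
    show "C2p (\<lambda>x. u \<epsilon> (x + \<sigma>)) (\<lambda>x. D1 (u \<epsilon>) (x + \<sigma>)) (\<lambda>x. w2 \<epsilon> (x + \<sigma>))" if "\<bar>\<epsilon>\<bar> < \<epsilon>s" for \<epsilon>
      by (rule C2p_shift[OF uC[OF that]])
    show "- of_real d * w2 \<epsilon> (x + \<sigma>) + \<i> * of_real (\<epsilon> * V x) * D1 (u \<epsilon>) (x + \<sigma>) + (of_real \<zeta> - \<i> * of_real \<mu>) * u \<epsilon> (x + \<sigma>)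
        - of_real ((cmod (u \<epsilon> (x + \<sigma>)))\<^sup>2) * u \<epsilon> (x + \<sigma>) + \<i> * of_real f0 = 0" if "\<bar>\<epsilon>\<bar> < \<epsilon>s" for \<epsilon> x
      using ueq[OF that, of "x + \<sigma>"] unfolding V .
  qed (use close that in blast)+
  show ?thesis
  proof (intro exI[of _ \<epsilon>0] conjI ballI impI e0)
    fix \<epsilon> assume "\<epsilon> \<in> {-\<epsilon>0<..<\<epsilon>0}"
    then have e: "\<bar>\<epsilon>\<bar> < \<epsilon>0" "\<bar>\<epsilon>\<bar> < \<epsilon>s" using e0 by (auto simp: abs_less_iff)
    { assume pos: "\<nu> * \<epsilon> > 0"
      show "spectrally_stable d \<zeta> \<mu> W \<epsilon> (u \<epsilon>)" unfolding spectrally_stable_def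
      proof (intro allI impI)
        fix y assume ev: "is_eigenvalue (Ltilde d \<zeta> \<mu> W (u \<epsilon>) \<epsilon>) y"
        show "Re y \<le> 0"
          by (rule eigenvalue_parts[OF d0 W uc[OF e(2)] ev]) (rule st[OF e(1) pos to_ev])
      qed }
    { assume neg: "\<nu> * \<epsilon> < 0"
      obtain \<alpha> \<beta> a a1 a2 b b1 b2 where ev: "ev_pair \<epsilon> (\<lambda>x. u \<epsilon> (x + \<sigma>)) \<alpha> \<beta> a a1 a2 b b1 b2" and al: "\<alpha> > 0"
        using un[OF e(1) neg] by blast
      have "is_eigenvalue (Ltilde d \<zeta> \<mu> W (u \<epsilon>) \<epsilon>) (Complex \<alpha> \<beta>)"
      proof (rule eigenvalueI)
        have p: "C2p a a1 a2" "C2p b b1 b2" "\<not> (\<forall>x. a x = 0 \<and> b x = 0)"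
          "\<And>x. evo d \<zeta> \<mu> (\<epsilon> * V x) (u \<epsilon> (x + \<sigma>)) (a x) (a1 x) (a2 x) = of_real \<alpha> * a x - of_real \<beta> * b x"
          "\<And>x. evo d \<zeta> \<mu> (\<epsilon> * V x) (u \<epsilon> (x + \<sigma>)) (b x) (b1 x) (b2 x) = of_real \<beta> * a x + of_real \<alpha> * b x"
          using ev unfolding ev_pair_def by blast+
        show "C2p (\<lambda>x. a (x + - \<sigma>)) (\<lambda>x. a1 (x + - \<sigma>)) (\<lambda>x. a2 (x + - \<sigma>))" by (rule C2p_shift[OF p(1)])
        show "C2p (\<lambda>x. b (x + - \<sigma>)) (\<lambda>x. b1 (x + - \<sigma>)) (\<lambda>x. b2 (x + - \<sigma>))" by (rule C2p_shift[OF p(2)])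
        show "\<not> (\<forall>x. a (x + - \<sigma>) = 0 \<and> b (x + - \<sigma>) = 0)" using p(3) by (metis add.assoc add.right_inverse add.right_neutral add.commute)
        fix x
        show "evo d \<zeta> \<mu> (\<epsilon> * W x) (u \<epsilon> x) (a (x + - \<sigma>)) (a1 (x + - \<sigma>)) (a2 (x + - \<sigma>))
            = of_real (Re (Complex \<alpha> \<beta>)) * a (x + - \<sigma>) - of_real (Im (Complex \<alpha> \<beta>)) * b (x + - \<sigma>)"
          "evo d \<zeta> \<mu> (\<epsilon> * W x) (u \<epsilon> x) (b (x + - \<sigma>)) (b1 (x + - \<sigma>)) (b2 (x + - \<sigma>))
            = of_real (Im (Complex \<alpha> \<beta>)) * a (x + - \<sigma>) + of_real (Re (Complex \<alpha> \<beta>)) * b (x + - \<sigma>)"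
          using p(4,5)[of "x + - \<sigma>"] V[of "x + - \<sigma>"] by simp_all
      qed
      then show "spectrally_unstable d \<zeta> \<mu> W \<epsilon> (u \<epsilon>)" unfolding spectrally_unstable_def using al by (intro exI[of _ "Complex \<alpha> \<beta>"]) simp }
  qed
qed

end

theorem theorem2:
  fixes d f0 \<zeta> \<mu> \<sigma>0 :: real
    and V :: "real \<Rightarrow> real"
    and u0 \<phi>0 :: "real \<Rightarrow> complex"
  assumes "d \<noteq> 0"
    and "periodic_2pi V" and "V C1_differentiable_on UNIV"
    and "solves_S d f0 \<zeta> \<mu> V 0 u0"
    and "\<not> u0 constant_on UNIV"
    and "nondegenerate d \<zeta> \<mu> u0"
    and "0 \<in> op_spectrum (Ltilde d \<zeta> \<mu> V u0 0)"
    and "algebraically_simple (Ltilde d \<zeta> \<mu> V u0 0) 0"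
    and "\<exists>\<xi>>0. op_spectrum (Ltilde d \<zeta> \<mu> V u0 0) \<subseteq> {z. Re z \<le> - \<xi>} \<union> {0}"
    and "ker_adjoint (L_op d \<zeta> \<mu> u0) = span_L2 \<phi>0"
    and "l2_inner (\<lambda>x. vec2 (D1 u0 x)) (\<lambda>x. J_mat *v vec2 (\<phi>0 x)) = 1"
    and "simple_zero (V_eff V u0 \<phi>0) \<sigma>0"
  shows "deriv (V_eff V u0 \<phi>0) \<sigma>0
           = Re (LINT x|leb_pi. \<i> * of_real (deriv V (x + \<sigma>0)) * D1 u0 x * cnj (\<phi>0 x))
       \<and> Re (LINT x|leb_pi. \<i> * of_real (deriv V (x + \<sigma>0)) * D1 u0 x * cnj (\<phi>0 x))
           = l2_inner (\<lambda>x. deriv V (x + \<sigma>0) *\<^sub>R vec2 (D1 u0 x)) (\<lambda>x. J_mat *v vec2 (\<phi>0 x))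
       \<and> l2_inner (\<lambda>x. deriv V (x + \<sigma>0) *\<^sub>R vec2 (D1 u0 x)) (\<lambda>x. J_mat *v vec2 (\<phi>0 x)) \<noteq> 0
       \<and> (\<exists>\<epsilon>s C u. solution_branch d f0 \<zeta> \<mu> V u0 \<sigma>0 \<epsilon>s C u)
       \<and> (\<forall>\<epsilon>s C u. solution_branch d f0 \<zeta> \<mu> V u0 \<sigma>0 \<epsilon>s C u \<longrightarrow>
            (\<exists>\<epsilon>0>0. \<epsilon>0 \<le> \<epsilon>s \<and>
              (\<forall>\<epsilon>\<in>{-\<epsilon>0<..<\<epsilon>0}.
                (deriv (V_eff V u0 \<phi>0) \<sigma>0 * \<epsilon> > 0 \<longrightarrow> spectrally_stable d \<zeta> \<mu> V \<epsilon> (u \<epsilon>)) \<and>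
                (deriv (V_eff V u0 \<phi>0) \<sigma>0 * \<epsilon> < 0 \<longrightarrow> spectrally_unstable d \<zeta> \<mu> V \<epsilon> (u \<epsilon>)))))"
proof -
  note V = C1_periodic_derivative[OF assms(2,3)]
  define \<Lambda> where "\<Lambda> h = l2_inner h \<phi>0" for h
  obtain u2 where u0: "C2p u0 (D1 u0) u2"
    and eq: "\<And>x. - of_real d * u2 x + \<i> * of_real (0 * V x) * D1 u0 x + (of_real \<zeta> - \<i> * of_real \<mu>) * u0 x
        - of_real ((cmod (u0 x))\<^sup>2) * u0 x + \<i> * of_real f0 = 0"
    by (rule solves_S_classical[OF assms(1) V(1) assms(4)]) (rule that)
  obtain u3 where u1: "C2p (D1 u0) u2 u3"
    and eq1: "\<And>x. lin d \<zeta> \<mu> (u0 x) (D1 u0 x) (u3 x) + \<i> * of_real (0 * V x) * u2 x = - \<i> * of_real (0 * deriv V x) * D1 u0 x"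
    by (rule stationary_derivative[OF assms(1) V u0 eq]) (rule that)
  have lin1: "lin d \<zeta> \<mu> (u0 x) (D1 u0 x) (u3 x) = 0" for x using eq1[of x] by simp
  note uC = C2pD(1)[OF u0] C2pD(1)[OF u1]
  have \<phi>_ker: "\<phi>0 \<in> ker_adjoint (L_op d \<zeta> \<mu> u0)"
    unfolding assms(10) span_L2_def by (auto intro!: exI[of _ 1])
  then have \<phi>L: "\<phi>0 \<in> L2" by (auto simp: ker_adjoint_def adjoint_graph_def)
  have \<Lambda>_lin: "\<Lambda> (\<lambda>x. lin d \<zeta> \<mu> (u0 x) (w x) (w2 x)) = 0" if "C2p w w1 w2" for w w1 w2
    unfolding \<Lambda>_def by (rule ker_adjoint_annihilates[OF \<phi>_ker uC(1) that])
  have \<Lambda>_u1: "\<Lambda> (\<lambda>x. \<i> * D1 u0 x) = 1"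
    using assms(11) by (simp add: \<Lambda>_def l2_inner_def vec2_J_inner)
  obtain x0 where x0: "D1 u0 x0 \<noteq> 0"
    using \<Lambda>_u1 by (fastforce simp: \<Lambda>_def l2_inner_def)
  obtain \<xi> where xi: "\<xi> > 0" "op_spectrum (Ltilde d \<zeta> \<mu> V u0 0) \<subseteq> {z. Re z \<le> - \<xi>} \<union> {0}"
    using assms(9) by blast
  have mu: "\<mu> > 0"
  proof -
    have "of_real (- 2 * \<mu>) \<in> op_spectrum (Ltilde d \<zeta> \<mu> V u0 0)"
      by (rule hamiltonian_symmetry[OF assms(1) V(1) uC(1) u1 lin1 x0])
    then have "of_real (- 2 * \<mu>) \<in> {z. Re z \<le> - \<xi>} \<union> {0 :: complex}" using xi(2) by blast
    then have "- 2 * \<mu> \<le> - \<xi> \<or> - 2 * \<mu> = 0" by (auto simp only: Un_iff mem_Collect_eq Re_complex_of_real singleton_iff of_real_eq_0_iff)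
    \<comment> \<open>For \<mu> = 0 the operator is symmetric, so \<open>D1 u0\<close> lies in the
      adjoint kernel and equals \<open>c \<phi>0\<close>. As \<open>i D1 u0\<close> is pointwise
      orthogonal to \<open>D1 u0\<close>, the normalization forces \<open>c = 0\<close>, and then
      \<open>D1 u0\<close> vanishes almost everywhere, contradicting the normalization
      again.\<close>
    moreover have "\<mu> \<noteq> 0"
    proof
      assume m0: "\<mu> = 0"
      have "D1 u0 \<in> ker_adjoint (L_op d \<zeta> 0 u0)" by (rule ker_adjoint_self[OF uC(1) u1 lin1[unfolded m0]])
      then obtain c where c: "AE x in leb_pi. D1 u0 x = c *\<^sub>R \<phi>0 x" using assms(10) by (auto simp: m0 span_L2_def)
      have "c = 0 * c"
      proof -
        have "AE x in leb_pi. c * ((\<i> * D1 u0 x) \<bullet> \<phi>0 x) = 0"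
          using c
        proof eventually_elim
          case (elim x)
          have "c * ((\<i> * D1 u0 x) \<bullet> \<phi>0 x) = (\<i> * D1 u0 x) \<bullet> (c *\<^sub>R \<phi>0 x)" by simp
          also have "\<dots> = (\<i> * D1 u0 x) \<bullet> D1 u0 x" by (simp only: elim)
          also have "\<dots> = 0" by (simp add: inner_complex_def algebra_simps)
          finally show ?case .
        qed
        then have "(LINT x|leb_pi. c * ((\<i> * D1 u0 x) \<bullet> \<phi>0 x)) = 0" by (rule integral_eq_zero_AE)
        then show ?thesis using \<Lambda>_u1 by (simp add: \<Lambda>_def l2_inner_def)
      qed
      then have "AE x in leb_pi. D1 u0 x = 0" using c by simp
      then have "AE x in leb_pi. (\<i> * D1 u0 x) \<bullet> \<phi>0 x = 0" by eventually_elim simp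
      then have "\<Lambda> (\<lambda>x. \<i> * D1 u0 x) = 0" unfolding \<Lambda>_def l2_inner_def by (rule integral_eq_zero_AE)
      then show False using \<Lambda>_u1 by simp
    qed
    ultimately show ?thesis using xi(1) by linarith
  qed
  have res: "z \<in> resolvent_set (Ltilde d \<zeta> \<mu> V u0 0)" if "Re z \<ge> 0" "z \<noteq> 0" for z
    using xi that by (force simp: op_spectrum_def)
  have der: "(V_eff V u0 \<phi>0 has_field_derivative l2_inner (\<lambda>x. \<i> * of_real (deriv V (x + \<sigma>0)) * D1 u0 x) \<phi>0) (at \<sigma>0)"
    by (rule V_eff_has_derivative[OF V uC(2) \<phi>L])
  then have dV: "deriv (V_eff V u0 \<phi>0) \<sigma>0 = \<Lambda> (\<lambda>x. \<i> * of_real (deriv V (x + \<sigma>0)) * D1 u0 x)"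
    unfolding \<Lambda>_def by (rule DERIV_imp_deriv)
  have c1: "(\<lambda>x. \<i> * of_real (deriv V (x + \<sigma>0)) * D1 u0 x) \<in> C0p" by (intro C0p_ints C0p_shift V uC)
  have nz: "deriv (V_eff V u0 \<phi>0) \<sigma>0 \<noteq> 0" and zero: "V_eff V u0 \<phi>0 \<sigma>0 = 0"
    using assms(12) by (auto simp: simple_zero_def)
  \<comment> \<open>The potential is the translated one, whereas the spectral hypotheses are stated
    with \<open>V\<close>. The two agree since at \<epsilon> = 0 the potential enters only through
    the factor \<open>0 * V x\<close>.\<close>
  interpret wave d \<zeta> \<mu> f0 u0 "D1 u0" u2 u3 "\<lambda>x. V (x + \<sigma>0)" "\<lambda>x. deriv V (x + \<sigma>0)" \<Lambda>
    "LINT x|leb_pi. norm (\<phi>0 x)" "deriv (V_eff V u0 \<phi>0) \<sigma>0"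
  proof
    show "d \<noteq> 0" "\<mu> > 0" "C2p u0 (D1 u0) u2" "C2p (D1 u0) u2 u3" by (rule assms(1) mu u0 u1)+
    show "- of_real d * u2 x + (of_real \<zeta> - \<i> * of_real \<mu>) * u0 x - of_real ((cmod (u0 x))\<^sup>2) * u0 x + \<i> * of_real f0 = 0" for x
      using eq[of x] by simp
    show "\<exists>c. \<forall>x. a x = of_real c * D1 u0 x" if a: "C2p a a1 a2" "\<forall>x. lin d \<zeta> \<mu> (u0 x) (a x) (a2 x) = 0" for a a1 a2
    proof -
      have "AE x in leb_pi. L_op d \<zeta> \<mu> u0 a x = 0"
        using C2p_H2(2)[OF a(1)] by eventually_elim (use a(2) in \<open>simp add: L_op_lin\<close>)
      then have "a \<in> ker_H2 (L_op d \<zeta> \<mu> u0)" using C2p_H2(1)[OF a(1)] by (simp add: ker_H2_def)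
      then obtain c where "a = (\<lambda>x. c *\<^sub>R D1 u0 x)" using assms(6) by (auto simp: nondegenerate_def span_fun_def)
      then show ?thesis by (auto simp: scaleR_conv_of_real)
    qed
    show "\<forall>x. a x = 0 \<and> b x = 0" if h: "C2p a a1 a2" "C2p b b1 b2" "0 \<le> \<alpha>" "\<alpha> \<noteq> 0 \<or> \<beta> \<noteq> 0"
        "\<forall>x. evo d \<zeta> \<mu> 0 (u0 x) (a x) (a1 x) (a2 x) = of_real \<alpha> * a x - of_real \<beta> * b x"
        "\<forall>x. evo d \<zeta> \<mu> 0 (u0 x) (b x) (b1 x) (b2 x) = of_real \<beta> * a x + of_real \<alpha> * b x" for a a1 a2 b b1 b2 \<alpha> \<beta>
    proof (rule ccontr)
      assume "\<not> (\<forall>x. a x = 0 \<and> b x = 0)"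
      then have "is_eigenvalue (Ltilde d \<zeta> \<mu> V u0 0) (Complex \<alpha> \<beta>)"
        by (rule eigenvalueI[OF h(1,2)]) (use h(5,6) in auto)
      moreover have "Complex \<alpha> \<beta> \<in> resolvent_set (Ltilde d \<zeta> \<mu> V u0 0)" using h(3,4) by (intro res) (auto simp: complex_eq_iff)
      ultimately show False using resolvent_set_no_eigenvalue[of "Complex \<alpha> \<beta>" "Ltilde d \<zeta> \<mu> V u0 0"] Ltilde_zero by blast
    qed
    show "\<exists>w w1 w2. C2p w w1 w2 \<and> (\<forall>x. evo d \<zeta> \<mu> 0 (u0 x) (w x) (w1 x) (w2 x) - of_real r * w x = h x)"
      if r: "0 < r" "h \<in> C0p" for r h
    proof -
      have "of_real r \<in> resolvent_set (Ltilde d \<zeta> \<mu> V u0 0)" using r(1) by (intro res) auto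
      from resolvent_set_solve_real[OF assms(1) V(1) uC(1) r(2) this] show ?thesis by (metis mult_zero_left)
    qed
    show "\<Lambda> (\<lambda>x. h x + k x) = \<Lambda> h + \<Lambda> k" if "h \<in> C0p" "k \<in> C0p" for h k
      unfolding \<Lambda>_def by (rule l2_inner_C0p(1)[OF that \<phi>L])
    show "\<Lambda> (\<lambda>x. of_real c * h x) = c * \<Lambda> h" if "h \<in> C0p" for h c
      unfolding \<Lambda>_def by (rule l2_inner_C0p(2)[OF that that \<phi>L])
    show "\<bar>\<Lambda> h\<bar> \<le> (LINT x|leb_pi. norm (\<phi>0 x)) * B" if "h \<in> C0p" "\<And>x. norm (h x) \<le> B" for h B
      unfolding \<Lambda>_def by (rule l2_inner_C0p(3)[OF that(1) that(1) \<phi>L that(2)])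
    show "\<Lambda> (\<lambda>x. lin d \<zeta> \<mu> (u0 x) (w x) (w2 x)) = 0" if "C2p w w1 w2" for w w1 w2 by (rule \<Lambda>_lin[OF that])
    show "\<Lambda> (\<lambda>x. \<i> * D1 u0 x) = 1" by (rule \<Lambda>_u1)
    show "(\<lambda>x. V (x + \<sigma>0)) \<in> C0p" "(\<lambda>x. deriv V (x + \<sigma>0)) \<in> C0p" by (intro C0p_shift V)+
    show "((\<lambda>x. V (x + \<sigma>0)) has_vector_derivative deriv V (x + \<sigma>0)) (at x)" for x by (rule has_vector_derivative_shift[OF V(3)])
    show "\<Lambda> (\<lambda>x. \<i> * of_real (V (x + \<sigma>0)) * D1 u0 x) = 0"
      using zero unfolding V_eff_l2_inner[OF V(1) uC(2) \<phi>L] \<Lambda>_def .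
    show "\<Lambda> (\<lambda>x. \<i> * of_real (deriv V (x + \<sigma>0)) * D1 u0 x) = deriv (V_eff V u0 \<phi>0) \<sigma>0" by (rule dV[symmetric])
    show "deriv (V_eff V u0 \<phi>0) \<sigma>0 \<noteq> 0" by (rule nz)
  qed
  have 1: "deriv (V_eff V u0 \<phi>0) \<sigma>0 = Re (LINT x|leb_pi. \<i> * of_real (deriv V (x + \<sigma>0)) * D1 u0 x * cnj (\<phi>0 x))"
    unfolding dV Re_LINT_eq_l2_inner[OF c1 \<phi>L] \<Lambda>_def ..
  moreover have 2: "Re (LINT x|leb_pi. \<i> * of_real (deriv V (x + \<sigma>0)) * D1 u0 x * cnj (\<phi>0 x))
           = l2_inner (\<lambda>x. deriv V (x + \<sigma>0) *\<^sub>R vec2 (D1 u0 x)) (\<lambda>x. J_mat *v vec2 (\<phi>0 x))"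
    unfolding Re_LINT_eq_l2_inner[OF c1 \<phi>L] l2_inner_vec2_J ..
  moreover have "l2_inner (\<lambda>x. deriv V (x + \<sigma>0) *\<^sub>R vec2 (D1 u0 x)) (\<lambda>x. J_mat *v vec2 (\<phi>0 x)) \<noteq> 0"
    using nz unfolding 1 2 .
  moreover have "\<exists>\<epsilon>s C u. solution_branch d f0 \<zeta> \<mu> V u0 \<sigma>0 \<epsilon>s C u" by (rule branch_classical) simp
  ultimately show ?thesis using branch_stability[of V \<sigma>0, OF refl C1_periodic_derivative(1)[OF assms(2,3)]] by blast
qed

end
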